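(* Assume the decay condition and the growth condition (both stated in the context) hold. Then, with $x=ny$, $$\nabla_\theta\log\hat L(\theta;x)=\nabla_\theta\log L(\theta;x)+O(1/n)\qquad\text{as }n\to\infty$$ for each fixed $(y,\theta)\in\operatorname{int}\mathcal Y^o$. Moreover, given a compact subset $C\subset\operatorname{int}\mathcal Y^o$, there exists $n_0\in\mathbb N$ such that the bound in the term $O(1/n)$ is uniform over $n\ge n_0$ and $(y,\theta)\in C$. (The statement includes the assertion that the likelihoods and their gradients exist for $n$ sufficiently large.)
   Context: Setting. $d,p$ are positive integers and $\mathcal R\subset\mathbb R^{p\times1}$ is open. For each $\theta\in\mathcal R$, $Y_\theta$ is a random column vector in $\mathbb R^{d\times1}$ whose distribution does not depend on $n$, and for $n\in\mathbb N$, $X_\theta=\sum_{i=1}^nY^{(i)}$ where $Y^{(1)},Y^{(2)},\dots$ are i.i.d. copies of $Y_\theta$ (the dependence of $X_\theta$ on $n$ is suppressed). Let $\mathcal S_\theta=\{s\in\mathbb R^{1\times d}:\mathbb E(e^{sY_\theta})<\infty\}$, $\mathcal S=\{(s,\theta):\theta\in\mathcal R,\ s\in\mathcal S_\theta\}$, and let $\operatorname{int}\mathcal S$ be its interior in $\mathbb R^{1\times d}\times\mathbb R^{p\times 1}$. For complex row vectors $z$ with $\operatorname{Re}z\in\mathcal S_\theta$ put $M_0(z;\theta)=\mathbb E(e^{zY_\theta})$, and $K_0(s;\theta)=\log M_0(s;\theta)$ for real $s$. $K_0'=\nabla_sK_0$ is the $d\times1$ gradient and $K_0''$ the $d\times d$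 Hessian with respect to $s$; $\nabla_\theta$ of a scalar is a $1\times p$ row vector. Throughout, $x\in\mathbb R^{d\times 1}$ and $y\in\mathbb R^{d\times 1}$ are related by $x=ny$. Decay condition: there is a continuous function $\delta:\operatorname{int}\mathcal S\to(0,\infty)$ such that $\left|\frac{M_0(s+\mathrm i\phi;\theta)}{M_0(s;\theta)}\right|\le(1+\delta(s,\theta)|\phi|^2)^{-\delta(s,\theta)}$ for all $\phi\in\mathbb R^{1\times d}$ and $(s,\theta)\in\operatorname{int}\mathcal S$. (This implies that $K_0''(s;\theta)$ is positive definite.) Growth condition: there is a continuous function $\gamma:\operatorname{int}\mathcal S\to(0,\infty)$ such that $\left|\frac{\partial^{k+\ell}M_0}{\partial\theta_{i_1}\cdots\partial\theta_{i_k}\partial s_{j_1}\cdots\partial s_{j_\ell}}(s+\mathrm i\phi;\theta)\right|\le\gamma(s,\theta)(1+|\phi|)^{\gamma(s,\theta)}$ for all $\phi\in\mathbb R^{1\times d}$ and $(s,\theta)\in\operatorname{int}\mathcal S$, for $k\in\{0,1\}$ with $1\le k+\ell\le6$ and for $k=2$ with $0\le\ell\le2$; and each of these partial derivatives exists and is continuous in all its variables. Saddlepoint. $\mathcal Y^o$ is the set of $(y,\theta)$ for which there is $s$ with $(s,\theta)\in\operatorname{int}\mathcal S$ and $K_0'(s;\theta)=y$; this $s$ is unique (strict convexity of $K_0$ in $s$) and is denoted $\hat s_0(\theta,y)$. Likelihoods. $L(\theta;x)$ is the value at $x$ of the continuous density of $X_\theta$ (which exists for $n$ large). For $(y,\theta)\in\mathcal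 Y^o$, the saddlepoint likelihood is, with $\hat s=\hat s_0(\theta,y)$, $$\hat L(\theta;x)=\frac{\exp\left(n[K_0(\hat s;\theta)-\hat sy]\right)}{\sqrt{\det(2\pi nK_0''(\hat s;\theta))}}.$$ *)

theory Defs
  imports "HOL-Probability.Probability"
begin

definition grad :: "('a::real_inner \<Rightarrow> real) \<Rightarrow> 'a \<Rightarrow> 'a" where
  "grad f x = (THE D. GDERIV f x :> D)"

text \<open>
  Row and column vectors are both elements of \<open>real ^ 'n\<close>; a product \<open>s y\<close> of a row and a
  column is the inner product. A family of random vectors \<open>Y\<close> is given with, for each parameter
  \<open>\<theta>\<close>, a probability space \<open>P \<theta>\<close> on which \<open>Y \<theta>\<close> lives.
\<close>

definition mgf_dom ::
  "(real ^ 'p) set \<Rightarrow> (real ^ 'p \<Rightarrow> 'w measure) \<Rightarrow> (real ^ 'p \<Rightarrow> 'w \<Rightarrow> real ^ 'd)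
   \<Rightarrow> ((real ^ 'd) \<times> (real ^ 'p)) set" where
  "mgf_dom R P Y = {(s, \<theta>). \<theta> \<in> R \<and> integrable (P \<theta>) (\<lambda>w. exp (s \<bullet> Y \<theta> w))}"

definition M0 ::
  "(real ^ 'p \<Rightarrow> 'w measure) \<Rightarrow> (real ^ 'p \<Rightarrow> 'w \<Rightarrow> real ^ 'd)
   \<Rightarrow> complex ^ 'd \<Rightarrow> real ^ 'p \<Rightarrow> complex" where
  "M0 P Y z \<theta> = (LINT w|P \<theta>. exp (\<Sum>j\<in>UNIV. z $ j * complex_of_real (Y \<theta> w $ j)))"

definition cvec :: "real ^ 'd \<Rightarrow> real ^ 'd \<Rightarrow> complex ^ 'd" where
  "cvec s \<phi> = (\<chi> j. Complex (s $ j) (\<phi> $ j))"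

definition K0 ::
  "(real ^ 'p \<Rightarrow> 'w measure) \<Rightarrow> (real ^ 'p \<Rightarrow> 'w \<Rightarrow> real ^ 'd)
   \<Rightarrow> real ^ 'd \<Rightarrow> real ^ 'p \<Rightarrow> real" where
  "K0 P Y s \<theta> = ln (Re (M0 P Y (cvec s 0) \<theta>))"

definition K0_grad ::
  "(real ^ 'p \<Rightarrow> 'w measure) \<Rightarrow> (real ^ 'p \<Rightarrow> 'w \<Rightarrow> real ^ 'd)
   \<Rightarrow> real ^ 'd \<Rightarrow> real ^ 'p \<Rightarrow> real ^ 'd" where
  "K0_grad P Y s \<theta> = grad (\<lambda>u. K0 P Y u \<theta>) s"

definition K0_hess ::
  "(real ^ 'p \<Rightarrow> 'w measure) \<Rightarrow> (real ^ 'p \<Rightarrow> 'w \<Rightarrow> real ^ 'd)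
   \<Rightarrow> real ^ 'd \<Rightarrow> real ^ 'p \<Rightarrow> real ^ 'd ^ 'd" where
  "K0_hess P Y s \<theta> = jacobian (\<lambda>u. K0_grad P Y u \<theta>) (at s)"

definition decay_condition ::
  "(real ^ 'p) set \<Rightarrow> (real ^ 'p \<Rightarrow> 'w measure) \<Rightarrow> (real ^ 'p \<Rightarrow> 'w \<Rightarrow> real ^ 'd) \<Rightarrow> bool" where
  "decay_condition R P Y \<longleftrightarrow>
    (\<exists>\<delta> :: (real ^ 'd) \<times> (real ^ 'p) \<Rightarrow> real.
      continuous_on (interior (mgf_dom R P Y)) \<delta> \<and>
      (\<forall>(s, \<theta>) \<in> interior (mgf_dom R P Y).
        \<delta> (s, \<theta>) > 0 \<and>
        (\<forall>\<phi>. cmod (M0 P Y (cvec s \<phi>) \<theta> / M0 P Y (cvec s 0) \<theta>)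
              \<le> (1 + \<delta> (s, \<theta>) * (norm \<phi>)\<^sup>2) powr (- \<delta> (s, \<theta>)))))"

text \<open>
  Partial derivatives of functions of \<open>(z, \<theta>)\<close>. The derivative in \<open>s\<^sub>j\<close> at \<open>s + \<i>\<phi>\<close> is taken along
  real increments of the \<open>j\<close>-th coordinate of \<open>z\<close>. In \<open>dM0 P Y is js\<close>, the heads of the lists are
  the derivatives applied last, and all \<open>s\<close>-derivatives are applied before the \<open>\<theta>\<close>-derivatives.
\<close>

definition s_partial ::
  "'d \<Rightarrow> (complex ^ 'd \<Rightarrow> real ^ 'p \<Rightarrow> complex) \<Rightarrow> complex ^ 'd \<Rightarrow> real ^ 'p \<Rightarrow> complex" where
  "s_partial j F z \<theta> = vector_derivative (\<lambda>h. F (z + axis j (complex_of_real h)) \<theta>) (at 0)"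

definition theta_partial ::
  "'p \<Rightarrow> (complex ^ 'd \<Rightarrow> real ^ 'p \<Rightarrow> complex) \<Rightarrow> complex ^ 'd \<Rightarrow> real ^ 'p \<Rightarrow> complex" where
  "theta_partial i F z \<theta> = vector_derivative (\<lambda>h. F z (\<theta> + axis i h)) (at 0)"

definition dM0 ::
  "(real ^ 'p \<Rightarrow> 'w measure) \<Rightarrow> (real ^ 'p \<Rightarrow> 'w \<Rightarrow> real ^ 'd) \<Rightarrow> 'p list \<Rightarrow> 'd list
   \<Rightarrow> complex ^ 'd \<Rightarrow> real ^ 'p \<Rightarrow> complex" where
  "dM0 P Y is js = foldr theta_partial is (foldr s_partial js (M0 P Y))"

text \<open>
  Only the derivative applied last is required to exist here: every intermediate derivative of one
  occurring in \<open>growth_condition\<close> occurs there itself.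
\<close>

fun dM0_exists ::
  "(real ^ 'p \<Rightarrow> 'w measure) \<Rightarrow> (real ^ 'p \<Rightarrow> 'w \<Rightarrow> real ^ 'd) \<Rightarrow> 'p list \<Rightarrow> 'd list
   \<Rightarrow> complex ^ 'd \<Rightarrow> real ^ 'p \<Rightarrow> bool" where
  "dM0_exists P Y [] [] z \<theta> \<longleftrightarrow> True"
| "dM0_exists P Y [] (j # js) z \<theta> \<longleftrightarrow>
    (\<lambda>h. dM0 P Y [] js (z + axis j (complex_of_real h)) \<theta>) differentiable (at (0::real))"
| "dM0_exists P Y (i # is) js z \<theta> \<longleftrightarrow>
    (\<lambda>h. dM0 P Y is js z (\<theta> + axis i h)) differentiable (at (0::real))"

definition growth_condition ::
  "(real ^ 'p) set \<Rightarrow> (real ^ 'p \<Rightarrow> 'w measure) \<Rightarrow> (real ^ 'p \<Rightarrow> 'w \<Rightarrow> real ^ 'd) \<Rightarrow> bool" where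
  "growth_condition R P Y \<longleftrightarrow>
    (\<exists>\<gamma> :: (real ^ 'd) \<times> (real ^ 'p) \<Rightarrow> real.
      continuous_on (interior (mgf_dom R P Y)) \<gamma> \<and>
      (\<forall>x \<in> interior (mgf_dom R P Y). \<gamma> x > 0) \<and>
      (\<forall>is js.
        length is \<le> 1 \<and> 1 \<le> length is + length js \<and> length is + length js \<le> 6 \<or>
        length is = 2 \<and> length js \<le> 2 \<longrightarrow>
          (\<forall>(s, \<theta>) \<in> interior (mgf_dom R P Y). \<forall>\<phi>.
            dM0_exists P Y is js (cvec s \<phi>) \<theta> \<and>
            cmod (dM0 P Y is js (cvec s \<phi>) \<theta>) \<le> \<gamma> (s, \<theta>) * (1 + norm \<phi>) powr \<gamma> (s, \<theta>)) \<and>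
          continuous_on (interior (mgf_dom R P Y) \<times> UNIV)
            (\<lambda>((s, \<theta>), \<phi>). dM0 P Y is js (cvec s \<phi>) \<theta>)))"

definition is_saddlepoint ::
  "(real ^ 'p) set \<Rightarrow> (real ^ 'p \<Rightarrow> 'w measure) \<Rightarrow> (real ^ 'p \<Rightarrow> 'w \<Rightarrow> real ^ 'd)
   \<Rightarrow> real ^ 'p \<Rightarrow> real ^ 'd \<Rightarrow> real ^ 'd \<Rightarrow> bool" where
  "is_saddlepoint R P Y \<theta> y s \<longleftrightarrow> (s, \<theta>) \<in> interior (mgf_dom R P Y) \<and> K0_grad P Y s \<theta> = y"

definition Y_open ::
  "(real ^ 'p) set \<Rightarrow> (real ^ 'p \<Rightarrow> 'w measure) \<Rightarrow> (real ^ 'p \<Rightarrow> 'w \<Rightarrow> real ^ 'd)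
   \<Rightarrow> ((real ^ 'd) \<times> (real ^ 'p)) set" where
  "Y_open R P Y = {(y, \<theta>). \<exists>s. is_saddlepoint R P Y \<theta> y s}"

definition s_hat ::
  "(real ^ 'p) set \<Rightarrow> (real ^ 'p \<Rightarrow> 'w measure) \<Rightarrow> (real ^ 'p \<Rightarrow> 'w \<Rightarrow> real ^ 'd)
   \<Rightarrow> real ^ 'p \<Rightarrow> real ^ 'd \<Rightarrow> real ^ 'd" where
  "s_hat R P Y \<theta> y = (THE s. is_saddlepoint R P Y \<theta> y s)"

definition saddle_lik ::
  "(real ^ 'p) set \<Rightarrow> (real ^ 'p \<Rightarrow> 'w measure) \<Rightarrow> (real ^ 'p \<Rightarrow> 'w \<Rightarrow> real ^ 'd)
   \<Rightarrow> nat \<Rightarrow> real ^ 'p \<Rightarrow> real ^ 'd \<Rightarrow> real" where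
  "saddle_lik R P Y n \<theta> x =
    (let y = x /\<^sub>R real n; s = s_hat R P Y \<theta> y in
      exp (real n * (K0 P Y s \<theta> - s \<bullet> y)) / sqrt (det ((2 * pi * real n) *\<^sub>R K0_hess P Y s \<theta>)))"

definition is_cont_density :: "'w measure \<Rightarrow> ('w \<Rightarrow> real ^ 'd) \<Rightarrow> (real ^ 'd \<Rightarrow> real) \<Rightarrow> bool" where
  "is_cont_density M X f \<longleftrightarrow>
    continuous_on UNIV f \<and> (\<forall>x. 0 \<le> f x) \<and> distributed M lborel X (\<lambda>x. ennreal (f x))"

definition X_sum ::
  "(real ^ 'p \<Rightarrow> nat \<Rightarrow> 'w \<Rightarrow> real ^ 'd) \<Rightarrow> nat \<Rightarrow> real ^ 'p \<Rightarrow> 'w \<Rightarrow> real ^ 'd" where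
  "X_sum Yc n \<theta> w = (\<Sum>i<n. Yc \<theta> i w)"

definition lik ::
  "(real ^ 'p \<Rightarrow> 'w measure) \<Rightarrow> (real ^ 'p \<Rightarrow> nat \<Rightarrow> 'w \<Rightarrow> real ^ 'd)
   \<Rightarrow> nat \<Rightarrow> real ^ 'p \<Rightarrow> real ^ 'd \<Rightarrow> real" where
  "lik P Yc n \<theta> x = (THE f. is_cont_density (P \<theta>) (X_sum Yc n \<theta>) f) x"

text \<open>
  Since \<open>lik\<close>, \<open>saddle_lik\<close> and \<open>grad\<close> are total, existence has to be asserted separately. A gradient
  at \<open>\<theta>\<close> presupposes that the (log-)likelihood is defined on a neighbourhood of \<open>\<theta>\<close>.
\<close>

definition log_lik_grad_exists ::
  "(real ^ 'p \<Rightarrow> 'w measure) \<Rightarrow> (real ^ 'p \<Rightarrow> nat \<Rightarrow> 'w \<Rightarrow> real ^ 'd)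
   \<Rightarrow> nat \<Rightarrow> real ^ 'p \<Rightarrow> real ^ 'd \<Rightarrow> bool" where
  "log_lik_grad_exists P Yc n \<theta> x \<longleftrightarrow>
    (\<forall>\<^sub>F u in nhds \<theta>. (\<exists>f. is_cont_density (P u) (X_sum Yc n u) f) \<and> lik P Yc n u x > 0) \<and>
    (\<lambda>u. ln (lik P Yc n u x)) differentiable (at \<theta>)"

definition log_saddle_lik_grad_exists ::
  "(real ^ 'p) set \<Rightarrow> (real ^ 'p \<Rightarrow> 'w measure) \<Rightarrow> (real ^ 'p \<Rightarrow> 'w \<Rightarrow> real ^ 'd)
   \<Rightarrow> nat \<Rightarrow> real ^ 'p \<Rightarrow> real ^ 'd \<Rightarrow> bool" where
  "log_saddle_lik_grad_exists R P Y n \<theta> x \<longleftrightarrow>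
    (\<forall>\<^sub>F u in nhds \<theta>. (\<exists>!s. is_saddlepoint R P Y u (x /\<^sub>R real n) s) \<and> saddle_lik R P Y n u x > 0) \<and>
    (\<lambda>u. ln (saddle_lik R P Y n u x)) differentiable (at \<theta>)"

end

theory Submission
  imports Defs "HOL-Complex_Analysis.Complex_Analysis"
begin

text \<open>
  For \<open>(s, \<theta>)\<close> in the interior of the domain, the law of the sum tilted by \<open>exp (s \<bullet> x)\<close> has the
  integrable Fourier transform \<open>M0 (s + \<i>\<phi>; \<theta>) ^ n\<close>, so that the likelihood is an inverse Fourier
  integral which can be differentiated in \<open>\<theta>\<close> with \<open>s\<close> kept fixed. At the saddlepoint the
  log-derivative is \<open>n \<integral> G T ^ (n - 1) / \<integral> T ^ n\<close>, where \<open>T\<close> is the normalised transform, centred so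
  that its gradient at \<open>0\<close> vanishes, and \<open>G\<close> comes from the derivative in \<open>\<theta>\<close>. Integration by parts
  shows that adding to \<open>G\<close> a combination of the derivatives of \<open>T\<close> with coefficients affine in \<open>\<phi>\<close>
  changes the quotient by an explicit amount. The coefficients can be chosen so that the new
  integrand \<open>F\<close> is of order \<open>|\<phi>| ^ 3\<close> with even part of order \<open>|\<phi>| ^ 4\<close>, and then the explicit terms are
  exactly the derivative of the saddlepoint log-likelihood. Since \<open>T\<close> concentrates on the scale
  \<open>|\<phi>| \<sim> n powr (- 1 / 2)\<close>, the remaining quotient is \<open>O (n powr (- 2))\<close>.
\<close>

subsection \<open>Fourier inversion for densities\<close>

text \<open>The claim compares derivatives, so an expansion of the likelihood with relative error
  O(1/n) would not suffice: the error would have to be differentiated too. Here nothing is expanded.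
  Integration by parts is an exact identity, and what it leaves is only bounded from above, against
  a lower bound of order n powr (- d / 2) for the integral of T ^ n.

  Two conditions fix the coefficients. At a real argument t \<omega>, F is a nonzero factor times
  D_w K0 (s + t \<omega>) - D_w K0 (s) + t (C \<omega>) \<bullet> (K0' (s + t \<omega>) - y) with w
  = (a, e). The linear term vanishes if a is the derivative of the saddlepoint in direction e, the
  quadratic one if C is - 1 / 2 times the inverse of K0'' times D_w K0''; the trace of C is then the
  derivative of - 1 / 2 log det K0''.

  Orders of vanishing are visible at real arguments, while the integrals run over imaginary ones.
  Holomorphy along complex lines and the Schwarz lemma carry the orders over, with constants
  governed by a bound on a disc. In the integrand, the even part of F leaves |\<phi>| ^ 4 and the
  odd part of T ^ (n - 1) leaves n |\<phi>| ^ 6; both scale to n powr (- 2).\<close>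

lemma lborel_prod_Basis:
  fixes f :: "'a::euclidean_space \<Rightarrow> real \<Rightarrow> 'b::{real_normed_field,banach,second_countable_topology}"
  assumes f: "\<And>b. b \<in> Basis \<Longrightarrow> integrable lborel (f b)"
  shows integrable_lborel_prod_Basis: "integrable lborel (\<lambda>x::'a. \<Prod>b\<in>Basis. f b (x \<bullet> b))" (is ?i)
    and integral_lborel_prod_Basis:
      "(\<integral>x. (\<Prod>b\<in>Basis. f b (x \<bullet> b)) \<partial>(lborel :: 'a measure)) = (\<Prod>b\<in>Basis. \<integral>t. f b t \<partial>lborel)" (is ?e)
proof -
  interpret product_sigma_finite "\<lambda>b::'a. lborel :: real measure" ..
  let ?T = "\<lambda>g. \<Sum>b\<in>Basis. g b *\<^sub>R b :: 'a"
  have T: "?T \<in> measurable (\<Pi>\<^sub>M b\<in>Basis. lborel) borel"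
    by measurable
  have [simp]: "(\<Prod>b\<in>Basis. f b (?T g \<bullet> b)) = (\<Prod>b\<in>Basis. f b (g b))" for g
    by (intro prod.cong refl) simp
  have fm: "f b \<in> borel_measurable borel" if "b \<in> Basis" for b
    using f[OF that] by (simp add: borel_measurable_integrable)
  have m: "(\<lambda>x::'a. \<Prod>b\<in>Basis. f b (x \<bullet> b)) \<in> borel_measurable borel"
    by (rule borel_measurable_prod, rule measurable_compose[OF _ fm]) auto
  show ?i
    apply (subst lborel_eq)
    apply (subst integrable_distr_eq[OF T m])
    using product_integrable_prod[of Basis f] f by simp
  show ?e
    apply (subst lborel_eq)
    apply (subst integral_distr[OF T m])
    using product_integral_prod[of Basis f] f by simp
qed

definition gauss_density :: "'a::euclidean_space \<Rightarrow> real" where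
  "gauss_density v = (\<Prod>b\<in>Basis. std_normal_density (v \<bullet> b))"

lemma gauss_density_eq:
  "gauss_density (v::'a::euclidean_space) = exp (- (norm v)\<^sup>2 / 2) / sqrt (2 * pi) ^ DIM('a)"
proof -
  have "gauss_density v = (\<Prod>b\<in>Basis. exp (- (v \<bullet> b)\<^sup>2 / 2)) / (\<Prod>b\<in>(Basis::'a set). sqrt (2 * pi))"
    unfolding gauss_density_def std_normal_density_def prod_dividef[symmetric]
    by (intro prod.cong) auto
  also have "(\<Prod>b\<in>Basis. exp (- (v \<bullet> b)\<^sup>2 / 2)) = exp (\<Sum>b\<in>Basis. - (v \<bullet> b)\<^sup>2 / 2)"
    by (simp add: exp_sum)
  also have "(\<Sum>b\<in>Basis. - (v \<bullet> b)\<^sup>2 / 2) = - (norm v)\<^sup>2 / 2"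
    by (simp add: norm_eq_sqrt_inner euclidean_inner[of v v] sum_negf sum_divide_distrib
        power2_eq_square sum_nonneg flip: sum_negf)
  finally show ?thesis by simp
qed

lemma gauss_density_nonneg: "0 \<le> gauss_density v"
  by (simp add: gauss_density_def prod_nonneg)

lemma gauss_density_le: "gauss_density (v::'a::euclidean_space) \<le> 1 / sqrt (2 * pi) ^ DIM('a)"
  unfolding gauss_density_eq by (intro divide_right_mono) auto

lemma gauss_density_measurable [measurable]: "gauss_density \<in> borel_measurable borel"
  unfolding gauss_density_eq[abs_def] by measurable

lemma integrable_gauss_density: "integrable lborel (gauss_density :: 'a::euclidean_space \<Rightarrow> real)"
  unfolding gauss_density_def[abs_def]
  by (rule integrable_lborel_prod_Basis) (simp add: integrable_normal_density)

lemma integral_gauss_density: "(\<integral>v. gauss_density v \<partial>(lborel :: 'a::euclidean_space measure)) = 1"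
  unfolding gauss_density_def[abs_def]
  by (subst integral_lborel_prod_Basis) (simp_all add: integrable_normal_density integral_normal_density)

text \<open>The Gaussian factorises over the coordinates, so the characteristic function of the
  one-dimensional standard normal law suffices. That the transform is again Gaussian is what makes
  this density a convenient mollifier below.\<close>

lemma fourier_gauss_density:
  fixes x :: "'a::euclidean_space"
  shows "(CLINT v|lborel. iexp (v \<bullet> x) * gauss_density v) = exp (- (norm x)\<^sup>2 / 2)"
proof -
  have 1: "(CLINT t|lborel. iexp (t * c) * std_normal_density t) = exp (- c\<^sup>2 / 2)" for c
  proof -
    have "exp (- c\<^sup>2 / 2) = char std_normal_distribution c"
      by (simp add: char_std_normal_distribution)
    also have "\<dots> = (CLINT t|lborel. std_normal_density t *\<^sub>R iexp (c * t))"
      unfolding char_def by (subst integral_density) (auto simp: normal_density_nonneg)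
    finally show ?thesis by (simp add: scaleR_conv_of_real mult_ac)
  qed
  have i: "integrable lborel (\<lambda>t. iexp (t * c) * std_normal_density t)" for c
    by (rule Bochner_Integration.integrable_bound[OF integrable_normal_density[of 1 0]])
       (auto simp: norm_mult)
  have eq: "iexp (v \<bullet> x) * gauss_density v
     = (\<Prod>b\<in>Basis. iexp ((v \<bullet> b) * (x \<bullet> b)) * std_normal_density (v \<bullet> b))" for v :: 'a
  proof -
    have "iexp (v \<bullet> x) = (\<Prod>b\<in>Basis. iexp ((v \<bullet> b) * (x \<bullet> b)))"
      by (subst euclidean_inner) (simp add: exp_sum sum_distrib_left of_real_sum)
    then show ?thesis by (simp add: gauss_density_def prod.distrib)
  qed
  have "(CLINT v|lborel. iexp (v \<bullet> x) * gauss_density v)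
      = of_real (\<Prod>b\<in>Basis. exp (- (x \<bullet> b)\<^sup>2 / 2))"
    unfolding eq using i 1
    by (subst integral_lborel_prod_Basis[of "\<lambda>b t. iexp (t * (x \<bullet> b)) * std_normal_density t"]) auto
  also have "(\<Prod>b\<in>Basis. exp (- (x \<bullet> b)\<^sup>2 / 2)) = exp (\<Sum>b\<in>Basis. - (x \<bullet> b)\<^sup>2 / 2)"
    by (simp add: exp_sum)
  also have "(\<Sum>b\<in>Basis. - (x \<bullet> b)\<^sup>2 / 2) = - (norm x)\<^sup>2 / 2"
    by (simp add: norm_eq_sqrt_inner euclidean_inner[of x x] sum_negf sum_divide_distrib
        power2_eq_square sum_nonneg flip: sum_negf)
  finally show ?thesis .
qed

lemma integral_lborel_affine:
  fixes f :: "'a::euclidean_space \<Rightarrow> 'b::{banach, second_countable_topology}"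
  assumes "c \<noteq> 0" and [measurable]: "f \<in> borel_measurable borel"
  shows "(\<integral>x. f x \<partial>lborel) = \<bar>c\<bar> ^ DIM('a) *\<^sub>R (\<integral>x. f (t + c *\<^sub>R x) \<partial>lborel)"
  by (subst lborel_affine[OF assms(1), of t])
     (simp add: integral_density integral_distr)

lemma integrable_lborel_affine:
  fixes f :: "'a::euclidean_space \<Rightarrow> 'b::{banach, second_countable_topology}"
  assumes "c \<noteq> 0" and f: "integrable lborel f"
  shows "integrable lborel (\<lambda>x. f (t + c *\<^sub>R x))"
proof -
  have m[measurable]: "f \<in> borel_measurable borel" using f by auto
  have "integrable (density (distr lborel borel (\<lambda>x. t + c *\<^sub>R x)) (\<lambda>_. \<bar>c\<bar>^DIM('a))) f"
    using f lborel_affine[OF assms(1), of t] by simp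
  then have "integrable (distr lborel borel (\<lambda>x. t + c *\<^sub>R x)) (\<lambda>x. \<bar>c\<bar>^DIM('a) *\<^sub>R f x)"
    by (subst (asm) integrable_density) auto
  then have "integrable lborel (\<lambda>x. \<bar>c\<bar>^DIM('a) *\<^sub>R f (t + c *\<^sub>R x))"
    by (subst (asm) integrable_distr_eq) auto
  then have "integrable lborel (\<lambda>x. inverse (\<bar>c\<bar>^DIM('a)) *\<^sub>R \<bar>c\<bar>^DIM('a) *\<^sub>R f (t + c *\<^sub>R x))"
    by (rule integrable_scaleR_right)
  then show ?thesis using assms(1) by simp
qed

lemma fourier_scaled_gauss:
  fixes v :: "'a::euclidean_space"
  assumes "0 < \<sigma>"
  shows "(CLINT \<phi>|lborel. iexp (\<phi> \<bullet> v) * exp (- (norm (\<sigma> *\<^sub>R \<phi>))\<^sup>2 / 2))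
    = (2 * pi / \<sigma>) ^ DIM('a) * gauss_density (v /\<^sub>R \<sigma>)"
proof -
  have E: "exp (- (norm \<eta>)\<^sup>2 / 2) = sqrt (2 * pi) ^ DIM('a) * gauss_density \<eta>" for \<eta> :: 'a
    by (simp add: gauss_density_eq)
  let ?f = "\<lambda>\<phi>::'a. iexp (\<phi> \<bullet> v) * complex_of_real (exp (- (norm (\<sigma> *\<^sub>R \<phi>))\<^sup>2 / 2))"
  have f: "?f (0 + (1 / \<sigma>) *\<^sub>R \<eta>) = sqrt (2 * pi) ^ DIM('a) * (iexp (\<eta> \<bullet> (v /\<^sub>R \<sigma>)) * gauss_density \<eta>)" for \<eta>
  proof -
    have 1: "\<sigma> *\<^sub>R (0 + (1 / \<sigma>) *\<^sub>R \<eta>) = \<eta>" using assms by simp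
    have 2: "(0 + (1 / \<sigma>) *\<^sub>R \<eta>) \<bullet> v = \<eta> \<bullet> (v /\<^sub>R \<sigma>)" by (simp add: divide_inverse)
    show ?thesis unfolding 1 2 E by (simp add: mult.left_commute)
  qed
  have "integral\<^sup>L lborel ?f = \<bar>1 / \<sigma>\<bar> ^ DIM('a) *\<^sub>R (\<integral>\<eta>. ?f (0 + (1 / \<sigma>) *\<^sub>R \<eta>) \<partial>lborel)"
    by (rule integral_lborel_affine) (use assms in \<open>simp, measurable\<close>)
  also have "(\<integral>\<eta>. ?f (0 + (1 / \<sigma>) *\<^sub>R \<eta>) \<partial>lborel)
      = (CLINT \<eta>|lborel. sqrt (2 * pi) ^ DIM('a) * (iexp (\<eta> \<bullet> (v /\<^sub>R \<sigma>)) * gauss_density \<eta>))"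
    unfolding f ..
  also have "\<dots> = sqrt (2 * pi) ^ DIM('a) * exp (- (norm (v /\<^sub>R \<sigma>))\<^sup>2 / 2)"
    by (simp only: integral_mult_right_zero fourier_gauss_density of_real_mult)
  also have "\<dots> = of_real ((2 * pi) ^ DIM('a) * gauss_density (v /\<^sub>R \<sigma>))"
  proof -
    have "sqrt (2 * pi) ^ DIM('a) * sqrt (2 * pi) ^ DIM('a) = (2 * pi) ^ DIM('a)"
      unfolding power_mult_distrib[symmetric] by simp
    then have "sqrt (2 * pi) ^ DIM('a) * exp (- (norm (v /\<^sub>R \<sigma>))\<^sup>2 / 2) = (2 * pi) ^ DIM('a) * gauss_density (v /\<^sub>R \<sigma>)"
      unfolding E mult.assoc[symmetric] by (rule arg_cong)
    then show ?thesis by (simp only: of_real_mult[symmetric] of_real_power[symmetric])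
  qed
  finally show ?thesis
    using assms by (simp only: scaleR_conv_of_real) (simp add: power_divide field_simps)
qed

lemma lebesgue_integral_norm_le:
  fixes f :: "'x \<Rightarrow> 'b::{banach,second_countable_topology}"
  assumes "integrable M g" and "\<And>x. x \<in> space M \<Longrightarrow> norm (f x) \<le> g x"
  shows "norm (\<integral>x. f x \<partial>M) \<le> (\<integral>x. g x \<partial>M)"
  using assms by (intro order_trans[OF integral_norm_bound Bochner_Integration.integral_mono'])
    (auto intro: order_trans[OF norm_ge_zero])

lemma integrable_bounded_support:
  fixes w :: "'a::euclidean_space \<Rightarrow> real"
  assumes [measurable]: "w \<in> borel_measurable borel"
    and "\<And>x. \<bar>w x\<bar> \<le> B" and "\<And>x. x \<notin> box l u \<Longrightarrow> w x = 0"
  shows "integrable lborel w"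
proof (rule Bochner_Integration.integrable_bound)
  show "integrable lborel (\<lambda>x. B * indicator (box l u) x)"
    by (auto intro!: integrable_mult_right integrable_real_indicator emeasure_bounded_finite)
  show "AE x in lborel. norm (w x) \<le> norm (B * indicat_real (box l u) x)"
    using assms(2,3) by (intro AE_I2) (auto simp: indicator_def intro: order_trans[OF _ abs_ge_self])
qed auto

context
  fixes \<nu> :: "'a::euclidean_space measure" and cf :: "'a \<Rightarrow> complex"
  assumes fin: "finite_measure \<nu>" and sets_nu [measurable_cong]: "sets \<nu> = sets borel"
    and chi: "\<And>\<phi>. cf \<phi> = (CLINT y|\<nu>. iexp (\<phi> \<bullet> y))"
    and int_chi: "integrable lborel cf"
begin

lemma chi_measurable [measurable]: "cf \<in> borel_measurable borel"
  using int_chi by auto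

lemma space_nu [simp]: "space \<nu> = UNIV"
  using sets_eq_imp_space_eq[OF sets_nu] by simp

text \<open>Fubini, made legitimate by the Gaussian factor: without it the double integrand has
  modulus 1 and is not integrable in \<phi>. Up to (2 * pi) ^ d the right side is the density at
  \<open>x\<close> of \<open>\<nu>\<close> convolved with a Gaussian of width
  \<open>\<sigma>\<close>. Only finiteness of \<open>\<nu>\<close> enters, since it will be a tilted
  law whose mass is not 1.\<close>

lemma smoothed_inversion:
  assumes "0 < \<sigma>"
  shows "(CLINT \<phi>|lborel. cf \<phi> * iexp (- (\<phi> \<bullet> x)) * exp (- (norm (\<sigma> *\<^sub>R \<phi>))\<^sup>2 / 2))
    = of_real ((2 * pi / \<sigma>) ^ DIM('a) * (\<integral>y. gauss_density ((y - x) /\<^sub>R \<sigma>) \<partial>\<nu>))"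
proof -
  interpret finite_measure \<nu> by (rule fin)
  interpret p: pair_sigma_finite \<nu> "lborel :: 'a measure" ..
  let ?E = "\<lambda>\<phi>::'a. exp (- (norm (\<sigma> *\<^sub>R \<phi>))\<^sup>2 / 2)"
  let ?f = "\<lambda>y \<phi>. iexp (\<phi> \<bullet> (y - x)) * of_real (?E \<phi>)"
  have "integrable lborel (\<lambda>\<eta>::'a. sqrt (2 * pi) ^ DIM('a) * gauss_density \<eta>)"
    by (intro integrable_mult_right integrable_gauss_density)
  then have "integrable lborel (\<lambda>\<eta>::'a. exp (- (norm \<eta>)\<^sup>2 / 2))"
    by (simp add: gauss_density_eq)
  from integrable_lborel_affine[OF _ this, of \<sigma> 0] assms
  have iE: "integrable lborel ?E" by simp
  have int: "integrable (\<nu> \<Otimes>\<^sub>M lborel) (\<lambda>(y, \<phi>). ?f y \<phi>)"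
  proof (rule p.Fubini_integrable)
    show "integrable \<nu> (\<lambda>y. LINT \<phi>|lborel. norm (case (y, \<phi>) of (y, \<phi>) \<Rightarrow> ?f y \<phi>))"
      by (simp add: norm_mult)
    show "AE y in \<nu>. integrable lborel (\<lambda>\<phi>. case (y, \<phi>) of (y, \<phi>) \<Rightarrow> ?f y \<phi>)"
      by (intro AE_I2, rule Bochner_Integration.integrable_bound[OF iE]) (auto simp: norm_mult)
  qed measurable
  have "(CLINT \<phi>|lborel. cf \<phi> * iexp (- (\<phi> \<bullet> x)) * ?E \<phi>) = (CLINT \<phi>|lborel. CLINT y|\<nu>. ?f y \<phi>)"
  proof (intro Bochner_Integration.integral_cong refl)
    fix \<phi> :: 'a
    have "cf \<phi> * iexp (- (\<phi> \<bullet> x)) * ?E \<phi> = (CLINT y|\<nu>. iexp (\<phi> \<bullet> y) * (iexp (- (\<phi> \<bullet> x)) * ?E \<phi>))"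
      by (simp add: chi)
    also have "\<dots> = (CLINT y|\<nu>. ?f y \<phi>)"
      by (intro Bochner_Integration.integral_cong refl)
         (simp add: inner_diff_right exp_diff right_diff_distrib exp_minus field_simps)
    finally show "cf \<phi> * iexp (- (\<phi> \<bullet> x)) * ?E \<phi> = (CLINT y|\<nu>. ?f y \<phi>)" .
  qed
  also have "\<dots> = (CLINT y|\<nu>. CLINT \<phi>|lborel. ?f y \<phi>)"
    using p.Fubini_integral[OF int] .
  also have "\<dots> = (CLINT y|\<nu>. of_real ((2 * pi / \<sigma>) ^ DIM('a) * gauss_density ((y - x) /\<^sub>R \<sigma>)))"
    unfolding fourier_scaled_gauss[OF assms] by simp
  finally show ?thesis by simp
qed

text \<open>Fubini and the substitution x = y - \<sigma> v move the smoothing from the measure to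
  the test function, where its limit is easy to take.\<close>

lemma smoothed_weak:
  fixes w :: "'a \<Rightarrow> real"
  assumes "0 < \<sigma>" and w [measurable]: "w \<in> borel_measurable borel"
    and iw: "integrable lborel w" 
  shows "(\<integral>x. w x * ((1 / \<sigma>) ^ DIM('a) * (\<integral>y. gauss_density ((y - x) /\<^sub>R \<sigma>) \<partial>\<nu>)) \<partial>lborel)
    = (\<integral>y. (\<integral>v. w (y - \<sigma> *\<^sub>R v) * gauss_density v \<partial>lborel) \<partial>\<nu>)"
proof -
  interpret finite_measure \<nu> by (rule fin)
  interpret p: pair_sigma_finite \<nu> "lborel :: 'a measure" ..
  let ?c = "(1 / \<sigma>) ^ DIM('a)"
  let ?f = "\<lambda>y x. w x * (?c * gauss_density ((y - x) /\<^sub>R \<sigma>))"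
  have pm[measurable]: "case_prod ?f \<in> borel_measurable (\<nu> \<Otimes>\<^sub>M lborel)" by measurable
  have *: "norm (?f y x) \<le> \<bar>w x\<bar> * (?c * (1 / sqrt (2 * pi) ^ DIM('a)))" for y x
    unfolding real_norm_def abs_mult[of "w _"]
  proof (rule mult_left_mono)
    have "\<bar>?c * gauss_density ((y - x) /\<^sub>R \<sigma>)\<bar> = ?c * gauss_density ((y - x) /\<^sub>R \<sigma>)"
      using assms(1) by (simp add: gauss_density_nonneg)
    then show "\<bar>?c * gauss_density ((y - x) /\<^sub>R \<sigma>)\<bar> \<le> ?c * (1 / sqrt (2 * pi) ^ DIM('a))"
      using mult_left_mono[OF gauss_density_le, of ?c "(y - x) /\<^sub>R \<sigma>"] assms(1) by simp
  qed simp
  have ib: "integrable lborel (\<lambda>x. \<bar>w x\<bar> * (?c * (1 / sqrt (2 * pi) ^ DIM('a))))"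
    using iw by auto
  have int: "integrable (\<nu> \<Otimes>\<^sub>M lborel) (case_prod ?f)"
  proof (rule p.Fubini_integrable)
    show i: "AE y in \<nu>. integrable lborel (\<lambda>x. case (y, x) of (y, x) \<Rightarrow> ?f y x)"
      by (intro AE_I2, rule Bochner_Integration.integrable_bound[OF ib])
         (auto simp only: prod.case real_norm_def intro!: AE_I2 order_trans[OF *[unfolded real_norm_def] abs_ge_self], measurable)
    show "integrable \<nu> (\<lambda>y. LINT x|lborel. norm (case (y, x) of (y, x) \<Rightarrow> ?f y x))"
    proof (rule integrable_const_bound)
      show "AE y in \<nu>. norm (LINT x|lborel. norm (case (y, x) of (y, x) \<Rightarrow> ?f y x))
           \<le> (LINT x|lborel. \<bar>w x\<bar> * (?c * (1 / sqrt (2 * pi) ^ DIM('a))))"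
        using i
      proof eventually_elim
        case (elim y)
        have "(LINT x|lborel. norm (?f y x)) \<le> (LINT x|lborel. \<bar>w x\<bar> * (?c * (1 / sqrt (2 * pi) ^ DIM('a))))"
          using elim * ib by (intro integral_mono integrable_norm) auto
        moreover have "0 \<le> (LINT x|lborel. norm (?f y x))" by simp
        ultimately show ?case by simp
      qed
    qed measurable
  qed measurable
  have "(\<integral>x. w x * (?c * (\<integral>y. gauss_density ((y - x) /\<^sub>R \<sigma>) \<partial>\<nu>)) \<partial>lborel)
      = (\<integral>x. (\<integral>y. ?f y x \<partial>\<nu>) \<partial>lborel)" by simp
  also have "\<dots> = (\<integral>y. (\<integral>x. ?f y x \<partial>lborel) \<partial>\<nu>)"
    using p.Fubini_integral[OF int] .
  also have "\<dots> = (\<integral>y. (\<integral>v. w (y - \<sigma> *\<^sub>R v) * gauss_density v \<partial>lborel) \<partial>\<nu>)"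
  proof (rule Bochner_Integration.integral_cong[OF refl])
    fix y
    have "(\<integral>x. ?f y x \<partial>lborel) = \<bar>- \<sigma>\<bar> ^ DIM('a) *\<^sub>R (\<integral>v. ?f y (y + (- \<sigma>) *\<^sub>R v) \<partial>lborel)"
      using assms by (intro integral_lborel_affine) auto
    also have "\<dots> = \<sigma> ^ DIM('a) * (\<integral>v. ?c * (w (y - \<sigma> *\<^sub>R v) * gauss_density v) \<partial>lborel)"
      using assms by (simp add: mult_ac)
    also have "\<dots> = (\<integral>v. w (y - \<sigma> *\<^sub>R v) * gauss_density v \<partial>lborel)"
      using assms by (simp add: power_one_over)
    finally show "(\<integral>x. ?f y x \<partial>lborel) = (\<integral>v. w (y - \<sigma> *\<^sub>R v) * gauss_density v \<partial>lborel)" .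
  qed
  finally show ?thesis .
qed

text \<open>Dominated convergence twice: in \<open>v\<close> with a multiple of the Gaussian as
  majorant, then in \<open>y\<close> with the constant \<open>B\<close>, which is integrable because
  \<open>\<nu>\<close> is finite.\<close>

lemma smoothed_weak_limit:
  fixes w :: "'a \<Rightarrow> real"
  assumes cont: "continuous_on UNIV w" and B: "\<And>x. \<bar>w x\<bar> \<le> B"
  shows "(\<lambda>n. \<integral>y. (\<integral>v. w (y - (1 / real (Suc n)) *\<^sub>R v) * gauss_density v \<partial>lborel) \<partial>\<nu>) \<longlonglongrightarrow> (\<integral>y. w y \<partial>\<nu>)"
proof -
  interpret finite_measure \<nu> by (rule fin)
  have [measurable]: "w \<in> borel_measurable borel" using cont by (rule borel_measurable_continuous_onI)
  have ig: "integrable lborel (\<lambda>v::'a. B * gauss_density v)"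
    by (intro integrable_mult_right integrable_gauss_density)
  have bd: "norm (w u * gauss_density (v::'a)) \<le> B * gauss_density v" for u v
    using mult_right_mono[OF B gauss_density_nonneg[of v]] gauss_density_nonneg[of v] by (simp add: abs_mult)
  have inner: "(\<lambda>n. \<integral>v. w (y - (1 / real (Suc n)) *\<^sub>R v) * gauss_density v \<partial>lborel) \<longlonglongrightarrow> w y" for y
  proof -
    have "(\<lambda>n. \<integral>v. w (y - (1 / real (Suc n)) *\<^sub>R v) * gauss_density v \<partial>lborel)
        \<longlonglongrightarrow> (\<integral>v. w y * gauss_density v \<partial>(lborel :: 'a measure))"
    proof (rule integral_dominated_convergence[where w = "\<lambda>v::'a. B * gauss_density v" and
          s = "\<lambda>n v. w (y - (1 / real (Suc n)) *\<^sub>R v) * gauss_density v"])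
      show "AE v in lborel. (\<lambda>n. w (y - (1 / real (Suc n)) *\<^sub>R v) * gauss_density v) \<longlonglongrightarrow> w y * gauss_density v"
      proof (intro AE_I2 tendsto_mult tendsto_const)
        fix v
        have "(\<lambda>n. y - (1 / real (Suc n)) *\<^sub>R v) \<longlonglongrightarrow> y - 0 *\<^sub>R v"
          by (intro tendsto_diff tendsto_const tendsto_scaleR[OF LIMSEQ_Suc[OF lim_1_over_n] tendsto_const])
        moreover have "isCont w (y - 0 *\<^sub>R v)" using cont by (simp add: continuous_on_eq_continuous_at)
        ultimately show "(\<lambda>n. w (y - (1 / real (Suc n)) *\<^sub>R v)) \<longlonglongrightarrow> w y"
          using isCont_tendsto_compose by fastforce
      qed
    qed (use ig bd in auto)
    then show ?thesis by (simp add: integral_gauss_density)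
  qed
  show ?thesis
  proof (rule integral_dominated_convergence[where w = "\<lambda>_. B"])
    show "AE y in \<nu>. norm (\<integral>v. w (y - (1 / real (Suc n)) *\<^sub>R v) * gauss_density v \<partial>lborel) \<le> B" for n
    proof (intro AE_I2)
      fix y
      have "norm (\<integral>v. w (y - (1 / real (Suc n)) *\<^sub>R v) * gauss_density v \<partial>lborel) \<le> (\<integral>v. B * gauss_density v \<partial>(lborel :: 'a measure))"
        by (intro lebesgue_integral_norm_le ig bd)
      then show "norm (\<integral>v. w (y - (1 / real (Suc n)) *\<^sub>R v) * gauss_density v \<partial>lborel) \<le> B"
        by (simp add: integral_gauss_density)
    qed
  qed (use inner in auto)
qed

text \<open>The real part gives a real function before the integral is known to be real;
  \<open>inv_density_complex\<close> shows that nothing is lost.\<close>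

definition inv_density :: "'a \<Rightarrow> real" where
  "inv_density x = Re (CLINT \<phi>|lborel. cf \<phi> * iexp (- (\<phi> \<bullet> x))) / (2 * pi) ^ DIM('a)"

text \<open>The three claims share the regularised inverse integrals. By
  \<open>smoothed_inversion\<close> these are real, they are bounded by the L1 norm of
  \<open>cf\<close>, and they converge to the inverse integral with |cf| as majorant. So the inverse
  integral is a limit of real numbers and hence real.\<close>

lemma smoothed_tendsto:
  "(\<lambda>n. real (Suc n) ^ DIM('a) * (\<integral>y. gauss_density (real (Suc n) *\<^sub>R (y - x)) \<partial>\<nu>))
     \<longlonglongrightarrow> inv_density x" (is "?g \<longlonglongrightarrow> _")
  and inv_density_complex: "(CLINT \<phi>|lborel. cf \<phi> * iexp (- (\<phi> \<bullet> x))) = of_real ((2 * pi) ^ DIM('a) * inv_density x)"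
  and smoothed_bound: "\<bar>real (Suc n) ^ DIM('a) * (\<integral>y. gauss_density (real (Suc n) *\<^sub>R (y - x)) \<partial>\<nu>)\<bar>
     \<le> (\<integral>\<phi>. norm (cf \<phi>) \<partial>lborel) / (2 * pi) ^ DIM('a)"
proof -
  let ?h = "\<lambda>n. CLINT \<phi>|lborel. cf \<phi> * iexp (- (\<phi> \<bullet> x)) * exp (- (norm ((1 / real (Suc n)) *\<^sub>R \<phi>))\<^sup>2 / 2)"
  let ?F = "CLINT \<phi>|lborel. cf \<phi> * iexp (- (\<phi> \<bullet> x))"
  have h: "?h n = of_real ((2 * pi) ^ DIM('a) * ?g n)" for n
    by (subst smoothed_inversion) (simp_all add: power_mult_distrib)
  have bd: "norm (cf \<phi> * iexp (- (\<phi> \<bullet> x)) * exp (- (norm ((1 / real (Suc n)) *\<^sub>R \<phi>))\<^sup>2 / 2)) \<le> norm (cf \<phi>)" for \<phi> n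
    by (simp add: norm_mult mult_left_le)
  have lim: "?h \<longlonglongrightarrow> ?F"
  proof (rule integral_dominated_convergence[where w = "\<lambda>\<phi>. norm (cf \<phi>)"])
    show "AE \<phi> in lborel. (\<lambda>n. cf \<phi> * iexp (- (\<phi> \<bullet> x)) * exp (- (norm ((1 / real (Suc n)) *\<^sub>R \<phi>))\<^sup>2 / 2))
         \<longlonglongrightarrow> cf \<phi> * iexp (- (\<phi> \<bullet> x))"
    proof (intro AE_I2)
      fix \<phi> :: 'a
      have "(\<lambda>n. (1 / real (Suc n)) *\<^sub>R \<phi>) \<longlonglongrightarrow> 0 *\<^sub>R \<phi>"
        by (rule tendsto_scaleR[OF LIMSEQ_Suc[OF lim_1_over_n] tendsto_const])
      from this have "(\<lambda>n. cf \<phi> * iexp (- (\<phi> \<bullet> x)) * complex_of_real (exp (- (norm ((1 / real (Suc n)) *\<^sub>R \<phi>))\<^sup>2 / 2)))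
         \<longlonglongrightarrow> cf \<phi> * iexp (- (\<phi> \<bullet> x)) * complex_of_real (exp (- (norm (0 *\<^sub>R \<phi>))\<^sup>2 / 2))"
        by (intro tendsto_mult tendsto_const tendsto_of_real tendsto_exp tendsto_divide tendsto_minus tendsto_power tendsto_norm) auto
      then show "(\<lambda>n. cf \<phi> * iexp (- (\<phi> \<bullet> x)) * exp (- (norm ((1 / real (Suc n)) *\<^sub>R \<phi>))\<^sup>2 / 2))
         \<longlonglongrightarrow> cf \<phi> * iexp (- (\<phi> \<bullet> x))" by simp
    qed
  qed (use bd int_chi in auto)
  have "(\<lambda>n. Re (?h n) / (2 * pi) ^ DIM('a)) \<longlonglongrightarrow> inv_density x"
    unfolding inv_density_def using lim by (intro tendsto_intros) auto
  then show "?g \<longlonglongrightarrow> inv_density x" unfolding h by simp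
  have "(\<lambda>n. Im (?h n)) \<longlonglongrightarrow> Im ?F" using lim by (intro tendsto_intros)
  then have "Im ?F = 0" unfolding h Im_complex_of_real using LIMSEQ_unique tendsto_const by blast
  then show "?F = of_real ((2 * pi) ^ DIM('a) * inv_density x)"
    by (intro complex_eqI) (simp_all add: inv_density_def)
  have "norm (?h n) \<le> (\<integral>\<phi>. norm (cf \<phi>) \<partial>lborel)"
    using int_chi by (intro lebesgue_integral_norm_le integrable_norm bd)
  then show "\<bar>?g n\<bar> \<le> (\<integral>\<phi>. norm (cf \<phi>) \<partial>lborel) / (2 * pi) ^ DIM('a)"
    unfolding h norm_of_real abs_mult by (simp add: field_simps)
qed

lemma inv_density_nonneg: "0 \<le> inv_density x"
  by (rule LIMSEQ_le_const[OF smoothed_tendsto])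
     (auto intro!: mult_nonneg_nonneg integral_nonneg simp: gauss_density_nonneg)

lemma inv_density_bound: "inv_density x \<le> (\<integral>\<phi>. norm (cf \<phi>) \<partial>lborel) / (2 * pi) ^ DIM('a)"
  by (rule LIMSEQ_le_const2[OF smoothed_tendsto]) (intro exI[of _ 0] allI impI abs_le_D1[OF smoothed_bound])

lemma continuous_inv_density: "continuous_on UNIV inv_density"
proof -
  have "continuous_on UNIV (\<lambda>x. CLINT \<phi>|lborel. cf \<phi> * iexp (- (\<phi> \<bullet> x)))"
    unfolding continuous_on_sequentially
  proof (intro ballI allI impI, unfold o_def)
    fix X :: "nat \<Rightarrow> 'a" and x assume X: "(\<forall>n. X n \<in> UNIV) \<and> X \<longlonglongrightarrow> x"
    show "(\<lambda>n. CLINT \<phi>|lborel. cf \<phi> * iexp (- (\<phi> \<bullet> X n))) \<longlonglongrightarrow> (CLINT \<phi>|lborel. cf \<phi> * iexp (- (\<phi> \<bullet> x)))"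
    proof (rule integral_dominated_convergence[where w = "\<lambda>\<phi>. norm (cf \<phi>)"])
      show "AE \<phi> in lborel. (\<lambda>n. cf \<phi> * iexp (- (\<phi> \<bullet> X n))) \<longlonglongrightarrow> cf \<phi> * iexp (- (\<phi> \<bullet> x))"
        using X by (intro AE_I2 tendsto_intros) auto
    qed (use int_chi in \<open>auto simp: norm_mult\<close>)
  qed
  then show ?thesis unfolding inv_density_def by (intro continuous_intros) auto
qed

lemma inv_density_measurable [measurable]: "inv_density \<in> borel_measurable borel"
  using continuous_inv_density by (rule borel_measurable_continuous_onI)

text \<open>Both sides are limits of the same smoothed integrals, the right one by pointwise
  convergence of the smoothed densities, the left one by \<open>smoothed_weak_limit\<close>. Bounded
  support makes \<open>w\<close> integrable, and the uniform bound on the smoothed densities then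
  supplies a majorant.\<close>

lemma integral_test_function:
  fixes w :: "'a \<Rightarrow> real"
  assumes cont: "continuous_on UNIV w" and B: "\<And>x. \<bar>w x\<bar> \<le> B" and supp: "\<And>x. x \<notin> box l u \<Longrightarrow> w x = 0"
  shows "(\<integral>y. w y \<partial>\<nu>) = (\<integral>x. w x * inv_density x \<partial>lborel)"
proof -
  have [measurable]: "w \<in> borel_measurable borel" using cont by (rule borel_measurable_continuous_onI)
  have iw: "integrable lborel w" using B supp by (intro integrable_bounded_support) auto
  let ?g = "\<lambda>n x. real (Suc n) ^ DIM('a) * (\<integral>y. gauss_density (real (Suc n) *\<^sub>R (y - x)) \<partial>\<nu>)"
  let ?C = "(\<integral>\<phi>. norm (cf \<phi>) \<partial>lborel) / (2 * pi) ^ DIM('a)"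
  interpret finite_measure \<nu> by (rule fin)
  have [measurable]: "?g n \<in> borel_measurable borel" for n by measurable
  have "(\<lambda>n. \<integral>x. w x * ?g n x \<partial>lborel) \<longlonglongrightarrow> (\<integral>x. w x * inv_density x \<partial>lborel)"
  proof (rule integral_dominated_convergence[where w = "\<lambda>x. \<bar>w x\<bar> * ?C"])
    show "AE x in lborel. (\<lambda>n. w x * ?g n x) \<longlonglongrightarrow> w x * inv_density x"
      by (intro AE_I2 tendsto_mult tendsto_const smoothed_tendsto)
    show "AE x in lborel. norm (w x * ?g n x) \<le> \<bar>w x\<bar> * ?C" for n
      unfolding real_norm_def abs_mult[of "w _"] by (intro AE_I2 mult_left_mono smoothed_bound abs_ge_zero)
  qed (use iw in auto)
  moreover have "(\<integral>x. w x * ?g n x \<partial>lborel)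
      = (\<integral>y. (\<integral>v. w (y - (1 / real (Suc n)) *\<^sub>R v) * gauss_density v \<partial>lborel) \<partial>\<nu>)" for n
    using smoothed_weak[of "1 / real (Suc n)" w] iw by simp
  ultimately show ?thesis
    using smoothed_weak_limit[OF cont B] LIMSEQ_unique by simp
qed

text \<open>Open boxes are stable under intersection and generate the Borel sets, so two measures
  that agree on them, with finite mass on an exhausting sequence of boxes, coincide. Agreement on a
  box follows by approximating its indicator with continuous functions.\<close>

lemma fourier_inversion_density: "\<nu> = density lborel (\<lambda>x. ennreal (inv_density x))"
proof (rule measure_eqI_generator_eq[where E = "range (\<lambda>(a, b). box a b)" and \<Omega> = UNIV
      and A = "\<lambda>n. box (- real n *\<^sub>R One) (real n *\<^sub>R One)"])
  interpret finite_measure \<nu> by (rule fin)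
  show "Int_stable (range (\<lambda>(a, b). box a b :: 'a set))"
    by (auto simp: Int_stable_def box_Int_box)
  show "emeasure \<nu> X = emeasure (density lborel (\<lambda>x. ennreal (inv_density x))) X"
    if "X \<in> range (\<lambda>(a, b). box a b)" for X
  proof -
    obtain l u where X: "X = box l u" using \<open>X \<in> _\<close> by auto
    \<comment> \<open>Continuous, zero off the box, and converging to its indicator because a point
      of an open set has positive distance to the complement.\<close>
    define w where "w k x = min 1 (real k * infdist x (- X))" for k :: nat and x
    \<comment> \<open>The distance to an empty set is 0 by convention, so the positivity of
      \<open>infdist\<close> needs the complement of the bounded box to be nonempty.\<close>
    have ne: "- X \<noteq> {}" 
      unfolding X using bounded_box[of l u] not_bounded_UNIV by (metis Compl_empty_eq double_compl)
    have cl: "closed (- X)" by (simp add: X open_box closed_Compl)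
    have w0: "0 \<le> w k x" "w k x \<le> 1" for k x by (auto simp: w_def infdist_nonneg)
    have ws: "w k x = 0" if "x \<notin> X" for k x using that by (auto simp: w_def)
    have cw: "continuous_on UNIV (w k)" for k
      unfolding w_def by (intro continuous_intros)
    have [measurable]: "w k \<in> borel_measurable borel" for k
      using cw by (rule borel_measurable_continuous_onI)
    have lim: "(\<lambda>k. w k x) \<longlonglongrightarrow> indicator X x" for x
    proof (cases "x \<in> X")
      case True
      then have pos: "0 < infdist x (- X)"
        using infdist_pos_not_in_closed[OF cl ne] by simp
      obtain k0 :: nat where k0: "1 < real k0 * infdist x (- X)"
        using reals_Archimedean3[OF pos] by blast
      have "w k x = 1" if "k0 \<le> k" for k
      proof -
        have "real k0 * infdist x (- X) \<le> real k * infdist x (- X)"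
          using that pos by (intro mult_right_mono) auto
        then show ?thesis using k0 by (simp add: w_def)
      qed
      then have "eventually (\<lambda>k. w k x = 1) sequentially"
        unfolding eventually_sequentially by blast
      then show ?thesis using True by (simp add: tendsto_eventually)
    qed (simp add: ws)
    have 1: "(\<lambda>k. \<integral>y. w k y \<partial>\<nu>) \<longlonglongrightarrow> (\<integral>y. indicator X y \<partial>\<nu>)"
      by (rule integral_dominated_convergence[where w = "\<lambda>_. 1"]) (use w0 lim X in auto)
    have ii: "integrable lborel (\<lambda>x. indicat_real X x * inv_density x)"
      by (rule integrable_bounded_support[of _ "(\<integral>\<phi>. norm (cf \<phi>) \<partial>lborel) / (2 * pi) ^ DIM('a)" l u])
         (auto simp: X indicator_def abs_of_nonneg[OF inv_density_nonneg] inv_density_bound[unfolded power_mult_distrib] integral_nonneg power_mult_distrib)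
    have 2: "(\<lambda>k. \<integral>x. w k x * inv_density x \<partial>lborel) \<longlonglongrightarrow> (\<integral>x. indicator X x * inv_density x \<partial>lborel)"
    proof (rule integral_dominated_convergence[where w = "\<lambda>x. indicator X x * inv_density x"])
      show "AE x in lborel. norm (w k x * inv_density x) \<le> indicat_real X x * inv_density x" for k
        using w0[of k] ws[of _ k] inv_density_nonneg by (intro AE_I2) (auto simp: indicator_def abs_mult mult_right_mono mult_left_le_one_le)
    qed (use ii lim X in \<open>auto intro!: AE_I2 tendsto_mult\<close>)
    have "(\<integral>y. w k y \<partial>\<nu>) = (\<integral>x. w k x * inv_density x \<partial>lborel)" for k
      by (rule integral_test_function[OF cw, of _ 1 l u]) (use w0 ws X in \<open>auto simp: abs_of_nonneg\<close>)
    with 1 2 have "(\<integral>y. indicator X y \<partial>\<nu>) = (\<integral>x. indicator X x * inv_density x \<partial>lborel)"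
      using LIMSEQ_unique by simp
    then have "measure \<nu> X = (\<integral>x. indicator X x * inv_density x \<partial>lborel)"
      by (simp add: X)
    moreover have "emeasure (density lborel (\<lambda>x. ennreal (inv_density x))) X
        = ennreal (\<integral>x. indicator X x * inv_density x \<partial>lborel)"
      using ii inv_density_nonneg
      by (subst emeasure_density) (auto simp: X nn_integral_eq_integral[symmetric] indicator_def intro!: nn_integral_cong)
    ultimately show ?thesis by (simp add: emeasure_eq_measure)
  qed
  show "(\<Union>i. box (- real i *\<^sub>R One) (real i *\<^sub>R One)) = (UNIV :: 'a set)"
    using UN_box_eq_UNIV by (simp add: scaleR_minus_left)
  show "sets \<nu> = sigma_sets UNIV (range (\<lambda>(a, b). box a b))"
    unfolding sets_nu borel_eq_box by (simp add: sets_measure_of)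
  show "sets (density lborel (\<lambda>x. ennreal (inv_density x))) = sigma_sets UNIV (range (\<lambda>(a, b). box a b))"
    unfolding sets_density sets_lborel borel_eq_box by (simp add: sets_measure_of)
qed (auto simp: finite_measure.emeasure_finite[OF fin])

end

section \<open>Integrals of derivatives and derivatives of integrals over the whole space\<close>

lemma integral_directional_derivative_eq_0:
  fixes G H :: "'a::euclidean_space \<Rightarrow> complex"
  assumes G: "integrable lborel G" and H: "integrable lborel H"
    and cont: "continuous_on UNIV H"
    and der: "\<And>x. ((\<lambda>t. G (x + t *\<^sub>R b)) has_vector_derivative H x) (at 0)"
  shows "(\<integral>x. H x \<partial>lborel) = 0"
proof -
  have [measurable]: "G \<in> borel_measurable borel" "H \<in> borel_measurable borel"
    using G H by auto
  let ?I = "\<lambda>t::real. indicat_real {0..1} t"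
  let ?f = "\<lambda>t x. ?I t *\<^sub>R H (x + t *\<^sub>R b)"
  have trans: "(\<integral>x. F (x + v) \<partial>lborel) = (\<integral>x. F x \<partial>lborel)"
    if [measurable]: "F \<in> borel_measurable borel" for F :: "'a \<Rightarrow> 'z::{banach, second_countable_topology}" and v
    using integral_lborel_affine[of 1 F v] by (simp add: add.commute)
  have transi: "integrable lborel (\<lambda>x. F (x + v))" if "integrable lborel F" for F :: "'a \<Rightarrow> complex" and v
    using integrable_lborel_affine[OF _ that, of 1 v] by (simp add: add.commute)
  have int: "integrable (lborel \<Otimes>\<^sub>M lborel) (case_prod ?f)"
  proof (rule lborel_pair.Fubini_integrable)
    have "(LINT x|lborel. norm (case (t, x) of (t, x) \<Rightarrow> ?f t x)) = ?I t * (LINT x|lborel. norm (H x))" for t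
      using trans[of "\<lambda>x. norm (H x)" "t *\<^sub>R b"] by simp
    then show "integrable lborel (\<lambda>t. LINT x|lborel. norm (case (t, x) of (t, x) \<Rightarrow> ?f t x))"
      by (simp only:) simp
    show "AE t in lborel. integrable lborel (\<lambda>x. case (t, x) of (t, x) \<Rightarrow> ?f t x)"
      by (intro AE_I2) (auto intro!: integrable_scaleR_right transi H)
  qed measurable
  have der': "((\<lambda>t. G (x + t *\<^sub>R b)) has_vector_derivative H (x + t *\<^sub>R b)) (at t)" for x t
  proof -
    have "((\<lambda>s. s - t) has_vector_derivative 1) (at t)"
      by (auto intro!: derivative_eq_intros)
    moreover have "((\<lambda>s. G ((x + t *\<^sub>R b) + s *\<^sub>R b)) has_vector_derivative H (x + t *\<^sub>R b)) (at (t - t))"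
      using der by simp
    ultimately have "((\<lambda>s. G ((x + t *\<^sub>R b) + s *\<^sub>R b)) \<circ> (\<lambda>s. s - t) has_vector_derivative 1 *\<^sub>R H (x + t *\<^sub>R b)) (at t)"
      by (rule vector_diff_chain_at)
    then show ?thesis by (simp add: o_def algebra_simps)
  qed
  have inner: "(\<integral>t. ?f t x \<partial>lborel) = G (x + b) - G x" for x
  proof -
    have "(\<integral>t. ?f t x \<partial>lborel) = G (x + 1 *\<^sub>R b) - G (x + 0 *\<^sub>R b)"
    proof (rule integral_FTC_atLeastAtMost)
      show "continuous_on {0..1} (\<lambda>t. H (x + t *\<^sub>R b))"
        by (intro continuous_on_compose2[OF cont] continuous_intros) auto
    qed (auto intro: has_vector_derivative_at_within der')
    then show ?thesis by simp
  qed
  have "integrable lborel ?I" by (intro integrable_real_indicator) auto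
  then have "(\<integral>t. ?I t *\<^sub>R (\<integral>x. H x \<partial>lborel) \<partial>lborel) = (\<integral>t. ?I t \<partial>lborel) *\<^sub>R (\<integral>x. H x \<partial>lborel)"
    by (rule integral_scaleR_left)
  \<comment> \<open>By translation invariance the integral of \<open>H\<close> equals its average
    over the shifts t b with t in [0, 1]. Exchanging the integrals leaves G (x + b) - G x, whose
    integral is 0, again by invariance. No decay of \<open>G\<close> at infinity is needed beyond
    integrability.\<close>
  then have "(\<integral>x. H x \<partial>lborel) = (\<integral>t. ?I t *\<^sub>R (\<integral>x. H x \<partial>lborel) \<partial>lborel)"
    by simp
  also have "\<dots> = (\<integral>t. (\<integral>x. ?f t x \<partial>lborel) \<partial>lborel)"
    using trans[of H] by simp
  also have "\<dots> = (\<integral>x. (\<integral>t. ?f t x \<partial>lborel) \<partial>lborel)"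
    using lborel_pair.Fubini_integral[OF int] by simp
  also have "\<dots> = (\<integral>x. G (x + b) \<partial>lborel) - (\<integral>x. G x \<partial>lborel)"
    unfolding inner by (rule Bochner_Integration.integral_diff[OF transi[OF G] G])
  also have "\<dots> = 0" by (simp add: trans)
  finally show ?thesis .
qed

text \<open>The bound on \<open>f'\<close> over the whole ball gives, through the mean value
  inequality, the majorant 2 g for the remainder divided by the norm of the increment; dominated
  convergence along sequences does the rest.\<close>

lemma has_derivative_lebesgue_integral:
  fixes f :: "'a::euclidean_space \<Rightarrow> 'b \<Rightarrow> 'c::{banach, second_countable_topology}"
  assumes r: "0 < r"
    and der: "\<And>u x. u \<in> ball \<theta> r \<Longrightarrow> x \<in> space M \<Longrightarrow> ((\<lambda>u. f u x) has_derivative f' u x) (at u)"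
    and int: "\<And>u. u \<in> ball \<theta> r \<Longrightarrow> integrable M (f u)"
    and g: "integrable M g"
    and bound: "\<And>u x v. u \<in> ball \<theta> r \<Longrightarrow> x \<in> space M \<Longrightarrow> norm (f' u x v) \<le> g x * norm v"
    and meas: "\<And>v. (\<lambda>x. f' \<theta> x v) \<in> borel_measurable M"
  shows integrable_deriv_lebesgue: "integrable M (\<lambda>x. f' \<theta> x v)"
    and "((\<lambda>u. \<integral>x. f u x \<partial>M) has_derivative (\<lambda>v. \<integral>x. f' \<theta> x v \<partial>M)) (at \<theta>)"
proof -
  have c: "\<theta> \<in> ball \<theta> r" using r by simp
  have i': "integrable M (\<lambda>x. f' \<theta> x v)" for v
  proof (rule Bochner_Integration.integrable_bound[of M "\<lambda>x. g x * norm v"])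
    show "AE x in M. norm (f' \<theta> x v) \<le> norm (g x * norm v)"
      using bound[OF c] by (intro AE_I2) (auto intro: order_trans[OF _ abs_ge_self])
  qed (use g meas in auto)
  then show "integrable M (\<lambda>x. f' \<theta> x v)" .
  have lin: "linear (f' \<theta> x)" if "x \<in> space M" for x
    using der[OF c that] by (rule has_derivative_linear)
  show "((\<lambda>u. \<integral>x. f u x \<partial>M) has_derivative (\<lambda>v. \<integral>x. f' \<theta> x v \<partial>M)) (at \<theta>)"
    unfolding has_derivative_at
  proof
    show "bounded_linear (\<lambda>v. \<integral>x. f' \<theta> x v \<partial>M)"
    proof (rule bounded_linear_intro[where K = "\<integral>x. g x \<partial>M"])
      fix v w and a :: real
      have "(\<integral>x. f' \<theta> x (v + w) \<partial>M) = (\<integral>x. f' \<theta> x v + f' \<theta> x w \<partial>M)"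
        using lin by (intro Bochner_Integration.integral_cong) (auto simp: linear_add)
      then show "(\<integral>x. f' \<theta> x (v + w) \<partial>M) = (\<integral>x. f' \<theta> x v \<partial>M) + (\<integral>x. f' \<theta> x w \<partial>M)"
        using i' by simp
      have "(\<integral>x. f' \<theta> x (a *\<^sub>R v) \<partial>M) = (\<integral>x. a *\<^sub>R f' \<theta> x v \<partial>M)"
        using lin by (intro Bochner_Integration.integral_cong) (auto simp: linear_cmul)
      then show "(\<integral>x. f' \<theta> x (a *\<^sub>R v) \<partial>M) = a *\<^sub>R (\<integral>x. f' \<theta> x v \<partial>M)" by simp
      have "norm (\<integral>x. f' \<theta> x v \<partial>M) \<le> (\<integral>x. g x * norm v \<partial>M)"
        using bound[OF c] g by (intro lebesgue_integral_norm_le) auto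
      then show "norm (\<integral>x. f' \<theta> x v \<partial>M) \<le> norm v * (\<integral>x. g x \<partial>M)" by (simp add: mult.commute)
    qed
    let ?e = "\<lambda>h x. f (\<theta> + h) x - f \<theta> x - f' \<theta> x h"
    have bd: "norm (f (\<theta> + h) x - f \<theta> x) \<le> g x * norm h" if "norm h < r" "x \<in> space M" for h x
    proof -
      have "norm (f (\<theta> + h) x - f \<theta> x) \<le> g x * norm ((\<theta> + h) - \<theta>)"
      proof (rule differentiable_bound[where S = "ball \<theta> r" and f' = "\<lambda>u. f' u x"])
        show "onorm (f' u x) \<le> g x" if "u \<in> ball \<theta> r" for u
          by (rule onorm_le, rule bound[OF that \<open>x \<in> space M\<close>])
      qed (use that der r in \<open>auto simp: dist_norm intro: has_derivative_at_withinI\<close>)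
      then show ?thesis by simp
    qed
    show "(\<lambda>h. norm ((\<integral>x. f (\<theta> + h) x \<partial>M) - (\<integral>x. f \<theta> x \<partial>M) - (\<integral>x. f' \<theta> x h \<partial>M)) / norm h) \<midarrow>0\<rightarrow> 0"
      unfolding tendsto_at_iff_sequentially
    proof (intro allI impI, unfold o_def)
      fix X :: "nat \<Rightarrow> 'a" assume X0: "\<forall>i. X i \<in> UNIV - {0}" and X: "X \<longlonglongrightarrow> 0"
      have "eventually (\<lambda>n. X n \<in> ball 0 r) sequentially"
        using X r by (intro topological_tendstoD) auto
      then obtain N where N: "\<And>n. n \<ge> N \<Longrightarrow> norm (X n) < r"
        unfolding eventually_sequentially by auto
      \<comment> \<open>Dropping an initial segment puts every increment inside the ball, so that
        the majorant holds for all indices and not only eventually.\<close>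
      define Z where "Z n = X (n + N)" for n
      have Z: "norm (Z n) < r" "Z n \<noteq> 0" for n using N X0 by (auto simp: Z_def)
      have Zlim: "Z \<longlonglongrightarrow> 0" unfolding Z_def using X by (rule LIMSEQ_ignore_initial_segment)
      have Zi: "integrable M (?e (Z n))" for n
        using Z[of n] i' int c by (intro Bochner_Integration.integrable_diff) (auto simp: dist_norm)
      have dom: "(\<lambda>n. \<integral>x. norm (?e (Z n) x) / norm (Z n) \<partial>M) \<longlonglongrightarrow> (\<integral>x. 0 \<partial>M)"
      proof (rule integral_dominated_convergence[where w = "\<lambda>x. 2 * g x"])
        show "AE x in M. (\<lambda>n. norm (?e (Z n) x) / norm (Z n)) \<longlonglongrightarrow> 0"
        proof (rule AE_I2)
          fix x assume "x \<in> space M"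
          from der[OF c this] have "(\<lambda>h. norm (f (\<theta> + h) x - f \<theta> x - f' \<theta> x h) / norm h) \<midarrow>0\<rightarrow> 0"
            unfolding has_derivative_at by blast
          then show "(\<lambda>n. norm (?e (Z n) x) / norm (Z n)) \<longlonglongrightarrow> 0"
            unfolding tendsto_at_iff_sequentially o_def using Z Zlim by auto
        qed
        show "AE x in M. norm (norm (?e (Z n) x) / norm (Z n)) \<le> 2 * g x" for n
        proof (rule AE_I2)
          fix x assume x: "x \<in> space M"
          have "norm (?e (Z n) x) \<le> norm (f (\<theta> + Z n) x - f \<theta> x) + norm (f' \<theta> x (Z n))"
            by (rule norm_triangle_ineq4)
          also have "\<dots> \<le> g x * norm (Z n) + g x * norm (Z n)"
            using Z x by (intro add_mono bd bound c) auto
          finally show "norm (norm (?e (Z n) x) / norm (Z n)) \<le> 2 * g x"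
            using Z[of n] by (simp add: divide_le_eq)
        qed
        show "(\<lambda>x. norm (?e (Z n) x) / norm (Z n)) \<in> borel_measurable M" for n
          using Zi[of n] by measurable
      qed (use g in auto)
      have "(\<lambda>n. norm ((\<integral>x. f (\<theta> + Z n) x \<partial>M) - (\<integral>x. f \<theta> x \<partial>M) - (\<integral>x. f' \<theta> x (Z n) \<partial>M)) / norm (Z n)) \<longlonglongrightarrow> 0"
      proof (rule Lim_null_comparison)
        show "\<forall>\<^sub>F n in sequentially. norm (norm ((\<integral>x. f (\<theta> + Z n) x \<partial>M) - (\<integral>x. f \<theta> x \<partial>M) - (\<integral>x. f' \<theta> x (Z n) \<partial>M)) / norm (Z n))
            \<le> (\<integral>x. norm (?e (Z n) x) / norm (Z n) \<partial>M)"
        proof (rule always_eventually, rule allI)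
          fix n
          have "(\<integral>x. f (\<theta> + Z n) x \<partial>M) - (\<integral>x. f \<theta> x \<partial>M) - (\<integral>x. f' \<theta> x (Z n) \<partial>M) = (\<integral>x. ?e (Z n) x \<partial>M)"
            using Z[of n] i' int c by (simp add: dist_norm)
          moreover have "norm (\<integral>x. ?e (Z n) x \<partial>M) \<le> (\<integral>x. norm (?e (Z n) x) \<partial>M)"
            by (rule integral_norm_bound)
          ultimately show "norm (norm ((\<integral>x. f (\<theta> + Z n) x \<partial>M) - (\<integral>x. f \<theta> x \<partial>M) - (\<integral>x. f' \<theta> x (Z n) \<partial>M)) / norm (Z n))
            \<le> (\<integral>x. norm (?e (Z n) x) / norm (Z n) \<partial>M)"
            by (simp add: divide_right_mono)
        qed
      qed (use dom in simp)
      then show "(\<lambda>n. norm ((\<integral>x. f (\<theta> + X n) x \<partial>M) - (\<integral>x. f \<theta> x \<partial>M) - (\<integral>x. f' \<theta> x (X n) \<partial>M)) / norm (X n)) \<longlonglongrightarrow> 0"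
        unfolding Z_def by (rule LIMSEQ_offset)
    qed
  qed
qed

section \<open>Polynomially weighted kernels and their scaling in n\<close>

lemma integrable_inverse_power_norm:
  "integrable lborel (\<lambda>x::'a::euclidean_space. 1 / (1 + (norm x)\<^sup>2) ^ DIM('a))"
proof (rule Bochner_Integration.integrable_bound)
  have "integrable lborel (\<lambda>t::real. inverse (1 + t\<^sup>2))"
    using integrable_inverse_1_plus_square by (simp add: set_integrable_def)
  then show "integrable lborel (\<lambda>x::'a. \<Prod>b\<in>Basis. inverse (1 + (x \<bullet> b)\<^sup>2))"
    by (intro integrable_lborel_prod_Basis)
  show "AE x in lborel. norm (1 / (1 + (norm (x::'a))\<^sup>2) ^ DIM('a)) \<le> norm (\<Prod>b\<in>Basis. inverse (1 + (x \<bullet> b)\<^sup>2))"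
  proof (rule AE_I2)
    fix x :: 'a
    \<comment> \<open>Each coordinate is bounded by the norm, so the product of one-dimensional
      Cauchy kernels dominates the radial kernel.\<close>
    have "(\<Prod>b\<in>Basis. 1 + (x \<bullet> b)\<^sup>2) \<le> (\<Prod>b\<in>(Basis::'a set). 1 + (norm x)\<^sup>2)"
    proof (rule prod_mono)
      fix b :: 'a assume "b \<in> Basis"
      then have "(x \<bullet> b)\<^sup>2 \<le> (norm x)\<^sup>2" by (metis Basis_le_norm abs_ge_zero power2_abs power_mono)
      then show "0 \<le> 1 + (x \<bullet> b)\<^sup>2 \<and> 1 + (x \<bullet> b)\<^sup>2 \<le> 1 + (norm x)\<^sup>2" by simp
    qed
    moreover have "0 < (\<Prod>b\<in>Basis. 1 + (x \<bullet> b)\<^sup>2)" by (intro prod_pos) (auto simp: add_pos_nonneg)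
    ultimately have "1 / (1 + (norm x)\<^sup>2) ^ DIM('a) \<le> 1 / (\<Prod>b\<in>Basis. 1 + (x \<bullet> b)\<^sup>2)"
      by (intro divide_left_mono mult_pos_pos) (auto simp: add_pos_nonneg)
    then show "norm (1 / (1 + (norm x)\<^sup>2) ^ DIM('a)) \<le> norm (\<Prod>b\<in>Basis. inverse (1 + (x \<bullet> b)\<^sup>2))"
      by (simp add: prod_inversef[symmetric] o_def inverse_eq_divide abs_of_nonneg prod_nonneg prod_dividef)
  qed
qed measurable

text \<open>The common majorant of all integrands. The first factor records the order of vanishing
  at 0, which becomes a rate in n; the second the polynomial growth of derivatives of the transform;
  the denominator the decay of its n-th power, for which \<open>c\<close> is replaced by
  \<open>c * real n\<close>.\<close>

definition moment_kernel :: "nat \<Rightarrow> nat \<Rightarrow> nat \<Rightarrow> real \<Rightarrow> 'a::euclidean_space \<Rightarrow> real" where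
  "moment_kernel k N P c \<phi> = norm \<phi> ^ k * (1 + norm \<phi>) ^ N / (1 + c * (norm \<phi>)\<^sup>2) ^ P"

lemma moment_kernel_nonneg: "0 \<le> c \<Longrightarrow> 0 \<le> moment_kernel k N P c \<phi>"
  by (simp add: moment_kernel_def)

lemma moment_kernel_measurable [measurable]: "moment_kernel k N P c \<in> borel_measurable borel"
  unfolding moment_kernel_def[abs_def] by measurable

lemma integrable_moment_kernel:
  assumes c: "0 < c" and P: "k + N + DIM('a) \<le> P"
  shows "integrable lborel (moment_kernel k N P c :: 'a::euclidean_space \<Rightarrow> real)"
proof (rule Bochner_Integration.integrable_bound)
  \<comment> \<open>With c' at most 1 and at most c, the quantity c' (1 + |x|^2) lies below 1 + c
    |x|^2, and the kernel can be compared with powers of 1 + |x|^2 alone.\<close>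
  define c' where "c' = min c 1"
  have c': "0 < c'" "c' \<le> 1" "c' \<le> c" using c by (auto simp: c'_def)
  show "integrable lborel (\<lambda>x::'a. (2 ^ (k + N) / c' ^ P) * (1 / (1 + (norm x)\<^sup>2) ^ DIM('a)))"
    by (intro integrable_mult_right integrable_inverse_power_norm)
  show "AE x in lborel. norm (moment_kernel k N P c (x::'a)) \<le> norm ((2 ^ (k + N) / c' ^ P) * (1 / (1 + (norm x)\<^sup>2) ^ DIM('a)))"
  proof (rule AE_I2)
    fix x :: 'a
    let ?q = "1 + (norm x)\<^sup>2"
    have q1: "1 \<le> ?q" by simp
    have "2 * norm x \<le> ?q" using zero_le_power2[of "norm x - 1"] by (simp add: power2_diff)
    then have n: "1 + norm x \<le> 2 * ?q" using zero_le_power2[of "norm x"] by argo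
    have "norm x ^ k * (1 + norm x) ^ N \<le> (1 + norm x) ^ k * (1 + norm x) ^ N"
      by (intro mult_right_mono power_mono) auto
    also have "\<dots> \<le> (2 * ?q) ^ (k + N)"
      unfolding power_add[symmetric] by (intro power_mono n) auto
    finally have num: "norm x ^ k * (1 + norm x) ^ N \<le> 2 ^ (k + N) * ?q ^ (k + N)"
      by (simp only: power_mult_distrib)
    have "c' * ?q \<le> 1 + c * (norm x)\<^sup>2"
      using c' mult_right_mono[OF c'(3) zero_le_power2[of "norm x"]] by (simp add: distrib_left)
    then have "(c' * ?q) ^ P \<le> (1 + c * (norm x)\<^sup>2) ^ P"
      using c' by (intro power_mono) auto
    then have den: "c' ^ P * ?q ^ P \<le> (1 + c * (norm x)\<^sup>2) ^ P" by (simp add: power_mult_distrib)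
    have "?q ^ (k + N + DIM('a)) \<le> ?q ^ P" using P q1 by (intro power_increasing)
    then have le: "c' ^ P * (?q ^ (k + N) * ?q ^ DIM('a)) \<le> (1 + c * (norm x)\<^sup>2) ^ P"
      using c' den by (auto simp: power_add intro!: order_trans[OF mult_left_mono den])
    have q0: "0 < ?q" using q1 by linarith
    have "moment_kernel k N P c x \<le> (2 ^ (k + N) * ?q ^ (k + N)) / (c' ^ P * (?q ^ (k + N) * ?q ^ DIM('a)))"
      unfolding moment_kernel_def using num le c' q0
      by (intro frac_le) auto
    also have "\<dots> = (2 ^ (k + N) / c' ^ P) * (1 / ?q ^ DIM('a))"
      using c' q0 by (simp add: field_simps)
    finally show "norm (moment_kernel k N P c (x::'a)) \<le> norm ((2 ^ (k + N) / c' ^ P) * (1 / ?q ^ DIM('a)))"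
      unfolding real_norm_def using moment_kernel_nonneg[of c k N P x] c by linarith
  qed
qed measurable

text \<open>Rescaling \<phi> by \<open>sqrt (real n)\<close>: the volume element gives the exponent
  d, and each factor \<open>norm \<phi>\<close> one more. The factors 1 + |\<phi>| gain nothing;
  they are only increased, which is harmless as n is at least 1.\<close>

lemma integral_moment_kernel_le:
  assumes c: "0 < c" and P: "k + N + DIM('a) \<le> P" and n: "1 \<le> n"
  shows "(\<integral>\<phi>. moment_kernel k N P (c * real n) \<phi> \<partial>(lborel :: 'a::euclidean_space measure))
    \<le> (\<integral>\<phi>. moment_kernel k N P c \<phi> \<partial>(lborel :: 'a measure)) / sqrt (real n) ^ (k + DIM('a))"
proof -
  let ?s = "sqrt (real n)"
  have s: "1 \<le> ?s" "0 < ?s" using n by auto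
  let ?Q = "moment_kernel k N P c :: 'a \<Rightarrow> real"
  have iQ: "integrable lborel ?Q" by (rule integrable_moment_kernel[OF c P])
  have le: "moment_kernel k N P (c * real n) \<phi> \<le> ?Q (0 + ?s *\<^sub>R \<phi>) / ?s ^ k" for \<phi>
  proof -
    have "norm \<phi> \<le> ?s * norm \<phi>" using s by (simp add: mult_le_cancel_right1)
    then have "norm \<phi> ^ k * (1 + norm \<phi>) ^ N \<le> norm \<phi> ^ k * (1 + ?s * norm \<phi>) ^ N"
      by (intro mult_left_mono power_mono) auto
    then have "moment_kernel k N P (c * real n) \<phi> \<le> norm \<phi> ^ k * (1 + ?s * norm \<phi>) ^ N / (1 + c * real n * (norm \<phi>)\<^sup>2) ^ P"
      unfolding moment_kernel_def using c by (intro divide_right_mono) auto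
    also have "\<dots> = ?Q (0 + ?s *\<^sub>R \<phi>) / ?s ^ k"
      unfolding moment_kernel_def using s by (simp add: power_mult_distrib mult.assoc)
    finally show ?thesis .
  qed
  have i: "integrable lborel (\<lambda>\<phi>. ?Q (0 + ?s *\<^sub>R \<phi>))"
    using s by (intro integrable_lborel_affine iQ) auto
  have "(\<integral>\<phi>. moment_kernel k N P (c * real n) \<phi> \<partial>(lborel :: 'a measure)) \<le> (\<integral>\<phi>. ?Q (0 + ?s *\<^sub>R \<phi>) / ?s ^ k \<partial>lborel)"
    using i le c n by (intro integral_mono integrable_moment_kernel P) auto
  also have "\<dots> = (\<integral>\<phi>. ?Q (0 + ?s *\<^sub>R \<phi>) \<partial>lborel) / ?s ^ k" by simp
  also have "(\<integral>\<phi>. ?Q (0 + ?s *\<^sub>R \<phi>) \<partial>lborel) = (\<integral>\<phi>. ?Q \<phi> \<partial>lborel) / ?s ^ DIM('a)"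
    using integral_lborel_affine[of ?s ?Q 0] s by (simp add: field_simps)
  finally show ?thesis by (simp add: power_add mult.commute)
qed

text \<open>The given decay may be too slow to be integrable, but powers accelerate it:
  \<open>n1\<close> factors together already have exponent at least \<open>P\<close>, and n factors
  contain n div n1 such blocks. The bound also covers all larger \<delta>', so that it will be
  uniform over a compact set.\<close>

lemma decay_power_bound:
  fixes \<delta> :: real
  assumes "0 < \<delta>"
  obtains c n1 where "0 < c" "1 \<le> n1"
    "\<And>n x \<delta>'. n1 \<le> n \<Longrightarrow> 0 \<le> x \<Longrightarrow> \<delta> \<le> \<delta>' \<Longrightarrow> ((1 + \<delta>' * x) powr (- \<delta>')) ^ n \<le> 1 / (1 + c * real n * x) ^ P"
proof -
  obtain m :: nat where m: "real P / \<delta> < real m" using reals_Archimedean2 by blast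
  define n1 where "n1 = Suc m"
  have n1: "1 \<le> n1" "real P \<le> \<delta> * real n1"
    using m assms by (auto simp: n1_def field_simps)
  define c where "c = \<delta> / (2 * real n1)"
  have "((1 + \<delta>' * x) powr (- \<delta>')) ^ n \<le> 1 / (1 + c * real n * x) ^ P"
    if n: "n1 \<le> n" and x: "0 \<le> x" and d: "\<delta> \<le> \<delta>'" for n x \<delta>'
  proof -
    \<comment> \<open>The number of full blocks. Each contributes exponent \<open>P\<close>, and
      Bernoulli turns the q-th power of 1 + \<delta> x into 1 + q \<delta> x. As n is at most 2 n1
      q, the rate is at least \<delta> n / (2 n1), whence the value of \<open>c\<close>.\<close>
    define q where "q = n div n1"
    have q: "n1 * q \<le> n" by (simp add: q_def)
    have "n < n1 * q + n1" unfolding q_def using n1 dividend_less_times_div[of n1 n] by simp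
    moreover have "1 \<le> q" unfolding q_def using n n1 by (simp add: div_greater_zero_iff Suc_leI)
    ultimately have "n \<le> 2 * (n1 * q)" using mult_le_mono2[of 1 q n1] by linarith
    then have q2: "real n \<le> 2 * (real n1 * real q)" by (metis of_nat_le_iff of_nat_mult of_nat_numeral)
    have b1: "1 \<le> 1 + \<delta> * x" using assms x by simp
    have "(1 + \<delta>' * x) powr (- \<delta>') \<le> (1 + \<delta> * x) powr (- \<delta>)"
    proof -
      have "(1 + \<delta>' * x) powr (- \<delta>') \<le> (1 + \<delta>' * x) powr (- \<delta>)"
        using d x assms by (intro powr_mono) auto
      also have "\<dots> \<le> (1 + \<delta> * x) powr (- \<delta>)"
        using d x assms by (intro powr_mono2') (auto simp: add_pos_nonneg mult_right_mono)
      finally show ?thesis .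
    qed
    then have "((1 + \<delta>' * x) powr (- \<delta>')) ^ n \<le> ((1 + \<delta> * x) powr (- \<delta>)) ^ n"
      by (intro power_mono) auto
    also have "\<dots> = (1 + \<delta> * x) powr (- (\<delta> * real n))"
      using b1 by (subst powr_realpow[symmetric]) (auto simp: powr_powr)
    also have "\<dots> \<le> (1 + \<delta> * x) powr (real q * - real P)"
    proof (rule powr_mono[OF _ b1])
      have "real q * real P \<le> real q * (\<delta> * real n1)" using n1 by (intro mult_left_mono) auto
      also have "\<dots> = \<delta> * real (n1 * q)" by simp
      also have "\<dots> \<le> \<delta> * real n" using q assms by (intro mult_left_mono) (auto simp del: of_nat_mult)
      finally show "- (\<delta> * real n) \<le> real q * - real P" by simp
    qed
    also have "\<dots> = ((1 + \<delta> * x) ^ q) powr (- real P)"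
      using b1 by (simp only: powr_powr[symmetric]) (simp add: powr_realpow)
    also have "\<dots> \<le> (1 + c * real n * x) powr (- real P)"
    proof (rule powr_mono2')
      have "c * real n \<le> \<delta> * real q"
        using q2 n1 assms by (simp add: c_def field_simps)
      then have "1 + c * real n * x \<le> 1 + real q * (\<delta> * x)"
        using x mult_right_mono[of "c * real n" "\<delta> * real q" x] by (simp add: mult_ac)
      also have "\<dots> \<le> (1 + \<delta> * x) ^ q"
        using assms x by (intro Bernoulli_inequality) (auto intro: order_trans[of _ 0])
      finally show "1 + c * real n * x \<le> (1 + \<delta> * x) ^ q" .
    qed (use assms n1 x in \<open>auto simp: c_def intro!: add_pos_nonneg\<close>)
    also have "\<dots> = 1 / (1 + c * real n * x) ^ P"
    proof -
      have "0 < 1 + c * real n * x" using assms n1 x by (auto simp: c_def intro!: add_pos_nonneg)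
      then show ?thesis by (simp add: powr_minus powr_realpow divide_inverse)
    qed
    finally show ?thesis .
  qed
  moreover have "0 < c" using assms n1 by (simp add: c_def)
  ultimately show ?thesis using n1 that by blast
qed

subsection \<open>Holomorphic functions and continuous differentiability\<close>

lemma holomorphic_ball_isCont:
  assumes "F holomorphic_on ball z R" "0 < R"
  shows "isCont F z"
  using holomorphic_on_imp_continuous_on[OF assms(1)] continuous_on_eq_continuous_at[OF open_ball, of z R F] assms(2)
  by simp

text \<open>The Schwarz lemma for a disc of radius \<open>R\<close>: the maximum modulus principle
  on a circle of radius \<rho> < R bounds the quotient by S / \<rho>, and \<rho> tends to R.
  Dividing out a zero thus costs exactly one factor 1 / R, which keeps all later constants
  explicit.\<close>

lemma Schwarz_factor:
  fixes F :: "complex \<Rightarrow> complex"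
  assumes hol: "F holomorphic_on ball 0 R" and bd: "\<And>z. norm z < R \<Longrightarrow> norm (F z) \<le> S"
    and F0: "F 0 = 0" and R: "0 < R"
  obtains G where "G holomorphic_on ball 0 R" "\<And>z. norm z < R \<Longrightarrow> F z = z * G z"
    "\<And>z. norm z < R \<Longrightarrow> norm (G z) \<le> S / R"
proof -
  obtain G where G: "G holomorphic_on ball 0 R" "\<And>z. norm z < R \<Longrightarrow> F z = z * G z"
    using Schwarz3[OF hol F0] by metis
  have "norm (G z) \<le> S / R" if z: "norm z < R" for z
  proof -
    have *: "norm (G z) \<le> S / \<rho>" if \<rho>: "norm z < \<rho>" "\<rho> < R" for \<rho>
    proof (rule maximum_modulus_frontier[of G "ball 0 \<rho>"])
      have pos: "0 < \<rho>" using \<rho>(1) norm_ge_zero le_less_trans by blast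
      have sub: "cball 0 \<rho> \<subseteq> ball (0::complex) R" using \<rho> by auto
      show "G holomorphic_on interior (ball 0 \<rho>)"
        using sub by (intro holomorphic_on_subset[OF G(1)]) (auto simp: interior_open)
      show "continuous_on (closure (ball 0 \<rho>)) G"
        using pos sub by (simp add: continuous_on_subset[OF holomorphic_on_imp_continuous_on[OF G(1)]])
      show "norm (G w) \<le> S / \<rho>" if "w \<in> frontier (ball 0 \<rho>)" for w
      proof -
        have w: "norm w = \<rho>" using that pos by simp
        have "\<rho> * norm (G w) \<le> S" using bd[of w] G(2)[of w] \<rho> w by (simp add: norm_mult)
        then show ?thesis using pos by (simp add: field_simps)
      qed
    qed (use \<rho> in auto)
    show ?thesis
    proof (rule ccontr)
      assume "\<not> norm (G z) \<le> S / R"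
      then have g: "S < norm (G z) * R" using R by (simp add: field_simps)
      have S0: "0 \<le> S" using bd[of z] z norm_ge_zero order_trans by blast
      have gp: "0 < norm (G z)" using g S0 R by (metis le_less_trans zero_less_mult_pos2)
      \<comment> \<open>The limit \<rho> to R is taken by contradiction: a radius above both
        quantities and below \<open>R\<close> already violates the bound obtained on its
        circle.\<close>
      have "max (norm z) (S / norm (G z)) < R" using z g gp by (simp add: field_simps)
      then obtain \<rho> where \<rho>: "max (norm z) (S / norm (G z)) < \<rho>" "\<rho> < R" using dense by blast
      then have "S < norm (G z) * \<rho>" using gp by (auto simp: field_simps)
      moreover have "0 < \<rho>" using le_less_trans[OF norm_ge_zero[of z]] \<rho>(1) by simp
      ultimately have "S < norm (G z) * \<rho>" "0 < \<rho>" by auto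
      with *[of \<rho>] \<rho> show False by (simp add: field_simps)
    qed
  qed
  with G show ?thesis using that by blast
qed

text \<open>The order of vanishing is tested along the real axis only. Continuity at 0 identifies
  the value F 0 with the limit along the axis, so zeros can be split off one by one, each by
  \<open>Schwarz_factor\<close>.\<close>

lemma holomorphic_order_factor:
  fixes F :: "complex \<Rightarrow> complex"
  assumes hol: "F holomorphic_on ball 0 R" and bd: "\<And>z. norm z < R \<Longrightarrow> norm (F z) \<le> S"
    and R: "0 < R" and lim: "((\<lambda>t::real. F (of_real t) / of_real t ^ k) \<longlongrightarrow> 0) (at 0)"
  obtains G where "G holomorphic_on ball 0 R" "\<And>z. norm z < R \<Longrightarrow> F z = z ^ Suc k * G z"
    "\<And>z. norm z < R \<Longrightarrow> norm (G z) \<le> S / R ^ Suc k"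
  using hol bd lim
proof (induction k arbitrary: F S thesis)
  case (0 F S)
  have "isCont F 0"
    using 0(2) R by (rule holomorphic_ball_isCont)
  then have "((\<lambda>t::real. F (of_real t)) \<longlongrightarrow> F 0) (at 0)"
    by (rule isCont_tendsto_compose) (auto intro!: tendsto_eq_intros)
  with 0(4) have "F 0 = 0" using LIM_unique by fastforce
  from Schwarz_factor[OF 0(2) 0(3) this R] obtain G where "G holomorphic_on ball 0 R" "\<And>z. norm z < R \<Longrightarrow> F z = z * G z"
    "\<And>z. norm z < R \<Longrightarrow> norm (G z) \<le> S / R" by blast
  then show ?case using 0(1)[of G] by simp
next
  case (Suc k F S)
  have "((\<lambda>t::real. of_real t ^ k * of_real t * (F (of_real t) / of_real t ^ Suc k)) \<longlongrightarrow> 0 ^ k * 0 * 0) (at 0)"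
    by (intro tendsto_mult tendsto_power Suc(5)) (auto intro!: tendsto_eq_intros)
  moreover have "\<forall>\<^sub>F t::real in at 0. of_real t ^ k * of_real t * (F (of_real t) / of_real t ^ Suc k) = F (of_real t)"
    using eventually_neq_at_within[of "0::real" 0 UNIV] by eventually_elim (simp add: field_simps)
  ultimately have l0: "((\<lambda>t::real. F (of_real t)) \<longlongrightarrow> 0) (at 0)"
    using tendsto_cong by fastforce
  have "isCont F 0"
    using Suc(3) R by (rule holomorphic_ball_isCont)
  then have "((\<lambda>t::real. F (of_real t)) \<longlongrightarrow> F 0) (at 0)"
    by (rule isCont_tendsto_compose) (auto intro!: tendsto_eq_intros)
  with l0 have "F 0 = 0" using LIM_unique by fastforce
  from Schwarz_factor[OF Suc(3) Suc(4) this R] obtain G where G: "G holomorphic_on ball 0 R" "\<And>z. norm z < R \<Longrightarrow> F z = z * G z"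
    "\<And>z. norm z < R \<Longrightarrow> norm (G z) \<le> S / R" by blast
  have ev: "\<forall>\<^sub>F t::real in at 0. F (of_real t) / of_real t ^ Suc k = G (of_real t) / of_real t ^ k"
  proof -
    have "\<forall>\<^sub>F t::real in at 0. t \<in> ball 0 R - {0}"
      using R by (intro eventually_at_in_open) auto
    then show ?thesis
    proof eventually_elim
      case (elim t)
      then show ?case using G(2)[of "of_real t"] by simp
    qed
  qed
  have "((\<lambda>t::real. G (of_real t) / of_real t ^ k) \<longlongrightarrow> 0) (at 0)"
    using Suc(5) tendsto_cong[OF ev] by blast
  from Suc.IH[OF _ G(1) G(3) this] obtain H where "H holomorphic_on ball 0 R" "\<And>z. norm z < R \<Longrightarrow> G z = z ^ Suc k * H z"
    "\<And>z. norm z < R \<Longrightarrow> norm (H z) \<le> S / R / R ^ Suc k" by blast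
  then show ?case using Suc(2)[of H] G(2) by simp
qed

lemma holomorphic_order_bound:
  fixes F :: "complex \<Rightarrow> complex"
  assumes "F holomorphic_on ball 0 R" and "\<And>z. norm z < R \<Longrightarrow> norm (F z) \<le> S"
    and "0 < R" and "((\<lambda>t::real. F (of_real t) / of_real t ^ k) \<longlongrightarrow> 0) (at 0)"
    and z: "norm z < R"
  shows "norm (F z) \<le> S / R ^ Suc k * norm z ^ Suc k"
proof -
  obtain G where G: "G holomorphic_on ball 0 R" "\<And>z. norm z < R \<Longrightarrow> F z = z ^ Suc k * G z"
    "\<And>z. norm z < R \<Longrightarrow> norm (G z) \<le> S / R ^ Suc k"
    using holomorphic_order_factor[OF assms(1-4)] by metis
  have "norm (F z) = norm (G z) * norm z ^ Suc k"
    using G(2)[OF z] by (simp add: norm_mult norm_power)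
  also have "\<dots> \<le> S / R ^ Suc k * norm z ^ Suc k"
    by (intro mult_right_mono G(3) z) auto
  finally show ?thesis .
qed

text \<open>The parity of \<open>F\<close> is that of \<open>k\<close>, so the coefficient of the
  power k + 1 vanishes too: after division by \<open>z ^ Suc k\<close> the quotient is odd and has
  one more zero at 0. This yields a cubic bound from a first-order limit and a quartic one from a
  second-order limit.\<close>

lemma holomorphic_order_bound_parity:
  fixes F :: "complex \<Rightarrow> complex"
  assumes hol: "F holomorphic_on ball 0 R" and bd: "\<And>z. norm z < R \<Longrightarrow> norm (F z) \<le> S"
    and R: "0 < R" and lim: "((\<lambda>t::real. F (of_real t) / of_real t ^ k) \<longlongrightarrow> 0) (at 0)"
    and par: "\<And>z. norm z < R \<Longrightarrow> F (- z) = (- 1) ^ k * F z"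
    and z: "norm z < R"
  shows "norm (F z) \<le> S / R ^ (k + 2) * norm z ^ (k + 2)"
proof -
  obtain G where G: "G holomorphic_on ball 0 R" "\<And>z. norm z < R \<Longrightarrow> F z = z ^ Suc k * G z"
    "\<And>z. norm z < R \<Longrightarrow> norm (G z) \<le> S / R ^ Suc k"
    using holomorphic_order_factor[OF hol bd R lim] by metis
  have odd: "G (- z) = - G z" if "norm z < R" "z \<noteq> 0" for z
  proof -
    have "(- z) ^ Suc k * G (- z) = (- 1) ^ k * (z ^ Suc k * G z)"
      using par[of z] G(2)[of z] G(2)[of "- z"] that by simp
    moreover have "(- z) ^ Suc k = - ((- 1) ^ k * z ^ Suc k)"
      using power_minus[of z "Suc k"] by simp
    ultimately have "((- 1) ^ k * z ^ Suc k) * (- G (- z)) = ((- 1) ^ k * z ^ Suc k) * G z"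
      by (simp only: mult_minus_left mult_minus_right mult.assoc)
    moreover have "(- 1) ^ k * z ^ Suc k \<noteq> 0" using that by simp
    ultimately have "- G (- z) = G z" using mult_left_cancel[of "(- 1) ^ k * z ^ Suc k" "- G (- z)" "G z"] by blast
    then show ?thesis by (simp add: minus_equation_iff)
  qed
  have contG: "isCont G 0"
    using G(1) R by (rule holomorphic_ball_isCont)
  have l1: "(G \<longlongrightarrow> G 0) (at 0)" using contG by (simp add: isCont_def)
  have "isCont (\<lambda>z. - G (- z)) 0"
    using contG isCont_o2[of 0 uminus G] by (intro continuous_intros) auto
  then have "((\<lambda>z. - G (- z)) \<longlongrightarrow> - G 0) (at 0)" by (simp add: isCont_def)
  moreover have "\<forall>\<^sub>F z in at 0. - G (- z) = G z"
  proof -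
    have "\<forall>\<^sub>F z in at 0. z \<in> ball 0 R - {0::complex}"
      using R by (intro eventually_at_in_open) auto
    then show ?thesis by eventually_elim (use odd in auto)
  qed
  ultimately have "(G \<longlongrightarrow> - G 0) (at 0)" using tendsto_cong by fastforce
  with l1 have "G 0 = - G 0" using LIM_unique by blast
  then have "G 0 = 0" by simp
  from Schwarz_factor[OF G(1) G(3) this R] obtain H where H: "\<And>z. norm z < R \<Longrightarrow> G z = z * H z"
    "\<And>z. norm z < R \<Longrightarrow> norm (H z) \<le> S / R ^ Suc k / R" by metis
  have "norm (F z) = norm (H z) * norm z ^ (k + 2)"
    using G(2)[OF z] H(1)[OF z] by (simp add: norm_mult norm_power)
  also have "\<dots> \<le> S / R ^ (k + 2) * norm z ^ (k + 2)"
    using H(2)[OF z] by (intro mult_right_mono) (auto simp: mult.commute)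
  finally show ?thesis .
qed

text \<open>Difference quotients in the real parameter are holomorphic and converge locally
  uniformly, so the Weierstrass theorem applies. This is how partial derivatives of
  \<open>M0\<close>, given only through real increments, become holomorphic along complex
  lines.\<close>

lemma holomorphic_param_derivative:
  fixes F :: "complex \<Rightarrow> real \<Rightarrow> complex"
  assumes S: "open S" and h0: "0 < h0"
    and hol: "\<And>h. \<bar>h\<bar> \<le> h0 \<Longrightarrow> (\<lambda>z. F z h) holomorphic_on S"
    and der: "\<And>z h. z \<in> S \<Longrightarrow> \<bar>h\<bar> \<le> h0 \<Longrightarrow> (F z has_vector_derivative G z h) (at h)"
    and cont: "continuous_on (S \<times> {- h0..h0}) (\<lambda>(z, h). G z h)"
  shows "(\<lambda>z. G z 0) holomorphic_on S"
proof (rule holomorphic_uniform_sequence[OF S, of "\<lambda>n z. (F z (h0 / real (Suc n)) - F z 0) / of_real (h0 / real (Suc n))"])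
  have le: "h0 / real (Suc n) \<le> h0" "0 < h0 / real (Suc n)" for n
    using h0 by (auto simp: divide_le_eq)
  show "(\<lambda>z. (F z (h0 / real (Suc n)) - F z 0) / of_real (h0 / real (Suc n))) holomorphic_on S" for n
    using le[of n] h0 by (intro holomorphic_intros hol) auto
  fix x assume "x \<in> S"
  then obtain d where d: "0 < d" "cball x d \<subseteq> S" using S open_contains_cball by blast
  have "uniform_limit (cball x d) (\<lambda>n z. (F z (h0 / real (Suc n)) - F z 0) / of_real (h0 / real (Suc n)))
     (\<lambda>z. G z 0) sequentially"
  proof (rule uniform_limitI)
    fix e :: real assume e: "0 < e"
    let ?K = "cball x d \<times> {- h0..h0}"
    define g where "g p = (case p of (z, h) \<Rightarrow> G z h)" for p
    \<comment> \<open>Uniform continuity on a compact product bounds the oscillation of the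
      derivative between parameters 0 and h for all \<open>z\<close> at once, and with it the error
      of the difference quotient.\<close>
    have uc: "uniformly_continuous_on ?K g"
      using d unfolding g_def
      by (intro compact_uniformly_continuous continuous_on_subset[OF cont] compact_Times) auto
    have "0 < e / 2" using e by simp
    then obtain \<delta> where \<delta>: "0 < \<delta>"
      "\<And>p q. p \<in> ?K \<Longrightarrow> q \<in> ?K \<Longrightarrow> dist q p < \<delta> \<Longrightarrow> dist (g q) (g p) < e / 2"
      by (rule uniformly_continuous_onE[OF uc]) blast
    have "(\<lambda>n. h0 / real (Suc n)) \<longlonglongrightarrow> 0"
      using tendsto_mult[OF tendsto_const LIMSEQ_inverse_real_of_nat, of h0] by (simp add: divide_inverse)
    then have "\<forall>\<^sub>F n in sequentially. h0 / real (Suc n) < \<delta>"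
      using \<delta>(1) order_tendstoD(2) by blast
    then show "\<forall>\<^sub>F n in sequentially. \<forall>z\<in>cball x d.
        dist ((F z (h0 / real (Suc n)) - F z 0) / of_real (h0 / real (Suc n))) (G z 0) < e"
    proof eventually_elim
      case (elim n)
      define h where "h = h0 / real (Suc n)"
      have h: "0 < h" "h \<le> h0" "h < \<delta>" using le[of n] elim by (auto simp: h_def)
      show ?case unfolding h_def[symmetric]
      proof
        fix z assume z: "z \<in> cball x d"
        have "norm (F z h - F z 0 - (h - 0) *\<^sub>R G z 0) \<le> norm (h - 0) * (e / 2)"
        proof (rule vector_differentiable_bound_linearization[where S = "{0..h}"])
          show "(F z has_vector_derivative G z t) (at t within {0..h})" if "t \<in> {0..h}" for t
            by (rule has_vector_derivative_at_within[OF der]) (use z d that h in auto)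
          show "norm (G z t - G z 0) \<le> e / 2" if "t \<in> {0..h}" for t
            
          proof -
            have "dist (g (z, t)) (g (z, 0)) < e / 2"
              by (rule \<delta>(2)) (use z that h h0 in \<open>auto simp: dist_Pair_Pair\<close>)
            then show ?thesis by (simp add: g_def dist_norm)
          qed
        qed (use h in \<open>auto simp: closed_segment_eq_real_ivl\<close>)
        then have "norm ((F z h - F z 0) - of_real h * G z 0) / h \<le> e / 2"
          using h by (simp add: scaleR_conv_of_real divide_le_eq mult.commute)
        moreover have "(F z h - F z 0) / of_real h - G z 0 = ((F z h - F z 0) - of_real h * G z 0) / of_real h"
          using h by (simp add: field_simps)
        ultimately show "dist ((F z h - F z 0) / of_real h) (G z 0) < e"
          using e h half_gt_zero[OF e] unfolding dist_norm by (simp only: norm_divide norm_of_real abs_of_pos)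
      qed
    qed
  qed
  with d show "\<exists>d>0. cball x d \<subseteq> S \<and> uniform_limit (cball x d) (\<lambda>n z. (F z (h0 / real (Suc n)) - F z 0) / of_real (h0 / real (Suc n)))
     (\<lambda>z. G z 0) sequentially" by blast
qed

section \<open>Continuous differentiability from partial derivatives\<close>

lemma has_derivative_partials:
  fixes f :: "'a::euclidean_space \<Rightarrow> 'b::real_normed_vector"
  assumes U: "open U" and x: "x \<in> U"
    and der: "\<And>b y. b \<in> Basis \<Longrightarrow> y \<in> U \<Longrightarrow> ((\<lambda>t. f (y + t *\<^sub>R b)) has_vector_derivative D b y) (at 0)"
    and cont: "\<And>b. b \<in> Basis \<Longrightarrow> continuous_on U (D b)"
  shows "(f has_derivative (\<lambda>h. \<Sum>b\<in>Basis. (h \<bullet> b) *\<^sub>R D b x)) (at x)"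
  unfolding has_derivative_at_alt
proof (intro conjI allI impI)
  show "bounded_linear (\<lambda>h. \<Sum>b\<in>Basis. (h \<bullet> b) *\<^sub>R D b x)"
    by (intro bounded_linear_sum bounded_linear_scaleR_const bounded_linear_inner_left)
  fix e :: real assume e: "0 < e"
  define e' where "e' = e / real DIM('a)"
  have e': "0 < e'" using e by (simp add: e'_def)
  obtain d0 where d0: "0 < d0" "ball x d0 \<subseteq> U" using U x open_contains_ball by blast
  have "\<forall>\<^sub>F y in nhds x. \<forall>b\<in>Basis. dist (D b y) (D b x) < e'"
  proof (subst eventually_ball_finite_distrib)
    show "\<forall>b\<in>Basis. \<forall>\<^sub>F y in nhds x. dist (D b y) (D b x) < e'"
    proof
      fix b :: 'a assume "b \<in> Basis"
      then have "isCont (D b) x" using cont U x continuous_on_eq_continuous_at by blast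
      then have "(D b \<longlongrightarrow> D b x) (nhds x)" by (simp add: continuous_within isCont_def tendsto_at_iff_tendsto_nhds)
      then show "\<forall>\<^sub>F y in nhds x. dist (D b y) (D b x) < e'" using e' by (rule tendstoD)
    qed
  qed simp
  then obtain d1 where d1: "0 < d1" "\<And>y b. dist y x < d1 \<Longrightarrow> b \<in> Basis \<Longrightarrow> dist (D b y) (D b x) < e'"
    unfolding eventually_nhds_metric by blast
  define d where "d = min d0 d1"
  have d: "0 < d" using d0 d1 by (simp add: d_def)
  \<comment> \<open>The coordinates of \<open>h\<close> are added one at a time. Every intermediate
    point is componentwise no larger than \<open>h\<close>, so it stays in the ball on which the
    partial derivatives are within e' of their values at \<open>x\<close>.\<close>
  have main: "norm (f (x + (\<Sum>b\<in>B. (h \<bullet> b) *\<^sub>R b)) - f x - (\<Sum>b\<in>B. (h \<bullet> b) *\<^sub>R D b x)) \<le> real (card B) * (e' * norm h)"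
    if B: "B \<subseteq> Basis" and h: "norm h < d" for B and h :: 'a
    using finite_subset[OF B finite_Basis] B
  proof induction
    case (insert b B)
    let ?p = "\<Sum>b\<in>B. (h \<bullet> b) *\<^sub>R b"
    have b: "b \<in> Basis" "B \<subseteq> Basis" using insert by auto
    have near: "norm (?p + t *\<^sub>R b) < d" if t: "t \<in> closed_segment 0 (h \<bullet> b)" for t
    proof -
      have t': "\<bar>t\<bar> \<le> \<bar>h \<bullet> b\<bar>" using t by (auto simp: closed_segment_eq_real_ivl split: if_splits)
      have "norm (?p + t *\<^sub>R b) \<le> norm h"
      proof (rule norm_le_componentwise)
        fix c :: 'a assume c: "c \<in> Basis"
        have "?p \<bullet> c = (if c \<in> B then h \<bullet> c else 0)"
          using b(2) c finite_subset[OF b(2) finite_Basis]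
          by (auto simp: inner_sum_left inner_Basis if_distrib sum.delta' subset_iff cong: if_cong intro!: sum.neutral
              sum.remove[THEN trans])
        moreover have "(t *\<^sub>R b) \<bullet> c = (if c = b then t else 0)"
          using b c by (auto simp: inner_Basis)
        ultimately show "\<bar>(?p + t *\<^sub>R b) \<bullet> c\<bar> \<le> \<bar>h \<bullet> c\<bar>"
          using t' insert(2) by (auto simp: inner_add_left)
      qed
      then show ?thesis using h by simp
    qed
    have pt: "x + ?p + t *\<^sub>R b \<in> U" "dist (x + ?p + t *\<^sub>R b) x < d1" if "t \<in> closed_segment 0 (h \<bullet> b)" for t
    proof -
      have "dist (x + ?p + t *\<^sub>R b) x < d" using near[OF that] by (simp add: dist_norm add.assoc)
      then show "x + ?p + t *\<^sub>R b \<in> U" "dist (x + ?p + t *\<^sub>R b) x < d1"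
        using d0(2) by (auto simp: d_def dist_commute)
    qed
    have "norm (f (x + ?p + (h \<bullet> b) *\<^sub>R b) - f (x + ?p + 0 *\<^sub>R b) - (h \<bullet> b - 0) *\<^sub>R D b x) \<le> norm (h \<bullet> b - 0) * e'"
    proof -
      have "norm ((\<lambda>t. f (x + ?p + t *\<^sub>R b) - t *\<^sub>R D b x) (h \<bullet> b) - (\<lambda>t. f (x + ?p + t *\<^sub>R b) - t *\<^sub>R D b x) 0) \<le> e' * norm (h \<bullet> b - 0)"
      proof (rule differentiable_bound[where S = "closed_segment 0 (h \<bullet> b)" and f' = "\<lambda>t s. s *\<^sub>R (D b (x + ?p + t *\<^sub>R b) - D b x)"])
        fix t assume t: "t \<in> closed_segment 0 (h \<bullet> b)"
        have "((\<lambda>s. f ((x + ?p + t *\<^sub>R b) + s *\<^sub>R b)) \<circ> (\<lambda>s. s - t) has_vector_derivative 1 *\<^sub>R D b (x + ?p + t *\<^sub>R b)) (at t)"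
          using der[OF b(1) pt(1)[OF t]] by (intro vector_diff_chain_at) (auto intro!: derivative_eq_intros)
        then have "((\<lambda>t. f (x + ?p + t *\<^sub>R b)) has_vector_derivative D b (x + ?p + t *\<^sub>R b)) (at t)"
          by (simp add: o_def algebra_simps)
        then have "((\<lambda>t. f (x + ?p + t *\<^sub>R b) - t *\<^sub>R D b x) has_vector_derivative (D b (x + ?p + t *\<^sub>R b) - 1 *\<^sub>R D b x)) (at t)"
          by (intro has_vector_derivative_diff has_vector_derivative_scaleR) (auto intro!: derivative_eq_intros)
        then show "((\<lambda>t. f (x + ?p + t *\<^sub>R b) - t *\<^sub>R D b x) has_derivative (\<lambda>s. s *\<^sub>R (D b (x + ?p + t *\<^sub>R b) - D b x))) (at t within closed_segment 0 (h \<bullet> b))"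
          by (simp add: has_vector_derivative_def has_derivative_at_withinI)
        have "norm (D b (x + ?p + t *\<^sub>R b) - D b x) \<le> e'"
          using d1(2)[OF pt(2)[OF t] b(1)] by (simp add: dist_norm)
        then show "onorm (\<lambda>s. s *\<^sub>R (D b (x + ?p + t *\<^sub>R b) - D b x)) \<le> e'"
          by (intro onorm_le) (simp add: mult.commute[of e'] mult_left_mono)
      qed auto
      then show ?thesis by (simp add: algebra_simps)
    qed
    also have "norm (h \<bullet> b - 0) * e' \<le> e' * norm h"
      using Basis_le_norm[OF b(1), of h] e' by (simp add: mult.commute mult_left_mono)
    finally have 1: "norm (f (x + ?p + (h \<bullet> b) *\<^sub>R b) - f (x + ?p) - (h \<bullet> b) *\<^sub>R D b x) \<le> e' * norm h" by simp
    have 2: "norm (f (x + ?p) - f x - (\<Sum>b\<in>B. (h \<bullet> b) *\<^sub>R D b x)) \<le> real (card B) * (e' * norm h)"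
      using insert b by blast
    have "f (x + (\<Sum>b\<in>insert b B. (h \<bullet> b) *\<^sub>R b)) - f x - (\<Sum>b\<in>insert b B. (h \<bullet> b) *\<^sub>R D b x)
      = (f (x + ?p + (h \<bullet> b) *\<^sub>R b) - f (x + ?p) - (h \<bullet> b) *\<^sub>R D b x) + (f (x + ?p) - f x - (\<Sum>b\<in>B. (h \<bullet> b) *\<^sub>R D b x))"
      using insert(1,2) by (simp add: algebra_simps)
    also have "norm \<dots> \<le> e' * norm h + real (card B) * (e' * norm h)"
      using 1 2 by (intro norm_triangle_le add_mono)
    finally show ?case using insert(1,2) by (simp add: algebra_simps)
  qed simp
  show "\<exists>d>0. \<forall>y. norm (y - x) < d \<longrightarrow> norm (f y - f x - (\<Sum>b\<in>Basis. ((y - x) \<bullet> b) *\<^sub>R D b x)) \<le> e * norm (y - x)"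
  proof (intro exI[of _ d] conjI d allI impI)
    fix y assume "norm (y - x) < d"
    from main[OF order_refl this] show "norm (f y - f x - (\<Sum>b\<in>Basis. ((y - x) \<bullet> b) *\<^sub>R D b x)) \<le> e * norm (y - x)"
      by (simp add: euclidean_representation e'_def)
  qed
qed

definition dird :: "'a::real_normed_vector \<Rightarrow> ('a \<Rightarrow> 'b::real_normed_vector) \<Rightarrow> 'a \<Rightarrow> 'b" where
  "dird v f x = frechet_derivative f (at x) v"

text \<open>Continuity is required for each fixed direction, so no topology on linear maps is
  involved. The price is that directions varying with the point must be expanded in a basis, as in
  \<open>dird_pair_expand\<close>.\<close>

definition C1_on :: "'a::real_normed_vector set \<Rightarrow> ('a \<Rightarrow> 'b::real_normed_vector) \<Rightarrow> bool" where
  "C1_on U f \<longleftrightarrow> (\<forall>x\<in>U. f differentiable (at x)) \<and> (\<forall>v. continuous_on U (dird v f))"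

lemma C1_on_has_derivative: "C1_on U f \<Longrightarrow> x \<in> U \<Longrightarrow> (f has_derivative (\<lambda>v. dird v f x)) (at x)"
  unfolding C1_on_def dird_def by (simp add: frechet_derivative_works)

lemma dird_eq: "(f has_derivative f') (at x) \<Longrightarrow> dird v f x = f' v"
  unfolding dird_def using frechet_derivative_at by metis

lemma C1_onI:
  assumes "\<And>x. x \<in> U \<Longrightarrow> (f has_derivative f' x) (at x)" and "\<And>v. continuous_on U (\<lambda>x. f' x v)"
  shows "C1_on U f"
  unfolding C1_on_def
proof (intro conjI ballI allI)
  fix v show "continuous_on U (dird v f)"
    using assms(2)[of v] by (rule continuous_on_eq) (simp add: dird_eq[OF assms(1)])
qed (use assms(1) differentiable_def in blast)

lemma C1_on_continuous: "C1_on U f \<Longrightarrow> continuous_on U f"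
  by (meson C1_on_has_derivative has_derivative_continuous continuous_at_imp_continuous_on)

lemma C1_on_continuous_dird: "C1_on U f \<Longrightarrow> continuous_on U (dird v f)"
  by (simp add: C1_on_def)

lemma C1_on_linear_dird: "C1_on U f \<Longrightarrow> x \<in> U \<Longrightarrow> linear (\<lambda>v. dird v f x)"
  using C1_on_has_derivative has_derivative_linear by blast

lemma C1_on_diff:
  assumes "C1_on U f" "C1_on U g" shows "C1_on U (\<lambda>x. f x - g x)"
  using assms by (intro C1_onI[where f' = "\<lambda>x v. dird v f x - dird v g x"])
    (auto intro!: has_derivative_diff C1_on_has_derivative continuous_on_diff C1_on_continuous_dird)

lemma C1_on_mult:
  fixes f g :: "'a::real_normed_vector \<Rightarrow> 'b::real_normed_algebra"
  assumes "C1_on U f" "C1_on U g" shows "C1_on U (\<lambda>x. f x * g x)"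
  using assms by (intro C1_onI[where f' = "\<lambda>x v. f x * dird v g x + dird v f x * g x"])
    (auto intro!: has_derivative_mult C1_on_has_derivative continuous_intros C1_on_continuous_dird
      C1_on_continuous[OF assms(1)] C1_on_continuous[OF assms(2)])

lemma C1_on_divide:
  fixes f g :: "'a::real_normed_vector \<Rightarrow> 'b::real_normed_field"
  assumes "C1_on U f" "C1_on U g" "\<And>x. x \<in> U \<Longrightarrow> g x \<noteq> 0" shows "C1_on U (\<lambda>x. f x / g x)"
  using assms by (intro C1_onI[where f' = "\<lambda>x v. (dird v f x * g x - f x * dird v g x) / (g x * g x)"])
    (auto intro!: has_derivative_divide' C1_on_has_derivative continuous_intros C1_on_continuous_dird
      C1_on_continuous[OF assms(1)] C1_on_continuous[OF assms(2)])

lemma C1_on_ln: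
  fixes f :: "'a::real_normed_vector \<Rightarrow> real"
  assumes "C1_on U f" "\<And>x. x \<in> U \<Longrightarrow> 0 < f x" shows "C1_on U (\<lambda>x. ln (f x))"
    and "\<And>v x. x \<in> U \<Longrightarrow> dird v (\<lambda>x. ln (f x)) x = dird v f x / f x"
proof -
  have d: "((\<lambda>x. ln (f x)) has_derivative (\<lambda>v. dird v f x / f x)) (at x)" if "x \<in> U" for x
    using has_derivative_ln[OF assms(2)[OF that] C1_on_has_derivative[OF assms(1) that]]
    by (simp add: divide_inverse mult.commute)
  show "C1_on U (\<lambda>x. ln (f x))"
    using d by (rule C1_onI) (use assms(2) in \<open>auto intro!: continuous_intros C1_on_continuous_dird[OF assms(1)] C1_on_continuous[OF assms(1)] simp: less_imp_neq[symmetric]\<close>)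
  show "\<And>v x. x \<in> U \<Longrightarrow> dird v (\<lambda>x. ln (f x)) x = dird v f x / f x"
    using dird_eq[OF d] by blast
qed

text \<open>The growth condition speaks of iterated partial derivatives and their continuity; this
  is the passage from there to joint differentiability in (s, \<theta>).\<close>

lemma C1_on_partials:
  fixes f :: "'a::euclidean_space \<Rightarrow> 'b::real_normed_vector"
  assumes U: "open U"
    and der: "\<And>b y. b \<in> Basis \<Longrightarrow> y \<in> U \<Longrightarrow> ((\<lambda>t. f (y + t *\<^sub>R b)) has_vector_derivative D b y) (at 0)"
    and cont: "\<And>b. b \<in> Basis \<Longrightarrow> continuous_on U (D b)"
  shows "C1_on U f" and "\<And>x v. x \<in> U \<Longrightarrow> dird v f x = (\<Sum>b\<in>Basis. (v \<bullet> b) *\<^sub>R D b x)"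
proof -
  note d = has_derivative_partials[OF U _ der cont]
  show "C1_on U f"
    by (rule C1_onI[OF d]) (auto intro!: continuous_intros cont)
  show "\<And>x v. x \<in> U \<Longrightarrow> dird v f x = (\<Sum>b\<in>Basis. (v \<bullet> b) *\<^sub>R D b x)"
    using dird_eq[OF d] by blast
qed

lemma C1_on_line:
  assumes "C1_on U f" "x + t *\<^sub>R v \<in> U"
  shows "((\<lambda>t. f (x + t *\<^sub>R v)) has_vector_derivative dird v f (x + t *\<^sub>R v)) (at t)"
proof -
  have "((\<lambda>t. f (x + t *\<^sub>R v)) has_derivative (\<lambda>s. dird (s *\<^sub>R v) f (x + t *\<^sub>R v))) (at t)"
    by (rule has_derivative_compose[of "\<lambda>t. x + t *\<^sub>R v" "\<lambda>s. s *\<^sub>R v" t UNIV f "\<lambda>w. dird w f (x + t *\<^sub>R v)"])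
       (auto intro!: derivative_eq_intros C1_on_has_derivative[OF assms])
  moreover have "dird (s *\<^sub>R v) f (x + t *\<^sub>R v) = s *\<^sub>R dird v f (x + t *\<^sub>R v)" for s
    using linear_cmul[OF C1_on_linear_dird[OF assms]] .
  ultimately show ?thesis by (simp add: has_vector_derivative_def)
qed

text \<open>An asymmetric form of the symmetry of second derivatives: only the derivative along
  \<open>b\<close> is assumed C1, and the conclusion is that the derivative along \<open>a\<close>
  is differentiable along \<open>b\<close>. It is needed since s-derivatives of the cumulant
  function are C1 in (s, \<theta>), whereas its \<theta>-derivatives are reached only through
  them.\<close>

lemma dird_commute:
  fixes f :: "'a::euclidean_space \<Rightarrow> real"
  assumes U: "open U" and f: "C1_on U f" and fb: "C1_on U (dird b f)" and x: "x \<in> U"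
  shows "((\<lambda>t. dird a f (x + t *\<^sub>R b)) has_vector_derivative dird a (dird b f) x) (at 0)"
proof -
  obtain r where r: "0 < r" "ball x r \<subseteq> U" using U x open_contains_ball by blast
  define \<rho> where "\<rho> = r / (2 * (norm a + norm b + 1))"
  have pos: "0 < norm a + norm b + 1" by (simp add: add_nonneg_pos)
  have \<rho>: "0 < \<rho>" using r pos by (simp add: \<rho>_def)
  have at0: "at (0::real) within {- \<rho>..\<rho>} = at 0"
    by (rule at_within_interior) (use \<rho> in simp)
  have inU: "x + s *\<^sub>R a + t *\<^sub>R b \<in> U" if "\<bar>s\<bar> \<le> \<rho>" "\<bar>t\<bar> \<le> \<rho>" for s t
  proof -
    have "norm (s *\<^sub>R a + t *\<^sub>R b) \<le> \<bar>s\<bar> * norm a + \<bar>t\<bar> * norm b"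
      using norm_triangle_ineq[of "s *\<^sub>R a" "t *\<^sub>R b"] by simp
    also have "\<dots> \<le> \<rho> * norm a + \<rho> * norm b" using that by (intro add_mono mult_right_mono) auto
    also have "\<dots> \<le> \<rho> * (norm a + norm b + 1)" using \<rho> by (simp add: algebra_simps)
    also have "\<rho> * (norm a + norm b + 1) = r / 2" unfolding \<rho>_def using pos by (metis divide_divide_eq_left nonzero_eq_divide_eq less_irrefl mult.commute)
    also have "r / 2 < r" using r by simp
    finally have "norm (s *\<^sub>R a + t *\<^sub>R b) < r" .
    then have "x + (s *\<^sub>R a + t *\<^sub>R b) \<in> ball x r" by (metis add_diff_cancel_left' dist_commute dist_norm mem_ball)
    then show ?thesis using r(2) by (metis add.assoc subsetD)
  qed
  have c: "continuous_on ({- \<rho>..\<rho>} \<times> {- \<rho>..\<rho>}) (\<lambda>p. g (x + fst p *\<^sub>R a + snd p *\<^sub>R b))"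
    if "continuous_on U g" for g :: "'a \<Rightarrow> real"
    using inU by (intro continuous_on_compose2[OF that] continuous_intros) auto
  have FTC: "integral {- \<rho>..t} (\<lambda>\<tau>. dird b f (x + s *\<^sub>R a + \<tau> *\<^sub>R b))
      = f (x + s *\<^sub>R a + t *\<^sub>R b) - f (x + s *\<^sub>R a + (- \<rho>) *\<^sub>R b)" if "\<bar>s\<bar> \<le> \<rho>" "\<bar>t\<bar> \<le> \<rho>" for s t
    using that by (intro integral_unique fundamental_theorem_of_calculus)
      (auto intro!: has_vector_derivative_at_within[OF C1_on_line[OF f]] inU)
  \<comment> \<open>Both sides are the derivative at s = 0 of the integral in \<open>FTC\<close>:
    once by differentiating under the integral, once by differentiating the increment of
    \<open>f\<close>. Differentiability in \<open>t\<close> is then the fundamental theorem of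
    calculus.\<close>
  have L: "dird a f (x + t *\<^sub>R b) - dird a f (x + (- \<rho>) *\<^sub>R b)
     = integral {- \<rho>..t} (\<lambda>\<tau>. dird a (dird b f) (x + \<tau> *\<^sub>R b))" if t: "\<bar>t\<bar> \<le> \<rho>" for t
  proof -
    have "((\<lambda>s. integral (cbox (- \<rho>) t) (\<lambda>\<tau>. dird b f (x + s *\<^sub>R a + \<tau> *\<^sub>R b))) has_vector_derivative
       integral (cbox (- \<rho>) t) (\<lambda>\<tau>. dird a (dird b f) (x + 0 *\<^sub>R a + \<tau> *\<^sub>R b))) (at 0 within {- \<rho>..\<rho>})"
    proof (rule leibniz_rule_vector_derivative)
      show "((\<lambda>s. dird b f (x + s *\<^sub>R a + \<tau> *\<^sub>R b)) has_vector_derivative dird a (dird b f) (x + s *\<^sub>R a + \<tau> *\<^sub>R b)) (at s within {- \<rho>..\<rho>})"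
        if "s \<in> {- \<rho>..\<rho>}" "\<tau> \<in> cbox (- \<rho>) t" for s \<tau>
      proof -
        have "(x + \<tau> *\<^sub>R b) + s *\<^sub>R a \<in> U" using inU[of s \<tau>] that t by (auto simp: add_ac)
        from has_vector_derivative_at_within[OF C1_on_line[OF fb this], of "{- \<rho>..\<rho>}"] show ?thesis
          by (simp add: add_ac)
      qed
      show "(\<lambda>\<tau>. dird b f (x + s *\<^sub>R a + \<tau> *\<^sub>R b)) integrable_on cbox (- \<rho>) t" if "s \<in> {- \<rho>..\<rho>}" for s
        using that t inU by (intro integrable_continuous continuous_on_compose2[OF C1_on_continuous[OF fb]] continuous_intros) auto
      show "continuous_on ({- \<rho>..\<rho>} \<times> cbox (- \<rho>) t) (\<lambda>(s, \<tau>). dird a (dird b f) (x + s *\<^sub>R a + \<tau> *\<^sub>R b))"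
        unfolding case_prod_beta
        using t by (intro continuous_on_subset[OF c[OF C1_on_continuous_dird[OF fb]]]) auto
    qed (use \<rho> in auto)
    then have 1: "((\<lambda>s. integral {- \<rho>..t} (\<lambda>\<tau>. dird b f (x + s *\<^sub>R a + \<tau> *\<^sub>R b))) has_vector_derivative
       integral {- \<rho>..t} (\<lambda>\<tau>. dird a (dird b f) (x + \<tau> *\<^sub>R b))) (at 0)"
      by (simp add: at0)
    have "((\<lambda>s. f ((x + t *\<^sub>R b) + s *\<^sub>R a) - f ((x + (- \<rho>) *\<^sub>R b) + s *\<^sub>R a)) has_vector_derivative
        (dird a f ((x + t *\<^sub>R b) + 0 *\<^sub>R a) - dird a f ((x + (- \<rho>) *\<^sub>R b) + 0 *\<^sub>R a))) (at 0)"
      using inU[of 0 t] inU[of 0 "- \<rho>"] t \<rho> by (intro has_vector_derivative_diff C1_on_line[OF f]) auto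
    then have 2: "((\<lambda>s. integral {- \<rho>..t} (\<lambda>\<tau>. dird b f (x + s *\<^sub>R a + \<tau> *\<^sub>R b))) has_vector_derivative
       (dird a f ((x + t *\<^sub>R b) + 0 *\<^sub>R a) - dird a f ((x + (- \<rho>) *\<^sub>R b) + 0 *\<^sub>R a))) (at 0)"
    proof (rule has_vector_derivative_transform_within_open[where S = "{- \<rho><..<\<rho>}"])
      show "f ((x + t *\<^sub>R b) + s *\<^sub>R a) - f ((x + (- \<rho>) *\<^sub>R b) + s *\<^sub>R a) = integral {- \<rho>..t} (\<lambda>\<tau>. dird b f (x + s *\<^sub>R a + \<tau> *\<^sub>R b))"
        if "s \<in> {- \<rho><..<\<rho>}" for s
      proof -
        have e: "x + c *\<^sub>R b + s *\<^sub>R a = x + s *\<^sub>R a + c *\<^sub>R b" for c by (simp add: add.commute add.left_commute)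
        show ?thesis unfolding e using FTC[of s t] that t by (simp add: abs_le_iff)
      qed
    qed (use \<rho> in auto)
    show ?thesis using vector_derivative_unique_at[OF 2 1] by simp
  qed
  have "((\<lambda>t. integral {- \<rho>..t} (\<lambda>\<tau>. dird a (dird b f) (x + \<tau> *\<^sub>R b))) has_vector_derivative
      dird a (dird b f) (x + 0 *\<^sub>R b)) (at 0 within {- \<rho>..\<rho>})"
    using inU[of 0] \<rho> by (intro integral_has_vector_derivative continuous_on_compose2[OF C1_on_continuous_dird[OF fb]] continuous_intros) auto
  then have "((\<lambda>t. integral {- \<rho>..t} (\<lambda>\<tau>. dird a (dird b f) (x + \<tau> *\<^sub>R b)) + dird a f (x + (- \<rho>) *\<^sub>R b)) has_vector_derivative
      dird a (dird b f) x + 0) (at 0)"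
    by (intro has_vector_derivative_add) (auto simp: at0)
  then show ?thesis
    using \<rho> L by (auto intro: has_vector_derivative_transform_within_open[where S = "{- \<rho><..<\<rho>}"] simp: abs_le_iff algebra_simps)
qed

section \<open>The derivative of the determinant\<close>

lemma det_has_derivative:
  fixes A :: "real^'n^'n"
  shows "\<exists>d. (det has_derivative d) (at A)"
proof -
  have "((\<lambda>A::real^'n^'n. A $ i $ j) has_derivative (\<lambda>D. D $ i $ j)) (at A)" for i j
    by (intro bounded_linear.has_derivative[OF bounded_linear_vec_nth] has_derivative_ident)
       
  then have "((\<lambda>A::real^'n^'n. of_int (sign p) * (\<Prod>i\<in>UNIV. A $ i $ p i)) has_derivative
      (\<lambda>D. of_int (sign p) * (\<Sum>i\<in>UNIV. D $ i $ p i * (\<Prod>j\<in>UNIV - {i}. A $ j $ p j)))) (at A)" for p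
    by (intro has_derivative_mult_right has_derivative_prod)
  then have "(det has_derivative (\<lambda>D. \<Sum>p | p permutes UNIV. of_int (sign p) * (\<Sum>i\<in>UNIV. D $ i $ p i * (\<Prod>j\<in>UNIV - {i}. A $ j $ p j)))) (at A)"
    unfolding det_def[abs_def] by (intro has_derivative_sum)
  then show ?thesis by blast
qed

text \<open>Only the identity permutation contributes: any other one moves at least two indices, so
  after one factor has been differentiated an off-diagonal zero of the identity remains in the
  product.\<close>

lemma det_I_plus_has_derivative:
  fixes X :: "real^'n^'n"
  shows "((\<lambda>t. det (mat 1 + t *\<^sub>R X)) has_real_derivative trace X) (at 0)"
proof -
  let ?e = "\<lambda>t i j. (mat 1 + t *\<^sub>R X) $ i $ j"
  let ?P = "{p. p permutes (UNIV :: 'n set)}"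
  have e: "((\<lambda>t. ?e t i j) has_real_derivative X $ i $ j) (at 0)" for i j
    by (auto intro!: derivative_eq_intros)
  have d: "((\<lambda>t. \<Prod>i\<in>UNIV. ?e t i (p i)) has_real_derivative (\<Sum>i\<in>UNIV. X $ i $ p i * (\<Prod>j\<in>UNIV - {i}. ?e 0 j (p j)))) (at 0)" for p
    unfolding has_field_derivative_def
    by (rule has_derivative_eq_rhs[OF has_derivative_prod[OF e[unfolded has_field_derivative_def]]])
       (auto simp: fun_eq_iff sum_distrib_left sum_distrib_right mult_ac)
  have z: "(\<Prod>j\<in>UNIV - {i}. ?e 0 j (p j)) = 0" if p: "p permutes UNIV" and ne: "p \<noteq> id" for p i
  proof -
    obtain k where k: "p k \<noteq> k" using ne by (auto simp: fun_eq_iff)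
    have "\<exists>j. j \<noteq> i \<and> p j \<noteq> j"
    proof (cases "k = i")
      case True
      have "p (p k) \<noteq> p k" using k permutes_inj[OF p] by (auto dest: injD)
      then show ?thesis using True k by blast
    qed (use k in blast)
    then obtain j where "j \<noteq> i" "p j \<noteq> j" by blast
    then have "j \<in> UNIV - {i}" "?e 0 j (p j) = 0" by (auto simp: mat_def)
    then show ?thesis by (intro prod_zero) auto
  qed
  have "((\<lambda>t. det (mat 1 + t *\<^sub>R X)) has_real_derivative
     (\<Sum>p\<in>?P. of_int (sign p) * (\<Sum>i\<in>UNIV. X $ i $ p i * (\<Prod>j\<in>UNIV - {i}. ?e 0 j (p j))))) (at 0)"
    unfolding det_def by (intro DERIV_sum DERIV_cmult d)
  also have "(\<Sum>p\<in>?P. of_int (sign p) * (\<Sum>i\<in>UNIV. X $ i $ p i * (\<Prod>j\<in>UNIV - {i}. ?e 0 j (p j))))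
     = (\<Sum>p\<in>{id}. of_int (sign p) * (\<Sum>i\<in>UNIV. X $ i $ p i * (\<Prod>j\<in>UNIV - {i}. ?e 0 j (p j))))"
  proof (rule sum.mono_neutral_right)
    show "\<forall>p\<in>?P - {id}. of_int (sign p) * (\<Sum>i\<in>UNIV. X $ i $ p i * (\<Prod>j\<in>UNIV - {i}. ?e 0 j (p j))) = 0"
    proof
      fix p assume "p \<in> ?P - {id}"
      then have "(\<Prod>j\<in>UNIV - {i}. ?e 0 j (p j)) = 0" for i by (intro z) auto
      then show "of_int (sign p) * (\<Sum>i\<in>UNIV. X $ i $ p i * (\<Prod>j\<in>UNIV - {i}. ?e 0 j (p j))) = 0"
        by (simp only: mult_zero_right sum.neutral_const)
    qed
  qed (auto simp: permutes_id finite_permutations)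
  also have "\<dots> = trace X" by (simp add: sign_id trace_def mat_def)
  finally show ?thesis .
qed

text \<open>Jacobi's formula. Writing A + t D as A (1 + t B D) reduces it to the derivative at the
  identity, and uniqueness of the derivative identifies \<open>d\<close>.\<close>

lemma det_has_derivative_trace:
  fixes A B D :: "real^'n^'n"
  assumes AB: "A ** B = mat 1" and d: "(det has_derivative d) (at A)"
  shows "d D = det A * trace (B ** D)"
proof -
  have "((\<lambda>t::real. A + t *\<^sub>R D) has_derivative (\<lambda>s. s *\<^sub>R D)) (at 0)"
    by (auto intro!: derivative_eq_intros)
  from has_derivative_compose[OF this, of det d] d
  have "((\<lambda>t::real. det (A + t *\<^sub>R D)) has_derivative (\<lambda>s. d (s *\<^sub>R D))) (at 0)" by simp
  moreover have "(\<lambda>s. d (s *\<^sub>R D)) = (*) (d D)"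
    using linear_cmul[OF has_derivative_linear[OF d]] by (simp add: fun_eq_iff mult.commute)
  ultimately have 1: "((\<lambda>t::real. det (A + t *\<^sub>R D)) has_real_derivative d D) (at 0)"
    by (simp add: has_field_derivative_def)
  have "A + t *\<^sub>R D = A ** (mat 1 + t *\<^sub>R (B ** D))" for t
    using AB by (simp add: matrix_add_ldistrib matrix_mul_assoc matrix_scalar_ac scalar_matrix_assoc[symmetric])
  then have "det (A + t *\<^sub>R D) = det A * det (mat 1 + t *\<^sub>R (B ** D))" for t
    by (simp add: det_mul)
  then have "((\<lambda>t::real. det (A + t *\<^sub>R D)) has_real_derivative det A * trace (B ** D)) (at 0)"
    using DERIV_cmult[OF det_I_plus_has_derivative] by simp
  with 1 show ?thesis using DERIV_unique by blast
qed

subsection \<open>The moment generating function\<close>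

lemma C1_on_Re:
  fixes f :: "'a::real_normed_vector \<Rightarrow> complex"
  assumes "C1_on U f"
  shows "C1_on U (\<lambda>x. Re (f x))" and "\<And>v x. x \<in> U \<Longrightarrow> dird v (\<lambda>x. Re (f x)) x = Re (dird v f x)"
proof -
  have d: "((\<lambda>x. Re (f x)) has_derivative (\<lambda>v. Re (dird v f x))) (at x)" if "x \<in> U" for x
    using C1_on_has_derivative[OF assms that] by (rule bounded_linear.has_derivative[OF bounded_linear_Re])
  show "C1_on U (\<lambda>x. Re (f x))"
    by (rule C1_onI[OF d]) (auto intro!: continuous_intros C1_on_continuous_dird[OF assms])
  show "\<And>v x. x \<in> U \<Longrightarrow> dird v (\<lambda>x. Re (f x)) x = Re (dird v f x)"
    using dird_eq[OF d] by blast
qed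

lemma C1_on_cong:
  assumes "open U" "C1_on U f" "\<And>x. x \<in> U \<Longrightarrow> g x = f x"
  shows "C1_on U g" and "\<And>v x. x \<in> U \<Longrightarrow> dird v g x = dird v f x"
proof -
  have d: "(g has_derivative (\<lambda>v. dird v f x)) (at x)" if "x \<in> U" for x
    by (rule has_derivative_transform_within_open[OF C1_on_has_derivative[OF assms(2) that] assms(1) that])
       (simp add: assms(3))
  show "C1_on U g" by (rule C1_onI[OF d]) (auto intro!: C1_on_continuous_dird[OF assms(2)])
  show "\<And>v x. x \<in> U \<Longrightarrow> dird v g x = dird v f x"
    using dird_eq[OF d] by blast
qed

lemma has_derivative_vec_lambda:
  fixes f :: "'a::real_normed_vector \<Rightarrow> 'b::real_normed_vector ^ 'n"
  assumes "\<And>j. ((\<lambda>x. f x $ j) has_derivative (\<lambda>v. f' v $ j)) (at x)"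
  shows "(f has_derivative f') (at x)"
proof -
  have bl: "bounded_linear (\<lambda>v. f' v $ j)" for j using assms has_derivative_bounded_linear by blast
  have "bounded_linear f'"
  proof (rule bounded_linear_intro[where K = "\<Sum>j\<in>UNIV. onorm (\<lambda>v. f' v $ j)"])
    fix v w and r :: real
    show "f' (v + w) = f' v + f' w"
      by (simp add: vec_eq_iff linear_add[OF bounded_linear.linear[OF bl]])
    show "f' (r *\<^sub>R v) = r *\<^sub>R f' v"
      by (simp add: vec_eq_iff linear_cmul[OF bounded_linear.linear[OF bl]])
    have "norm (f' v) \<le> (\<Sum>j\<in>UNIV. norm (f' v $ j))"
      unfolding norm_vec_def by (rule L2_set_le_sum) simp
    also have "\<dots> \<le> (\<Sum>j\<in>UNIV. onorm (\<lambda>v. f' v $ j) * norm v)"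
      by (intro sum_mono onorm bl)
    finally show "norm (f' v) \<le> norm v * (\<Sum>j\<in>UNIV. onorm (\<lambda>v. f' v $ j))"
      by (simp add: sum_distrib_left mult.commute)
  qed
  moreover have "((\<lambda>y. ((f y - f x) - f' (y - x)) /\<^sub>R norm (y - x)) \<longlongrightarrow> 0) (at x)"
  proof (rule vec_tendstoI)
    fix j
    show "((\<lambda>y. (((f y - f x) - f' (y - x)) /\<^sub>R norm (y - x)) $ j) \<longlongrightarrow> 0 $ j) (at x)"
      using assms[of j] unfolding has_derivative_within by (simp add: divide_inverse_commute scaleR_diff_right diff_diff_eq scaleR_add_right)
  qed
  ultimately show ?thesis
    unfolding has_derivative_within by (simp add: diff_diff_eq divide_inverse)
qed

lemma C1_on_vec:
  fixes f :: "'a::real_normed_vector \<Rightarrow> 'b::real_normed_vector ^ 'n"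
  assumes "\<And>j. C1_on U (\<lambda>x. f x $ j)"
  shows "C1_on U f" and "\<And>v x j. x \<in> U \<Longrightarrow> dird v f x $ j = dird v (\<lambda>x. f x $ j) x"
proof -
  have d: "(f has_derivative (\<lambda>v. \<chi> j. dird v (\<lambda>x. f x $ j) x)) (at x)" if "x \<in> U" for x
    by (rule has_derivative_vec_lambda) (simp add: C1_on_has_derivative[OF assms that])
  show "C1_on U f"
    by (rule C1_onI[OF d]) (auto intro!: continuous_on_vec_lambda C1_on_continuous_dird[OF assms])
  show "\<And>v x j. x \<in> U \<Longrightarrow> dird v f x $ j = dird v (\<lambda>x. f x $ j) x"
    using dird_eq[OF d] by simp
qed

lemma grad_eq:
  fixes f :: "'a::real_inner \<Rightarrow> real"
  assumes "(f has_derivative (\<lambda>h. h \<bullet> D)) (at x)"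
  shows "grad f x = D"
  unfolding grad_def
proof (rule the_equality)
  show "GDERIV f x :> D" using assms by (simp add: gderiv_def)
  fix D' assume "GDERIV f x :> D'"
  then have "(\<lambda>h. h \<bullet> D') = (\<lambda>h. h \<bullet> D)"
    using assms has_derivative_unique unfolding gderiv_def by blast
  then have "(D' - D) \<bullet> D' = (D' - D) \<bullet> D" by metis
  then have "(D' - D) \<bullet> (D' - D) = 0" by (simp add: inner_diff_right)
  then show "D' = D" by simp
qed

lemma Basis_cart: "Basis = range (\<lambda>j::'n::finite. axis j (1::real))"
  by (auto simp: Basis_vec_def)

lemma cvec_add_axis: "cvec s \<phi> + axis j (complex_of_real h) = cvec (s + h *\<^sub>R axis j 1) \<phi>"
  by (auto simp: cvec_def vec_eq_iff axis_def complex_eq_iff)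

section \<open>The model, its domain, and the transform on complex lines\<close>

locale saddle_model =
  fixes R :: "(real ^ 'p) set"
    and P :: "real ^ 'p \<Rightarrow> 'w measure"
    and Y :: "real ^ 'p \<Rightarrow> 'w \<Rightarrow> real ^ 'd"
  assumes openR: "open R"
    and prob: "\<And>\<theta>. \<theta> \<in> R \<Longrightarrow> prob_space (P \<theta>)"
    and meas: "\<And>\<theta>. \<theta> \<in> R \<Longrightarrow> Y \<theta> \<in> borel_measurable (P \<theta>)"
    and decay: "decay_condition R P Y"
    and growth: "growth_condition R P Y"
begin

abbreviation "U \<equiv> interior (mgf_dom R P Y)"
abbreviation "law \<theta> \<equiv> distr (P \<theta>) borel (Y \<theta>)"

lemma U_R: "(s, \<theta>) \<in> U \<Longrightarrow> \<theta> \<in> R"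
  using interior_subset by (fastforce simp: mgf_dom_def)

lemma prob_law: "\<theta> \<in> R \<Longrightarrow> prob_space (law \<theta>)"
  by (intro prob_space.prob_space_distr prob meas)

lemma mgf_dom_law: "\<theta> \<in> R \<Longrightarrow> (s, \<theta>) \<in> mgf_dom R P Y \<longleftrightarrow> integrable (law \<theta>) (\<lambda>y. exp (s \<bullet> y))"
  unfolding mgf_dom_def by (simp add: integrable_distr_eq[OF meas])

lemma M0_law: "\<theta> \<in> R \<Longrightarrow> M0 P Y (cvec s \<phi>) \<theta> = (CLINT y|law \<theta>. exp (s \<bullet> y) * iexp (\<phi> \<bullet> y))"
proof -
  assume "\<theta> \<in> R"
  have *: "(\<Sum>j\<in>UNIV. cvec s \<phi> $ j * complex_of_real (y $ j)) = of_real (s \<bullet> y) + \<i> * of_real (\<phi> \<bullet> y)" for y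
    by (simp add: cvec_def complex_eq_iff inner_vec_def)
  show ?thesis
    unfolding M0_def * using \<open>\<theta> \<in> R\<close>
    by (subst integral_distr[OF meas]) (auto simp: exp_add exp_of_real)
qed

lemma integrable_law: "(s, \<theta>) \<in> U \<Longrightarrow> integrable (law \<theta>) (\<lambda>y. exp (s \<bullet> y))"
  using mgf_dom_law U_R interior_subset by blast

lemma integrable_law_complex: "(s, \<theta>) \<in> U \<Longrightarrow> integrable (law \<theta>) (\<lambda>y. exp (s \<bullet> y) * iexp (\<phi> \<bullet> y))"
  by (rule Bochner_Integration.integrable_bound[OF integrable_law]) (auto simp: norm_mult)

definition mgf :: "real ^ 'd \<Rightarrow> real ^ 'p \<Rightarrow> real" where
  "mgf s \<theta> = (\<integral>y. exp (s \<bullet> y) \<partial>law \<theta>)"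

lemma M0_real: "(s, \<theta>) \<in> U \<Longrightarrow> M0 P Y (cvec s 0) \<theta> = of_real (mgf s \<theta>)"
  by (simp add: M0_law U_R mgf_def)

lemma mgf_pos: "(s, \<theta>) \<in> U \<Longrightarrow> 0 < mgf s \<theta>"
proof -
  assume a: "(s, \<theta>) \<in> U"
  interpret prob_space "law \<theta>" using prob_law U_R[OF a] .
  have "0 \<le> mgf s \<theta>" unfolding mgf_def by simp
  moreover have "mgf s \<theta> \<noteq> 0"
  proof
    assume "mgf s \<theta> = 0"
    then have "AE y in law \<theta>. exp (s \<bullet> y) = 0"
      unfolding mgf_def by (subst (asm) integral_nonneg_eq_0_iff_AE[OF integrable_law[OF a]]) auto
    then show False by (simp add: AE_False)
  qed
  ultimately show ?thesis by simp
qed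

lemma norm_M0_le: "(s, \<theta>) \<in> U \<Longrightarrow> norm (M0 P Y (cvec s \<phi>) \<theta>) \<le> mgf s \<theta>"
  unfolding mgf_def by (subst M0_law[OF U_R], assumption)
     (rule lebesgue_integral_norm_le, auto intro: integrable_law simp: norm_mult)

lemma M0_cnj: "(s, \<theta>) \<in> U \<Longrightarrow> M0 P Y (cvec s (- \<phi>)) \<theta> = cnj (M0 P Y (cvec s \<phi>) \<theta>)"
proof -
  assume "(s, \<theta>) \<in> U"
  then have \<theta>: "\<theta> \<in> R" by (rule U_R)
  have "exp (s \<bullet> y) * iexp ((- \<phi>) \<bullet> y) = cnj (exp (s \<bullet> y) * iexp (\<phi> \<bullet> y))" for y
    by (simp add: exp_cnj)
  then show ?thesis unfolding M0_law[OF \<theta>]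
    using integral_bounded_linear[OF bounded_linear_cnj integrable_law_complex[OF \<open>(s, \<theta>) \<in> U\<close>, of \<phi>]] by simp
qed

lemma M0_measurable:
  assumes "(s, \<theta>) \<in> U"
  shows "(\<lambda>\<phi>. M0 P Y (cvec s \<phi>) \<theta>) \<in> borel_measurable borel"
proof -
  interpret prob_space "law \<theta>" using prob_law U_R[OF assms] .
  show ?thesis using assms by (simp add: M0_law U_R)
qed

lemma mgf_dom_convex:
  assumes "(s, \<theta>) \<in> mgf_dom R P Y" "(s', \<theta>) \<in> mgf_dom R P Y" "0 \<le> t" "t \<le> 1"
  shows "((1 - t) *\<^sub>R s + t *\<^sub>R s', \<theta>) \<in> mgf_dom R P Y"
proof -
  have R: "\<theta> \<in> R" using assms(1) by (auto simp: mgf_dom_def)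
  have i: "integrable (law \<theta>) (\<lambda>y. exp (s \<bullet> y))" "integrable (law \<theta>) (\<lambda>y. exp (s' \<bullet> y))"
    using assms mgf_dom_law[OF R] by auto
  have "integrable (law \<theta>) (\<lambda>y. exp (((1 - t) *\<^sub>R s + t *\<^sub>R s') \<bullet> y))"
  proof (rule Bochner_Integration.integrable_bound)
    show "integrable (law \<theta>) (\<lambda>y. exp (s \<bullet> y) + exp (s' \<bullet> y))" using i by auto
    show "AE y in law \<theta>. norm (exp (((1 - t) *\<^sub>R s + t *\<^sub>R s') \<bullet> y)) \<le> norm (exp (s \<bullet> y) + exp (s' \<bullet> y))"
    proof (rule AE_I2)
      fix y
      have "(1 - t) * (s \<bullet> y) + t * (s' \<bullet> y) \<le> max (s \<bullet> y) (s' \<bullet> y)"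
        using assms(3,4) by (intro convex_bound_le) auto
      then have "exp (((1 - t) *\<^sub>R s + t *\<^sub>R s') \<bullet> y) \<le> exp (max (s \<bullet> y) (s' \<bullet> y))"
        by (simp add: inner_add_left)
      also have "\<dots> \<le> exp (s \<bullet> y) + exp (s' \<bullet> y)" by (simp add: max_def)
      finally show "norm (exp (((1 - t) *\<^sub>R s + t *\<^sub>R s') \<bullet> y)) \<le> norm (exp (s \<bullet> y) + exp (s' \<bullet> y))"
        by (simp add: abs_of_nonneg add_nonneg_nonneg)
    qed
  qed auto
  then show ?thesis using mgf_dom_law[OF R] by simp
qed

text \<open>Convexity holds in \<open>s\<close> for fixed \<theta>. Translating one small ball to
  both end points shows that it passes to the interior, so the whole segment between two candidate
  saddlepoints is available.\<close>

lemma U_convex: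
  assumes "(s, \<theta>) \<in> U" "(s', \<theta>) \<in> U" "0 \<le> t" "t \<le> 1"
  shows "((1 - t) *\<^sub>R s + t *\<^sub>R s', \<theta>) \<in> U"
proof -
  obtain r where r: "0 < r" "ball (s, \<theta>) r \<subseteq> mgf_dom R P Y" using assms(1) mem_interior by blast
  obtain r' where r': "0 < r'" "ball (s', \<theta>) r' \<subseteq> mgf_dom R P Y" using assms(2) mem_interior by blast
  have "ball ((1 - t) *\<^sub>R s + t *\<^sub>R s', \<theta>) (min r r') \<subseteq> mgf_dom R P Y"
  proof
    fix q assume q: "q \<in> ball ((1 - t) *\<^sub>R s + t *\<^sub>R s', \<theta>) (min r r')"
    obtain u \<eta> where qe: "q = (u, \<eta>)" by (cases q)
    define v where "v = u - ((1 - t) *\<^sub>R s + t *\<^sub>R s')"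
    have d: "dist ((1 - t) *\<^sub>R s + t *\<^sub>R s', \<theta>) (u, \<eta>) = dist (0, \<theta>) (v, \<eta>)"
      by (simp add: dist_Pair_Pair v_def dist_norm norm_minus_commute)
    have "dist (s, \<theta>) (s + v, \<eta>) = dist (0, \<theta>) (v, \<eta>)" "dist (s', \<theta>) (s' + v, \<eta>) = dist (0, \<theta>) (v, \<eta>)"
      by (simp_all add: dist_Pair_Pair dist_norm)
    then have "(s + v, \<eta>) \<in> mgf_dom R P Y" "(s' + v, \<eta>) \<in> mgf_dom R P Y"
      using q r(2) r'(2) d qe by (auto simp: subset_iff)
    from mgf_dom_convex[OF this assms(3,4)]
    have "((1 - t) *\<^sub>R (s + v) + t *\<^sub>R (s' + v), \<eta>) \<in> mgf_dom R P Y" .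
    moreover have "(1 - t) *\<^sub>R (s + v) + t *\<^sub>R (s' + v) = u" by (simp add: v_def algebra_simps)
    ultimately show "q \<in> mgf_dom R P Y" using qe by simp
  qed
  then show ?thesis using r r' by (auto simp: mem_interior intro!: exI[of _ "min r r'"])
qed

text \<open>Differentiation under the integral along the complex line s + i \<phi> + \<zeta>
  \<omega>. The factor \<open>\<omega> \<bullet> y\<close> produced by the derivative is absorbed by
  the exponentials at the two real end points s + r \<omega> and s - r \<omega>, which are
  integrable.\<close>

lemma M0_holomorphic:
  assumes r: "0 < r" and inU: "\<And>t. \<bar>t\<bar> \<le> r \<Longrightarrow> (s + t *\<^sub>R \<omega>, \<theta>) \<in> U"
  shows "(\<lambda>\<zeta>. M0 P Y (cvec (s + Re \<zeta> *\<^sub>R \<omega>) (\<phi> + Im \<zeta> *\<^sub>R \<omega>)) \<theta>) holomorphic_on ball 0 r"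
  unfolding holomorphic_on_def
proof
  fix z :: complex assume "z \<in> ball 0 r"
  then have z: "norm z < r" by simp
  have "(s, \<theta>) \<in> U" using inU[of 0] r by simp
  then have \<theta>: "\<theta> \<in> R" using U_R by blast
  \<comment> \<open>Half of the room left around \<open>z\<close>: on the ball of radius \<epsilon>
    the real part stays at distance at least \<epsilon> from the ends, and that second \<epsilon>
    pays for the linear factor.\<close>
  define \<epsilon> where "\<epsilon> = (r - norm z) / 2"
  have \<epsilon>: "0 < \<epsilon>" using z by (simp add: \<epsilon>_def)
  let ?f = "\<lambda>\<zeta> y. exp (of_real (s \<bullet> y) + \<i> * of_real (\<phi> \<bullet> y) + \<zeta> * of_real (\<omega> \<bullet> y))"
  let ?f' = "\<lambda>\<zeta> y v. v * (of_real (\<omega> \<bullet> y) * ?f \<zeta> y)"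
  let ?g = "\<lambda>y. (1 / \<epsilon>) * (exp ((s + r *\<^sub>R \<omega>) \<bullet> y) + exp ((s + (- r) *\<^sub>R \<omega>) \<bullet> y))"
  have i: "integrable (law \<theta>) ?g"
    using inU[of r] inU[of "- r"] r by (intro integrable_mult_right Bochner_Integration.integrable_add integrable_law) auto
  have nf: "norm (?f \<zeta> y) = exp (s \<bullet> y + Re \<zeta> * (\<omega> \<bullet> y))" for \<zeta> y by simp
  \<comment> \<open>Uses that 1 + \<epsilon> |a| is at most exp (\<epsilon> |a|), and that exp (r
    |a|) is at most exp (r a) + exp (- r a).\<close>
  have ub: "exp (s \<bullet> y + x * (\<omega> \<bullet> y)) * (1 + \<epsilon> * \<bar>\<omega> \<bullet> y\<bar>) \<le> exp ((s + r *\<^sub>R \<omega>) \<bullet> y) + exp ((s + (- r) *\<^sub>R \<omega>) \<bullet> y)"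
    if "\<bar>x\<bar> + \<epsilon> \<le> r" for x y
  proof -
    let ?w = "\<omega> \<bullet> y"
    have "exp (x * ?w) * (1 + \<epsilon> * \<bar>?w\<bar>) \<le> exp (\<bar>x\<bar> * \<bar>?w\<bar>) * exp (\<epsilon> * \<bar>?w\<bar>)"
      using \<epsilon> by (intro mult_mono exp_ge_add_one_self) (auto simp: abs_mult[symmetric])
    also have "\<dots> = exp ((\<bar>x\<bar> + \<epsilon>) * \<bar>?w\<bar>)" by (simp add: exp_add[symmetric] algebra_simps)
    also have "\<dots> \<le> exp (r * \<bar>?w\<bar>)" using that by (simp add: mult_right_mono)
    also have "\<dots> \<le> exp (r * ?w) + exp (- r * ?w)" by (cases "0 \<le> ?w") auto
    finally have "exp (s \<bullet> y) * (exp (x * ?w) * (1 + \<epsilon> * \<bar>?w\<bar>)) \<le> exp (s \<bullet> y) * (exp (r * ?w) + exp (- r * ?w))"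
      by (intro mult_left_mono) auto
    then show ?thesis by (simp add: exp_add inner_add_left inner_diff_left distrib_left exp_diff exp_minus divide_inverse mult.assoc)
  qed
  have re: "\<bar>Re \<zeta>\<bar> + \<epsilon> \<le> r" if "\<zeta> \<in> ball z \<epsilon>" for \<zeta>
  proof -
    have "norm \<zeta> \<le> norm z + norm (\<zeta> - z)" using norm_triangle_ineq[of z "\<zeta> - z"] by simp
    also have "\<dots> \<le> norm z + \<epsilon>" using that by (simp add: dist_norm norm_minus_commute)
    finally show ?thesis using abs_Re_le_cmod[of \<zeta>] by (simp add: \<epsilon>_def field_simps)
  qed
  have bd0: "norm (?f \<zeta> y) \<le> exp ((s + r *\<^sub>R \<omega>) \<bullet> y) + exp ((s + (- r) *\<^sub>R \<omega>) \<bullet> y)"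
    and bd1: "norm (of_real (\<omega> \<bullet> y) * ?f \<zeta> y) \<le> ?g y" if "\<zeta> \<in> ball z \<epsilon>" for \<zeta> y
  proof -
    let ?E = "exp (s \<bullet> y + Re \<zeta> * (\<omega> \<bullet> y))" and ?w = "\<bar>\<omega> \<bullet> y\<bar>"
    note u = ub[OF re[OF that], of y]
    have "0 \<le> ?E * (\<epsilon> * ?w)" using \<epsilon> by simp
    then have a: "?E \<le> exp ((s + r *\<^sub>R \<omega>) \<bullet> y) + exp ((s + (- r) *\<^sub>R \<omega>) \<bullet> y)"
      and b: "?E * (\<epsilon> * ?w) \<le> exp ((s + r *\<^sub>R \<omega>) \<bullet> y) + exp ((s + (- r) *\<^sub>R \<omega>) \<bullet> y)"
      using u exp_ge_zero[of "s \<bullet> y + Re \<zeta> * (\<omega> \<bullet> y)"] unfolding distrib_left mult_1_right by linarith+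
    show "norm (?f \<zeta> y) \<le> exp ((s + r *\<^sub>R \<omega>) \<bullet> y) + exp ((s + (- r) *\<^sub>R \<omega>) \<bullet> y)" unfolding nf by (rule a)
    have "norm (of_real (\<omega> \<bullet> y) * ?f \<zeta> y) = (1 / \<epsilon>) * (?E * (\<epsilon> * ?w))"
      using \<epsilon> unfolding norm_mult nf by simp
    also have "\<dots> \<le> ?g y" using b \<epsilon> by (intro mult_left_mono) auto
    finally show "norm (of_real (\<omega> \<bullet> y) * ?f \<zeta> y) \<le> ?g y" .
  qed
  have "((\<lambda>\<zeta>. \<integral>y. ?f \<zeta> y \<partial>law \<theta>) has_derivative (\<lambda>v. \<integral>y. ?f' z y v \<partial>law \<theta>)) (at z)"
  proof (rule has_derivative_lebesgue_integral[OF \<epsilon> _ _ i])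
    show "((\<lambda>\<zeta>. ?f \<zeta> y) has_derivative ?f' u y) (at u)" for u y
      by (auto intro!: derivative_eq_intros simp: mult_ac)
    show "integrable (law \<theta>) (?f u)" if "u \<in> ball z \<epsilon>" for u
    proof (rule Bochner_Integration.integrable_bound)
      show "integrable (law \<theta>) (\<lambda>y. exp ((s + r *\<^sub>R \<omega>) \<bullet> y) + exp ((s + (- r) *\<^sub>R \<omega>) \<bullet> y))"
        using inU[of r] inU[of "- r"] r by (intro Bochner_Integration.integrable_add integrable_law) auto
      show "AE y in law \<theta>. norm (?f u y) \<le> norm (exp ((s + r *\<^sub>R \<omega>) \<bullet> y) + exp ((s + (- r) *\<^sub>R \<omega>) \<bullet> y))"
        by (intro AE_I2 order_trans[OF bd0[OF that]]) simp
    qed measurable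
    show "norm (?f' u y v) \<le> ?g y * norm v" if "u \<in> ball z \<epsilon>" for u y v
      unfolding norm_mult[of v] using mult_left_mono[OF bd1[OF that, of y] norm_ge_zero[of v]]
      by (simp add: mult.commute)
  qed measurable
  \<comment> \<open>The derivative was obtained over the reals; being multiplication by a complex
    number, it is a complex derivative.\<close>
  then have "((\<lambda>\<zeta>. \<integral>y. ?f \<zeta> y \<partial>law \<theta>) has_field_derivative (\<integral>y. of_real (\<omega> \<bullet> y) * ?f z y \<partial>law \<theta>)) (at z)"
    unfolding has_field_derivative_def by (simp only: integral_mult_right_zero mult.commute[of _ "integral\<^sup>L _ _"])
  moreover have "(\<lambda>\<zeta>. M0 P Y (cvec (s + Re \<zeta> *\<^sub>R \<omega>) (\<phi> + Im \<zeta> *\<^sub>R \<omega>)) \<theta>) = (\<lambda>\<zeta>. \<integral>y. ?f \<zeta> y \<partial>law \<theta>)"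
  proof
    fix \<zeta> :: complex
    have "of_real (exp ((s + Re \<zeta> *\<^sub>R \<omega>) \<bullet> y)) * iexp ((\<phi> + Im \<zeta> *\<^sub>R \<omega>) \<bullet> y) = ?f \<zeta> y" for y
    proof -
      have "of_real ((s + Re \<zeta> *\<^sub>R \<omega>) \<bullet> y) + \<i> * of_real ((\<phi> + Im \<zeta> *\<^sub>R \<omega>) \<bullet> y)
         = of_real (s \<bullet> y) + \<i> * of_real (\<phi> \<bullet> y) + \<zeta> * of_real (\<omega> \<bullet> y)"
        by (simp add: complex_eq_iff inner_add_left)
      from this[symmetric] show ?thesis by (simp only: exp_add exp_of_real)
    qed
    then show "M0 P Y (cvec (s + Re \<zeta> *\<^sub>R \<omega>) (\<phi> + Im \<zeta> *\<^sub>R \<omega>)) \<theta> = (\<integral>y. ?f \<zeta> y \<partial>law \<theta>)"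
      by (simp only: M0_law[OF \<theta>])
  qed
  ultimately show "(\<lambda>\<zeta>. M0 P Y (cvec (s + Re \<zeta> *\<^sub>R \<omega>) (\<phi> + Im \<zeta> *\<^sub>R \<omega>)) \<theta>) field_differentiable at z within ball 0 r"
    unfolding field_differentiable_def by (simp only:) (rule exI, erule has_field_derivative_at_within)
qed

lemma U_nbhd:
  assumes "(s, \<theta>) \<in> U"
  obtains r where "0 < r" "\<And>v e. norm v \<le> r \<Longrightarrow> norm e \<le> r \<Longrightarrow> (s + v, \<theta> + e) \<in> U"
proof -
  obtain r where r: "0 < r" "ball (s, \<theta>) r \<subseteq> U" using assms open_contains_ball[of U] open_interior by blast
  have "(s + v, \<theta> + e) \<in> U" if "norm v \<le> r / 3" "norm e \<le> r / 3" for v e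
  proof -
    have "dist (s, \<theta>) (s + v, \<theta> + e) \<le> norm v + norm e"
      by (simp add: dist_norm norm_Pair sqrt_sum_squares_le_sum)
    then show ?thesis using r that by (auto simp: subset_iff)
  qed
  with r show ?thesis using that[of "r / 3"] by simp
qed

end

section \<open>Derivatives of the transform and their bounds\<close>

context saddle_model
begin

lemma growth_props:
  obtains \<gamma> where "continuous_on U \<gamma>" "\<And>x. x \<in> U \<Longrightarrow> 0 < \<gamma> x"
    "\<And>is js s \<theta> \<phi>. length is \<le> 1 \<Longrightarrow> 1 \<le> length is + length js \<Longrightarrow> length is + length js \<le> 6 \<Longrightarrow> (s, \<theta>) \<in> U \<Longrightarrow>
      dM0_exists P Y is js (cvec s \<phi>) \<theta>"
    "\<And>is js s \<theta> \<phi>. length is \<le> 1 \<Longrightarrow> 1 \<le> length is + length js \<Longrightarrow> length is + length js \<le> 6 \<Longrightarrow> (s, \<theta>) \<in> U \<Longrightarrow>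
      cmod (dM0 P Y is js (cvec s \<phi>) \<theta>) \<le> \<gamma> (s, \<theta>) * (1 + norm \<phi>) powr \<gamma> (s, \<theta>)"
    "\<And>is js. length is \<le> 1 \<Longrightarrow> 1 \<le> length is + length js \<Longrightarrow> length is + length js \<le> 6 \<Longrightarrow>
      continuous_on (U \<times> UNIV) (\<lambda>((s, \<theta>), \<phi>). dM0 P Y is js (cvec s \<phi>) \<theta>)"
  using growth unfolding growth_condition_def by (elim exE conjE) (rule that, blast+)

lemma dM0_continuous:
  assumes "length is \<le> 1" "1 \<le> length is + length js" "length is + length js \<le> 6"
  shows "continuous_on (U \<times> UNIV) (\<lambda>((s, \<theta>), \<phi>). dM0 P Y is js (cvec s \<phi>) \<theta>)"
  using growth_props assms by metis

lemma dM0_continuous_compose: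
  assumes "length is \<le> 1" "1 \<le> length is + length js" "length is + length js \<le> 6"
    and "continuous_on A f" "continuous_on A g" "continuous_on A h" "\<And>x. x \<in> A \<Longrightarrow> (f x, g x) \<in> U"
  shows "continuous_on A (\<lambda>x. dM0 P Y is js (cvec (f x) (h x)) (g x))"
proof -
  have "continuous_on A (\<lambda>x. (\<lambda>((s, \<theta>), \<phi>). dM0 P Y is js (cvec s \<phi>) \<theta>) ((f x, g x), h x))"
    by (rule continuous_on_compose2[OF dM0_continuous[OF assms(1-3)]])
       (use assms(4-) in \<open>auto intro!: continuous_intros\<close>)
  then show ?thesis by simp
qed

lemma dM0_Nil [simp]: "dM0 P Y [] [] = M0 P Y"
  by (simp add: dM0_def)

lemma dM0_s_deriv:
  assumes "length js \<le> 5" "(s, \<theta>) \<in> U"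
  shows "((\<lambda>h. dM0 P Y [] js (cvec (s + h *\<^sub>R axis j 1) \<phi>) \<theta>) has_vector_derivative
    dM0 P Y [] (j # js) (cvec s \<phi>) \<theta>) (at 0)"
proof -
  obtain \<gamma> where "\<And>is js s \<theta> \<phi>. length is \<le> 1 \<Longrightarrow> 1 \<le> length is + length js \<Longrightarrow> length is + length js \<le> 6 \<Longrightarrow> (s, \<theta>) \<in> U \<Longrightarrow>
      dM0_exists P Y is js (cvec s \<phi>) \<theta>" using growth_props by metis
  from this[of "[]" "j # js" s \<theta> \<phi>] assms
  have "(\<lambda>h. dM0 P Y [] js (cvec s \<phi> + axis j (complex_of_real h)) \<theta>) differentiable (at 0)" by simp
  then show ?thesis
    unfolding vector_derivative_works by (simp add: dM0_def s_partial_def cvec_add_axis)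
qed

lemma axis_scaleR: "h *\<^sub>R axis i (1::real) = axis i h"
  by (simp add: axis_def vec_eq_iff)

lemma dM0_theta_deriv:
  assumes "length js \<le> 5" "(s, \<theta>) \<in> U"
  shows "((\<lambda>h. dM0 P Y [] js (cvec s \<phi>) (\<theta> + h *\<^sub>R axis i 1)) has_vector_derivative
    dM0 P Y [i] js (cvec s \<phi>) \<theta>) (at 0)"
proof -
  obtain \<gamma> where "\<And>is js s \<theta> \<phi>. length is \<le> 1 \<Longrightarrow> 1 \<le> length is + length js \<Longrightarrow> length is + length js \<le> 6 \<Longrightarrow> (s, \<theta>) \<in> U \<Longrightarrow>
      dM0_exists P Y is js (cvec s \<phi>) \<theta>" using growth_props by metis
  from this[of "[i]" js s \<theta> \<phi>] assms
  have "(\<lambda>h. dM0 P Y [] js (cvec s \<phi>) (\<theta> + axis i h)) differentiable (at 0)" by simp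
  then show ?thesis
    unfolding vector_derivative_works by (simp add: dM0_def theta_partial_def axis_scaleR)
qed

text \<open>The total derivative in (s, \<theta>), applied to \<open>v\<close>, of the s-derivative
  indexed by \<open>js\<close>, with the imaginary part \<phi> frozen. Assembling it from partials
  makes its linearity in \<open>v\<close> and its continuity immediate; \<open>dird_dM0\<close>
  identifies it.\<close>

definition dM :: "'d list \<Rightarrow> real ^ 'd \<Rightarrow> (real ^ 'd) \<times> (real ^ 'p) \<Rightarrow> (real ^ 'd) \<times> (real ^ 'p) \<Rightarrow> complex" where
  "dM js \<phi> v p = (\<Sum>j\<in>UNIV. (fst v $ j) *\<^sub>R dM0 P Y [] (j # js) (cvec (fst p) \<phi>) (snd p))
     + (\<Sum>i\<in>UNIV. (snd v $ i) *\<^sub>R dM0 P Y [i] js (cvec (fst p) \<phi>) (snd p))"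

lemma linear_dM: "linear (\<lambda>v. dM js \<phi> v p)"
  by (rule linearI) (simp_all add: dM_def algebra_simps sum.distrib scaleR_sum_right)

lemma dM_axis [simp]:
  "dM js \<phi> (axis j 1, 0) p = dM0 P Y [] (j # js) (cvec (fst p) \<phi>) (snd p)"
  "dM js \<phi> (0, axis i 1) p = dM0 P Y [i] js (cvec (fst p) \<phi>) (snd p)"
  by (simp_all add: dM_def axis_def if_distrib[of "\<lambda>x. x *\<^sub>R _"] sum.delta cong: if_cong)

lemma dM0_C1:
  assumes js: "length js \<le> 5"
  shows C1_on_dM0: "C1_on U (\<lambda>p. dM0 P Y [] js (cvec (fst p) \<phi>) (snd p))"
    and dird_dM0: "\<And>v p. p \<in> U \<Longrightarrow> dird v (\<lambda>p. dM0 P Y [] js (cvec (fst p) \<phi>) (snd p)) p = dM js \<phi> v p"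
proof -
  let ?f = "\<lambda>p. dM0 P Y [] js (cvec (fst p) \<phi>) (snd p)"
  have der: "((\<lambda>t. ?f (p + t *\<^sub>R b)) has_vector_derivative dM js \<phi> b p) (at 0)" if "b \<in> Basis" "p \<in> U" for b p
  proof -
    obtain s \<theta> where p: "p = (s, \<theta>)" by (cases p)
    consider j where "b = (axis j 1, 0)" | i where "b = (0, axis i 1)"
      using \<open>b \<in> Basis\<close> by (auto simp: Basis_prod_def Basis_cart)
    then show ?thesis
      using dM0_s_deriv[OF js] dM0_theta_deriv[OF js] that(2) by cases (simp_all add: p)
  qed
  have cont: "continuous_on U (dM js \<phi> b)" for b
    unfolding dM_def[abs_def] using js
    by (intro continuous_intros dM0_continuous_compose) auto
  show "C1_on U ?f" by (rule C1_on_partials(1)[OF open_interior der cont])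
  fix v p assume p: "p \<in> U"
  have "dird v ?f p = (\<Sum>b\<in>Basis. (v \<bullet> b) *\<^sub>R dM js \<phi> b p)"
    by (rule C1_on_partials(2)[where D = "dM js \<phi>", OF open_interior]) (use der cont p in auto)
  also have "\<dots> = dM js \<phi> (\<Sum>b\<in>Basis. (v \<bullet> b) *\<^sub>R b) p"
    by (simp add: linear_sum[OF linear_dM] linear_cmul[OF linear_dM])
  finally show "dird v ?f p = dM js \<phi> v p" by (simp add: euclidean_representation)
qed

lemma line_nbhd:
  assumes nb: "\<And>v e. norm v \<le> \<rho> \<Longrightarrow> norm e \<le> \<rho> \<Longrightarrow> (s + v, \<theta> + e) \<in> U" and \<omega>: "norm \<omega> \<le> 1" and \<rho>: "0 < \<rho>"
    and "\<bar>t\<bar> \<le> \<rho> / 2" "norm u \<le> \<rho> / 2" "norm e \<le> \<rho> / 2"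
  shows "(s + t *\<^sub>R \<omega> + u, \<theta> + e) \<in> U"
proof -
  have "norm (t *\<^sub>R \<omega> + u) \<le> \<bar>t\<bar> * norm \<omega> + norm u" using norm_triangle_ineq[of "t *\<^sub>R \<omega>" u] by simp
  also have "\<dots> \<le> \<rho> / 2 * 1 + \<rho> / 2" using assms by (intro add_mono mult_mono) auto
  finally show ?thesis using nb[of "t *\<^sub>R \<omega> + u" e] assms by (simp add: add.assoc)
qed

text \<open>First derivatives of \<open>M0\<close> are derivatives, in a real parameter, of
  functions holomorphic in \<zeta>, so \<open>holomorphic_param_derivative\<close> applies. The
  radius is halved because the other half is spent on the parameter increment.\<close>

lemma dM0_holomorphic:
  assumes nb: "\<And>v e. norm v \<le> \<rho> \<Longrightarrow> norm e \<le> \<rho> \<Longrightarrow> (s + v, \<theta> + e) \<in> U" and \<rho>: "0 < \<rho>" and \<omega>: "norm \<omega> \<le> 1"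
  shows M0_holo: "(\<lambda>\<zeta>. M0 P Y (cvec (s + Re \<zeta> *\<^sub>R \<omega>) (\<phi> + Im \<zeta> *\<^sub>R \<omega>)) \<theta>) holomorphic_on ball 0 (\<rho> / 2)"
    and dM_holo: "(\<lambda>\<zeta>. dM [] (\<phi> + Im \<zeta> *\<^sub>R \<omega>) v (s + Re \<zeta> *\<^sub>R \<omega>, \<theta>)) holomorphic_on ball 0 (\<rho> / 2)"
proof -
  note nbl = line_nbhd[OF nb \<omega> \<rho>]
  have \<rho>2: "0 < \<rho> / 2" using \<rho> by simp
  have inU: "(s + t *\<^sub>R \<omega> + u, \<theta> + e) \<in> U" if "\<bar>t\<bar> \<le> \<rho> / 2" "norm u \<le> \<rho> / 2" "norm e \<le> \<rho> / 2" for t u e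
    using nbl that by blast
  have hol: "(\<lambda>\<zeta>. M0 P Y (cvec (s + u + Re \<zeta> *\<^sub>R \<omega>) (\<phi> + Im \<zeta> *\<^sub>R \<omega>)) (\<theta> + e)) holomorphic_on ball 0 (\<rho> / 2)"
    if "norm u \<le> \<rho> / 2" "norm e \<le> \<rho> / 2" for u e
    by (rule M0_holomorphic[OF \<rho>2]) (use inU[OF _ that] in \<open>simp add: add_ac\<close>)
  from this[of 0 0] \<rho> show "(\<lambda>\<zeta>. M0 P Y (cvec (s + Re \<zeta> *\<^sub>R \<omega>) (\<phi> + Im \<zeta> *\<^sub>R \<omega>)) \<theta>) holomorphic_on ball 0 (\<rho> / 2)" by simp
  have re: "\<bar>Re z\<bar> \<le> \<rho> / 2" if "z \<in> ball 0 (\<rho> / 2)" for z :: complex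
    using that abs_Re_le_cmod[of z] by simp
  have shift: "((\<lambda>h. g h) has_vector_derivative D) (at h)" if "((\<lambda>k. g (h + k)) has_vector_derivative D) (at 0)" for g :: "real \<Rightarrow> complex" and D h
  proof -
    have "((\<lambda>k. g (h + k)) \<circ> (\<lambda>x. x - h) has_vector_derivative 1 *\<^sub>R D) (at h)"
      using that by (intro vector_diff_chain_at) (auto intro!: derivative_eq_intros)
    then show ?thesis by (simp add: o_def)
  qed
  have 1: "(\<lambda>\<zeta>. dM0 P Y [] [j] (cvec (s + Re \<zeta> *\<^sub>R \<omega>) (\<phi> + Im \<zeta> *\<^sub>R \<omega>)) \<theta>) holomorphic_on ball 0 (\<rho> / 2)" for j
  proof -
    let ?G = "\<lambda>\<zeta> h. dM0 P Y [] [j] (cvec (s + Re \<zeta> *\<^sub>R \<omega> + h *\<^sub>R axis j 1) (\<phi> + Im \<zeta> *\<^sub>R \<omega>)) \<theta>"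
    have "(\<lambda>\<zeta>. ?G \<zeta> 0) holomorphic_on ball 0 (\<rho> / 2)"
    proof (rule holomorphic_param_derivative[where F = "\<lambda>\<zeta> h. M0 P Y (cvec (s + Re \<zeta> *\<^sub>R \<omega> + h *\<^sub>R axis j 1) (\<phi> + Im \<zeta> *\<^sub>R \<omega>)) \<theta>", OF open_ball \<rho>2])
      show "(\<lambda>\<zeta>. M0 P Y (cvec (s + Re \<zeta> *\<^sub>R \<omega> + h *\<^sub>R axis j 1) (\<phi> + Im \<zeta> *\<^sub>R \<omega>)) \<theta>) holomorphic_on ball 0 (\<rho> / 2)" if "\<bar>h\<bar> \<le> \<rho> / 2" for h
        using hol[of "h *\<^sub>R axis j 1" 0] that \<rho> by (simp add: add_ac)
      fix z :: complex and h assume z: "z \<in> ball 0 (\<rho> / 2)" and h: "\<bar>h\<bar> \<le> \<rho> / 2"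
      have "(s + Re z *\<^sub>R \<omega> + h *\<^sub>R axis j 1, \<theta>) \<in> U"
        using inU[OF re[OF z], of "h *\<^sub>R axis j 1" 0] h \<rho> by simp
      note d = dM0_s_deriv[OF _ this, of "[]" j "\<phi> + Im z *\<^sub>R \<omega>"]
      show "((\<lambda>h. M0 P Y (cvec (s + Re z *\<^sub>R \<omega> + h *\<^sub>R axis j 1) (\<phi> + Im z *\<^sub>R \<omega>)) \<theta>) has_vector_derivative ?G z h) (at h)"
        by (rule shift) (use d in \<open>simp add: scaleR_add_left add.assoc\<close>)
    next
      show "continuous_on (ball 0 (\<rho> / 2) \<times> {- (\<rho> / 2)..\<rho> / 2}) (\<lambda>(\<zeta>, h). ?G \<zeta> h)"
        unfolding case_prod_beta
      proof (rule dM0_continuous_compose)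
        fix x assume "x \<in> ball (0::complex) (\<rho> / 2) \<times> {- (\<rho> / 2)..\<rho> / 2}"
        then show "(s + Re (fst x) *\<^sub>R \<omega> + snd x *\<^sub>R axis j 1, \<theta>) \<in> U"
          using inU[OF re, of "fst x" "snd x *\<^sub>R axis j 1" 0] \<rho> by (auto simp: abs_le_iff)
      qed (auto intro!: continuous_intros)
    qed
    then show ?thesis by simp
  qed
  have 2: "(\<lambda>\<zeta>. dM0 P Y [i] [] (cvec (s + Re \<zeta> *\<^sub>R \<omega>) (\<phi> + Im \<zeta> *\<^sub>R \<omega>)) \<theta>) holomorphic_on ball 0 (\<rho> / 2)" for i
  proof -
    let ?G = "\<lambda>\<zeta> h. dM0 P Y [i] [] (cvec (s + Re \<zeta> *\<^sub>R \<omega>) (\<phi> + Im \<zeta> *\<^sub>R \<omega>)) (\<theta> + h *\<^sub>R axis i 1)"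
    have "(\<lambda>\<zeta>. ?G \<zeta> 0) holomorphic_on ball 0 (\<rho> / 2)"
    proof (rule holomorphic_param_derivative[where F = "\<lambda>\<zeta> h. M0 P Y (cvec (s + Re \<zeta> *\<^sub>R \<omega>) (\<phi> + Im \<zeta> *\<^sub>R \<omega>)) (\<theta> + h *\<^sub>R axis i 1)", OF open_ball \<rho>2])
      show "(\<lambda>\<zeta>. M0 P Y (cvec (s + Re \<zeta> *\<^sub>R \<omega>) (\<phi> + Im \<zeta> *\<^sub>R \<omega>)) (\<theta> + h *\<^sub>R axis i 1)) holomorphic_on ball 0 (\<rho> / 2)" if "\<bar>h\<bar> \<le> \<rho> / 2" for h
        using hol[of 0 "h *\<^sub>R axis i 1"] that \<rho> by simp
      fix z :: complex and h assume z: "z \<in> ball 0 (\<rho> / 2)" and h: "\<bar>h\<bar> \<le> \<rho> / 2"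
      have "(s + Re z *\<^sub>R \<omega>, \<theta> + h *\<^sub>R axis i 1) \<in> U"
        using inU[OF re[OF z], of 0 "h *\<^sub>R axis i 1"] h \<rho> by simp
      note d = dM0_theta_deriv[OF _ this, of "[]" "\<phi> + Im z *\<^sub>R \<omega>" i]
      show "((\<lambda>h. M0 P Y (cvec (s + Re z *\<^sub>R \<omega>) (\<phi> + Im z *\<^sub>R \<omega>)) (\<theta> + h *\<^sub>R axis i 1)) has_vector_derivative ?G z h) (at h)"
        by (rule shift) (use d in \<open>simp add: scaleR_add_left add.assoc\<close>)
    next
      show "continuous_on (ball 0 (\<rho> / 2) \<times> {- (\<rho> / 2)..\<rho> / 2}) (\<lambda>(\<zeta>, h). ?G \<zeta> h)"
        unfolding case_prod_beta
      proof (rule dM0_continuous_compose)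
        fix x assume "x \<in> ball (0::complex) (\<rho> / 2) \<times> {- (\<rho> / 2)..\<rho> / 2}"
        then show "(s + Re (fst x) *\<^sub>R \<omega>, \<theta> + snd x *\<^sub>R axis i 1) \<in> U"
          using inU[OF re, of "fst x" 0 "snd x *\<^sub>R axis i 1"] \<rho> by (auto simp: abs_le_iff)
      qed (auto intro!: continuous_intros)
    qed
    then show ?thesis by simp
  qed
  show "(\<lambda>\<zeta>. dM [] (\<phi> + Im \<zeta> *\<^sub>R \<omega>) v (s + Re \<zeta> *\<^sub>R \<omega>, \<theta>)) holomorphic_on ball 0 (\<rho> / 2)"
    unfolding dM_def fst_conv snd_conv scaleR_conv_of_real[where 'a = complex]
    using 1 2 by (intro holomorphic_intros)
qed

text \<open>The Cauchy-Riemann equations: the derivatives in the j-th real and imaginary directions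
  are the derivatives of one holomorphic function along 1 and \<open>\<i>\<close>.\<close>

lemma M0_phi_deriv:
  assumes "(s, \<theta>) \<in> U"
  shows "((\<lambda>t. M0 P Y (cvec s (\<phi> + t *\<^sub>R axis j 1)) \<theta>) has_vector_derivative \<i> * dM0 P Y [] [j] (cvec s \<phi>) \<theta>) (at 0)"
proof -
  obtain r where r: "0 < r" "\<And>v e. norm v \<le> r \<Longrightarrow> norm e \<le> r \<Longrightarrow> (s + v, \<theta> + e) \<in> U"
    using U_nbhd[OF assms] by metis
  let ?F = "\<lambda>\<zeta>. M0 P Y (cvec (s + Re \<zeta> *\<^sub>R axis j 1) (\<phi> + Im \<zeta> *\<^sub>R axis j 1)) \<theta>"
  have "?F holomorphic_on ball 0 (r / 2)" by (rule M0_holo[OF r(2) r(1)]) auto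
  then have "?F field_differentiable at 0"
    using r(1) by (auto intro: holomorphic_on_imp_differentiable_at)
  then obtain D where D: "(?F has_field_derivative D) (at 0)" by (auto simp: field_differentiable_def)
  have c: "(?F \<circ> (\<lambda>t. t *\<^sub>R c) has_vector_derivative c * D) (at 0)" for c
    by (rule field_vector_diff_chain_at) (use D in \<open>auto intro!: derivative_eq_intros\<close>)
  have "((\<lambda>t. M0 P Y (cvec (s + t *\<^sub>R axis j 1) \<phi>) \<theta>) has_vector_derivative D) (at 0)"
    using c[of 1] by (simp add: o_def)
  moreover have "((\<lambda>t. M0 P Y (cvec (s + t *\<^sub>R axis j 1) \<phi>) \<theta>) has_vector_derivative dM0 P Y [] [j] (cvec s \<phi>) \<theta>) (at 0)"
    using dM0_s_deriv[OF _ assms, of "[]" j \<phi>] by simp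
  ultimately have "D = dM0 P Y [] [j] (cvec s \<phi>) \<theta>"
    by (rule vector_derivative_unique_at)
  then show ?thesis using c[of \<i>] by (simp add: o_def)
qed

text \<open>The growth condition gives continuity of derivatives of order at least one. Continuity
  of \<open>M0\<close> in \<phi> is recovered from its continuous first derivatives.\<close>

lemma M0_phi_continuous:
  assumes "(s, \<theta>) \<in> U"
  shows "continuous_on UNIV (\<lambda>\<phi>. M0 P Y (cvec s \<phi>) \<theta>)"
proof (rule C1_on_continuous, rule C1_on_partials(1)[OF open_UNIV])
  let ?D = "\<lambda>b \<phi>. \<Sum>j\<in>UNIV. (b $ j) *\<^sub>R (\<i> * dM0 P Y [] [j] (cvec s \<phi>) \<theta>)"
  show "((\<lambda>t. M0 P Y (cvec s (\<phi> + t *\<^sub>R b)) \<theta>) has_vector_derivative ?D b \<phi>) (at 0)" if "b \<in> Basis" for b \<phi>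
  proof -
    obtain j where j: "b = axis j 1" using \<open>b \<in> Basis\<close> by (auto simp: Basis_cart)
    have "?D b \<phi> = \<i> * dM0 P Y [] [j] (cvec s \<phi>) \<theta>"
      by (simp add: j axis_def if_distrib[of "\<lambda>x. x *\<^sub>R _"] sum.delta cong: if_cong)
    then show ?thesis using M0_phi_deriv[OF assms] j by simp
  qed
  show "continuous_on UNIV (?D b)" for b
    by (intro continuous_intros dM0_continuous_compose) (use assms in auto)
qed

lemma dM0_bound:
  assumes K: "compact K" "K \<subseteq> U"
  obtains C N where "1 \<le> C" "\<And>is js s \<theta> \<phi>. length is \<le> 1 \<Longrightarrow> 1 \<le> length is + length js \<Longrightarrow> length is + length js \<le> 6 \<Longrightarrow> (s, \<theta>) \<in> K \<Longrightarrow>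
    cmod (dM0 P Y is js (cvec s \<phi>) \<theta>) \<le> C * (1 + norm \<phi>) ^ N"
proof -
  obtain \<gamma> where \<gamma>: "continuous_on U \<gamma>" "\<And>x. x \<in> U \<Longrightarrow> 0 < \<gamma> x" and b:
    "\<And>is js s \<theta> \<phi>. length is \<le> 1 \<Longrightarrow> 1 \<le> length is + length js \<Longrightarrow> length is + length js \<le> 6 \<Longrightarrow> (s, \<theta>) \<in> U \<Longrightarrow>
      cmod (dM0 P Y is js (cvec s \<phi>) \<theta>) \<le> \<gamma> (s, \<theta>) * (1 + norm \<phi>) powr \<gamma> (s, \<theta>)"
    using growth_props by metis
  have "bounded (\<gamma> ` K)"
    using K \<gamma>(1) by (meson compact_continuous_image compact_imp_bounded continuous_on_subset)
  then obtain G where G: "\<And>x. x \<in> K \<Longrightarrow> \<bar>\<gamma> x\<bar> \<le> G" by (auto simp: bounded_iff)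
  \<comment> \<open>One constant bounds both the factor and the exponent given by \<gamma>; rounding
    the exponent up to an integer fits it to \<open>moment_kernel\<close>.\<close>
  define C where "C = max G 1"
  define N where "N = nat \<lceil>C\<rceil>"
  have N: "C \<le> real N" by (simp add: N_def real_nat_ceiling_ge)
  have "cmod (dM0 P Y is js (cvec s \<phi>) \<theta>) \<le> C * (1 + norm \<phi>) ^ N"
    if "length is \<le> 1" "1 \<le> length is + length js" "length is + length js \<le> 6" "(s, \<theta>) \<in> K" for "is" js s \<theta> \<phi>
  proof -
    have g: "\<gamma> (s, \<theta>) \<le> C" using G[OF that(4)] by (simp add: C_def)
    have "cmod (dM0 P Y is js (cvec s \<phi>) \<theta>) \<le> \<gamma> (s, \<theta>) * (1 + norm \<phi>) powr \<gamma> (s, \<theta>)"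
      using b that K by blast
    also have "\<dots> \<le> C * (1 + norm \<phi>) powr (real N)"
      using g N by (intro mult_mono powr_mono) (auto simp: C_def)
    also have "\<dots> = C * (1 + norm \<phi>) ^ N" by (simp add: powr_realpow add_pos_nonneg)
    finally show ?thesis .
  qed
  then show ?thesis using that[of C N] by (simp add: C_def)
qed

text \<open>The continuous decay function has a positive minimum on \<open>K\<close>, to which
  \<open>decay_power_bound\<close> applies. The exponent \<open>PP\<close> is at the caller's
  disposal: a larger one is paid for by the threshold \<open>n1\<close> and the constant
  \<open>c\<close>.\<close>

lemma M0_decay:
  assumes K: "compact K" "K \<subseteq> U"
  obtains c n1 where "0 < c" "1 \<le> n1"
    "\<And>n s \<theta> \<phi>. n1 \<le> n \<Longrightarrow> (s, \<theta>) \<in> K \<Longrightarrow> norm (M0 P Y (cvec s \<phi>) \<theta> / of_real (mgf s \<theta>)) ^ n \<le> 1 / (1 + c * real n * (norm \<phi>)\<^sup>2) ^ PP"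
proof -
  obtain \<delta> where d: "continuous_on U \<delta>" and d2: "\<And>s \<theta>. (s, \<theta>) \<in> U \<Longrightarrow> 0 < \<delta> (s, \<theta>)"
    and d3: "\<And>s \<theta> \<phi>. (s, \<theta>) \<in> U \<Longrightarrow> cmod (M0 P Y (cvec s \<phi>) \<theta> / M0 P Y (cvec s 0) \<theta>)
              \<le> (1 + \<delta> (s, \<theta>) * (norm \<phi>)\<^sup>2) powr (- \<delta> (s, \<theta>))"
    using decay unfolding decay_condition_def by (elim exE conjE) (force simp: Ball_def)
  obtain \<delta>0 where d0: "0 < \<delta>0" "\<And>x. x \<in> K \<Longrightarrow> \<delta>0 \<le> \<delta> x"
  proof (cases "K = {}")
    case False
    then obtain x where x: "x \<in> K" "\<And>y. y \<in> K \<Longrightarrow> \<delta> x \<le> \<delta> y"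
      using continuous_attains_inf[OF K(1) False continuous_on_subset[OF d K(2)]] by blast
    then have "0 < \<delta> x" using K(2) d2 by (cases x) auto
    with x show ?thesis using that by blast
  qed (use that[of 1] in auto)
  obtain c n1 where c: "0 < c" "1 \<le> n1" "\<And>n x \<delta>'. n1 \<le> n \<Longrightarrow> 0 \<le> x \<Longrightarrow> \<delta>0 \<le> \<delta>' \<Longrightarrow> ((1 + \<delta>' * x) powr (- \<delta>')) ^ n \<le> 1 / (1 + c * real n * x) ^ PP"
    using decay_power_bound[OF d0(1)] by metis
  have "norm (M0 P Y (cvec s \<phi>) \<theta> / of_real (mgf s \<theta>)) ^ n \<le> 1 / (1 + c * real n * (norm \<phi>)\<^sup>2) ^ PP"
    if "n1 \<le> n" "(s, \<theta>) \<in> K" for n s \<theta> \<phi>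
  proof -
    have U: "(s, \<theta>) \<in> U" using that K by blast
    have "norm (M0 P Y (cvec s \<phi>) \<theta> / of_real (mgf s \<theta>)) ^ n \<le> ((1 + \<delta> (s, \<theta>) * (norm \<phi>)\<^sup>2) powr (- \<delta> (s, \<theta>))) ^ n"
      using d3[OF U, of \<phi>] by (intro power_mono) (auto simp: M0_real[OF U])
    also have "\<dots> \<le> 1 / (1 + c * real n * (norm \<phi>)\<^sup>2) ^ PP"
      using that d0 by (intro c) auto
    finally show ?thesis .
  qed
  then show ?thesis using c that by blast
qed

end

lemma dird_divide:
  fixes f g :: "'a::real_normed_vector \<Rightarrow> 'b::real_normed_field"
  assumes "C1_on U f" "C1_on U g" "x \<in> U" "g x \<noteq> 0"
  shows "dird v (\<lambda>x. f x / g x) x = (dird v f x * g x - f x * dird v g x) / (g x * g x)"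
  using dird_eq[OF has_derivative_divide'[OF C1_on_has_derivative[OF assms(1,3)] C1_on_has_derivative[OF assms(2,3)] assms(4)]] .

lemma tendsto_div_at_0:
  fixes f :: "real \<Rightarrow> real"
  assumes "(f has_vector_derivative D) (at 0)" "f 0 = 0"
  shows "((\<lambda>t. f t / t) \<longlongrightarrow> D) (at 0)"
  using assms by (simp add: has_real_derivative_iff_has_vector_derivative[symmetric] DERIV_def)

lemma tendsto_second_order:
  fixes f f' :: "real \<Rightarrow> real"
  assumes r: "0 < r" and f: "\<And>t. \<bar>t\<bar> < r \<Longrightarrow> (f has_vector_derivative f' t) (at t)"
    and f0: "f 0 = 0" and lim: "((\<lambda>t. f' t / t) \<longlongrightarrow> 0) (at 0)"
  shows "((\<lambda>t. f t / t\<^sup>2) \<longlongrightarrow> 0) (at 0)"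
proof (rule lhopital[where f' = f' and g' = "\<lambda>t. 2 * t"])
  have ev: "\<forall>\<^sub>F t::real in at 0. \<bar>t\<bar> < r"
    using eventually_at_in_open'[of "{- r<..<r}" 0] r by (auto elim!: eventually_mono)
  have d: "DERIV f t :> f' t" if "\<bar>t\<bar> < r" for t
    using f[OF that] by (simp add: has_real_derivative_iff_has_vector_derivative)
  have "isCont f 0" using d[of 0] r DERIV_isCont by simp
  then show "f \<midarrow>0\<rightarrow> 0" using f0 by (simp add: isCont_def)
  show "((\<lambda>t. t\<^sup>2) \<longlongrightarrow> (0::real)) (at 0)" by (auto intro!: tendsto_eq_intros)
  show "\<forall>\<^sub>F t::real in at 0. t\<^sup>2 \<noteq> 0" "\<forall>\<^sub>F t::real in at 0. 2 * t \<noteq> 0"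
    using eventually_neq_at_within[of "0::real" 0 UNIV] by (auto elim!: eventually_mono)
  show "\<forall>\<^sub>F t in at 0. DERIV f t :> f' t" using ev by eventually_elim (rule d)
  show "\<forall>\<^sub>F t::real in at 0. DERIV (\<lambda>t. t\<^sup>2) t :> 2 * t"
    by (auto intro!: always_eventually derivative_eq_intros)
  show "((\<lambda>t. f' t / (2 * t)) \<longlongrightarrow> 0) (at 0)"
    using tendsto_mult[OF lim tendsto_const[of "1/2"]] by (simp add: mult.commute)
qed

section \<open>The cumulant function and its Hessian\<close>

context saddle_model
begin

definition Mr :: "'d list \<Rightarrow> (real ^ 'd) \<times> (real ^ 'p) \<Rightarrow> real" where
  "Mr js p = Re (dM0 P Y [] js (cvec (fst p) 0) (snd p))"

text \<open>
  On \<open>U\<close>, the functions \<open>kap\<close>, \<open>kg\<close>, \<open>hs\<close> are \<open>K0\<close>, \<open>K0_grad\<close>, \<open>K0_hess\<close>. The explicit quotients give joint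
  differentiability in \<open>(s, \<theta>)\<close>, which the definitions through \<open>grad\<close> and \<open>jacobian\<close> in \<open>s\<close> do not show.
\<close>

definition kap :: "(real ^ 'd) \<times> (real ^ 'p) \<Rightarrow> real" where
  "kap p = ln (Mr [] p)"

definition kg :: "(real ^ 'd) \<times> (real ^ 'p) \<Rightarrow> real ^ 'd" where
  "kg p = (\<chi> j. Mr [j] p / Mr [] p)"

definition hs :: "(real ^ 'd) \<times> (real ^ 'p) \<Rightarrow> real ^ 'd ^ 'd" where
  "hs p = (\<chi> l m. (Mr [m, l] p * Mr [] p - Mr [l] p * Mr [m] p) / (Mr [] p * Mr [] p))"

lemma Mr_Nil: "p \<in> U \<Longrightarrow> Mr [] p = mgf (fst p) (snd p)"
  using M0_real[of "fst p" "snd p"] by (simp add: Mr_def)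

lemma Mr_pos: "p \<in> U \<Longrightarrow> 0 < Mr [] p"
  using mgf_pos[of "fst p" "snd p"] by (simp add: Mr_Nil)

lemma Mr_C1: "length js \<le> 5 \<Longrightarrow> C1_on U (Mr js)"
  unfolding Mr_def[abs_def] by (intro C1_on_Re C1_on_dM0)

lemma dird_Mr: "length js \<le> 5 \<Longrightarrow> p \<in> U \<Longrightarrow> dird v (Mr js) p = Re (dM js 0 v p)"
  unfolding Mr_def[abs_def] by (simp add: C1_on_Re(2)[OF C1_on_dM0] dird_dM0)

lemma dird_Mr_s: "length js \<le> 5 \<Longrightarrow> p \<in> U \<Longrightarrow> dird (h, 0) (Mr js) p = (\<Sum>m\<in>UNIV. h $ m * Mr (m # js) p)"
  by (simp add: dird_Mr dM_def Mr_def)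

lemma dird_Mr_axis: "length js \<le> 5 \<Longrightarrow> p \<in> U \<Longrightarrow> dird (axis m 1, 0) (Mr js) p = Mr (m # js) p"
  by (simp add: dird_Mr Mr_def)

lemma kap_C1: "C1_on U kap" and dird_kap: "p \<in> U \<Longrightarrow> dird v kap p = dird v (Mr []) p / Mr [] p"
  unfolding kap_def[abs_def] using C1_on_ln[OF Mr_C1, of "[]"] Mr_pos by auto

lemma kg_C1: "C1_on U kg"
  by (rule C1_on_vec) (auto simp: kg_def intro!: C1_on_divide Mr_C1 dest: Mr_pos)

lemma hs_C1: "C1_on U hs"
  by (rule C1_on_vec, rule C1_on_vec)
     (auto simp: hs_def intro!: C1_on_divide C1_on_mult C1_on_diff Mr_C1 dest: Mr_pos)

lemma dird_kap_s: "p \<in> U \<Longrightarrow> dird (h, 0) kap p = h \<bullet> kg p"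
  by (simp add: dird_kap dird_Mr_s inner_vec_def kg_def sum_divide_distrib)

lemma dird_kg_s: "p \<in> U \<Longrightarrow> dird (h, 0) kg p = hs p *v h"
proof -
  assume p: "p \<in> U"
  have c: "C1_on U (\<lambda>p. kg p $ l)" for l
    by (auto simp: kg_def intro!: C1_on_divide Mr_C1 dest: Mr_pos)
  have "dird (h, 0) kg p $ l = (hs p *v h) $ l" for l
  proof -
    have "dird (h, 0) kg p $ l = dird (h, 0) (\<lambda>p. Mr [l] p / Mr [] p) p"
      using C1_on_vec(2)[OF c p, of "(h, 0)" l] by (simp add: kg_def[abs_def])
    also have "\<dots> = (dird (h, 0) (Mr [l]) p * Mr [] p - Mr [l] p * dird (h, 0) (Mr []) p) / (Mr [] p * Mr [] p)"
      using Mr_pos[OF p] by (intro dird_divide[OF Mr_C1 Mr_C1 p]) auto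
    also have "\<dots> = (hs p *v h) $ l"
      by (simp add: dird_Mr_s p hs_def matrix_vector_mult_def sum_distrib_left sum_distrib_right
          sum_subtractf[symmetric] sum_divide_distrib algebra_simps)
    finally show ?thesis .
  qed
  then show ?thesis by (simp add: vec_eq_iff)
qed

lemma K0_kap: "K0 P Y s \<theta> = kap (s, \<theta>)"
  by (simp add: K0_def kap_def Mr_def)

lemma compose_fst:
  assumes "C1_on U f" "(s, \<theta>) \<in> U"
  shows "((\<lambda>u. f (u, \<theta>)) has_derivative (\<lambda>h. dird (h, 0) f (s, \<theta>))) (at s)"
  by (rule has_derivative_compose[of "\<lambda>u. (u, \<theta>)" "\<lambda>h. (h, 0)" s UNIV f "\<lambda>v. dird v f (s, \<theta>)"])
     (auto intro!: derivative_eq_intros C1_on_has_derivative[OF assms])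

lemma K0_grad_kg: "(s, \<theta>) \<in> U \<Longrightarrow> K0_grad P Y s \<theta> = kg (s, \<theta>)"
  unfolding K0_grad_def K0_kap
  by (rule grad_eq, rule has_derivative_eq_rhs[OF compose_fst[OF kap_C1]]) (auto simp: dird_kap_s)

lemma open_section: "open {s. (s, \<theta>) \<in> U}"
proof -
  have "{s. (s, \<theta>) \<in> U} = (\<lambda>s. (s, \<theta>)) -` U" by auto
  then show ?thesis by (simp only:) (intro open_vimage open_interior continuous_intros)
qed

lemma K0_hess_hs: "(s, \<theta>) \<in> U \<Longrightarrow> K0_hess P Y s \<theta> = hs (s, \<theta>)"
proof -
  assume U: "(s, \<theta>) \<in> U"
  have "((\<lambda>u. kg (u, \<theta>)) has_derivative (\<lambda>h. hs (s, \<theta>) *v h)) (at s)"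
    using compose_fst[OF kg_C1 U] by (simp add: dird_kg_s[OF U])
  then have "((\<lambda>u. K0_grad P Y u \<theta>) has_derivative (\<lambda>h. hs (s, \<theta>) *v h)) (at s)"
    by (rule has_derivative_transform_within_open[OF _ open_section[of \<theta>]]) (use U K0_grad_kg in auto)
  then have "frechet_derivative (\<lambda>u. K0_grad P Y u \<theta>) (at s) = (\<lambda>h. hs (s, \<theta>) *v h)"
    by (rule frechet_derivative_at[symmetric])
  then show ?thesis by (simp add: K0_hess_def jacobian_def)
qed

text \<open>\<open>Mr [l, m]\<close> and \<open>Mr [m, l]\<close> are both the derivative along the
  m-th axis of the first derivative along the l-th one: the former by \<open>dird_commute\<close>,
  the latter directly.\<close>

lemma hs_sym: "p \<in> U \<Longrightarrow> hs p $ l $ m = hs p $ m $ l"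
proof -
  assume p: "p \<in> U"
  have C: "C1_on U (dird (axis m 1, 0) (Mr []))" and
    D: "\<And>v x. x \<in> U \<Longrightarrow> dird v (dird (axis m 1, 0) (Mr [])) x = dird v (Mr [m]) x"
    using C1_on_cong[OF open_interior Mr_C1[of "[m]"], of "dird (axis m 1, 0) (Mr [])"]
    by (auto simp: dird_Mr_axis)
  have 1: "((\<lambda>t. dird (axis l 1, 0) (Mr []) (p + t *\<^sub>R (axis m 1, 0))) has_vector_derivative Mr [l, m] p) (at 0)"
    using dird_commute[OF open_interior Mr_C1 C p, of "(axis l 1, 0)"] by (simp add: D p dird_Mr_axis flip: zero_prod_def)
  have C': "C1_on U (dird (axis l 1, 0) (Mr []))" and
    D': "\<And>v x. x \<in> U \<Longrightarrow> dird v (dird (axis l 1, 0) (Mr [])) x = dird v (Mr [l]) x"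
    using C1_on_cong[OF open_interior Mr_C1[of "[l]"], of "dird (axis l 1, 0) (Mr [])"]
    by (auto simp: dird_Mr_axis)
  have 2: "((\<lambda>t. dird (axis l 1, 0) (Mr []) (p + t *\<^sub>R (axis m 1, 0))) has_vector_derivative Mr [m, l] p) (at 0)"
    using C1_on_line[OF C', of p 0 "(axis m 1, 0)"] p by (simp add: D' dird_Mr_axis flip: zero_prod_def)
  have "Mr [l, m] p = Mr [m, l] p" by (rule vector_derivative_unique_at[OF 1 2])
  then show ?thesis by (simp add: hs_def mult.commute)
qed

lemma hs_inner_sym: "p \<in> U \<Longrightarrow> x \<bullet> (hs p *v y) = (hs p *v x) \<bullet> y"
proof -
  assume p: "p \<in> U"
  have "transpose (hs p) = hs p" by (simp add: transpose_def vec_eq_iff hs_sym[OF p])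
  then show ?thesis by (metis dot_lmul_matrix vector_transpose_matrix)
qed

lemma line_in_U:
  assumes "p \<in> U" obtains r where "0 < r" "\<And>t. \<bar>t\<bar> < r \<Longrightarrow> p + t *\<^sub>R (\<omega>, 0) \<in> U"
proof -
  obtain r where r: "0 < r" "\<And>v e. norm v \<le> r \<Longrightarrow> norm e \<le> r \<Longrightarrow> (fst p + v, snd p + e) \<in> U"
    using U_nbhd[of "fst p" "snd p"] assms by auto
  have "p + t *\<^sub>R (\<omega>, 0) \<in> U" if "\<bar>t\<bar> < r / (norm \<omega> + 1)" for t
  proof -
    have pos: "0 < norm \<omega> + 1" by (simp add: add_nonneg_pos)
    have "\<bar>t\<bar> * norm \<omega> \<le> \<bar>t\<bar> * (norm \<omega> + 1)" by (simp add: mult_left_mono)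
    also have "\<dots> \<le> r" using that pos by (simp add: field_simps)
    finally have "(fst p + t *\<^sub>R \<omega>, snd p + 0) \<in> U" using r by (intro r(2)) auto
    then show ?thesis by (cases p) simp
  qed
  then show ?thesis using that[of "r / (norm \<omega> + 1)"] r(1) by (simp add: add_nonneg_pos)
qed

text \<open>In the expansion at t = 0 the linear coefficient is the inner product of \<omega> with
  \<open>dird w kg p\<close>, which vanishes by the choice of \<open>w\<close>; the quadratic one is
  half of \<open>\<omega> \<bullet> (dird w hs p *v \<omega>)\<close> plus
  \<open>c \<bullet> (hs p *v \<omega>)\<close>, which vanishes by the choice of \<open>c\<close>.
  One use of l'Hopital replaces the second-order Taylor formula.\<close>

lemma saddle_direction_order:
  assumes p: "p \<in> U" and w: "dird w kg p = 0"
    and c: "c \<bullet> (hs p *v \<omega>) = - (\<omega> \<bullet> (dird w hs p *v \<omega>)) / 2"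
  shows "((\<lambda>t. (dird w kap (p + t *\<^sub>R (\<omega>, 0)) - dird w kap p + t * (c \<bullet> (kg (p + t *\<^sub>R (\<omega>, 0)) - kg p))) / t\<^sup>2)
    \<longlongrightarrow> 0) (at 0)"
proof -
  obtain r where r: "0 < r" "\<And>t. \<bar>t\<bar> < r \<Longrightarrow> p + t *\<^sub>R (\<omega>, 0) \<in> U" using line_in_U[OF p] by metis
  let ?l = "\<lambda>t. p + t *\<^sub>R (\<omega>, 0)"
  \<comment> \<open>\<open>k1\<close> and later \<open>k2\<close> are the first and second
    derivatives of \<open>kap\<close> along \<omega>. On \<open>U\<close> they agree with
    expressions in \<open>kg\<close> and \<open>hs\<close>, so both are C1 in (s, \<theta>), which
    is what \<open>dird_commute\<close> asks for.\<close>
  define k1 where "k1 = dird (\<omega>, 0) kap"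
  have d1: "((\<lambda>p. \<omega> \<bullet> kg p) has_derivative (\<lambda>v. \<omega> \<bullet> dird v kg x)) (at x)" if "x \<in> U" for x
    using C1_on_has_derivative[OF kg_C1 that] by (rule has_derivative_inner_right)
  have c1: "C1_on U (\<lambda>p. \<omega> \<bullet> kg p)"
    by (rule C1_onI[OF d1]) (auto intro!: continuous_intros C1_on_continuous_dird kg_C1)
  have k1: "C1_on U k1" "\<And>v x. x \<in> U \<Longrightarrow> dird v k1 x = \<omega> \<bullet> dird v kg x"
    using C1_on_cong[OF open_interior c1, of k1] dird_eq[OF d1] by (auto simp: k1_def dird_kap_s)
  define k2 where "k2 = dird (\<omega>, 0) k1"
  have bl: "bounded_linear (\<lambda>A. \<omega> \<bullet> (A *v \<omega>))"
    by (auto intro!: linear_conv_bounded_linear[THEN iffD1] linearI simp: matrix_vector_mult_add_rdistrib inner_add_right scaleR_matrix_vector_assoc[symmetric])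
  have d2: "((\<lambda>p. \<omega> \<bullet> (hs p *v \<omega>)) has_derivative (\<lambda>v. \<omega> \<bullet> (dird v hs x *v \<omega>))) (at x)" if "x \<in> U" for x
    using C1_on_has_derivative[OF hs_C1 that] by (rule bounded_linear.has_derivative[OF bl])
  have c2: "C1_on U (\<lambda>p. \<omega> \<bullet> (hs p *v \<omega>))"
    by (rule C1_onI[OF d2], assumption, rule bounded_linear.continuous_on[OF bl C1_on_continuous_dird[OF hs_C1]])
  have k2: "C1_on U k2" "\<And>v x. x \<in> U \<Longrightarrow> dird v k2 x = \<omega> \<bullet> (dird v hs x *v \<omega>)"
    using C1_on_cong[OF open_interior c2, of k2] dird_eq[OF d2] by (auto simp: k2_def k1 dird_kg_s)
  have shift: "(f has_vector_derivative D) (at t)" if "((\<lambda>k. f (t + k)) has_vector_derivative D) (at 0)" for f :: "real \<Rightarrow> real" and D t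
  proof -
    have "((\<lambda>k. f (t + k)) \<circ> (\<lambda>x. x - t) has_vector_derivative 1 *\<^sub>R D) (at t)"
      using that by (intro vector_diff_chain_at) (auto intro!: derivative_eq_intros)
    then show ?thesis by (simp add: o_def)
  qed
  have comm: "((\<lambda>t. dird w f (?l t)) has_vector_derivative dird w (dird (\<omega>, 0) f) (?l t)) (at t)"
    if f: "C1_on U f" "C1_on U (dird (\<omega>, 0) f)" and t: "\<bar>t\<bar> < r" for f :: "_ \<Rightarrow> real" and t
    by (rule shift) (use dird_commute[OF open_interior f r(2)[OF t], of w] in \<open>simp add: scaleR_add_left add.assoc\<close>)
  have hkg: "((\<lambda>t. c \<bullet> (kg (?l t) - kg p)) has_vector_derivative c \<bullet> (hs (?l t) *v \<omega>)) (at t)" if "\<bar>t\<bar> < r" for t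
  proof -
    have "((\<lambda>t. kg (?l t)) has_vector_derivative hs (?l t) *v \<omega>) (at t)"
      using C1_on_line[OF kg_C1 r(2)[OF that], unfolded dird_kg_s[OF r(2)[OF that]]] .
    then have "((\<lambda>t. kg (?l t) - kg p) has_vector_derivative hs (?l t) *v \<omega>) (at t)"
      using has_vector_derivative_diff[OF _ has_vector_derivative_const] by fastforce
    then show ?thesis by (rule bounded_linear.has_vector_derivative[OF bounded_linear_inner_right])
  qed
  have f': "((\<lambda>t. dird w kap (?l t) - dird w kap p + t * (c \<bullet> (kg (?l t) - kg p))) has_vector_derivative
      (dird w k1 (?l t) - 0 + (t * (c \<bullet> (hs (?l t) *v \<omega>)) + 1 * (c \<bullet> (kg (?l t) - kg p))))) (at t)" if t: "\<bar>t\<bar> < r" for t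
    using comm[OF kap_C1 _ t] k1(1) hkg[OF t]
    by (intro has_vector_derivative_add has_vector_derivative_diff has_vector_derivative_mult has_vector_derivative_const)
       (auto simp: k1_def)
  show ?thesis
  proof (rule tendsto_second_order[OF r(1) f'])
    have l1: "((\<lambda>t. dird w k1 (?l t) / t) \<longlongrightarrow> \<omega> \<bullet> (dird w hs p *v \<omega>)) (at 0)"
    proof (rule tendsto_div_at_0)
      show "((\<lambda>t. dird w k1 (?l t)) has_vector_derivative \<omega> \<bullet> (dird w hs p *v \<omega>)) (at 0)"
        using comm[OF k1(1) k2(1)[unfolded k2_def], of 0] k2(2)[OF p] r(1) p by (simp add: k2_def flip: zero_prod_def)
      show "dird w k1 (p + 0 *\<^sub>R (\<omega>, 0)) = 0" using p w by (simp add: k1 flip: zero_prod_def)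
    qed
    have l2: "((\<lambda>t. (c \<bullet> (kg (?l t) - kg p)) / t) \<longlongrightarrow> c \<bullet> (hs p *v \<omega>)) (at 0)"
      using hkg[of 0] r(1) by (intro tendsto_div_at_0) (auto simp flip: zero_prod_def)
    have "isCont (\<lambda>t. hs (?l t)) 0"
    proof -
      have "isCont hs (?l 0)" using C1_on_continuous[OF hs_C1] p by (simp add: continuous_on_eq_continuous_at flip: zero_prod_def)
      then show ?thesis by (intro isCont_o2[of 0 ?l hs] continuous_intros) auto
    qed
    then have "((\<lambda>t. hs (?l t)) \<longlongrightarrow> hs p) (at 0)" by (simp add: isCont_def flip: zero_prod_def)
    then have l3: "((\<lambda>t. c \<bullet> (hs (?l t) *v \<omega>)) \<longlongrightarrow> c \<bullet> (hs p *v \<omega>)) (at 0)"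
      by (intro tendsto_intros bounded_linear.tendsto[where f = "\<lambda>A. A *v \<omega>"])
         (auto intro!: linear_conv_bounded_linear[THEN iffD1] linearI simp: matrix_vector_mult_add_rdistrib scaleR_matrix_vector_assoc[symmetric])
    have "((\<lambda>t. dird w k1 (?l t) / t + (c \<bullet> (hs (?l t) *v \<omega>) + (c \<bullet> (kg (?l t) - kg p)) / t)) \<longlongrightarrow>
        \<omega> \<bullet> (dird w hs p *v \<omega>) + (c \<bullet> (hs p *v \<omega>) + c \<bullet> (hs p *v \<omega>))) (at 0)"
      by (intro tendsto_add l1 l2 l3)
    then have "((\<lambda>t. dird w k1 (?l t) / t + (c \<bullet> (hs (?l t) *v \<omega>) + (c \<bullet> (kg (?l t) - kg p)) / t)) \<longlongrightarrow> 0) (at 0)"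
      by (simp add: c)
    moreover have "\<forall>\<^sub>F t in at 0. dird w k1 (?l t) / t + (c \<bullet> (hs (?l t) *v \<omega>) + (c \<bullet> (kg (?l t) - kg p)) / t)
        = (dird w k1 (?l t) - 0 + (t * (c \<bullet> (hs (?l t) *v \<omega>)) + 1 * (c \<bullet> (kg (?l t) - kg p)))) / t"
      using eventually_neq_at_within[of "0::real" 0 UNIV] by eventually_elim (simp add: add_divide_distrib)
    ultimately show "((\<lambda>t. (dird w k1 (?l t) - 0 + (t * (c \<bullet> (hs (?l t) *v \<omega>)) + 1 * (c \<bullet> (kg (?l t) - kg p)))) / t) \<longlongrightarrow> 0) (at 0)"
      by (rule Lim_transform_eventually)
  next
    have z: "p + 0 *\<^sub>R (\<omega>, 0) = p" by (cases p) simp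
    show "dird w kap (?l 0) - dird w kap p + 0 * (c \<bullet> (kg (?l 0) - kg p)) = 0" unfolding z by simp
  qed
qed

text \<open>If the quadratic form were at most 0 in direction \<open>v\<close>, the squared modulus
  of the normalised transform at t v would be at least 1 - C t^3, by the second-order expansion
  continued to imaginary arguments. The decay condition, on the other hand, forces its
  \<open>n1\<close>-th power below 1 / (1 + \<beta> t^2). These are incompatible for small
  t.\<close>

lemma hs_pos_def:
  assumes p: "p \<in> U" and v: "v \<noteq> 0"
  shows "0 < v \<bullet> (hs p *v v)"
proof (rule ccontr)
  assume neg: "\<not> 0 < v \<bullet> (hs p *v v)"
  define \<alpha> where "\<alpha> = v \<bullet> (hs p *v v)"
  have \<alpha>: "\<alpha> \<le> 0" using neg by (simp add: \<alpha>_def)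
  obtain s \<theta> where ps: "p = (s, \<theta>)" by (cases p)
  have sU: "(s, \<theta>) \<in> U" using p ps by simp
  obtain r0 where r0: "0 < r0" "\<And>t. \<bar>t\<bar> < r0 \<Longrightarrow> p + t *\<^sub>R (v, 0) \<in> U" using line_in_U[OF p] by metis
  define r where "r = r0 / 2"
  have r: "0 < r" "\<And>t. \<bar>t\<bar> \<le> r \<Longrightarrow> (s + t *\<^sub>R v, \<theta>) \<in> U" using r0 by (auto simp: r_def ps)
  define m where "m = mgf s \<theta>"
  have m: "0 < m" using mgf_pos[OF sU] by (simp add: m_def)
  define h where "h \<zeta> = M0 P Y (cvec (s + Re \<zeta> *\<^sub>R v) (0 + Im \<zeta> *\<^sub>R v)) \<theta> / of_real m" for \<zeta>
  have hh: "h holomorphic_on ball 0 r"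
    unfolding h_def using m by (intro holomorphic_intros M0_holomorphic r) auto
  \<comment> \<open>The product h \<zeta> h (- \<zeta>) is even, so its expansion has no linear term
    whatever the mean is; at imaginary \<zeta> it is the squared modulus of h. On the real axis it
    is \<open>q\<close>, the exponential of a second difference of \<open>kap\<close>.\<close>
  define F where "F \<zeta> = h \<zeta> * h (- \<zeta>) - 1 - of_real \<alpha> * \<zeta>\<^sup>2" for \<zeta>
  have "(h \<circ> uminus) holomorphic_on ball 0 r"
    by (rule holomorphic_on_compose_gen[OF _ hh]) (auto intro!: holomorphic_intros)
  then have hF: "F holomorphic_on ball 0 r"
    unfolding F_def using hh by (intro holomorphic_intros) (auto simp: o_def)
  have hr: "h (of_real t) = of_real (mgf (s + t *\<^sub>R v) \<theta> / m)" if "\<bar>t\<bar> \<le> r" for t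
    using M0_real[OF r(2)[OF that]] by (simp add: h_def)
  define q where "q t = mgf (s + t *\<^sub>R v) \<theta> * mgf (s + (- t) *\<^sub>R v) \<theta> / m\<^sup>2" for t
  have Fr: "F (of_real t) = of_real (q t - 1 - \<alpha> * t\<^sup>2)" if "\<bar>t\<bar> \<le> r" for t
  proof -
    have "h (- of_real t) = of_real (mgf (s + (- t) *\<^sub>R v) \<theta> / m)" using hr[of "- t"] that by simp
    then show ?thesis using hr[OF that] by (simp add: F_def q_def power2_eq_square)
  qed
  let ?g = "\<lambda>t. v \<bullet> kg (p + t *\<^sub>R (v, 0)) - v \<bullet> kg (p + (- t) *\<^sub>R (v, 0))"
  have qe: "q t = exp (kap (p + t *\<^sub>R (v, 0)) + kap (p + (- t) *\<^sub>R (v, 0)) - 2 * kap p)" if "\<bar>t\<bar> \<le> r" for t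
  proof -
    have U: "(s + t *\<^sub>R v, \<theta>) \<in> U" "(s + (- t) *\<^sub>R v, \<theta>) \<in> U" using r(2)[of t] r(2)[of "- t"] that by auto
    have e: "exp (kap x) = mgf (fst x) (snd x)" if "x \<in> U" for x
      using Mr_pos[OF that] by (simp add: kap_def Mr_Nil[OF that])
    have "exp (2 * kap p) = m\<^sup>2" using e[OF p] by (simp add: m_def ps exp_double)
    then show ?thesis using e[OF U(1)] e[OF U(2)] by (simp add: q_def exp_add exp_diff ps)
  qed
  have line: "((\<lambda>t. kap (p + (\<sigma> * t) *\<^sub>R (v, 0))) has_vector_derivative \<sigma> * (v \<bullet> kg (p + (\<sigma> * t) *\<^sub>R (v, 0)))) (at t)"
    if "\<bar>t\<bar> < r" "\<bar>\<sigma>\<bar> = 1" for t \<sigma>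
  proof -
    have U: "p + (\<sigma> * t) *\<^sub>R (v, 0) \<in> U" using r(2)[of "\<sigma> * t"] that by (simp add: ps abs_mult)
    have "((\<lambda>t. kap (p + t *\<^sub>R (v, 0))) \<circ> (\<lambda>t. \<sigma> * t) has_vector_derivative \<sigma> *\<^sub>R (v \<bullet> kg (p + (\<sigma> * t) *\<^sub>R (v, 0)))) (at t)"
      using C1_on_line[OF kap_C1 U, unfolded dird_kap_s[OF U]] by (intro vector_diff_chain_at) (auto intro!: derivative_eq_intros)
    then show ?thesis by (simp add: o_def)
  qed
  have qd: "(q has_vector_derivative ?g t * q t) (at t)" if t: "\<bar>t\<bar> < r" for t
  proof -
    have "((\<lambda>t. kap (p + t *\<^sub>R (v, 0)) + kap (p + (- t) *\<^sub>R (v, 0)) - 2 * kap p) has_vector_derivative ?g t + 0 - 0) (at t)"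
      using line[of t 1] line[of t "- 1"] t
      by (intro has_vector_derivative_diff has_vector_derivative_const)
         (auto dest: has_vector_derivative_add[rotated])
    then have "((\<lambda>t. kap (p + t *\<^sub>R (v, 0)) + kap (p + (- t) *\<^sub>R (v, 0)) - 2 * kap p) has_real_derivative ?g t) (at t)"
      by (simp add: has_real_derivative_iff_has_vector_derivative)
    from DERIV_chain2[OF DERIV_exp this]
    have "((\<lambda>t. exp (kap (p + t *\<^sub>R (v, 0)) + kap (p + (- t) *\<^sub>R (v, 0)) - 2 * kap p)) has_vector_derivative q t * ?g t) (at t)"
      using qe[of t] t by (simp add: has_real_derivative_iff_has_vector_derivative)
    then have "(q has_vector_derivative q t * ?g t) (at t)"
      by (rule has_vector_derivative_transform_within_open[where S = "{- r<..<r}"]) (use t qe in auto)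
    then show ?thesis by (simp add: mult.commute)
  qed
  have gl: "((\<lambda>t. ?g t / t) \<longlongrightarrow> 2 * \<alpha>) (at 0)"
  proof -
    have k: "((\<lambda>t. v \<bullet> kg (p + t *\<^sub>R (v, 0))) has_vector_derivative \<alpha>) (at 0)"
      using bounded_linear.has_vector_derivative[OF bounded_linear_inner_right C1_on_line[OF kg_C1, of p 0 "(v, 0)"], of v] p
      by (simp add: dird_kg_s \<alpha>_def flip: zero_prod_def)
    have "((\<lambda>t. v \<bullet> kg (p + t *\<^sub>R (v, 0))) \<circ> uminus has_vector_derivative (- 1) *\<^sub>R \<alpha>) (at 0)"
      using k by (intro vector_diff_chain_at) (auto intro!: derivative_eq_intros)
    from has_vector_derivative_diff[OF k this] have "(?g has_vector_derivative 2 * \<alpha>) (at 0)"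
      by (simp add: o_def)
    then show ?thesis by (rule tendsto_div_at_0) simp
  qed
  have q0: "q 0 = 1" using m by (simp add: q_def m_def power2_eq_square)
  have "((\<lambda>t. (q t - 1 - \<alpha> * t\<^sup>2) / t\<^sup>2) \<longlongrightarrow> 0) (at 0)"
  proof (rule tendsto_second_order[OF r(1)])
    fix t assume "\<bar>t\<bar> < r"
    from qd[OF this] have "(q has_real_derivative ?g t * q t) (at t)"
      by (simp add: has_real_derivative_iff_has_vector_derivative)
    then have "((\<lambda>t. q t - 1 - \<alpha> * t\<^sup>2) has_real_derivative (?g t * q t - 2 * \<alpha> * t)) (at t)"
      by (auto intro!: derivative_eq_intros)
    then show "((\<lambda>t. q t - 1 - \<alpha> * t\<^sup>2) has_vector_derivative (?g t * q t - 2 * \<alpha> * t)) (at t)"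
      by (simp add: has_real_derivative_iff_has_vector_derivative)
  next
    have "isCont q 0" by (rule has_vector_derivative_continuous[OF qd]) (use r(1) in simp)
    then have "(q \<longlongrightarrow> 1) (at 0)" using q0 by (simp add: isCont_def)
    then have "((\<lambda>t. ?g t / t * q t - 2 * \<alpha>) \<longlongrightarrow> 2 * \<alpha> * 1 - 2 * \<alpha>) (at 0)"
      by (intro tendsto_intros gl)
    moreover have "\<forall>\<^sub>F t in at 0. ?g t / t * q t - 2 * \<alpha> = (?g t * q t - 2 * \<alpha> * t) / t"
      using eventually_neq_at_within[of "0::real" 0 UNIV] by eventually_elim (simp add: field_simps)
    ultimately show "((\<lambda>t. (?g t * q t - 2 * \<alpha> * t) / t) \<longlongrightarrow> 0) (at 0)"
      by simp (rule Lim_transform_eventually)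
  qed (simp add: q0)
  then have "((\<lambda>t. complex_of_real ((q t - 1 - \<alpha> * t\<^sup>2) / t\<^sup>2)) \<longlongrightarrow> of_real 0) (at 0)"
    by (intro tendsto_of_real)
  moreover have "\<forall>\<^sub>F t in at 0. complex_of_real ((q t - 1 - \<alpha> * t\<^sup>2) / t\<^sup>2) = F (of_real t) / of_real t ^ 2"
  proof -
    have "\<forall>\<^sub>F t::real in at 0. t \<in> {- r<..<r}" using r(1) by (intro eventually_at_in_open') auto
    then show ?thesis
    proof eventually_elim
      case (elim t)
      then have "F (of_real t) = of_real (q t - 1 - \<alpha> * t\<^sup>2)" by (intro Fr) auto
      then show ?case by (simp only: of_real_divide of_real_power)
    qed
  qed
  ultimately have lim: "((\<lambda>t::real. F (of_real t) / of_real t ^ 2) \<longlongrightarrow> 0) (at 0)"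
    unfolding of_real_0 by (rule Lim_transform_eventually)
  have r2: "0 < r / 2" "r / 2 < r" using r(1) by auto
  have "compact (F ` cball 0 (r / 2))"
    using r2 by (intro compact_continuous_image continuous_on_subset[OF holomorphic_on_imp_continuous_on[OF hF]]) auto
  then obtain S where S: "\<And>z. norm z \<le> r / 2 \<Longrightarrow> norm (F z) \<le> S"
    using compact_imp_bounded by (fastforce simp: bounded_iff)
  define C where "C = \<bar>S\<bar> / (r / 2) ^ 3"
  have S': "norm (F z) \<le> \<bar>S\<bar>" if "norm z < r / 2" for z
    using S[of z] that by linarith
  have FC: "norm (F z) \<le> C * norm z ^ 3" if "norm z < r / 2" for z
  proof -
    have "norm (F z) \<le> \<bar>S\<bar> / (r / 2) ^ Suc 2 * norm z ^ Suc 2"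
      by (rule holomorphic_order_bound[OF _ _ r2(1) lim that])
         (use hF r2 S' in \<open>auto intro: holomorphic_on_subset\<close>)
    then show ?thesis by (simp add: C_def eval_nat_numeral)
  qed
  have C0: "0 \<le> C" using r2 by (simp add: C_def)
  obtain c n1 where c: "0 < c" "1 \<le> n1"
    "\<And>n s \<theta> \<phi>. n1 \<le> n \<Longrightarrow> (s, \<theta>) \<in> {p} \<Longrightarrow> norm (M0 P Y (cvec s \<phi>) \<theta> / of_real (mgf s \<theta>)) ^ n \<le> 1 / (1 + c * real n * (norm \<phi>)\<^sup>2) ^ 1"
    using M0_decay[of "{p}" 1] p by auto
  define \<beta> where "\<beta> = c * real n1 * (norm v)\<^sup>2"
  have \<beta>: "0 < \<beta>" using c v by (simp add: \<beta>_def)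
  define C' where "C' = C * real n1"
  have C': "0 \<le> C'" using C0 by (simp add: C'_def)
  \<comment> \<open>Bernoulli raises the lower bound to the power \<open>n1\<close>; comparing it
    with the decay bound and cancelling t^2 leaves an inequality whose right side tends to 0 with
    t.\<close>
  have key: "\<beta> \<le> C' * t * (1 + \<beta>)" if t: "0 < t" "t < r / 2" "t \<le> 1" "C * t ^ 3 \<le> 1" for t
  proof -
    let ?x = "norm (h (\<i> * of_real t))"
    have "h (- (\<i> * of_real t)) = cnj (h (\<i> * of_real t))"
      using M0_cnj[OF sU, of "t *\<^sub>R v"] by (simp add: h_def)
    then have "h (\<i> * of_real t) * h (- (\<i> * of_real t)) = of_real (?x\<^sup>2)"
      by (simp only: complex_norm_square)
    then have "F (\<i> * of_real t) = of_real (?x\<^sup>2 - 1 + \<alpha> * t\<^sup>2)"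
      by (simp add: F_def power_mult_distrib)
    then have "\<bar>?x\<^sup>2 - 1 + \<alpha> * t\<^sup>2\<bar> \<le> C * t ^ 3"
      using FC[of "\<i> * of_real t"] t by (simp add: norm_mult del: of_real_diff of_real_add)
    moreover have "\<alpha> * t\<^sup>2 \<le> 0" using \<alpha> by (simp add: mult_nonpos_nonneg)
    ultimately have lo: "1 - C * t ^ 3 \<le> ?x\<^sup>2" by linarith
    have hx: "?x ^ n1 \<le> 1 / (1 + \<beta> * t\<^sup>2)"
      using c(3)[of n1 s \<theta> "t *\<^sub>R v"] by (simp add: h_def m_def ps \<beta>_def power_mult_distrib mult_ac)
    have b1: "1 \<le> 1 + \<beta> * t\<^sup>2" using \<beta> by simp
    have hx1: "?x ^ n1 \<le> 1" using hx b1 by (smt (verit) divide_le_eq_1)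
    have "1 - C' * t ^ 3 \<le> 1 + real n1 * (- (C * t ^ 3))" by (simp add: C'_def)
    also have "\<dots> \<le> (1 + - (C * t ^ 3)) ^ n1" using t by (intro Bernoulli_inequality) auto
    also have "\<dots> \<le> (?x\<^sup>2) ^ n1" using lo t by (intro power_mono) auto
    also have "\<dots> = ?x ^ n1 * ?x ^ n1" by (simp add: power2_eq_square power_mult_distrib)
    also have "\<dots> \<le> 1 * (1 / (1 + \<beta> * t\<^sup>2))" using hx hx1 by (intro mult_mono) auto
    finally have "(1 - C' * t ^ 3) * (1 + \<beta> * t\<^sup>2) \<le> 1" using b1 by (simp add: le_divide_eq)
    then have "\<beta> * t\<^sup>2 \<le> C' * t ^ 3 * (1 + \<beta> * t\<^sup>2)" by (simp add: algebra_simps)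
    also have "\<dots> \<le> C' * t ^ 3 * (1 + \<beta> * 1)"
      using C' t \<beta> by (intro mult_left_mono add_mono mult_left_mono power_le_one) auto
    finally have "\<beta> * t\<^sup>2 \<le> (C' * t * (1 + \<beta>)) * t\<^sup>2" by (simp add: power3_eq_cube power2_eq_square mult_ac)
    then show ?thesis using t by simp
  qed
  \<comment> \<open>The first three entries meet the side conditions of \<open>key\<close>; the last
    pushes its right side to at most \<beta> / 2. Adding 1 to C and C' avoids division by 0.\<close>
  define t where "t = Min {r / 4, 1, 1 / (C + 1), \<beta> / (2 * (C' + 1) * (1 + \<beta>))}"
  have tle: "t \<le> r / 4" "t \<le> 1" "t \<le> 1 / (C + 1)" "t \<le> \<beta> / (2 * (C' + 1) * (1 + \<beta>))"
    unfolding t_def by (rule Min_le; blast)+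
  have t0: "0 < t" unfolding t_def using r(1) C0 C' \<beta> by (subst Min_gr_iff) (auto intro!: divide_pos_pos mult_pos_pos add_nonneg_pos)
  have "C * t ^ 3 \<le> C * t"
  proof -
    have "t ^ 3 \<le> t" using power_decreasing[of 1 3 t] t0 tle(2) by simp
    then show ?thesis using C0 by (rule mult_left_mono)
  qed
  also have "C * t \<le> C * (1 / (C + 1))" using tle(3) C0 by (rule mult_left_mono)
  also have "\<dots> \<le> 1" using C0 by simp
  finally have "\<beta> \<le> C' * t * (1 + \<beta>)" using key[of t] t0 tle r(1) by auto
  also have "\<dots> \<le> (C' + 1) * t * (1 + \<beta>)" using t0 \<beta> by (intro mult_right_mono) auto
  also have "\<dots> \<le> (C' + 1) * (\<beta> / (2 * (C' + 1) * (1 + \<beta>))) * (1 + \<beta>)"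
    using tle(4) C' \<beta> by (intro mult_right_mono mult_left_mono) auto
  also have "\<dots> = \<beta> / 2"
  proof -
    have "C' + 1 \<noteq> 0" "1 + \<beta> \<noteq> 0" using C' \<beta> by auto
    then show ?thesis by (simp add: divide_simps)
  qed
  finally show False using \<beta> by simp
qed

end

subsection \<open>The saddlepoint likelihood\<close>

text \<open>Positivity of the form makes a matrix injective, and it persists on the segment from the
  identity to \<open>A\<close>. Hence the determinant has no zero there, and by the intermediate
  value theorem it keeps the sign it has at the identity.\<close>

lemma pos_def_invertible:
  fixes A :: "real^'n^'n"
  assumes "\<And>v. v \<noteq> 0 \<Longrightarrow> 0 < v \<bullet> (A *v v)"
  shows "invertible A" and "0 < det A"
proof -
  have inj: "invertible B" if "\<And>v. v \<noteq> 0 \<Longrightarrow> 0 < v \<bullet> (B *v v)" for B :: "real^'n^'n"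
  proof -
    have "inj ((*v) B)"
      unfolding linear_injective_0[OF matrix_vector_mul_linear]
      using that by (metis inner_zero_right less_irrefl)
    then show ?thesis using matrix_left_invertible_injective invertible_left_inverse by blast
  qed
  show "invertible A" by (rule inj[OF assms])
  let ?B = "\<lambda>t::real. (1 - t) *\<^sub>R mat 1 + t *\<^sub>R A"
  have nz: "det (?B t) \<noteq> 0" if "0 \<le> t" "t \<le> 1" for t
  proof -
    have "0 < v \<bullet> (?B t *v v)" if "v \<noteq> 0" for v
    proof -
      have "v \<bullet> (?B t *v v) = (1 - t) * (v \<bullet> v) + t * (v \<bullet> (A *v v))"
        by (simp add: matrix_vector_mult_add_rdistrib scaleR_matrix_vector_assoc[symmetric] inner_add_right)
      moreover have "0 < v \<bullet> v" "0 < v \<bullet> (A *v v)" using assms that by auto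
      ultimately show ?thesis using \<open>0 \<le> t\<close> \<open>t \<le> 1\<close>
        by (cases "t = 0") (auto intro: add_nonneg_pos)
    qed
    then show ?thesis using inj invertible_det_nz by blast
  qed
  have cont: "continuous_on {0..1} (\<lambda>t. det (?B t))"
    unfolding det_def by (intro continuous_intros)
  show "0 < det A"
  proof (rule ccontr)
    assume "\<not> 0 < det A"
    then have "det (?B 1) \<le> 0" "0 \<le> det (?B 0)" by auto
    from IVT2'[of "\<lambda>t. det (?B t)" 1 0 0, OF this _ cont] obtain t where "0 \<le> t" "t \<le> 1" "det (?B t) = 0" by auto
    with nz show False by blast
  qed
qed

lemma det_scaleR: "det (c *\<^sub>R (A::real^'n^'n)) = c ^ CARD('n) * det A"
proof -
  have "c *\<^sub>R A = (\<chi> i. c *s (A $ i))" by (simp add: vec_eq_iff)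
  then show ?thesis by (simp only: det_rows_mul) simp
qed

context saddle_model
begin

text \<open>Along the segment joining two points with the same \<theta>, the component of
  \<open>kg\<close> in the direction of the segment has positive derivative by
  \<open>hs_pos_def\<close>, so its end values differ.\<close>

lemma kg_inj:
  assumes "(s1, \<theta>) \<in> U" "(s2, \<theta>) \<in> U" "kg (s1, \<theta>) = kg (s2, \<theta>)"
  shows "s1 = s2"
proof (rule ccontr)
  assume ne: "s1 \<noteq> s2"
  define v where "v = s2 - s1"
  have v: "v \<noteq> 0" using ne by (simp add: v_def)
  have inU: "(s1, \<theta>) + t *\<^sub>R (v, 0) \<in> U" if "0 \<le> t" "t \<le> 1" for t
  proof -
    have "(1 - t) *\<^sub>R s1 + t *\<^sub>R s2 = s1 + t *\<^sub>R v" by (simp add: v_def algebra_simps)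
    then show ?thesis using U_convex[OF assms(1,2) that] by simp
  qed
  let ?g = "\<lambda>t. v \<bullet> kg ((s1, \<theta>) + t *\<^sub>R (v, 0))"
  have "?g 0 < ?g 1"
  proof (rule DERIV_pos_imp_increasing[OF zero_less_one])
    fix t :: real assume t: "0 \<le> t" "t \<le> 1"
    note l = C1_on_line[OF kg_C1 inU[OF t], unfolded dird_kg_s[OF inU[OF t]]]
    have "(?g has_vector_derivative v \<bullet> (hs ((s1, \<theta>) + t *\<^sub>R (v, 0)) *v v)) (at t)"
      by (rule bounded_linear.has_vector_derivative[OF bounded_linear_inner_right l])
    then show "\<exists>y. DERIV ?g t :> y \<and> 0 < y"
      using hs_pos_def[OF inU[OF t] v] by (auto simp: has_real_derivative_iff_has_vector_derivative)
  qed
  then show False using assms(3) by (simp add: v_def)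
qed

text \<open>Carrying \<theta> along turns the saddlepoint equation into the inversion of a map
  between spaces of equal dimension. Invariance of domain and the inverse function theorem then
  treat y and \<theta> together.\<close>

definition Phi :: "(real ^ 'd) \<times> (real ^ 'p) \<Rightarrow> (real ^ 'd) \<times> (real ^ 'p)" where
  "Phi p = (kg p, snd p)"

definition Psi :: "(real ^ 'd) \<times> (real ^ 'p) \<Rightarrow> (real ^ 'd) \<times> (real ^ 'p)" where
  "Psi q = (s_hat R P Y (snd q) (fst q), snd q)"

lemma is_saddlepoint_iff: "is_saddlepoint R P Y \<theta> y s \<longleftrightarrow> (s, \<theta>) \<in> U \<and> kg (s, \<theta>) = y"
  unfolding is_saddlepoint_def using K0_grad_kg by auto

lemma s_hat_eq: "(s, \<theta>) \<in> U \<Longrightarrow> s_hat R P Y \<theta> (kg (s, \<theta>)) = s"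
  unfolding s_hat_def is_saddlepoint_iff by (rule the_equality) (auto dest: kg_inj)

lemma Psi_Phi: "p \<in> U \<Longrightarrow> Psi (Phi p) = p"
  by (cases p) (simp add: Psi_def Phi_def s_hat_eq)

lemma Y_open_eq: "Y_open R P Y = Phi ` U"
  unfolding Y_open_def is_saddlepoint_iff by (force simp: Phi_def image_iff)

lemma Phi_continuous: "continuous_on U Phi"
  unfolding Phi_def[abs_def] by (intro continuous_intros C1_on_continuous kg_C1)

lemma Phi_inj: "inj_on Phi U"
  by (metis Psi_Phi inj_onI)

text \<open>\<open>Phi\<close> is continuous and injective between spaces of equal dimension.
  Openness is what lets the saddlepoint persist when \<theta> moves and y is held fixed.\<close>

lemma Y_open_open: "open (Y_open R P Y)"
  unfolding Y_open_eq by (rule invariance_of_domain[OF Phi_continuous open_interior Phi_inj])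

lemma Psi_in_U: "q \<in> Y_open R P Y \<Longrightarrow> Psi q \<in> U"
  unfolding Y_open_eq by (auto simp: Psi_Phi)

lemma Phi_Psi: "q \<in> Y_open R P Y \<Longrightarrow> Phi (Psi q) = q"
  unfolding Y_open_eq by (auto simp: Psi_Phi)

lemma Psi_continuous: "continuous_on (Y_open R P Y) Psi"
proof -
  obtain g where g: "homeomorphism U (Phi ` U) Phi g"
    by (rule invariance_of_domain_homeomorphism[OF open_interior Phi_continuous order_refl Phi_inj])
  have "continuous_on (Phi ` U) g" using g by (simp add: homeomorphism_def)
  then show ?thesis unfolding Y_open_eq
    by (rule continuous_on_eq) (use g in \<open>auto simp: homeomorphism_def Psi_Phi\<close>)
qed

definition hinv :: "(real ^ 'd) \<times> (real ^ 'p) \<Rightarrow> real ^ 'd ^ 'd" where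
  "hinv p = (SOME B. hs p ** B = mat 1 \<and> B ** hs p = mat 1)"

lemma hinv: "p \<in> U \<Longrightarrow> hs p ** hinv p = mat 1" "p \<in> U \<Longrightarrow> hinv p ** hs p = mat 1"
proof -
  have *: "hs p ** hinv p = mat 1 \<and> hinv p ** hs p = mat 1" if "p \<in> U"
    unfolding hinv_def
    by (rule someI_ex) (use pos_def_invertible(1)[OF hs_pos_def[OF that]] in \<open>simp add: invertible_def\<close>)
  then show "p \<in> U \<Longrightarrow> hs p ** hinv p = mat 1" "p \<in> U \<Longrightarrow> hinv p ** hs p = mat 1" by auto
qed

lemma hs_hinv_apply: "p \<in> U \<Longrightarrow> hs p *v (hinv p *v x) = x"
  by (simp add: matrix_vector_mul_assoc hinv)

lemma det_hs_pos: "p \<in> U \<Longrightarrow> 0 < det (hs p)"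
  by (rule pos_def_invertible(2)[OF hs_pos_def])

text \<open>
  The derivative of the saddlepoint in direction \<open>e\<close>, from differentiating \<open>kg (s_hat \<theta> y, \<theta>) = y\<close>.
\<close>

definition sa :: "(real ^ 'd) \<times> (real ^ 'p) \<Rightarrow> real ^ 'p \<Rightarrow> real ^ 'd" where
  "sa p e = - (hinv p *v dird (0, e) kg p)"

lemma dird_add: "C1_on S f \<Longrightarrow> p \<in> S \<Longrightarrow> dird (v + w) f p = dird v f p + dird w f p"
  using linear_add[OF C1_on_linear_dird] by blast

lemma dird_sa_kg: "p \<in> U \<Longrightarrow> dird (sa p e, e) kg p = 0"
proof -
  assume p: "p \<in> U"
  have "dird (sa p e, e) kg p = dird ((sa p e, 0) + (0, e)) kg p" by simp
  also have "\<dots> = dird (sa p e, 0) kg p + dird (0, e) kg p" by (rule dird_add[OF kg_C1 p])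
  also have "\<dots> = 0" by (simp add: dird_kg_s p sa_def hs_hinv_apply linear_neg[OF matrix_vector_mul_linear])
  finally show ?thesis .
qed

lemma dird_sa_kap: "p \<in> U \<Longrightarrow> dird (sa p e, e) kap p = sa p e \<bullet> kg p + dird (0, e) kap p"
  using dird_add[OF kap_C1, of p "(sa p e, 0)" "(0, e)"] by (simp add: dird_kap_s)

text \<open>The derivative of \<open>Phi\<close> is block triangular, with the invertible Hessian in
  one block and the identity in the other, so its right inverse can be written down: the given
  s-component solves c = hs a + D_e kg for a.\<close>

lemma Psi_has_derivative:
  assumes p: "p \<in> U"
  shows "(Psi has_derivative (\<lambda>(c, e). (hinv p *v (c - dird (0, e) kg p), e))) (at (Phi p))"
proof (rule has_derivative_inverse_strong[OF open_interior p Phi_continuous Psi_Phi])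
  show "(Phi has_derivative (\<lambda>v. (dird v kg p, snd v))) (at p)"
    unfolding Phi_def[abs_def] by (intro has_derivative_Pair C1_on_has_derivative[OF kg_C1 p] has_derivative_snd has_derivative_ident)
  show "(\<lambda>v. (dird v kg p, snd v)) \<circ> (\<lambda>(c, e). (hinv p *v (c - dird (0, e) kg p), e)) = id"
  proof
    fix q :: "(real ^ 'd) \<times> (real ^ 'p)"
    obtain c e where q: "q = (c, e)" by (cases q)
    have "dird (hinv p *v (c - dird (0, e) kg p), e) kg p
      = dird ((hinv p *v (c - dird (0, e) kg p), 0) + (0, e)) kg p" by simp
    also have "\<dots> = dird (hinv p *v (c - dird (0, e) kg p), 0) kg p + dird (0, e) kg p"
      by (rule dird_add[OF kg_C1 p])
    also have "\<dots> = c" by (simp add: dird_kg_s p hs_hinv_apply)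
    finally show "((\<lambda>v. (dird v kg p, snd v)) \<circ> (\<lambda>(c, e). (hinv p *v (c - dird (0, e) kg p), e))) q = id q"
      by (simp add: q)
  qed
qed auto

lemma saddle_path_has_derivative:
  assumes p: "(s, \<theta>) \<in> U"
  shows "((\<lambda>u. (s_hat R P Y u (kg (s, \<theta>)), u)) has_derivative (\<lambda>e. (sa (s, \<theta>) e, e))) (at \<theta>)"
proof -
  have "((\<lambda>u. Psi (kg (s, \<theta>), u)) has_derivative (\<lambda>e. (\<lambda>(c, e). (hinv (s, \<theta>) *v (c - dird (0, e) kg (s, \<theta>)), e)) (0, e))) (at \<theta>)"
    using Psi_has_derivative[OF p] unfolding Phi_def
    by (intro has_derivative_compose[of "\<lambda>u. (kg (s, \<theta>), u)" "\<lambda>e. (0, e)" \<theta> UNIV Psi]) (auto intro!: derivative_eq_intros)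
  then show ?thesis by (simp add: Psi_def sa_def linear_neg[OF matrix_vector_mul_linear] linear_diff[OF matrix_vector_mul_linear] linear_0[OF matrix_vector_mul_linear])
qed

text \<open>
  The derivative of the saddlepoint log-likelihood in direction \<open>e\<close> with \<open>y\<close> fixed; the trace comes
  from the logarithm of the determinant.
\<close>

definition sdl :: "(real ^ 'd) \<times> (real ^ 'p) \<Rightarrow> nat \<Rightarrow> real ^ 'p \<Rightarrow> real" where
  "sdl p n e = real n * dird (0, e) kap p - trace (hinv p ** dird (sa p e, e) hs p) / 2"

lemma saddle_lik_eq:
  assumes "(s, u) \<in> U" "kg (s, u) = y" "1 \<le> n"
  shows "0 < saddle_lik R P Y n u (real n *\<^sub>R y)"
    and "ln (saddle_lik R P Y n u (real n *\<^sub>R y)) = real n * (kap (s, u) - s \<bullet> y)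
      - (ln ((2 * pi * real n) ^ CARD('d)) + ln (det (hs (s, u)))) / 2"
proof -
  have y: "(real n *\<^sub>R y) /\<^sub>R real n = y" using assms(3) by simp
  have sh: "s_hat R P Y u y = s" using s_hat_eq[OF assms(1)] assms(2) by simp
  let ?D = "det ((2 * pi * real n) *\<^sub>R hs (s, u))"
  have e: "saddle_lik R P Y n u (real n *\<^sub>R y) = exp (real n * (kap (s, u) - s \<bullet> y)) / sqrt ?D"
    unfolding saddle_lik_def Let_def y sh K0_kap K0_hess_hs[OF assms(1)] ..
  have c: "0 < (2 * pi * real n) ^ CARD('d)" using assms(3) by simp
  have D: "0 < ?D" unfolding det_scaleR using c det_hs_pos[OF assms(1)] by (rule mult_pos_pos)
  show "0 < saddle_lik R P Y n u (real n *\<^sub>R y)" unfolding e using D by simp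
  have "ln (exp (real n * (kap (s, u) - s \<bullet> y)) / sqrt ?D) = real n * (kap (s, u) - s \<bullet> y) - ln ?D / 2"
    using D by (simp add: ln_div ln_sqrt)
  also have "ln ?D = ln ((2 * pi * real n) ^ CARD('d)) + ln (det (hs (s, u)))"
    unfolding det_scaleR by (rule ln_mult_pos[OF c det_hs_pos[OF assms(1)]])
  finally show "ln (saddle_lik R P Y n u (real n *\<^sub>R y)) = real n * (kap (s, u) - s \<bullet> y)
      - (ln ((2 * pi * real n) ^ CARD('d)) + ln (det (hs (s, u)))) / 2" unfolding e .
qed

lemma saddle_nbhd:
  assumes p: "(s, \<theta>) \<in> U"
  shows "\<forall>\<^sub>F u in nhds \<theta>. (kg (s, \<theta>), u) \<in> Y_open R P Y"
proof -
  have "(kg (s, \<theta>), \<theta>) \<in> Y_open R P Y" using p by (force simp: Y_open_eq Phi_def)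
  moreover have "open ((\<lambda>u. (kg (s, \<theta>), u)) -` Y_open R P Y)"
    by (intro open_vimage Y_open_open continuous_intros)
  ultimately show ?thesis by (intro eventually_nhds[THEN iffD2]) (auto intro!: exI[of _ "(\<lambda>u. (kg (s, \<theta>), u)) -` Y_open R P Y"])
qed

lemma Psi_saddle:
  assumes "(y, u) \<in> Y_open R P Y"
  shows "(s_hat R P Y u y, u) \<in> U" "kg (s_hat R P Y u y, u) = y"
  using Psi_in_U[OF assms] Phi_Psi[OF assms] by (auto simp: Psi_def Phi_def)

text \<open>The exponent is stationary in s at the saddlepoint, since there \<open>kg\<close> equals
  y; so the motion of the saddlepoint drops out and only the \<theta>-derivative of
  \<open>kap\<close> remains. In the determinant the motion does count and enters through Jacobi's
  formula.\<close>

lemma saddle_lik_has_derivative: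
  assumes p: "(s, \<theta>) \<in> U" and n: "1 \<le> n"
  shows "((\<lambda>u. ln (saddle_lik R P Y n u (real n *\<^sub>R kg (s, \<theta>)))) has_derivative sdl (s, \<theta>) n) (at \<theta>)"
    and "log_saddle_lik_grad_exists R P Y n \<theta> (real n *\<^sub>R kg (s, \<theta>))"
proof -
  let ?y = "kg (s, \<theta>)" and ?p = "(s, \<theta>)"
  let ?sh = "\<lambda>u. s_hat R P Y u ?y"
  let ?q = "\<lambda>u. (?sh u, u)"
  have q\<theta>: "?q \<theta> = ?p" using s_hat_eq[OF p] by simp
  have dq: "(?q has_derivative (\<lambda>e. (sa ?p e, e))) (at \<theta>)" by (rule saddle_path_has_derivative[OF p])
  have ds: "(?sh has_derivative sa ?p) (at \<theta>)"
    using has_derivative_fst[OF dq] by simp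
  have dk: "((\<lambda>u. kap (?q u)) has_derivative (\<lambda>e. dird (sa ?p e, e) kap ?p)) (at \<theta>)"
    by (rule has_derivative_compose[OF dq]) (simp only: q\<theta> C1_on_has_derivative[OF kap_C1 p])
  have dh: "((\<lambda>u. hs (?q u)) has_derivative (\<lambda>e. dird (sa ?p e, e) hs ?p)) (at \<theta>)"
    by (rule has_derivative_compose[OF dq]) (simp only: q\<theta> C1_on_has_derivative[OF hs_C1 p])
  obtain d where d: "(det has_derivative d) (at (hs ?p))" using det_has_derivative by blast
  have "((\<lambda>u. det (hs (?q u))) has_derivative (\<lambda>e. d (dird (sa ?p e, e) hs ?p))) (at \<theta>)"
    by (rule has_derivative_compose[OF dh]) (simp only: q\<theta> d)
  then have dd: "((\<lambda>u. det (hs (?q u))) has_derivative (\<lambda>e. det (hs ?p) * trace (hinv ?p ** dird (sa ?p e, e) hs ?p))) (at \<theta>)"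
    by (simp only: det_has_derivative_trace[OF hinv(1)[OF p] d])
  have dl: "((\<lambda>u. ln (det (hs (?q u)))) has_derivative (\<lambda>e. trace (hinv ?p ** dird (sa ?p e, e) hs ?p))) (at \<theta>)"
    using has_derivative_ln[OF _ dd] det_hs_pos[OF p] unfolding q\<theta>
    by (simp add: mult.commute[of "det (hs (s, \<theta>))"] mult.assoc)
  let ?l = "\<lambda>u. real n * (kap (?q u) - ?sh u \<bullet> ?y) - (ln ((2 * pi * real n) ^ CARD('d)) + ln (det (hs (?q u)))) / 2"
  have "(?l has_derivative (\<lambda>e. real n * (dird (sa ?p e, e) kap ?p - sa ?p e \<bullet> ?y) - (0 + trace (hinv ?p ** dird (sa ?p e, e) hs ?p)) / 2)) (at \<theta>)"
    by (intro has_derivative_diff has_derivative_mult_right has_derivative_inner_left has_derivative_add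
        has_derivative_const bounded_linear.has_derivative[OF bounded_linear_divide] dk ds dl)
  then have l: "(?l has_derivative sdl ?p n) (at \<theta>)"
    by (simp add: sdl_def[abs_def] dird_sa_kap[OF p])
  have ev: "\<forall>\<^sub>F u in nhds \<theta>. ?l u = ln (saddle_lik R P Y n u (real n *\<^sub>R ?y))"
    using saddle_nbhd[OF p] by eventually_elim (simp add: saddle_lik_eq(2)[OF Psi_saddle n])
  show D: "((\<lambda>u. ln (saddle_lik R P Y n u (real n *\<^sub>R ?y))) has_derivative sdl ?p n) (at \<theta>)"
  proof -
    obtain S where S: "open S" "\<theta> \<in> S" "\<And>u. u \<in> S \<Longrightarrow> ?l u = ln (saddle_lik R P Y n u (real n *\<^sub>R ?y))"
      using ev unfolding eventually_nhds by blast
    show ?thesis by (rule has_derivative_transform_within_open[OF l S])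
  qed
  have y: "(real n *\<^sub>R ?y) /\<^sub>R real n = ?y" using n by simp
  show "log_saddle_lik_grad_exists R P Y n \<theta> (real n *\<^sub>R ?y)"
    unfolding log_saddle_lik_grad_exists_def y
  proof
    show "\<forall>\<^sub>F u in nhds \<theta>. (\<exists>!s. is_saddlepoint R P Y u ?y s) \<and> 0 < saddle_lik R P Y n u (real n *\<^sub>R ?y)"
      using saddle_nbhd[OF p]
    proof eventually_elim
      case (elim u)
      have "is_saddlepoint R P Y u ?y (?sh u)" using Psi_saddle[OF elim] by (simp add: is_saddlepoint_iff)
      moreover have "s' = ?sh u" if "is_saddlepoint R P Y u ?y s'" for s'
        using that s_hat_eq[of s' u] by (auto simp: is_saddlepoint_iff)
      ultimately show ?case using saddle_lik_eq(1)[OF Psi_saddle[OF elim] n] by blast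
    qed
    show "(\<lambda>u. ln (saddle_lik R P Y n u (real n *\<^sub>R ?y))) differentiable at \<theta>"
      using D differentiable_def by blast
  qed
qed

end

subsection \<open>The Laplace method\<close>

lemma norm_power_diff_le:
  fixes a b :: complex
  assumes "norm a \<le> m" "norm b \<le> m"
  shows "norm (a ^ Suc k - b ^ Suc k) \<le> real (Suc k) * norm (a - b) * m ^ k"
proof (induction k)
  case (Suc k)
  have m: "0 \<le> m" using assms(1) norm_ge_zero order_trans by blast
  have "norm (a ^ Suc (Suc k) - b ^ Suc (Suc k)) = norm (a * (a ^ Suc k - b ^ Suc k) + (a - b) * b ^ Suc k)"
    by (simp add: algebra_simps)
  also have "\<dots> \<le> norm a * norm (a ^ Suc k - b ^ Suc k) + norm (a - b) * norm b ^ Suc k"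
    by (rule order_trans[OF norm_triangle_ineq]) (simp add: norm_mult norm_power)
  also have "\<dots> \<le> m * (real (Suc k) * norm (a - b) * m ^ k) + norm (a - b) * m ^ Suc k"
    using assms Suc m by (intro add_mono mult_mono mult_left_mono power_mono) auto
  also have "\<dots> = real (Suc (Suc k)) * norm (a - b) * m ^ Suc k" by (simp add: algebra_simps)
  finally show ?case .
qed simp

lemma integral_lborel_reflect:
  fixes f :: "'a::euclidean_space \<Rightarrow> 'b::{banach, second_countable_topology}"
  assumes "f \<in> borel_measurable borel"
  shows "(\<integral>x. f (- x) \<partial>lborel) = (\<integral>x. f x \<partial>lborel)"
  using integral_lborel_affine[of "- 1" f 0] assms by simp

lemma integrable_lborel_reflect:
  fixes f :: "'a::euclidean_space \<Rightarrow> 'b::{banach, second_countable_topology}"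
  assumes "integrable lborel f"
  shows "integrable lborel (\<lambda>x. f (- x))"
  using integrable_lborel_affine[of "- 1" f 0] assms by simp

text \<open>A named constant, with the space passed as a type, so that the bounds in
  \<open>laplace_ratio\<close> visibly depend on \<open>T\<close> and \<open>F\<close> through the
  constants of the hypotheses only. This is the source of uniformity.\<close>

definition kernel_mass :: "'a::euclidean_space itself \<Rightarrow> nat \<Rightarrow> nat \<Rightarrow> nat \<Rightarrow> real \<Rightarrow> real" where
  "kernel_mass _ k N P c = (\<integral>\<phi>. moment_kernel k N P c \<phi> \<partial>(lborel :: 'a measure))"

context
  fixes c C2 C3 C4 r :: real and n1 N PP :: nat and T F :: "'a::euclidean_space \<Rightarrow> complex"
  assumes c: "0 < c" and n1: "1 \<le> n1" and PP: "6 + N + DIM('a) \<le> PP"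
    and r: "0 < r" and C2: "C2 * r\<^sup>2 \<le> 1 / 2" "0 \<le> C2" and C3: "0 \<le> C3" and C4: "0 \<le> C4"
    and T_meas [measurable]: "T \<in> borel_measurable borel"
    and F_meas [measurable]: "F \<in> borel_measurable borel"
    and T_le: "\<And>\<phi>. norm (T \<phi>) \<le> 1"
    and T_cnj: "\<And>\<phi>. T (- \<phi>) = cnj (T \<phi>)"
    and T_decay: "\<And>k \<phi>. n1 \<le> k \<Longrightarrow> norm (T \<phi>) ^ k \<le> 1 / (1 + c * real k * (norm \<phi>)\<^sup>2) ^ PP"
    and T_odd: "\<And>\<phi>. norm (T \<phi> - T (- \<phi>)) \<le> C3 * norm \<phi> ^ 3"
    and T_low: "\<And>\<phi>. norm \<phi> < r \<Longrightarrow> 1 - C2 * (norm \<phi>)\<^sup>2 \<le> Re (T \<phi>)"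
    and F_le: "\<And>\<phi>. norm (F \<phi>) \<le> C4 * norm \<phi> ^ 3 * (1 + norm \<phi>) ^ N"
    and F_even: "\<And>\<phi>. norm (F \<phi> + F (- \<phi>)) \<le> C4 * norm \<phi> ^ 4 * (1 + norm \<phi>) ^ N"
begin

text \<open>The largest weight that occurs is |\<phi>| ^ 6 (1 + |\<phi>|) ^ N, from the cubic order
  of \<open>F\<close> times the cubic odd part of \<open>T\<close>; hence the lower bound on
  \<open>PP\<close>.\<close>

lemma kernel_integrable:
  assumes "1 \<le> k" "j + M \<le> 6 + N"
  shows "integrable lborel (moment_kernel j M PP (c * real k) :: 'a \<Rightarrow> real)"
  using assms c PP by (intro integrable_moment_kernel) auto

lemma J_nonneg: "0 \<le> kernel_mass TYPE('a) k M PP c"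
  unfolding kernel_mass_def using c by (intro Bochner_Integration.integral_nonneg) (simp add: moment_kernel_nonneg)

lemma kernel_integral_le:
  assumes "1 \<le> k" "j + M \<le> 6 + N"
  shows "(\<integral>\<phi>. moment_kernel j M PP (c * real k) \<phi> \<partial>(lborel :: 'a measure)) \<le> kernel_mass TYPE('a) j M PP c / sqrt (real k) ^ (j + DIM('a))"
  unfolding kernel_mass_def using assms PP by (intro integral_moment_kernel_le c) auto

lemma T_kernel:
  assumes "n1 \<le> k"
  shows "norm \<phi> ^ j * (1 + norm \<phi>) ^ M * norm (T \<phi>) ^ k \<le> moment_kernel j M PP (c * real k) \<phi>"
proof -
  have "norm \<phi> ^ j * (1 + norm \<phi>) ^ M * norm (T \<phi>) ^ k \<le> norm \<phi> ^ j * (1 + norm \<phi>) ^ M * (1 / (1 + c * real k * (norm \<phi>)\<^sup>2) ^ PP)"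
    by (intro mult_left_mono T_decay assms) auto
  then show ?thesis by (simp add: moment_kernel_def)
qed

lemma T_power_integrable: "n1 \<le> k \<Longrightarrow> integrable lborel (\<lambda>\<phi>. T \<phi> ^ k)"
proof -
  assume k: "n1 \<le> k"
  show ?thesis
  proof (rule Bochner_Integration.integrable_bound[OF kernel_integrable[of k 0 0]])
    show "AE \<phi> in lborel. norm (T \<phi> ^ k) \<le> norm (moment_kernel 0 0 PP (c * real k) \<phi>)"
      using T_kernel[OF k, of _ 0 0] c
      by (intro AE_I2) (simp add: norm_power abs_of_nonneg[OF moment_kernel_nonneg])
  qed (use k n1 in auto)
qed

lemma F_T_integrable: "n1 \<le> k \<Longrightarrow> integrable lborel (\<lambda>\<phi>. F \<phi> * T \<phi> ^ k)"
proof -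
  assume k: "n1 \<le> k"
  show ?thesis
  proof (rule Bochner_Integration.integrable_bound)
    show "integrable lborel (\<lambda>\<phi>::'a. C4 * moment_kernel 3 N PP (c * real k) \<phi>)"
      using k n1 by (intro integrable_mult_right kernel_integrable) auto
    show "AE \<phi> in lborel. norm (F \<phi> * T \<phi> ^ k) \<le> norm (C4 * moment_kernel 3 N PP (c * real k) \<phi>)"
    proof (rule AE_I2)
      fix \<phi> :: 'a
      have "norm (F \<phi> * T \<phi> ^ k) \<le> C4 * norm \<phi> ^ 3 * (1 + norm \<phi>) ^ N * norm (T \<phi>) ^ k"
        by (simp add: norm_mult norm_power mult_right_mono F_le)
      also have "\<dots> \<le> C4 * moment_kernel 3 N PP (c * real k) \<phi>"
        using mult_left_mono[OF T_kernel[OF k, of \<phi> 3 N] C4] by (simp add: mult.assoc)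
      finally show "norm (F \<phi> * T \<phi> ^ k) \<le> norm (C4 * moment_kernel 3 N PP (c * real k) \<phi>)" by simp
    qed
  qed auto
qed

text \<open>Averaging the integrand with its reflection replaces the cubic size of \<open>F\<close>
  by the quartic size of its even part, plus \<open>F\<close> times the odd part of the power of
  \<open>T\<close>. The latter has a factor \<nu>, but its six powers of |\<phi>| repay it, so both
  terms are of order \<nu> ^ (- 2) beyond the volume factor.\<close>

lemma numerator_bound:
  assumes \<nu>: "n1 \<le> \<nu>"
  shows "norm (\<integral>\<phi>. F \<phi> * T \<phi> ^ Suc \<nu> \<partial>lborel) \<le> (C4 * kernel_mass TYPE('a) 4 N PP c + 2 * C4 * C3 * kernel_mass TYPE('a) 6 N PP c) / sqrt (real \<nu>) ^ (4 + DIM('a))"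
proof -
  let ?G = "\<lambda>\<phi>. F \<phi> * T \<phi> ^ Suc \<nu>"
  let ?k = "\<lambda>j. moment_kernel j N PP (c * real \<nu>)"
  have \<nu>1: "1 \<le> \<nu>" using \<nu> n1 by simp
  have iG: "integrable lborel ?G" using \<nu> by (intro F_T_integrable) simp
  have iG': "integrable lborel (\<lambda>\<phi>. ?G (- \<phi>))" using iG by (rule integrable_lborel_reflect)
  have "(\<integral>\<phi>. ?G \<phi> + ?G (- \<phi>) \<partial>lborel) = 2 * (\<integral>\<phi>. ?G \<phi> \<partial>lborel)"
    using iG iG' integral_lborel_reflect[of ?G] by simp
  then have "2 * norm (\<integral>\<phi>. ?G \<phi> \<partial>lborel) = norm (\<integral>\<phi>. ?G \<phi> + ?G (- \<phi>) \<partial>lborel)"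
    by (simp add: norm_mult)
  also have "\<dots> \<le> (\<integral>\<phi>. C4 * ?k 4 \<phi> + C4 * C3 * real (Suc \<nu>) * ?k 6 \<phi> \<partial>(lborel :: 'a measure))"
  proof (rule lebesgue_integral_norm_le)
    show "integrable lborel (\<lambda>\<phi>. C4 * ?k 4 \<phi> + C4 * C3 * real (Suc \<nu>) * ?k 6 (\<phi>::'a))"
      using \<nu>1 by (intro Bochner_Integration.integrable_add integrable_mult_right kernel_integrable) auto
    fix \<phi> :: 'a
    let ?w = "(1 + norm \<phi>) ^ N"
    have nT: "norm (T (- \<phi>)) = norm (T \<phi>)" by (simp add: T_cnj)
    have nT1: "norm (T \<phi>) ^ Suc \<nu> \<le> norm (T \<phi>) ^ \<nu>"
      using T_le[of \<phi>] by (intro power_decreasing) auto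
    \<comment> \<open>The difference of powers loses one factor \<open>T\<close> in
      \<open>norm_power_diff_le\<close>. The first term gives up one factor as well, so that both
      are compared with kernels of the same index \<nu>.\<close>
    have "?G \<phi> + ?G (- \<phi>) = (F \<phi> + F (- \<phi>)) * T \<phi> ^ Suc \<nu> + F (- \<phi>) * (T (- \<phi>) ^ Suc \<nu> - T \<phi> ^ Suc \<nu>)"
      by (simp add: algebra_simps)
    also have "norm \<dots> \<le> norm (F \<phi> + F (- \<phi>)) * norm (T \<phi>) ^ Suc \<nu> + norm (F (- \<phi>)) * norm (T (- \<phi>) ^ Suc \<nu> - T \<phi> ^ Suc \<nu>)"
      by (rule order_trans[OF norm_triangle_ineq]) (simp add: norm_mult norm_power)
    also have "\<dots> \<le> (C4 * norm \<phi> ^ 4 * ?w) * norm (T \<phi>) ^ \<nu>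
        + (C4 * norm \<phi> ^ 3 * ?w) * (real (Suc \<nu>) * (C3 * norm \<phi> ^ 3) * norm (T \<phi>) ^ \<nu>)"
    proof (intro add_mono mult_mono F_even nT1)
      show "norm (F (- \<phi>)) \<le> C4 * norm \<phi> ^ 3 * ?w" using F_le[of "- \<phi>"] by simp
      have "norm (T (- \<phi>) ^ Suc \<nu> - T \<phi> ^ Suc \<nu>) \<le> real (Suc \<nu>) * norm (T (- \<phi>) - T \<phi>) * norm (T \<phi>) ^ \<nu>"
        by (rule norm_power_diff_le) (simp_all add: nT)
      also have "\<dots> \<le> real (Suc \<nu>) * (C3 * norm \<phi> ^ 3) * norm (T \<phi>) ^ \<nu>"
        using T_odd[of \<phi>] by (intro mult_right_mono mult_left_mono) (auto simp: norm_minus_commute)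
      finally show "norm (T (- \<phi>) ^ Suc \<nu> - T \<phi> ^ Suc \<nu>) \<le> real (Suc \<nu>) * (C3 * norm \<phi> ^ 3) * norm (T \<phi>) ^ \<nu>" .
    qed (use C4 in auto)
    also have "\<dots> = C4 * (norm \<phi> ^ 4 * ?w * norm (T \<phi>) ^ \<nu>) + C4 * C3 * real (Suc \<nu>) * (norm \<phi> ^ 6 * ?w * norm (T \<phi>) ^ \<nu>)"
      by (simp add: power_add[of _ 3 3, simplified] algebra_simps)
    also have "\<dots> \<le> C4 * ?k 4 \<phi> + C4 * C3 * real (Suc \<nu>) * ?k 6 \<phi>"
      using C3 C4 by (intro add_mono mult_left_mono T_kernel \<nu>) auto
    finally show "norm (?G \<phi> + ?G (- \<phi>)) \<le> C4 * ?k 4 \<phi> + C4 * C3 * real (Suc \<nu>) * ?k 6 \<phi>" .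
  qed
  also have "\<dots> = C4 * (\<integral>\<phi>. ?k 4 \<phi> \<partial>(lborel :: 'a measure)) + C4 * C3 * real (Suc \<nu>) * (\<integral>\<phi>. ?k 6 \<phi> \<partial>(lborel :: 'a measure))"
    using \<nu>1 kernel_integrable[of \<nu> 4 N] kernel_integrable[of \<nu> 6 N] by simp
  also have "\<dots> \<le> C4 * (kernel_mass TYPE('a) 4 N PP c / sqrt (real \<nu>) ^ (4 + DIM('a))) + C4 * C3 * (2 * real \<nu>) * (kernel_mass TYPE('a) 6 N PP c / sqrt (real \<nu>) ^ (6 + DIM('a)))"
    using C3 C4 \<nu>1 by (intro add_mono mult_mono mult_left_mono kernel_integral_le Bochner_Integration.integral_nonneg)
      (auto intro!: mult_nonneg_nonneg divide_nonneg_nonneg J_nonneg simp: moment_kernel_nonneg c less_imp_le)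
  also have "\<dots> = (C4 * kernel_mass TYPE('a) 4 N PP c + 2 * C4 * C3 * kernel_mass TYPE('a) 6 N PP c) / sqrt (real \<nu>) ^ (4 + DIM('a))"
  proof -
    have "sqrt (real \<nu>) ^ (6 + DIM('a)) = real \<nu> * sqrt (real \<nu>) ^ (4 + DIM('a))"
      using power_add[of "sqrt (real \<nu>)" 2 "4 + DIM('a)"] by simp
    then show ?thesis using \<nu>1 by (simp add: add_divide_distrib)
  qed
  finally have "2 * norm (\<integral>\<phi>. ?G \<phi> \<partial>lborel) \<le> (C4 * kernel_mass TYPE('a) 4 N PP c + 2 * C4 * C3 * kernel_mass TYPE('a) 6 N PP c) / sqrt (real \<nu>) ^ (4 + DIM('a))" .
  moreover have "0 \<le> norm (\<integral>\<phi>. ?G \<phi> \<partial>lborel)" by simp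
  ultimately show ?thesis by linarith
qed

text \<open>A ball of radius of order \<nu> ^ (- 1 / 2), on which the integrand is at least 1 / 2 up
  to errors, supplies the main term. Two errors of relative order \<nu> ^ (- 1 / 2) are subtracted:
  the region beyond \<open>r\<close>, where 1 is bounded by |\<phi>| / r, and the imaginary part of
  \<open>T\<close>.\<close>

lemma denominator_bound:
  assumes \<nu>: "n1 \<le> \<nu>"
  shows "((measure lborel (ball (0::'a) r) / 2 ^ Suc DIM('a)) - (kernel_mass TYPE('a) 1 0 PP c / r + C3 * kernel_mass TYPE('a) 3 0 PP c) / sqrt (real \<nu>)) / sqrt (real \<nu>) ^ DIM('a)
    \<le> Re (\<integral>\<phi>. T \<phi> ^ Suc \<nu> \<partial>lborel)"
proof -
  let ?n = "Suc \<nu>"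
  let ?k = "\<lambda>j. moment_kernel j 0 PP (c * real \<nu>)"
  have \<nu>1: "1 \<le> \<nu>" using \<nu> n1 by simp
  have s: "1 \<le> sqrt (real ?n)" by simp
  \<comment> \<open>On this ball n C2 |\<phi>|^2 is at most C2 r^2, hence at most 1 / 2, and
    Bernoulli keeps the n-th power of the real part above 1 / 2.\<close>
  let ?b = "r / sqrt (real ?n)"
  have b: "0 < ?b" "?b \<le> r" using r s by (auto simp: divide_le_eq mult_le_cancel_left1)
  let ?low = "\<lambda>\<phi>::'a. indicator (ball 0 ?b) \<phi> / 2 - ?k 1 \<phi> / r - C3 * real \<nu> * ?k 3 \<phi>"
  have iT: "integrable lborel (\<lambda>\<phi>. T \<phi> ^ ?n)" using \<nu> by (intro T_power_integrable) simp
  have ib: "integrable lborel (indicat_real (ball (0::'a) ?b))"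
    using emeasure_bounded_finite[OF bounded_ball, of "0::'a" ?b] by (intro integrable_real_indicator) auto
  have pt: "?low \<phi> \<le> Re (T \<phi> ^ ?n)" for \<phi>
  proof -
    let ?x = "Re (T \<phi>)"
    have xT: "\<bar>?x\<bar> \<le> norm (T \<phi>)" by (rule abs_Re_le_cmod)
    \<comment> \<open>By \<open>T_cnj\<close> the odd part of \<open>T\<close> is twice its
      imaginary part, so \<open>T_odd\<close> controls the cost of replacing \<open>T\<close> by its
      real part.\<close>
    have "norm (T \<phi> - of_real ?x) = norm (T \<phi> - T (- \<phi>)) / 2"
    proof -
      have e1: "T \<phi> - of_real ?x = \<i> * of_real (Im (T \<phi>))" by (simp add: complex_eq_iff)
      have e2: "T \<phi> - T (- \<phi>) = 2 * (\<i> * of_real (Im (T \<phi>)))" by (simp add: T_cnj complex_eq_iff)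
      show ?thesis unfolding e1 e2 by (simp add: norm_mult)
    qed
    then have d: "norm (T \<phi> - of_real ?x) \<le> C3 * norm \<phi> ^ 3 / 2" using T_odd[of \<phi>] by simp
    have "\<bar>Re (T \<phi> ^ ?n) - ?x ^ ?n\<bar> \<le> norm (T \<phi> ^ ?n - of_real ?x ^ ?n)"
      using abs_Re_le_cmod[of "T \<phi> ^ ?n - of_real ?x ^ ?n"] by (simp del: power_Suc flip: of_real_power)
    also have "\<dots> \<le> real ?n * norm (T \<phi> - of_real ?x) * norm (T \<phi>) ^ \<nu>"
      using xT by (intro norm_power_diff_le) auto
    also have "\<dots> \<le> (2 * real \<nu>) * (C3 * norm \<phi> ^ 3 / 2) * norm (T \<phi>) ^ \<nu>"
      using d \<nu>1 by (intro mult_right_mono mult_mono) auto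
    also have "\<dots> = C3 * real \<nu> * (norm \<phi> ^ 3 * (1 + norm \<phi>) ^ 0 * norm (T \<phi>) ^ \<nu>)" by simp
    also have "\<dots> \<le> C3 * real \<nu> * ?k 3 \<phi>"
      using C3 by (intro mult_left_mono T_kernel \<nu>) auto
    finally have 1: "?x ^ ?n - C3 * real \<nu> * ?k 3 \<phi> \<le> Re (T \<phi> ^ ?n)" by linarith
    have 2: "indicator (ball 0 ?b) \<phi> / 2 - ?k 1 \<phi> / r \<le> ?x ^ ?n"
    proof (cases "norm \<phi> < r")
      case True
      have k0: "0 \<le> ?k 1 \<phi> / r" using r c by (simp add: moment_kernel_nonneg)
      have low: "1 - C2 * (norm \<phi>)\<^sup>2 \<le> ?x" by (rule T_low[OF True])
      have "C2 * (norm \<phi>)\<^sup>2 \<le> C2 * r\<^sup>2" using True C2 by (intro mult_left_mono power_mono) auto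
      then have h: "C2 * (norm \<phi>)\<^sup>2 \<le> 1 / 2" using C2 by linarith
      then have x0: "0 \<le> ?x" using low by linarith
      show ?thesis
      proof (cases "\<phi> \<in> ball 0 ?b")
        case True
        then have nb: "norm \<phi> \<le> ?b" by simp
        have "(norm \<phi>)\<^sup>2 \<le> ?b\<^sup>2" using nb by (intro power_mono) auto
        also have "?b\<^sup>2 = r\<^sup>2 / real ?n" by (simp add: power_divide)
        finally have "C2 * (norm \<phi>)\<^sup>2 \<le> C2 * (r\<^sup>2 / real ?n)" using C2 by (intro mult_left_mono) auto
        then have "real ?n * (C2 * (norm \<phi>)\<^sup>2) \<le> C2 * r\<^sup>2" by (simp add: field_simps)
        then have q: "real ?n * (C2 * (norm \<phi>)\<^sup>2) \<le> 1 / 2" using C2 by linarith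
        have "1 / 2 \<le> 1 + real ?n * (- (C2 * (norm \<phi>)\<^sup>2))" using q by simp
        also have "\<dots> \<le> (1 + - (C2 * (norm \<phi>)\<^sup>2)) ^ ?n" using h by (intro Bernoulli_inequality) auto
        also have "\<dots> \<le> ?x ^ ?n" using low h by (intro power_mono) auto
        finally show ?thesis using k0 True by simp
      next
        case False
        have "0 \<le> ?x ^ ?n" using x0 by simp
        with False k0 show ?thesis by simp
      qed
    next
      case False
      have "norm \<phi> ^ 1 * (1 + norm \<phi>) ^ 0 * norm (T \<phi>) ^ \<nu> \<le> ?k 1 \<phi>" by (rule T_kernel[OF \<nu>])
      moreover have "r * norm (T \<phi>) ^ \<nu> \<le> norm \<phi> * norm (T \<phi>) ^ \<nu>" using False by (intro mult_right_mono) auto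
      ultimately have "norm (T \<phi>) ^ \<nu> \<le> ?k 1 \<phi> / r" using r by (simp add: field_simps)
      moreover have "\<bar>?x ^ ?n\<bar> \<le> norm (T \<phi>) ^ \<nu>"
      proof -
        have "\<bar>?x ^ ?n\<bar> \<le> norm (T \<phi>) ^ ?n" unfolding power_abs using xT by (intro power_mono) auto
        also have "\<dots> \<le> norm (T \<phi>) ^ \<nu>" using T_le[of \<phi>] by (intro power_decreasing) auto
        finally show ?thesis .
      qed
      moreover have "\<phi> \<notin> ball 0 ?b" using False b by auto
      ultimately show ?thesis by simp
    qed
    from 1 2 show ?thesis by linarith
  qed
  have k: "integrable lborel (?k j :: 'a \<Rightarrow> real)" if "j \<le> 6" for j
    using that \<nu>1 by (intro kernel_integrable) auto
  have ball: "measure lborel (ball (0::'a) ?b) = measure lborel (ball (0::'a) r) / sqrt (real ?n) ^ DIM('a)"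
    using b r by (simp add: content_ball power_divide)
  \<comment> \<open>The volume involves n, the kernels involve n - 1. The change of index costs at
    most 2 ^ d, which with the 1 / 2 from Bernoulli gives the denominator
    \<open>2 ^ Suc DIM('a)\<close>.\<close>
  have sn: "sqrt (real ?n) ^ DIM('a) \<le> 2 ^ DIM('a) * sqrt (real \<nu>) ^ DIM('a)"
  proof -
    have "sqrt (real ?n) \<le> sqrt (4 * real \<nu>)" using \<nu>1 by (intro real_sqrt_le_mono) simp
    also have "\<dots> = 2 * sqrt (real \<nu>)" by (simp add: real_sqrt_mult)
    finally show ?thesis unfolding power_mult_distrib[symmetric] by (intro power_mono) auto
  qed
  have s\<nu>: "0 < sqrt (real \<nu>)" using \<nu>1 by simp
  have "((measure lborel (ball (0::'a) r) / 2 ^ Suc DIM('a)) - (kernel_mass TYPE('a) 1 0 PP c / r + C3 * kernel_mass TYPE('a) 3 0 PP c) / sqrt (real \<nu>)) / sqrt (real \<nu>) ^ DIM('a)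
    = (measure lborel (ball (0::'a) r) / 2 ^ Suc DIM('a)) / sqrt (real \<nu>) ^ DIM('a) - (kernel_mass TYPE('a) 1 0 PP c / sqrt (real \<nu>) ^ (1 + DIM('a))) / r
      - C3 * real \<nu> * (kernel_mass TYPE('a) 3 0 PP c / sqrt (real \<nu>) ^ (3 + DIM('a)))"
  proof -
    have e: "sqrt (real \<nu>) ^ (3 + DIM('a)) = real \<nu> * (sqrt (real \<nu>) * sqrt (real \<nu>) ^ DIM('a))"
      using \<nu>1 by (simp add: power_add power3_eq_cube)
    show ?thesis unfolding e using \<nu>1 r by (simp add: field_simps)
  qed
  also have "\<dots> \<le> measure lborel (ball (0::'a) ?b) / 2 - (\<integral>\<phi>. ?k 1 \<phi> \<partial>(lborel::'a measure)) / r - C3 * real \<nu> * (\<integral>\<phi>. ?k 3 \<phi> \<partial>(lborel::'a measure))"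
  proof (intro diff_mono)
    have "(measure lborel (ball (0::'a) r) / 2 ^ Suc DIM('a)) / sqrt (real \<nu>) ^ DIM('a) = measure lborel (ball (0::'a) r) / (2 * (2 ^ DIM('a) * sqrt (real \<nu>) ^ DIM('a)))"
      by simp
    also have "\<dots> \<le> measure lborel (ball (0::'a) r) / (2 * sqrt (real ?n) ^ DIM('a))"
      using sn s\<nu> by (intro divide_left_mono mult_left_mono mult_pos_pos) auto
    also have "\<dots> = measure lborel (ball (0::'a) ?b) / 2" unfolding ball by simp
    finally show "(measure lborel (ball (0::'a) r) / 2 ^ Suc DIM('a)) / sqrt (real \<nu>) ^ DIM('a) \<le> measure lborel (ball (0::'a) ?b) / 2" .
    show "(\<integral>\<phi>. ?k 1 \<phi> \<partial>(lborel::'a measure)) / r \<le> (kernel_mass TYPE('a) 1 0 PP c / sqrt (real \<nu>) ^ (1 + DIM('a))) / r"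
      using r \<nu>1 by (intro divide_right_mono kernel_integral_le) auto
    show "C3 * real \<nu> * (\<integral>\<phi>. ?k 3 \<phi> \<partial>(lborel::'a measure)) \<le> C3 * real \<nu> * (kernel_mass TYPE('a) 3 0 PP c / sqrt (real \<nu>) ^ (3 + DIM('a)))"
      using C3 \<nu>1 by (intro mult_left_mono kernel_integral_le) auto
  qed
  also have "\<dots> = (\<integral>\<phi>. ?low \<phi> \<partial>lborel)"
    using k[of 1] k[of 3] ib by simp
  also have "\<dots> \<le> (\<integral>\<phi>. Re (T \<phi> ^ ?n) \<partial>lborel)"
    using k[of 1] k[of 3] ib iT by (intro integral_mono pt) (auto simp del: power_Suc)
  also have "\<dots> = Re (\<integral>\<phi>. T \<phi> ^ ?n \<partial>lborel)"
    by (rule integral_bounded_linear[OF bounded_linear_Re iT])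
  finally show ?thesis .
qed

text \<open>The second hypothesis makes the errors of \<open>denominator_bound\<close> at most half
  of its main term. The volume factors of numerator and denominator then cancel and leave n powr (-
  2), times the factor n of the logarithmic derivative.\<close>

lemma laplace_ratio:
  assumes n: "n1 + 4 \<le> n" "(kernel_mass TYPE('a) 1 0 PP c / r + C3 * kernel_mass TYPE('a) 3 0 PP c) / sqrt (real (n - 1)) \<le> (measure lborel (ball (0::'a) r) / 2 ^ Suc DIM('a)) / 2"
  shows "0 < Re (\<integral>\<phi>. T \<phi> ^ n \<partial>lborel)"
    and "real n * norm ((\<integral>\<phi>. F \<phi> * T \<phi> ^ (n - 1) \<partial>lborel) / (\<integral>\<phi>. T \<phi> ^ n \<partial>lborel))
      \<le> ((C4 * kernel_mass TYPE('a) 4 N PP c + 2 * C4 * C3 * kernel_mass TYPE('a) 6 N PP c) * 2 ^ (4 + DIM('a)) / ((measure lborel (ball (0::'a) r) / 2 ^ Suc DIM('a)) / 2)) / real n"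
proof -
  let ?d = "DIM('a)"
  let ?B = "C4 * kernel_mass TYPE('a) 4 N PP c + 2 * C4 * C3 * kernel_mass TYPE('a) 6 N PP c"
  have vol: "0 < (measure lborel (ball (0::'a) r) / 2 ^ Suc DIM('a))" using r by simp
  \<comment> \<open>Each bound speaks of a power \<open>Suc\<close> k with kernels of index k: the
    denominator has power n and index n - 1, the numerator power n - 1 and index n - 2.\<close>
  define \<mu> where "\<mu> = n - 1"
  define \<nu> where "\<nu> = n - 2"
  have e: "n = Suc \<mu>" "n - 1 = Suc \<nu>" "n1 \<le> \<mu>" "n1 \<le> \<nu>" using n by (auto simp: \<mu>_def \<nu>_def)
  have n0: "4 \<le> n" "1 \<le> \<mu>" "1 \<le> \<nu>" using n by (auto simp: \<mu>_def \<nu>_def)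
  have s\<mu>: "0 < sqrt (real \<mu>) ^ ?d" using n0 by simp
  have "(measure lborel (ball (0::'a) r) / 2 ^ Suc DIM('a)) / 2 / sqrt (real \<mu>) ^ ?d \<le> ((measure lborel (ball (0::'a) r) / 2 ^ Suc DIM('a)) - (kernel_mass TYPE('a) 1 0 PP c / r + C3 * kernel_mass TYPE('a) 3 0 PP c) / sqrt (real \<mu>)) / sqrt (real \<mu>) ^ ?d"
    using n(2) s\<mu> by (intro divide_right_mono) (auto simp: \<mu>_def)
  also have "\<dots> \<le> Re (\<integral>\<phi>. T \<phi> ^ n \<partial>lborel)" unfolding e(1) by (rule denominator_bound[OF e(3)])
  finally have D: "(measure lborel (ball (0::'a) r) / 2 ^ Suc DIM('a)) / 2 / sqrt (real \<mu>) ^ ?d \<le> Re (\<integral>\<phi>. T \<phi> ^ n \<partial>lborel)" .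
  moreover have "0 < (measure lborel (ball (0::'a) r) / 2 ^ Suc DIM('a)) / 2 / sqrt (real \<mu>) ^ ?d" using divide_pos_pos[OF half_gt_zero[OF vol] s\<mu>] .
  ultimately show pos: "0 < Re (\<integral>\<phi>. T \<phi> ^ n \<partial>lborel)" by linarith
  have "sqrt (real \<mu>) ^ ?d \<le> sqrt (real n) ^ ?d" by (intro power_mono) (auto simp: \<mu>_def)
  then have "(measure lborel (ball (0::'a) r) / 2 ^ Suc DIM('a)) / 2 / sqrt (real n) ^ ?d \<le> (measure lborel (ball (0::'a) r) / 2 ^ Suc DIM('a)) / 2 / sqrt (real \<mu>) ^ ?d"
    using vol s\<mu> n0 by (intro divide_left_mono mult_pos_pos) auto
  also have "\<dots> \<le> norm (\<integral>\<phi>. T \<phi> ^ n \<partial>lborel)" using D complex_Re_le_cmod order_trans by blast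
  finally have D': "(measure lborel (ball (0::'a) r) / 2 ^ Suc DIM('a)) / 2 / sqrt (real n) ^ ?d \<le> norm (\<integral>\<phi>. T \<phi> ^ n \<partial>lborel)" .
  have B: "0 \<le> ?B" using C3 C4 by (auto intro!: add_nonneg_nonneg mult_nonneg_nonneg J_nonneg)
  have sn: "0 < sqrt (real n)" using n0 by simp
  \<comment> \<open>For n at least 4, n / 4 is at most n - 2; restoring n in place of n - 2
    therefore costs \<open>2 ^ (4 + DIM('a))\<close>.\<close>
  have "sqrt (real n) / 2 = sqrt (real n / 4)" by (simp add: real_sqrt_divide)
  also have "\<dots> \<le> sqrt (real \<nu>)" using n0 by (intro real_sqrt_le_mono) (auto simp: \<nu>_def)
  finally have "(sqrt (real n) / 2) ^ (4 + ?d) \<le> sqrt (real \<nu>) ^ (4 + ?d)" using sn by (intro power_mono) auto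
  then have "?B / sqrt (real \<nu>) ^ (4 + ?d) \<le> ?B / (sqrt (real n) / 2) ^ (4 + ?d)"
    using B sn n0 by (intro divide_left_mono mult_pos_pos zero_less_power) auto
  with numerator_bound[OF e(4)] have Nn: "norm (\<integral>\<phi>. F \<phi> * T \<phi> ^ (n - 1) \<partial>lborel) \<le> ?B / (sqrt (real n) / 2) ^ (4 + ?d)"
    unfolding e(2) by linarith
  have "norm ((\<integral>\<phi>. F \<phi> * T \<phi> ^ (n - 1) \<partial>lborel) / (\<integral>\<phi>. T \<phi> ^ n \<partial>lborel))
     \<le> (?B / (sqrt (real n) / 2) ^ (4 + ?d)) / ((measure lborel (ball (0::'a) r) / 2 ^ Suc DIM('a)) / 2 / sqrt (real n) ^ ?d)"
    unfolding norm_divide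
  proof (rule frac_le[OF _ Nn _ D'])
    show "0 \<le> ?B / (sqrt (real n) / 2) ^ (4 + ?d)" using B sn by (intro divide_nonneg_nonneg) auto
    show "0 < (measure lborel (ball (0::'a) r) / 2 ^ Suc DIM('a)) / 2 / sqrt (real n) ^ ?d"
      by (rule divide_pos_pos[OF half_gt_zero[OF vol] zero_less_power[OF sn]])
  qed
  also have "\<dots> = (?B * 2 ^ (4 + ?d) / ((measure lborel (ball (0::'a) r) / 2 ^ Suc DIM('a)) / 2)) / (real n)\<^sup>2"
  proof -
    have pw: "sqrt (real n) ^ (4 + ?d) = (real n)\<^sup>2 * sqrt (real n) ^ ?d"
    proof -
      have "sqrt (real n) ^ 4 = ((sqrt (real n))\<^sup>2)\<^sup>2" by (simp only: power_mult[symmetric]) simp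
      then show ?thesis by (simp add: power_add)
    qed
    have gen: "b / (s / 2) ^ k / (v / 2 / S) = (b * 2 ^ k / (v / 2)) / m"
      if "s ^ k = m * S" "S \<noteq> 0" "m \<noteq> 0" "v \<noteq> 0" for b s v S m :: real and k :: nat
      using that by (simp add: power_divide field_simps)
    show ?thesis
      by (rule gen[OF pw]) (use zero_less_power[OF sn, of ?d] vol n0 in \<open>linarith | simp\<close>)+
  qed
  finally have "real n * norm ((\<integral>\<phi>. F \<phi> * T \<phi> ^ (n - 1) \<partial>lborel) / (\<integral>\<phi>. T \<phi> ^ n \<partial>lborel))
     \<le> real n * ((?B * 2 ^ (4 + ?d) / ((measure lborel (ball (0::'a) r) / 2 ^ Suc DIM('a)) / 2)) / (real n)\<^sup>2)" by (intro mult_left_mono) auto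
  also have "\<dots> = (?B * 2 ^ (4 + ?d) / ((measure lborel (ball (0::'a) r) / 2 ^ Suc DIM('a)) / 2)) / real n" using n0 by (simp add: power2_eq_square)
  finally show "real n * norm ((\<integral>\<phi>. F \<phi> * T \<phi> ^ (n - 1) \<partial>lborel) / (\<integral>\<phi>. T \<phi> ^ n \<partial>lborel))
      \<le> (?B * 2 ^ (4 + ?d) / ((measure lborel (ball (0::'a) r) / 2 ^ Suc DIM('a)) / 2)) / real n" .
qed

end

section \<open>Estimates uniform over compact sets\<close>

lemma compact_thicken:
  fixes K :: "('a::euclidean_space \<times> 'b::euclidean_space) set"
  assumes "compact K" "open V" "K \<subseteq> V"
  obtains K' \<rho> where "compact K'" "K' \<subseteq> V" "0 < \<rho>" "K \<subseteq> K'"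
    "\<And>s \<theta> v e. (s, \<theta>) \<in> K \<Longrightarrow> norm v \<le> \<rho> \<Longrightarrow> norm e \<le> \<rho> \<Longrightarrow> (s + v, \<theta> + e) \<in> K'"
proof (cases "K = {}")
  case True
  then show ?thesis using that[of "{}" 1] by auto
next
  case False
  obtain \<epsilon> where \<epsilon>: "0 < \<epsilon>" "{x. infdist x K \<le> \<epsilon>} \<subseteq> V"
    using compact_in_open_separated[OF False assms] by metis
  show ?thesis
  proof (rule that[of "{x. infdist x K \<le> \<epsilon>}" "\<epsilon> / 2"])
    show "compact {x. infdist x K \<le> \<epsilon>}" by (rule compact_infdist_le[OF False assms(1) \<epsilon>(1)])
    show "(s + v, \<theta> + e) \<in> {x. infdist x K \<le> \<epsilon>}"
      if "(s, \<theta>) \<in> K" "norm v \<le> \<epsilon> / 2" "norm e \<le> \<epsilon> / 2" for s \<theta> v e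
    proof -
      have "infdist (s + v, \<theta> + e) K \<le> dist (s + v, \<theta> + e) (s, \<theta>)" by (rule infdist_le[OF that(1)])
      also have "\<dots> \<le> norm v + norm e" by (simp add: dist_norm norm_Pair sqrt_sum_squares_le_sum)
      finally show ?thesis using that by simp
    qed
  qed (use \<epsilon> in auto)
qed

lemma compact_bound:
  fixes f :: "'a::metric_space \<Rightarrow> 'b::real_normed_vector"
  assumes "compact K" "continuous_on K f"
  obtains B where "1 \<le> B" "\<And>x. x \<in> K \<Longrightarrow> norm (f x) \<le> B"
proof -
  have "bounded (f ` K)" using assms by (simp add: compact_continuous_image compact_imp_bounded)
  then obtain B where "\<And>x. x \<in> K \<Longrightarrow> norm (f x) \<le> B" by (auto simp: bounded_iff)
  then show ?thesis using that[of "max 1 B"] by (meson max.cobounded1 max.coboundedI2)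
qed

lemma continuous_on_nth:
  fixes f :: "'a::topological_space \<Rightarrow> 'b::topological_space ^ 'n"
  shows "continuous_on S f \<Longrightarrow> continuous_on S (\<lambda>x. f x $ i)"
  unfolding continuous_on by (auto intro: tendsto_vec_nth)

lemma continuous_on_matrix_vector_mult:
  fixes A :: "'a::topological_space \<Rightarrow> real^'n^'m"
  assumes "continuous_on S A" "continuous_on S v"
  shows "continuous_on S (\<lambda>x. A x *v v x)"
  unfolding matrix_vector_mult_def
  by (intro continuous_on_vec_lambda continuous_intros continuous_on_nth assms)

context saddle_model
begin

text \<open>
  The factor \<open>- 1 / 2\<close> is the one that cancels the quadratic terms of \<open>Fn\<close> below.
\<close>

definition Cm :: "real ^ 'p \<Rightarrow> (real ^ 'd) \<times> (real ^ 'p) \<Rightarrow> real ^ 'd ^ 'd" where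
  "Cm e p = (- 1 / 2) *\<^sub>R (hinv p ** dird (sa p e, e) hs p)"

lemma mgf_continuous: "continuous_on U (\<lambda>p. mgf (fst p) (snd p))"
  by (rule continuous_on_eq[OF C1_on_continuous[OF Mr_C1[of "[]"]]]) (auto simp: Mr_Nil)

lemma hs_coercive:
  assumes "compact K" "K \<subseteq> U"
  obtains \<mu> where "0 < \<mu>" "\<And>p v. p \<in> K \<Longrightarrow> \<mu> * (norm v)\<^sup>2 \<le> v \<bullet> (hs p *v v)"
proof (cases "K = {}")
  case False
  let ?S = "K \<times> sphere (0::real^'d) 1"
  have "axis undefined 1 \<in> sphere (0::real^'d) 1" by simp
  then have ne: "?S \<noteq> {}" using False by blast
  have "continuous_on ?S (\<lambda>q. snd q \<bullet> (hs (fst q) *v snd q))"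
    using assms by (intro continuous_intros continuous_on_matrix_vector_mult
        continuous_on_compose2[OF C1_on_continuous[OF hs_C1]]) auto
  then obtain q where q: "q \<in> ?S" "\<And>q'. q' \<in> ?S \<Longrightarrow> snd q \<bullet> (hs (fst q) *v snd q) \<le> snd q' \<bullet> (hs (fst q') *v snd q')"
    using continuous_attains_inf[OF compact_Times[OF assms(1) compact_sphere] ne, of "\<lambda>q. snd q \<bullet> (hs (fst q) *v snd q)"] by blast
  let ?l = "snd q \<bullet> (hs (fst q) *v snd q)"
  have "snd q \<noteq> 0" using q(1) by auto
  then have "0 < ?l" using q(1) assms by (intro hs_pos_def) auto
  moreover have "?l * (norm v)\<^sup>2 \<le> v \<bullet> (hs p *v v)" if "p \<in> K" for p v
  proof (cases "v = 0")
    case False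
    let ?u = "v /\<^sub>R norm v"
    have "(p, ?u) \<in> ?S" using that False by simp
    from q(2)[OF this] have "?l \<le> ?u \<bullet> (hs p *v ?u)" by simp
    also have "\<dots> = (v \<bullet> (hs p *v v)) / (norm v)\<^sup>2"
      by (simp add: matrix_vector_mult_scaleR power2_eq_square divide_inverse mult_ac)
    finally show ?thesis using False by (simp add: field_simps)
  qed simp
  ultimately show ?thesis using that by blast
qed (use that[of 1] in auto)

text \<open>\<open>hinv\<close> is a choice, with no continuity established, so bounds for it come
  from coercivity: pair \<open>hinv p *v x\<close> with \<open>x\<close> and apply
  Cauchy-Schwarz.\<close>

lemma hinv_bound:
  assumes "p \<in> U" "0 < \<mu>" "\<And>v. \<mu> * (norm v)\<^sup>2 \<le> v \<bullet> (hs p *v v)"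
  shows "norm (hinv p *v x) \<le> norm x / \<mu>"
proof (cases "hinv p *v x = 0")
  case False
  let ?v = "hinv p *v x"
  have "\<mu> * (norm ?v)\<^sup>2 \<le> ?v \<bullet> x" using assms(3)[of ?v] by (simp add: hs_hinv_apply assms(1))
  also have "\<dots> \<le> norm ?v * norm x" by (rule norm_cauchy_schwarz)
  finally have "\<mu> * norm ?v \<le> norm x" using False by (simp add: power2_eq_square mult.left_commute)
  then show ?thesis using assms(2) by (simp add: field_simps)
qed (use assms(2) in simp)

text \<open>\<open>C1_on\<close> gives continuity for fixed directions, while \<open>sa p e\<close>
  varies with the point. The expansion separates the varying coefficients from derivatives in fixed
  directions.\<close>

lemma dird_pair_expand:
  assumes "C1_on U f" "p \<in> U"
  shows "dird (a, e) f p = (\<Sum>l\<in>UNIV. (a $ l) *\<^sub>R dird (axis l 1, 0) f p) + dird (0, e) f p"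
proof -
  note lin = C1_on_linear_dird[OF assms]
  have "(a, 0::real^'p) = (\<Sum>l\<in>UNIV. (a $ l) *\<^sub>R (axis l 1, 0))"
    by (rule prod_eqI) (simp_all add: fst_sum snd_sum basis_expansion[of a, unfolded scalar_mult_eq_scaleR])
  then have "dird (a, 0) f p = (\<Sum>l\<in>UNIV. (a $ l) *\<^sub>R dird (axis l 1, 0) f p)"
    by (simp only: linear_sum[OF lin] linear_cmul[OF lin])
  moreover have "dird (a, e) f p = dird (a, 0) f p + dird (0, e) f p"
    using dird_add[OF assms, of "(a, 0)" "(0, e)"] by simp
  ultimately show ?thesis by simp
qed

lemma saddle_constants:
  assumes K: "compact K" "K \<subseteq> U"
  obtains G where "1 \<le> G" "\<And>p. p \<in> K \<Longrightarrow> norm (kg p) \<le> G" "\<And>p. p \<in> K \<Longrightarrow> norm (sa p e) \<le> G"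
    "\<And>p v. p \<in> K \<Longrightarrow> norm (Cm e p *v v) \<le> G * norm v" "\<And>p. p \<in> K \<Longrightarrow> \<bar>dird (sa p e, e) kap p\<bar> \<le> G"
proof -
  obtain \<mu> where \<mu>: "0 < \<mu>" "\<And>p v. p \<in> K \<Longrightarrow> \<mu> * (norm v)\<^sup>2 \<le> v \<bullet> (hs p *v v)"
    using hs_coercive[OF K] by metis
  note sub = continuous_on_subset[OF _ K(2)]
  obtain G1 where G1: "1 \<le> G1" "\<And>p. p \<in> K \<Longrightarrow> norm (kg p) \<le> G1"
    using compact_bound[OF K(1) sub[OF C1_on_continuous[OF kg_C1]]] by metis
  obtain G2 where G2: "1 \<le> G2" "\<And>p. p \<in> K \<Longrightarrow> norm (dird (0, e) kg p) \<le> G2"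
    using compact_bound[OF K(1) sub[OF C1_on_continuous_dird[OF kg_C1]]] by metis
  obtain G3 where G3: "1 \<le> G3" "\<And>p. p \<in> K \<Longrightarrow> norm (dird (0, e) kap p) \<le> G3"
    using compact_bound[OF K(1) sub[OF C1_on_continuous_dird[OF kap_C1]]] by metis
  define A where "A = G2 / \<mu>"
  have A: "norm (sa p e) \<le> A" if "p \<in> K" for p
  proof -
    have "norm (sa p e) \<le> norm (dird (0, e) kg p) / \<mu>"
      unfolding sa_def norm_minus_cancel using that K \<mu> by (intro hinv_bound) auto
    also have "\<dots> \<le> A" unfolding A_def using G2(2)[OF that] \<mu>(1) by (intro divide_right_mono) auto
    finally show ?thesis .
  qed
  \<comment> \<open>Since \<open>sa p e\<close> is known to be bounded but not to be continuous, its
    values are replaced by an independent variable in a closed ball, and continuity is used on the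
    resulting compact product.\<close>
  let ?D = "\<lambda>a p. (\<Sum>l\<in>UNIV. (a $ l) *\<^sub>R dird (axis l 1, 0) hs p) + dird (0, e) hs p"
  let ?S = "K \<times> cball (0::real^'d) A \<times> cball (0::real^'d) 1"
  have cD: "continuous_on ?S (\<lambda>q. ?D (fst (snd q)) (fst q) *v snd (snd q))"
    using K by (intro continuous_intros continuous_on_matrix_vector_mult
        continuous_on_compose2[OF C1_on_continuous_dird[OF hs_C1]] continuous_on_nth) auto
  obtain G4 where G4: "1 \<le> G4" "\<And>q. q \<in> ?S \<Longrightarrow> norm (?D (fst (snd q)) (fst q) *v snd (snd q)) \<le> G4"
    by (rule compact_bound[OF compact_Times[OF K(1) compact_Times[OF compact_cball compact_cball]] cD]) (rule that)
  have D: "norm (dird (sa p e, e) hs p *v v) \<le> G4 * norm v" if "p \<in> K" for p v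
  proof (cases "v = 0")
    case False
    have p: "p \<in> U" using that K by blast
    have "(p, sa p e, v /\<^sub>R norm v) \<in> ?S" using that A[OF that] False by simp
    from G4(2)[OF this] have 1: "norm (dird (sa p e, e) hs p *v (v /\<^sub>R norm v)) \<le> G4"
      unfolding dird_pair_expand[OF hs_C1 p, of "sa p e"] by (simp only: fst_conv snd_conv)
    have "norm (dird (sa p e, e) hs p *v v) = norm v * norm (dird (sa p e, e) hs p *v (v /\<^sub>R norm v))"
      using False by (simp add: matrix_vector_mult_scaleR)
    also have "\<dots> \<le> norm v * G4" using 1 by (intro mult_left_mono) auto
    finally show ?thesis by (simp add: mult.commute)
  qed (simp add: linear_0[OF matrix_vector_mul_linear])
  define B where "B = G4 / \<mu>"
  have B: "norm (Cm e p *v v) \<le> B * norm v" if "p \<in> K" for p v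
  proof -
    have "norm (Cm e p *v v) = norm (hinv p *v (dird (sa p e, e) hs p *v v)) / 2"
    proof -
      have "norm ((x *\<^sub>R (hinv p ** dird (sa p e, e) hs p)) *v v) = \<bar>x\<bar> * norm (hinv p *v (dird (sa p e, e) hs p *v v))" for x
        by (simp add: scaleR_matrix_vector_assoc[symmetric] matrix_vector_mul_assoc)
      from this[of "- 1 / 2"] show ?thesis by (simp add: Cm_def)
    qed
    also have "\<dots> \<le> norm (hinv p *v (dird (sa p e, e) hs p *v v))" by simp
    also have "\<dots> \<le> norm (dird (sa p e, e) hs p *v v) / \<mu>"
      using that K \<mu> by (intro hinv_bound) auto
    also have "\<dots> \<le> (G4 * norm v) / \<mu>" using D[OF that] \<mu>(1) by (intro divide_right_mono) auto
    finally show ?thesis by (simp add: B_def)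
  qed
  have A0: "0 \<le> A" "0 \<le> B" using G2 G4 \<mu> by (auto simp: A_def B_def)
  have c0: "\<bar>dird (sa p e, e) kap p\<bar> \<le> A * G1 + G3" if "p \<in> K" for p
  proof -
    have p: "p \<in> U" using that K by blast
    have "\<bar>sa p e \<bullet> kg p\<bar> \<le> norm (sa p e) * norm (kg p)" by (rule Cauchy_Schwarz_ineq2)
    also have "\<dots> \<le> A * G1" using A[OF that] G1(2)[OF that] A0 by (intro mult_mono) auto
    finally show ?thesis using G3(2)[OF that] dird_sa_kap[OF p, of e] by simp
  qed
  define G where "G = G1 + A + B + A * G1 + G3"
  have AG: "0 \<le> A * G1" using A0 G1 by simp
  have le: "1 \<le> G" "G1 \<le> G" "A \<le> G" "B \<le> G" "A * G1 + G3 \<le> G"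
    using A0 AG G1(1) G3(1) unfolding G_def by linarith+
  show ?thesis
  proof (rule that[of G])
    show "1 \<le> G" by (rule le)
    show "norm (kg p) \<le> G" if "p \<in> K" for p by (rule order_trans[OF G1(2)[OF that] le(2)])
    show "norm (sa p e) \<le> G" if "p \<in> K" for p by (rule order_trans[OF A[OF that] le(3)])
    show "norm (Cm e p *v v) \<le> G * norm v" if "p \<in> K" for p v
      by (rule order_trans[OF B[OF that] mult_right_mono[OF le(4) norm_ge_zero]])
    show "\<bar>dird (sa p e, e) kap p\<bar> \<le> G" if "p \<in> K" for p by (rule order_trans[OF c0[OF that] le(5)])
  qed
qed

lemma norm_dM_le:
  assumes "\<And>is js. length is \<le> 1 \<Longrightarrow> length is + length js = 1 \<Longrightarrow> cmod (dM0 P Y is js (cvec (fst q) \<phi>) (snd q)) \<le> X"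
  shows "norm (dM [] \<phi> v q) \<le> real (CARD('d) + CARD('p)) * norm v * X"
proof -
  have b: "cmod (dM0 P Y [] [j] (cvec (fst q) \<phi>) (snd q)) \<le> X" "cmod (dM0 P Y [i] [] (cvec (fst q) \<phi>) (snd q)) \<le> X" for i j
    by (rule assms; simp)+
  have X: "0 \<le> X" by (rule order_trans[OF norm_ge_zero b(1)])
  have "norm (dM [] \<phi> v q) \<le> norm (\<Sum>j\<in>UNIV. (fst v $ j) *\<^sub>R dM0 P Y [] [j] (cvec (fst q) \<phi>) (snd q))
     + norm (\<Sum>i\<in>UNIV. (snd v $ i) *\<^sub>R dM0 P Y [i] [] (cvec (fst q) \<phi>) (snd q))"
    unfolding dM_def[of "[]"] by (rule norm_triangle_ineq)
  also have "\<dots> \<le> (\<Sum>j\<in>(UNIV::'d set). norm v * X) + (\<Sum>i\<in>(UNIV::'p set). norm v * X)"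
  proof (intro add_mono sum_norm_le)
    fix j :: 'd
    have "\<bar>fst v $ j\<bar> \<le> norm v" using component_le_norm_cart[of "fst v" j] norm_fst_le[of "fst v" "snd v"] by simp
    then show "norm ((fst v $ j) *\<^sub>R dM0 P Y [] [j] (cvec (fst q) \<phi>) (snd q)) \<le> norm v * X"
      unfolding norm_scaleR by (intro mult_mono b) auto
  next
    fix i :: 'p
    have "\<bar>snd v $ i\<bar> \<le> norm v" using component_le_norm_cart[of "snd v" i] norm_snd_le[of "snd v" "fst v"] by simp
    then show "norm ((snd v $ i) *\<^sub>R dM0 P Y [i] [] (cvec (fst q) \<phi>) (snd q)) \<le> norm v * X"
      unfolding norm_scaleR by (intro mult_mono b) auto
  qed
  also have "\<dots> = real (CARD('d) + CARD('p)) * norm v * X" by (simp add: algebra_simps)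
  finally show ?thesis .
qed

text \<open>
  \<open>Tl\<close> and \<open>Fl\<close> extend \<open>Tn\<close> and \<open>Fn\<close> holomorphically along the line \<open>\<zeta> = \<i>\<tau>\<close> through \<open>\<phi> = \<tau>\<omega>\<close>: an order of
  vanishing seen at real \<open>\<zeta>\<close>, where everything is a real moment, bounds them at imaginary \<open>\<zeta>\<close>.
\<close>

definition Tl :: "(real ^ 'd) \<times> (real ^ 'p) \<Rightarrow> real ^ 'd \<Rightarrow> complex \<Rightarrow> complex" where
  "Tl p \<omega> \<zeta> = M0 P Y (cvec (fst p + Re \<zeta> *\<^sub>R \<omega>) (Im \<zeta> *\<^sub>R \<omega>)) (snd p) / of_real (mgf (fst p) (snd p))
     * exp (- \<zeta> * of_real (\<omega> \<bullet> kg p))"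

definition Fl :: "real ^ 'p \<Rightarrow> (real ^ 'd) \<times> (real ^ 'p) \<Rightarrow> real ^ 'd \<Rightarrow> complex \<Rightarrow> complex" where
  "Fl e p \<omega> \<zeta> = (dM [] (Im \<zeta> *\<^sub>R \<omega>) (sa p e, e) (fst p + Re \<zeta> *\<^sub>R \<omega>, snd p)
      - of_real (dird (sa p e, e) kap p) * M0 P Y (cvec (fst p + Re \<zeta> *\<^sub>R \<omega>) (Im \<zeta> *\<^sub>R \<omega>)) (snd p)
      + \<zeta> * (dM [] (Im \<zeta> *\<^sub>R \<omega>) (Cm e p *v \<omega>, 0) (fst p + Re \<zeta> *\<^sub>R \<omega>, snd p)
          - of_real (kg p \<bullet> (Cm e p *v \<omega>)) * M0 P Y (cvec (fst p + Re \<zeta> *\<^sub>R \<omega>) (Im \<zeta> *\<^sub>R \<omega>)) (snd p)))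
     / of_real (mgf (fst p) (snd p)) * exp (- \<zeta> * of_real (\<omega> \<bullet> kg p))"

definition Tn :: "(real ^ 'd) \<times> (real ^ 'p) \<Rightarrow> real ^ 'd \<Rightarrow> complex" where
  "Tn p \<phi> = Tl p \<phi> \<i>"

definition Fn :: "real ^ 'p \<Rightarrow> (real ^ 'd) \<times> (real ^ 'p) \<Rightarrow> real ^ 'd \<Rightarrow> complex" where
  "Fn e p \<phi> = Fl e p \<phi> \<i>"

lemma Tl_scale: "Tl p (\<tau> *\<^sub>R \<omega>) \<i> = Tl p \<omega> (\<i> * of_real \<tau>)"
  by (simp add: Tl_def mult_ac)

lemma Fl_scale: "Fl e p (\<tau> *\<^sub>R \<omega>) \<i> = Fl e p \<omega> (\<i> * of_real \<tau>)"
proof -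
  have "dM [] \<phi> (\<tau> *\<^sub>R v, 0) q = of_real \<tau> * dM [] \<phi> (v, 0) q" for v \<phi> q
    using linear_cmul[OF linear_dM[of "[]" \<phi> q], of \<tau> "(v, 0)"] by (simp add: scaleR_conv_of_real)
  then show ?thesis
    by (simp add: Fl_def matrix_vector_mult_scaleR algebra_simps)
qed

lemma dM_real: "q \<in> U \<Longrightarrow> dM [] 0 v q = of_real (dird v (Mr []) q)"
proof -
  assume q: "q \<in> U"
  have d: "((\<lambda>p. complex_of_real (Mr [] p)) has_derivative (\<lambda>v. of_real (dird v (Mr []) x))) (at x)" if "x \<in> U" for x
    by (rule has_derivative_of_real[OF C1_on_has_derivative[OF Mr_C1 that]]) simp
  have C: "C1_on U (\<lambda>p. complex_of_real (Mr [] p))"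
    by (rule C1_onI[OF d]) (auto intro!: continuous_intros C1_on_continuous_dird Mr_C1)
  have "dird v (\<lambda>p. M0 P Y (cvec (fst p) 0) (snd p)) q = dird v (\<lambda>p. complex_of_real (Mr [] p)) q"
    by (rule C1_on_cong(2)[OF open_interior C _ q]) (metis M0_real Mr_Nil prod.collapse)
  then show ?thesis using dird_dM0[of "[]" q v 0] q dird_eq[OF d[OF q]] by simp
qed

lemma Tl_real:
  assumes "p + t *\<^sub>R (\<omega>, 0) \<in> U" "p \<in> U"
  shows "Tl p \<omega> (of_real t) = of_real (Mr [] (p + t *\<^sub>R (\<omega>, 0)) / Mr [] p * exp (- t * (\<omega> \<bullet> kg p)))"
proof -
  have "M0 P Y (cvec (fst p + t *\<^sub>R \<omega>) 0) (snd p) = of_real (Mr [] (p + t *\<^sub>R (\<omega>, 0)))"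
    using M0_real[of "fst p + t *\<^sub>R \<omega>" "snd p"] Mr_Nil[OF assms(1)] assms(1) by (cases p) simp
  then show ?thesis by (simp add: Tl_def Mr_Nil[OF assms(2)] exp_of_real[symmetric])
qed

text \<open>At real points derivatives of \<open>M0\<close> are \<open>Mr []\<close> times
  derivatives of \<open>kap\<close>. After this factor is pulled out, the bracket is the expression
  of \<open>saddle_direction_order\<close> with \<open>c\<close> equal to
  \<open>Cm e p *v \<omega>\<close>.\<close>

lemma Fl_real:
  assumes q: "p + t *\<^sub>R (\<omega>, 0) \<in> U" and p: "p \<in> U"
  shows "Fl e p \<omega> (of_real t) = of_real (Mr [] (p + t *\<^sub>R (\<omega>, 0)) / Mr [] p * exp (- t * (\<omega> \<bullet> kg p))
    * (dird (sa p e, e) kap (p + t *\<^sub>R (\<omega>, 0)) - dird (sa p e, e) kap p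
       + t * ((Cm e p *v \<omega>) \<bullet> (kg (p + t *\<^sub>R (\<omega>, 0)) - kg p))))"
proof -
  define q where "q = p + t *\<^sub>R (\<omega>, 0)"
  have q: "q \<in> U" using assms(1) by (simp only: q_def)
  have qe: "(fst p + t *\<^sub>R \<omega>, snd p) = q" by (cases p) (simp add: q_def)
  have M: "M0 P Y (cvec (fst p + t *\<^sub>R \<omega>) 0) (snd p) = of_real (Mr [] q)"
    using M0_real[of "fst p + t *\<^sub>R \<omega>" "snd p"] Mr_Nil[OF q] q unfolding qe[symmetric] by simp
  have D: "dM [] 0 v q = of_real (Mr [] q * dird v kap q)" for v
    using Mr_pos[OF q] by (simp add: dM_real[OF q] dird_kap[OF q])
  have "Fl e p \<omega> (of_real t) = of_real ((Mr [] q * dird (sa p e, e) kap q - dird (sa p e, e) kap p * Mr [] q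
      + t * (Mr [] q * ((Cm e p *v \<omega>) \<bullet> kg q) - (kg p \<bullet> (Cm e p *v \<omega>)) * Mr [] q)) / Mr [] p * exp (- t * (\<omega> \<bullet> kg p)))"
    unfolding Fl_def by (simp add: qe D M dird_kap_s[OF q] Mr_Nil[OF p] exp_of_real[symmetric])
  also have "\<dots> = of_real (Mr [] q / Mr [] p * exp (- t * (\<omega> \<bullet> kg p))
    * (dird (sa p e, e) kap q - dird (sa p e, e) kap p
       + t * ((Cm e p *v \<omega>) \<bullet> (kg q - kg p))))"
    by (simp add: inner_diff_right inner_commute[of "kg p"] algebra_simps diff_divide_distrib add_divide_distrib)
  finally show ?thesis unfolding q_def .
qed

lemma Cm_direction:
  assumes "p \<in> U"
  shows "(Cm e p *v \<omega>) \<bullet> (hs p *v \<omega>) = - (\<omega> \<bullet> (dird (sa p e, e) hs p *v \<omega>)) / 2"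
proof -
  have "(Cm e p *v \<omega>) \<bullet> (hs p *v \<omega>) = (hs p *v (Cm e p *v \<omega>)) \<bullet> \<omega>"
    using hs_inner_sym[OF assms, of "Cm e p *v \<omega>" \<omega>] .
  also have "hs p *v (Cm e p *v \<omega>) = (- 1 / 2) *\<^sub>R (dird (sa p e, e) hs p *v \<omega>)"
  proof -
    have "hs p *v ((x *\<^sub>R (hinv p ** dird (sa p e, e) hs p)) *v \<omega>) = x *\<^sub>R (dird (sa p e, e) hs p *v \<omega>)" for x
      by (simp add: scaleR_matrix_vector_assoc[symmetric] matrix_vector_mul_assoc[symmetric]
          matrix_vector_mult_scaleR hs_hinv_apply[OF assms])
    then show ?thesis unfolding Cm_def .
  qed
  also have "((- 1 / 2) *\<^sub>R (dird (sa p e, e) hs p *v \<omega>)) \<bullet> \<omega> = - (\<omega> \<bullet> (dird (sa p e, e) hs p *v \<omega>)) / 2"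
    unfolding inner_scaleR_left by (simp add: inner_commute)
  finally show ?thesis .
qed

text \<open>The choices of \<open>sa\<close> and \<open>Cm\<close> enter here: by
  \<open>dird_sa_kg\<close> and \<open>Cm_direction\<close> they satisfy the two conditions of
  \<open>saddle_direction_order\<close>. The remaining factor is continuous in t and does not affect
  the order.\<close>

lemma Fl_order:
  assumes p: "p \<in> U"
  shows "((\<lambda>t::real. Fl e p \<omega> (of_real t) / of_real t ^ 2) \<longlongrightarrow> 0) (at 0)"
proof -
  obtain r where r: "0 < r" "\<And>t. \<bar>t\<bar> < r \<Longrightarrow> p + t *\<^sub>R (\<omega>, 0) \<in> U" using line_in_U[OF p] by metis
  let ?l = "\<lambda>t. p + t *\<^sub>R (\<omega>, 0)"
  let ?f = "\<lambda>t. dird (sa p e, e) kap (?l t) - dird (sa p e, e) kap p + t * ((Cm e p *v \<omega>) \<bullet> (kg (?l t) - kg p))"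
  let ?h = "\<lambda>t. Mr [] (?l t) / Mr [] p * exp (- t * (\<omega> \<bullet> kg p))"
  have l: "((\<lambda>t. ?f t / t\<^sup>2) \<longlongrightarrow> 0) (at 0)"
    by (rule saddle_direction_order[OF p dird_sa_kg[OF p] Cm_direction[OF p]])
  have l0: "?l 0 = p" by (cases p) simp
  have "isCont (Mr []) (?l 0)"
    unfolding l0 using C1_on_continuous[OF Mr_C1[of "[]"]] p by (simp add: continuous_on_eq_continuous_at)
  then have "isCont (\<lambda>t. Mr [] (?l t)) 0"
    by (intro isCont_o2[of 0 ?l "Mr []"] continuous_intros) auto
  then have "isCont ?h 0" using Mr_pos[OF p] by (intro continuous_intros) auto
  then have "(?h \<longlongrightarrow> ?h 0) (at 0)" by (simp only: isCont_def)
  from tendsto_mult[OF this l] have "((\<lambda>t. complex_of_real (?h t * (?f t / t\<^sup>2))) \<longlongrightarrow> of_real (?h 0 * 0)) (at 0)"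
    by (intro tendsto_of_real)
  then have "((\<lambda>t. complex_of_real (?h t * (?f t / t\<^sup>2))) \<longlongrightarrow> 0) (at 0)" by simp
  moreover have "\<forall>\<^sub>F t in at 0. complex_of_real (?h t * (?f t / t\<^sup>2)) = Fl e p \<omega> (of_real t) / of_real t ^ 2"
  proof -
    have "\<forall>\<^sub>F t::real in at 0. t \<in> {- r<..<r}" using r(1) by (intro eventually_at_in_open') auto
    then show ?thesis
    proof eventually_elim
      case (elim t)
      then have "?l t \<in> U" by (intro r(2)) auto
      from Fl_real[OF this p, of e] show ?case
        by (simp only: of_real_mult[symmetric] of_real_divide[symmetric] of_real_power[symmetric] times_divide_eq_right)
    qed
  qed
  ultimately show ?thesis by (rule Lim_transform_eventually)
qed

text \<open>The centring factor exp (- t (\<omega> \<bullet> kg p)) cancels the first derivative at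
  0. So the odd part vanishes beyond first order, which parity raises to third, and the even part is
  2 up to second order.\<close>

lemma Tl_order:
  assumes p: "p \<in> U"
  shows "((\<lambda>t::real. (Tl p \<omega> (of_real t) - Tl p \<omega> (- of_real t)) / of_real t ^ 1) \<longlongrightarrow> 0) (at 0)"
    and "((\<lambda>t::real. (Tl p \<omega> (of_real t) + Tl p \<omega> (- of_real t) - 2) / of_real t ^ 1) \<longlongrightarrow> 0) (at 0)"
proof -
  obtain r where r: "0 < r" "\<And>t. \<bar>t\<bar> < r \<Longrightarrow> p + t *\<^sub>R (\<omega>, 0) \<in> U" using line_in_U[OF p] by metis
  let ?l = "\<lambda>t. p + t *\<^sub>R (\<omega>, 0)"
  let ?h = "\<lambda>t. Mr [] (?l t) / Mr [] p * exp (- t * (\<omega> \<bullet> kg p))"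
  have l0: "?l 0 = p" by (cases p) simp
  have "((\<lambda>t. Mr [] (?l t)) has_vector_derivative dird (\<omega>, 0) (Mr []) (?l 0)) (at 0)"
    by (rule C1_on_line[OF Mr_C1]) (use p l0 in auto)
  moreover have "dird (\<omega>, 0) (Mr []) p = Mr [] p * (\<omega> \<bullet> kg p)"
    using dird_kap[OF p, of "(\<omega>, 0)"] dird_kap_s[OF p] Mr_pos[OF p] by (simp add: field_simps)
  ultimately have "((\<lambda>t. Mr [] (?l t)) has_real_derivative Mr [] p * (\<omega> \<bullet> kg p)) (at 0)"
    unfolding l0 by (simp add: has_real_derivative_iff_has_vector_derivative)
  from DERIV_cdivide[OF this, of "Mr [] p"]
  have d1: "((\<lambda>t. Mr [] (?l t) / Mr [] p) has_real_derivative (\<omega> \<bullet> kg p)) (at 0)"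
    using Mr_pos[OF p] by simp
  have d2: "((\<lambda>t. exp (- t * (\<omega> \<bullet> kg p))) has_real_derivative (- (\<omega> \<bullet> kg p))) (at 0)"
    by (auto intro!: derivative_eq_intros)
  have h: "(?h has_real_derivative 0) (at 0)"
    using DERIV_mult[OF d1 d2] Mr_pos[OF p] unfolding l0 by simp
  have h': "((\<lambda>t. ?h (- t)) has_real_derivative 0) (at 0)"
  proof -
    have um: "(uminus has_real_derivative - 1) (at (0::real))" by (auto intro!: derivative_eq_intros)
    have "((\<lambda>t. ?h (- t)) has_real_derivative 0 * (- 1)) (at 0)"
      by (rule DERIV_chain2[where f = ?h, OF _ um]) (simp only: minus_zero h)
    then show ?thesis by (simp only: mult_zero_left)
  qed
  have h0: "?h 0 = 1" using Mr_pos[OF p] unfolding l0 by simp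
  have 1: "((\<lambda>t. (?h t - ?h (- t)) / t) \<longlongrightarrow> 0) (at 0)"
    by (rule tendsto_div_at_0) (use DERIV_diff[OF h h'] in \<open>auto simp: has_real_derivative_iff_has_vector_derivative\<close>)
  have "((\<lambda>t. ?h t + ?h (- t) - 2) has_real_derivative 0 + 0 - 0) (at 0)"
    by (intro DERIV_diff DERIV_add h h' DERIV_const)
  then have 2: "((\<lambda>t. (?h t + ?h (- t) - 2) / t) \<longlongrightarrow> 0) (at 0)"
    by (intro tendsto_div_at_0) (use h0 in \<open>auto simp: has_real_derivative_iff_has_vector_derivative\<close>)
  have ev: "\<forall>\<^sub>F t in at 0. Tl p \<omega> (of_real t) = of_real (?h t) \<and> Tl p \<omega> (- of_real t) = of_real (?h (- t))"
  proof -
    have "\<forall>\<^sub>F t::real in at 0. t \<in> {- r<..<r}" using r(1) by (intro eventually_at_in_open') auto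
    then show ?thesis
    proof eventually_elim
      case (elim t)
      then have t: "\<bar>t\<bar> < r" "\<bar>- t\<bar> < r" by (auto simp: abs_less_iff)
      have "?l t \<in> U" "?l (- t) \<in> U" by (rule r(2)[OF t(1)], rule r(2)[OF t(2)])
      from Tl_real[OF this(1) p] Tl_real[OF this(2) p] show ?case by simp
    qed
  qed
  have "((\<lambda>t. complex_of_real ((?h t - ?h (- t)) / t)) \<longlongrightarrow> 0) (at 0)"
    using tendsto_of_real[OF 1, where 'a = complex] by simp
  moreover have "\<forall>\<^sub>F t in at 0. complex_of_real ((?h t - ?h (- t)) / t) = (Tl p \<omega> (of_real t) - Tl p \<omega> (- of_real t)) / of_real t ^ 1"
    using ev by eventually_elim simp
  ultimately show "((\<lambda>t::real. (Tl p \<omega> (of_real t) - Tl p \<omega> (- of_real t)) / of_real t ^ 1) \<longlongrightarrow> 0) (at 0)"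
    by (rule Lim_transform_eventually)
  have "((\<lambda>t. complex_of_real ((?h t + ?h (- t) - 2) / t)) \<longlongrightarrow> 0) (at 0)"
    using tendsto_of_real[OF 2, where 'a = complex] by simp
  moreover have "\<forall>\<^sub>F t in at 0. complex_of_real ((?h t + ?h (- t) - 2) / t) = (Tl p \<omega> (of_real t) + Tl p \<omega> (- of_real t) - 2) / of_real t ^ 1"
    using ev by eventually_elim simp
  ultimately show "((\<lambda>t::real. (Tl p \<omega> (of_real t) + Tl p \<omega> (- of_real t) - 2) / of_real t ^ 1) \<longlongrightarrow> 0) (at 0)"
    by (rule Lim_transform_eventually)
qed

end

section \<open>The Laplace bounds for the centred transform\<close>

context saddle_model
begin

lemma Tn_eq: "Tn p \<phi> = M0 P Y (cvec (fst p) \<phi>) (snd p) / of_real (mgf (fst p) (snd p)) * exp (- (\<i> * of_real (\<phi> \<bullet> kg p)))"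
  by (simp add: Tn_def Tl_def)

lemma Fn_eq: "Fn e p \<phi> = (dM [] \<phi> (sa p e, e) p - of_real (dird (sa p e, e) kap p) * M0 P Y (cvec (fst p) \<phi>) (snd p)
      + \<i> * (dM [] \<phi> (Cm e p *v \<phi>, 0) p - of_real (kg p \<bullet> (Cm e p *v \<phi>)) * M0 P Y (cvec (fst p) \<phi>) (snd p)))
     / of_real (mgf (fst p) (snd p)) * exp (- (\<i> * of_real (\<phi> \<bullet> kg p)))"
  by (simp add: Fn_def Fl_def)

lemma M0_cont: "p \<in> U \<Longrightarrow> continuous_on UNIV (\<lambda>\<phi>. M0 P Y (cvec (fst p) \<phi>) (snd p))"
  using M0_phi_continuous[of "fst p" "snd p"] by simp

lemma dM0_cont:
  assumes "p \<in> U" "length is \<le> 1" "length is + length js = 1"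
  shows "continuous_on UNIV (\<lambda>\<phi>. dM0 P Y is js (cvec (fst p) \<phi>) (snd p))"
  by (rule dM0_continuous_compose) (use assms in \<open>auto intro!: continuous_intros\<close>)

lemma exp_cont: "continuous_on UNIV (\<lambda>\<phi>::real^'d. exp (- (\<i> * of_real (\<phi> \<bullet> y))))"
  by (intro continuous_intros)

lemma mgf_nz: "p \<in> U \<Longrightarrow> complex_of_real (mgf (fst p) (snd p)) \<noteq> 0"
  using mgf_pos[of "fst p" "snd p"] by simp

lemma Tn_cont: "p \<in> U \<Longrightarrow> continuous_on UNIV (Tn p)"
  unfolding Tn_eq[abs_def] by (intro continuous_on_mult continuous_on_divide M0_cont exp_cont continuous_on_const) (use mgf_nz in auto)

lemma dM_cont:
  assumes "p \<in> U" "continuous_on UNIV f"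
  shows "continuous_on UNIV (\<lambda>\<phi>. dM [] \<phi> (f \<phi>, e) p)"
  unfolding dM_def fst_conv snd_conv
  using assms by (intro continuous_on_add continuous_on_sum continuous_on_scaleR continuous_on_nth dM0_cont continuous_on_const) auto

lemma Cm_cont: "continuous_on UNIV (\<lambda>\<phi>. Cm e p *v \<phi>)"
  by (intro continuous_on_matrix_vector_mult continuous_intros)

lemma Fn_cont: "p \<in> U \<Longrightarrow> continuous_on UNIV (Fn e p)"
  unfolding Fn_eq[abs_def]
  by (intro continuous_on_mult continuous_on_divide continuous_on_add continuous_on_diff M0_cont exp_cont dM_cont Cm_cont
      continuous_on_of_real continuous_on_inner continuous_on_const) (use mgf_nz in auto)

lemma norm_exp_i: "norm (exp (- (\<i> * complex_of_real x))) = 1"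
  using norm_exp_i_times[of "- x"] by simp

lemma norm_Tn: "p \<in> U \<Longrightarrow> norm (Tn p \<phi>) = norm (M0 P Y (cvec (fst p) \<phi>) (snd p) / of_real (mgf (fst p) (snd p)))"
  unfolding Tn_eq norm_mult[of _ "exp _"] norm_exp_i by simp

lemma norm_Tn_le: "p \<in> U \<Longrightarrow> norm (Tn p \<phi>) \<le> 1"
  using norm_M0_le[of "fst p" "snd p" \<phi>] mgf_pos[of "fst p" "snd p"] by (simp add: norm_Tn norm_divide divide_le_eq)

lemma Tn_cnj: "p \<in> U \<Longrightarrow> Tn p (- \<phi>) = cnj (Tn p \<phi>)"
  using M0_cnj[of "fst p" "snd p" \<phi>] by (simp add: Tn_eq exp_cnj)

lemma Tn_integrable:
  assumes K: "compact K" "K \<subseteq> U"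
  obtains n1 where "1 \<le> n1" "\<And>p k g C. p \<in> K \<Longrightarrow> n1 \<le> k \<Longrightarrow> continuous_on UNIV g \<Longrightarrow> (\<And>\<phi>. norm (g \<phi>) \<le> C * (1 + norm \<phi>) ^ M) \<Longrightarrow>
    integrable lborel (\<lambda>\<phi>. g \<phi> * Tn p \<phi> ^ k)"
proof -
  obtain c n1 where c: "0 < c" "1 \<le> n1"
    "\<And>n s \<theta> \<phi>. n1 \<le> n \<Longrightarrow> (s, \<theta>) \<in> K \<Longrightarrow> norm (M0 P Y (cvec s \<phi>) \<theta> / of_real (mgf s \<theta>)) ^ n \<le> 1 / (1 + c * real n * (norm \<phi>)\<^sup>2) ^ (M + CARD('d))"
    using M0_decay[OF K, of "M + CARD('d)"] by blast
  have "integrable lborel (\<lambda>\<phi>. g \<phi> * Tn p \<phi> ^ k)"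
    if p: "p \<in> K" and k: "n1 \<le> k" and g: "continuous_on UNIV g" "\<And>\<phi>. norm (g \<phi>) \<le> C * (1 + norm \<phi>) ^ M" for p k g C
  proof (rule Bochner_Integration.integrable_bound)
    have pU: "p \<in> U" using p K by blast
    show "integrable lborel (\<lambda>\<phi>::real^'d. C * moment_kernel 0 M (M + CARD('d)) (c * real k) \<phi>)"
      using c k by (intro integrable_mult_right integrable_moment_kernel) auto
    show "(\<lambda>\<phi>. g \<phi> * Tn p \<phi> ^ k) \<in> borel_measurable lborel"
      using borel_measurable_continuous_onI[OF g(1)] borel_measurable_continuous_onI[OF Tn_cont[OF pU]] by simp
    show "AE \<phi> in lborel. norm (g \<phi> * Tn p \<phi> ^ k) \<le> norm (C * moment_kernel 0 M (M + CARD('d)) (c * real k) \<phi>)"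
    proof (rule AE_I2)
      fix \<phi> :: "real ^ 'd"
      have "norm (g \<phi> * Tn p \<phi> ^ k) = norm (g \<phi>) * norm (Tn p \<phi>) ^ k" by (simp add: norm_mult norm_power)
      also have "\<dots> \<le> (C * (1 + norm \<phi>) ^ M) * (1 / (1 + c * real k * (norm \<phi>)\<^sup>2) ^ (M + CARD('d)))"
      proof (intro mult_mono g)
        show "norm (Tn p \<phi>) ^ k \<le> 1 / (1 + c * real k * (norm \<phi>)\<^sup>2) ^ (M + CARD('d))"
          unfolding norm_Tn[OF pU] using c(3)[OF k, of "fst p" "snd p" \<phi>] p by simp
        show "0 \<le> C * (1 + norm \<phi>) ^ M" using order_trans[OF norm_ge_zero g(2)] .
      qed auto
      also have "\<dots> = C * moment_kernel 0 M (M + CARD('d)) (c * real k) \<phi>" by (simp add: moment_kernel_def)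
      finally show "norm (g \<phi> * Tn p \<phi> ^ k) \<le> norm (C * moment_kernel 0 M (M + CARD('d)) (c * real k) \<phi>)" by simp
    qed
  qed
  then show ?thesis using that c(2) by blast
qed

text \<open>Each hypothesis of the Laplace bounds is verified with constants depending on
  \<open>K\<close> and \<open>e\<close> alone. Near 0 they come from bounds on a disc of radius
  \<open>r0\<close> in \<zeta>, away from 0 from polynomial growth.\<close>

lemma laplace_model:
  assumes K: "compact K" "K \<subseteq> U"
  obtains n0 B where "1 \<le> n0" "\<And>p n. p \<in> K \<Longrightarrow> n0 \<le> n \<Longrightarrow> 0 < Re (\<integral>\<phi>. Tn p \<phi> ^ n \<partial>lborel)"
    "\<And>p n. p \<in> K \<Longrightarrow> n0 \<le> n \<Longrightarrow>
      real n * norm ((\<integral>\<phi>. Fn e p \<phi> * Tn p \<phi> ^ (n - 1) \<partial>lborel) / (\<integral>\<phi>. Tn p \<phi> ^ n \<partial>lborel)) \<le> B / real n"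
proof -
  obtain K' \<rho>' where K': "compact K'" "K' \<subseteq> U" "0 < \<rho>'" "K \<subseteq> K'"
    and nb': "\<And>s \<theta> v e. (s, \<theta>) \<in> K \<Longrightarrow> norm v \<le> \<rho>' \<Longrightarrow> norm e \<le> \<rho>' \<Longrightarrow> (s + v, \<theta> + e) \<in> K'"
    using compact_thicken[OF K(1) open_interior K(2)] by blast
  \<comment> \<open>Capping at 1 keeps the imaginary parts on the disc at norm at most 1, so the
    growth bounds there become constants and the centring factor is at most exp G.\<close>
  define \<rho> where "\<rho> = min \<rho>' 1"
  have \<rho>: "0 < \<rho>" "\<rho> \<le> 1" using K'(3) by (auto simp: \<rho>_def)
  have nb: "(s + v, \<theta> + e) \<in> K'" if "(s, \<theta>) \<in> K" "norm v \<le> \<rho>" "norm e \<le> \<rho>" for s \<theta> v e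
    by (rule nb'[OF that(1)]) (use that in \<open>auto simp: \<rho>_def\<close>)
  define r0 where "r0 = \<rho> / 2"
  have r0: "0 < r0" "r0 < 1" using \<rho> by (auto simp: r0_def)
  obtain G where G: "1 \<le> G" "\<And>p. p \<in> K \<Longrightarrow> norm (kg p) \<le> G" "\<And>p. p \<in> K \<Longrightarrow> norm (sa p e) \<le> G"
    "\<And>p v. p \<in> K \<Longrightarrow> norm (Cm e p *v v) \<le> G * norm v" "\<And>p. p \<in> K \<Longrightarrow> \<bar>dird (sa p e, e) kap p\<bar> \<le> G"
    using saddle_constants[OF K, of e] by blast
  obtain C N0 where C: "1 \<le> C" and dM0C: "\<And>is js s \<theta> \<phi>. length is \<le> 1 \<Longrightarrow> 1 \<le> length is + length js \<Longrightarrow> length is + length js \<le> 6 \<Longrightarrow> (s, \<theta>) \<in> K' \<Longrightarrow>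
    cmod (dM0 P Y is js (cvec s \<phi>) \<theta>) \<le> C * (1 + norm \<phi>) ^ N0"
    using dM0_bound[OF K'(1,2)] by blast
  have m': "continuous_on K' (\<lambda>p. mgf (fst p) (snd p))" by (rule continuous_on_subset[OF mgf_continuous K'(2)])
  have mpos: "0 < mgf (fst p) (snd p)" if "p \<in> U" for p using mgf_pos[of "fst p" "snd p"] that by simp
  obtain M1 where M1: "1 \<le> M1" "\<And>p. p \<in> K' \<Longrightarrow> norm (mgf (fst p) (snd p)) \<le> M1"
    by (rule compact_bound[OF K'(1) m']) (rule that)
  have "continuous_on K' (\<lambda>p. 1 / mgf (fst p) (snd p))"
    using mpos K'(2) by (intro continuous_on_divide m' continuous_on_const) (auto simp: less_imp_neq[symmetric] subset_iff)
  then obtain M2 where M2: "1 \<le> M2" "\<And>p. p \<in> K' \<Longrightarrow> norm (1 / mgf (fst p) (snd p)) \<le> M2"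
    by (rule compact_bound[OF K'(1)]) (rule that)
  define q where "q = real (CARD('d) + CARD('p))"
  have q: "0 \<le> q" by (simp add: q_def)
  define E where "E = exp G"
  have E: "1 \<le> E" using G(1) by (simp add: E_def)
  define X where "X = C * 2 ^ N0"
  have X: "0 \<le> X" using C by (simp add: X_def)
  \<comment> \<open>\<open>S1\<close> bounds \<open>Fl\<close> and \<open>S2\<close> bounds
    \<open>Tl\<close> on the disc; \<open>S3\<close> is the constant in the polynomial growth of
    \<open>Fn\<close>. Their sum \<open>S\<close> serves for all three.\<close>
  define S1 where "S1 = (q * (G + norm e) * X + G * M1 + (q * G * X + G * G * M1)) * M2 * E"
  define S2 where "S2 = M1 * M2 * E"
  define S3 where "S3 = (q * (G + norm e) * C + G * M1 + (q * G * C + G * G * M1)) * M2"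
  have S0: "0 \<le> S1" "0 \<le> S2" "0 \<le> S3"
    unfolding S1_def S2_def S3_def using q G(1) X M1(1) M2(1) E C by (auto intro!: mult_nonneg_nonneg add_nonneg_nonneg)
  define S where "S = S1 + S2 + S3"
  have SS: "0 \<le> S" "S1 \<le> S" "S2 \<le> S" "S3 \<le> S" using S0 by (auto simp: S_def)
  have M0b: "norm (M0 P Y (cvec (fst p) \<phi>) (snd p)) \<le> M1" if "p \<in> K'" for p \<phi>
    using norm_M0_le[of "fst p" "snd p" \<phi>] M1(2)[OF that] that K'(2) by force
  have dMb: "norm (dM [] \<phi> v p) \<le> q * norm v * (C * (1 + norm \<phi>) ^ N0)" if "p \<in> K'" for p \<phi> v
    unfolding q_def using that by (intro norm_dM_le dM0C) auto
  have w: "norm (sa p e, e) \<le> G + norm e" if "p \<in> K" for p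
    using norm_Pair_le[of "sa p e" e] G(3)[OF that] by simp
  have ky: "\<bar>kg p \<bullet> (Cm e p *v v)\<bar> \<le> G * (G * norm v)" if "p \<in> K" for p v
    using Cauchy_Schwarz_ineq2[of "kg p" "Cm e p *v v"] mult_mono[OF G(2)[OF that] G(4)[OF that, of v]] G(1) by simp
  \<comment> \<open>The coefficients are frozen at \<open>p\<close>, the transform is evaluated at
    \<open>p'\<close>. On the complex line p' is p shifted by the real part of \<zeta>; for
    \<open>Fn\<close> the two coincide and \<zeta> is the imaginary unit.\<close>
  have num: "norm (dM [] \<phi> (sa p e, e) p' - of_real (dird (sa p e, e) kap p) * M0 P Y (cvec (fst p') \<phi>) (snd p')
      + \<zeta> * (dM [] \<phi> (Cm e p *v v, 0) p' - of_real (kg p \<bullet> (Cm e p *v v)) * M0 P Y (cvec (fst p') \<phi>) (snd p')))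
    \<le> q * (G + norm e) * (C * (1 + norm \<phi>) ^ N0) + G * M1 + (q * G * (C * (1 + norm \<phi>) ^ N0) + G * G * M1) * (norm \<zeta> * norm v)"
    if p: "p \<in> K" and p': "p' \<in> K'" for p p' \<phi> \<zeta> v
  proof -
    let ?Z = "C * (1 + norm \<phi>) ^ N0"
    have Z: "0 \<le> ?Z" using C by simp
    have 1: "norm (dM [] \<phi> (sa p e, e) p') \<le> q * (G + norm e) * ?Z"
      by (rule order_trans[OF dMb[OF p']]) (intro mult_right_mono mult_left_mono w p q Z)
    have 2: "norm (of_real (dird (sa p e, e) kap p) * M0 P Y (cvec (fst p') \<phi>) (snd p')) \<le> G * M1"
      unfolding norm_mult norm_of_real using G(1) by (intro mult_mono G(5) p M0b p') auto
    have 3: "norm (dM [] \<phi> (Cm e p *v v, 0) p') \<le> q * (G * norm v) * ?Z"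
      by (rule order_trans[OF dMb[OF p']]) (use G(4)[OF p, of v] q Z in \<open>auto simp: norm_Pair intro!: mult_right_mono mult_left_mono\<close>)
    have 4: "norm (of_real (kg p \<bullet> (Cm e p *v v)) * M0 P Y (cvec (fst p') \<phi>) (snd p')) \<le> (G * (G * norm v)) * M1"
      unfolding norm_mult norm_of_real using G(1) by (intro mult_mono ky p M0b p') auto
    have "norm (\<zeta> * (dM [] \<phi> (Cm e p *v v, 0) p' - of_real (kg p \<bullet> (Cm e p *v v)) * M0 P Y (cvec (fst p') \<phi>) (snd p')))
      \<le> norm \<zeta> * (q * (G * norm v) * ?Z + (G * (G * norm v)) * M1)"
      unfolding norm_mult[of \<zeta>] using 3 4 by (intro mult_left_mono norm_triangle_le_diff add_mono) auto
    also have "\<dots> = (q * G * ?Z + G * G * M1) * (norm \<zeta> * norm v)" by (simp add: algebra_simps)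
    finally show ?thesis using 1 2 by (intro norm_triangle_le add_mono norm_triangle_le_diff) auto
  qed
  have line: "(fst p + Re \<zeta> *\<^sub>R \<omega>, snd p) \<in> K'" "norm (Im \<zeta> *\<^sub>R \<omega>) \<le> 1" "norm (exp (- \<zeta> * of_real (\<omega> \<bullet> kg p))) \<le> E"
    if p: "p \<in> K" and z: "norm \<zeta> < r0" and \<omega>: "norm \<omega> \<le> 1" for p \<omega> \<zeta>
  proof -
    have "\<bar>Re \<zeta>\<bar> * norm \<omega> \<le> r0 * 1" using abs_Re_le_cmod[of \<zeta>] z \<omega> r0 by (intro mult_mono) auto
    then show "(fst p + Re \<zeta> *\<^sub>R \<omega>, snd p) \<in> K'"
      using nb[of "fst p" "snd p" "Re \<zeta> *\<^sub>R \<omega>" 0] p \<rho> by (simp add: r0_def)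
    have "\<bar>Im \<zeta>\<bar> * norm \<omega> \<le> 1 * 1" using abs_Im_le_cmod[of \<zeta>] z \<omega> r0 by (intro mult_mono) auto
    then show "norm (Im \<zeta> *\<^sub>R \<omega>) \<le> 1" by simp
    have "\<bar>\<omega> \<bullet> kg p\<bar> \<le> norm \<omega> * norm (kg p)" by (rule Cauchy_Schwarz_ineq2)
    also have "\<dots> \<le> 1 * G" using \<omega> G(2)[OF p] by (intro mult_mono) auto
    finally have "norm \<zeta> * \<bar>\<omega> \<bullet> kg p\<bar> \<le> 1 * G" using z r0 by (intro mult_mono) auto
    then have "norm (- \<zeta> * of_real (\<omega> \<bullet> kg p)) \<le> G" by (simp add: norm_mult)
    then show "norm (exp (- \<zeta> * of_real (\<omega> \<bullet> kg p))) \<le> E"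
      unfolding E_def using norm_exp[of "- \<zeta> * of_real (\<omega> \<bullet> kg p)"] by (meson exp_le_cancel_iff order_trans)
  qed
  have Fb: "norm (Fl e p \<omega> \<zeta>) \<le> S" if p: "p \<in> K" and z: "norm \<zeta> < r0" and \<omega>: "norm \<omega> \<le> 1" for p \<omega> \<zeta>
  proof -
    note l = line[OF p z \<omega>]
    let ?Z = "C * (1 + norm (Im \<zeta> *\<^sub>R \<omega>)) ^ N0"
    have Z: "?Z \<le> X" unfolding X_def using C l(2) by (intro mult_left_mono power_mono) auto
    have zv: "norm \<zeta> * norm \<omega> \<le> 1" using mult_mono[of "norm \<zeta>" 1 "norm \<omega>" 1] z \<omega> r0 by simp
    have b: "q * (G + norm e) * ?Z + G * M1 + (q * G * ?Z + G * G * M1) * (norm \<zeta> * norm \<omega>)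
      \<le> q * (G + norm e) * X + G * M1 + (q * G * X + G * G * M1) * 1"
      using q G(1) Z zv X M1(1) C by (intro add_mono mult_mono mult_left_mono order_refl) (auto intro!: add_nonneg_nonneg mult_nonneg_nonneg)
    have "norm (Fl e p \<omega> \<zeta>) \<le> (q * (G + norm e) * X + G * M1 + (q * G * X + G * G * M1) * 1) * M2 * E"
      unfolding Fl_def norm_mult[of _ "exp _"] divide_inverse norm_mult[of _ "inverse _"]
    proof (intro mult_mono l(3))
      show "norm (inverse (complex_of_real (mgf (fst p) (snd p)))) \<le> M2"
        using M2(2)[of p] p K'(4) by (auto simp: norm_inverse norm_divide inverse_eq_divide)
    qed (use order_trans[OF num[OF p l(1)] b] q G(1) X M1(1) M2(1) in \<open>auto intro!: add_nonneg_nonneg mult_nonneg_nonneg\<close>)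
    then show ?thesis using SS(2) by (simp add: S1_def)
  qed
  have Tb: "norm (Tl p \<omega> \<zeta>) \<le> S" if p: "p \<in> K" and z: "norm \<zeta> < r0" and \<omega>: "norm \<omega> \<le> 1" for p \<omega> \<zeta>
  proof -
    note l = line[OF p z \<omega>]
    have "norm (Tl p \<omega> \<zeta>) \<le> M1 * M2 * E"
      unfolding Tl_def norm_mult[of _ "exp _"] divide_inverse norm_mult[of _ "inverse _"]
    proof (intro mult_mono l(3))
      show "norm (inverse (complex_of_real (mgf (fst p) (snd p)))) \<le> M2"
        using M2(2)[of p] p K'(4) by (auto simp: norm_inverse norm_divide inverse_eq_divide)
    qed (use M0b[OF l(1)] M1(1) M2(1) in auto)
    then show ?thesis using SS(3) by (simp add: S2_def)
  qed
  \<comment> \<open>The exponent exceeds \<open>N0\<close> by one because the coefficient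
    \<open>Cm e p *v \<phi>\<close> is linear in \<phi>.\<close>
  have Fg: "norm (Fn e p \<phi>) \<le> S * (1 + norm \<phi>) ^ Suc N0" if p: "p \<in> K" for p \<phi>
  proof -
    let ?w = "1 + norm \<phi>"
    have w1: "1 \<le> ?w" by simp
    have wN: "?w ^ N0 \<le> ?w ^ Suc N0" "1 \<le> ?w ^ Suc N0" "norm \<phi> \<le> ?w ^ Suc N0" "?w ^ N0 * norm \<phi> \<le> ?w ^ Suc N0"
    proof -
      show "?w ^ N0 \<le> ?w ^ Suc N0" by (rule power_increasing) auto
      show "1 \<le> ?w ^ Suc N0" by (rule one_le_power[OF w1])
      have "?w ^ 1 \<le> ?w ^ Suc N0" by (rule power_increasing) auto
      then show "norm \<phi> \<le> ?w ^ Suc N0" by simp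
      show "?w ^ N0 * norm \<phi> \<le> ?w ^ Suc N0" by (simp add: mult.commute mult_right_mono)
    qed
    have pK': "p \<in> K'" using p K'(4) by blast
    have "norm (Fn e p \<phi>) \<le> (q * (G + norm e) * (C * ?w ^ N0) + G * M1 + (q * G * (C * ?w ^ N0) + G * G * M1) * norm \<phi>) * M2"
      unfolding Fn_eq norm_mult[of _ "exp _"] norm_exp_i mult_1_right divide_inverse norm_mult[of _ "inverse _"]
    proof (intro mult_mono)
      show "norm (inverse (complex_of_real (mgf (fst p) (snd p)))) \<le> M2"
        using M2(2)[OF pK'] by (auto simp: norm_inverse norm_divide inverse_eq_divide)
    qed (use num[OF p pK', of \<phi> \<i> \<phi>] q G(1) M1(1) M2(1) C in \<open>auto intro!: add_nonneg_nonneg mult_nonneg_nonneg\<close>)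
    also have "\<dots> = (q * (G + norm e) * C * ?w ^ N0 + G * M1 * 1 + (q * G * C * (?w ^ N0 * norm \<phi>) + G * G * M1 * norm \<phi>)) * M2"
      by (simp add: algebra_simps)
    also have "\<dots> \<le> (q * (G + norm e) * C * ?w ^ Suc N0 + G * M1 * ?w ^ Suc N0 + (q * G * C * ?w ^ Suc N0 + G * G * M1 * ?w ^ Suc N0)) * M2"
      using wN q G(1) M1(1) M2(1) C by (intro mult_right_mono add_mono mult_left_mono) (auto intro!: mult_nonneg_nonneg add_nonneg_nonneg)
    also have "\<dots> = S3 * ?w ^ Suc N0" by (simp add: S3_def algebra_simps)
    also have "\<dots> \<le> S * ?w ^ Suc N0" using SS(4) by (intro mult_right_mono) auto
    finally show ?thesis .
  qed
  have hol: "Fl e p \<omega> holomorphic_on ball 0 r0" "Tl p \<omega> holomorphic_on ball 0 r0" if p: "p \<in> K" and \<omega>: "norm \<omega> \<le> 1" for p \<omega>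
  proof -
    have nbU: "(fst p + v, snd p + e) \<in> U" if "norm v \<le> \<rho>" "norm e \<le> \<rho>" for v e
      using nb[of "fst p" "snd p" v e] that p K'(2) by auto
    have pU: "p \<in> U" using p K by blast
    note h = M0_holo[OF nbU \<rho>(1) \<omega>, of 0, simplified] dM_holo[OF nbU \<rho>(1) \<omega>, of 0, simplified]
    show "Fl e p \<omega> holomorphic_on ball 0 r0" "Tl p \<omega> holomorphic_on ball 0 r0"
      unfolding Fl_def[abs_def] Tl_def[abs_def] r0_def using h mgf_nz[OF pU] by (intro holomorphic_intros; simp)+
  qed
  \<comment> \<open>Norm at most 1 instead of equal to 1 lets \<phi> = 0 take part: there the
    division by zero yields \<omega> = 0.\<close>
  have dec: "\<exists>\<tau> \<omega>. \<phi> = \<tau> *\<^sub>R \<omega> \<and> norm \<omega> \<le> 1 \<and> \<tau> = norm \<phi>" for \<phi> :: "real ^ 'd"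
    by (rule exI[of _ "norm \<phi>"], rule exI[of _ "\<phi> /\<^sub>R norm \<phi>"]) (cases "\<phi> = 0"; simp)
  define N where "N = Suc N0"
  \<comment> \<open>\<open>C4\<close> covers the cubic bound S / r0 ^ 3 for \<open>Fn\<close> and
    the quartic one 2 S / r0 ^ 4 for its even part; \<open>C3\<close> covers 2 S on the disc and the
    trivial bound 2 outside it; \<open>C2\<close> is half of the disc bound 2 S + 2, divided by
    r0^2.\<close>
  define C4 where "C4 = 2 * S / r0 ^ 3 + 2 * S / r0 ^ 4"
  define C3 where "C3 = (2 * S + 2) / r0 ^ 3"
  define C2 where "C2 = (S + 1) / r0\<^sup>2"
  \<comment> \<open>Chosen so that C2 r^2 equals 1 / (4 (S + 1)), which is at most 1 / 2.\<close>
  define r where "r = r0 / (2 * (S + 1))"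
  define PP where "PP = 6 + N + DIM(real^'d)"
  have r: "0 < r" "r \<le> r0"
  proof -
    show "0 < r" using r0 SS by (simp add: r_def)
    have "r0 * 1 \<le> r0 * (2 * (S + 1))" using r0 SS by (intro mult_left_mono) auto
    then show "r \<le> r0" using SS by (simp add: r_def divide_le_eq)
  qed
  have Cpos: "0 \<le> C4" "0 \<le> C3" "0 \<le> C2" using SS r0 by (auto simp: C4_def C3_def C2_def)
  have C2r: "C2 * r\<^sup>2 \<le> 1 / 2"
  proof -
    have "C2 * r\<^sup>2 = 1 / (4 * (S + 1))" using r0 SS by (simp add: C2_def r_def power2_eq_square divide_simps) (simp add: algebra_simps)
    also have "\<dots> \<le> 1 / 2" using SS by (intro divide_left_mono) auto
    finally show ?thesis .
  qed
  obtain c n1 where c: "0 < c" "1 \<le> n1"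
    "\<And>n s \<theta> \<phi>. n1 \<le> n \<Longrightarrow> (s, \<theta>) \<in> K \<Longrightarrow> norm (M0 P Y (cvec s \<phi>) \<theta> / of_real (mgf s \<theta>)) ^ n \<le> 1 / (1 + c * real n * (norm \<phi>)\<^sup>2) ^ PP"
    using M0_decay[OF K, of PP] by blast
  \<comment> \<open>Outside the disc any power of |\<phi>| / r0 may be inserted for free, which
    turns a bound without order of vanishing into one with the order required.\<close>
  have big: "1 \<le> (norm \<phi> / r0) ^ k" if "\<not> norm \<phi> < r0" for \<phi> :: "real ^ 'd" and k
    using that r0 by (intro one_le_power) auto
  have hypT: "norm (Tn p \<phi> - Tn p (- \<phi>)) \<le> C3 * norm \<phi> ^ 3" if p: "p \<in> K" for p \<phi>
  proof (cases "norm \<phi> < r0")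
    case True
    have pU: "p \<in> U" using p K by blast
    obtain \<tau> \<omega> where d: "\<phi> = \<tau> *\<^sub>R \<omega>" "norm \<omega> \<le> 1" "\<tau> = norm \<phi>" using dec by blast
    let ?O = "\<lambda>\<zeta>. Tl p \<omega> \<zeta> - Tl p \<omega> (- \<zeta>)"
    have "(Tl p \<omega> \<circ> uminus) holomorphic_on ball 0 r0"
      by (rule holomorphic_on_compose_gen[OF _ hol(2)[OF p d(2)]]) (auto intro!: holomorphic_intros)
    then have hO: "?O holomorphic_on ball 0 r0" using hol(2)[OF p d(2)] by (intro holomorphic_intros) (auto simp: o_def)
    have "norm (?O (\<i> * of_real \<tau>)) \<le> (2 * S) / r0 ^ (1 + 2) * norm (\<i> * complex_of_real \<tau>) ^ (1 + 2)"
    proof (rule holomorphic_order_bound_parity[OF hO _ r0(1) Tl_order(1)[OF pU]])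
      show "norm (?O z) \<le> 2 * S" if "norm z < r0" for z
        using norm_triangle_ineq4[of "Tl p \<omega> z" "Tl p \<omega> (- z)"] Tb[OF p that d(2)] Tb[OF p _ d(2), of "- z"] that by simp
      show "norm (\<i> * complex_of_real \<tau>) < r0" using True d(3) by (simp add: norm_mult)
    qed simp
    moreover have "Tn p \<phi> - Tn p (- \<phi>) = ?O (\<i> * of_real \<tau>)"
      using Tl_scale[of p \<tau> \<omega>] Tl_scale[of p "- \<tau>" \<omega>] by (simp add: Tn_def d(1))
    ultimately have "norm (Tn p \<phi> - Tn p (- \<phi>)) \<le> (2 * S) / r0 ^ 3 * norm \<phi> ^ 3"
      by (simp add: norm_mult d(3) eval_nat_numeral)
    also have "\<dots> \<le> C3 * norm \<phi> ^ 3" unfolding C3_def using r0 by (intro mult_right_mono divide_right_mono) auto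
    finally show ?thesis .
  next
    case False
    have pU: "p \<in> U" using p K by blast
    have "norm (Tn p \<phi> - Tn p (- \<phi>)) \<le> 2 * 1"
      using norm_triangle_ineq4[of "Tn p \<phi>" "Tn p (- \<phi>)"] norm_Tn_le[OF pU, of \<phi>] norm_Tn_le[OF pU, of "- \<phi>"] by simp
    also have "\<dots> \<le> (2 * S + 2) * (norm \<phi> / r0) ^ 3" using big[OF False, of 3] SS by (intro mult_mono) auto
    finally show ?thesis by (simp add: C3_def power_divide)
  qed
  have hypR: "1 - C2 * (norm \<phi>)\<^sup>2 \<le> Re (Tn p \<phi>)" if p: "p \<in> K" and n: "norm \<phi> < r" for p \<phi>
  proof -
    have n0: "norm \<phi> < r0" using n r by linarith
    have pU: "p \<in> U" using p K by blast
    obtain \<tau> \<omega> where d: "\<phi> = \<tau> *\<^sub>R \<omega>" "norm \<omega> \<le> 1" "\<tau> = norm \<phi>" using dec by blast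
    let ?O = "\<lambda>\<zeta>. Tl p \<omega> \<zeta> + Tl p \<omega> (- \<zeta>) - 2"
    have "(Tl p \<omega> \<circ> uminus) holomorphic_on ball 0 r0"
      by (rule holomorphic_on_compose_gen[OF _ hol(2)[OF p d(2)]]) (auto intro!: holomorphic_intros)
    then have hO: "?O holomorphic_on ball 0 r0" using hol(2)[OF p d(2)] by (intro holomorphic_intros) (auto simp: o_def)
    have "norm (?O (\<i> * of_real \<tau>)) \<le> (2 * S + 2) / r0 ^ Suc 1 * norm (\<i> * complex_of_real \<tau>) ^ Suc 1"
    proof (rule holomorphic_order_bound[OF hO _ r0(1) Tl_order(2)[OF pU]])
      show "norm (?O z) \<le> 2 * S + 2" if "norm z < r0" for z
        using norm_triangle_ineq4[of "Tl p \<omega> z + Tl p \<omega> (- z)" 2] norm_triangle_ineq[of "Tl p \<omega> z" "Tl p \<omega> (- z)"]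
          Tb[OF p that d(2)] Tb[OF p _ d(2), of "- z"] that by simp
      show "norm (\<i> * complex_of_real \<tau>) < r0" using n0 d(3) by (simp add: norm_mult)
    qed
    moreover have "?O (\<i> * of_real \<tau>) = of_real (2 * (Re (Tn p \<phi>) - 1))"
    proof -
      have "?O (\<i> * of_real \<tau>) = Tn p \<phi> + Tn p (- \<phi>) - 2"
        using Tl_scale[of p \<tau> \<omega>] Tl_scale[of p "- \<tau>" \<omega>] by (simp add: Tn_def d(1))
      then show ?thesis unfolding Tn_cnj[OF pU] by (simp add: complex_eq_iff)
    qed
    ultimately have "norm (complex_of_real (2 * (Re (Tn p \<phi>) - 1))) \<le> (2 * S + 2) / r0\<^sup>2 * (norm \<phi>)\<^sup>2"
      by (simp add: norm_mult d(3) power2_eq_square del: of_real_mult of_real_diff)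
    then have "\<bar>2 * (Re (Tn p \<phi>) - 1)\<bar> \<le> 2 * (C2 * (norm \<phi>)\<^sup>2)" unfolding norm_of_real
      by (simp add: C2_def add_divide_distrib distrib_left distrib_right)
    then have "- (2 * (Re (Tn p \<phi>) - 1)) \<le> 2 * (C2 * (norm \<phi>)\<^sup>2)" by (rule abs_le_D2)
    then show ?thesis by (simp add: algebra_simps)
  qed
  have hypF: "norm (Fn e p \<phi>) \<le> C4 * norm \<phi> ^ 3 * (1 + norm \<phi>) ^ N"
    and hypE: "norm (Fn e p \<phi> + Fn e p (- \<phi>)) \<le> C4 * norm \<phi> ^ 4 * (1 + norm \<phi>) ^ N" if p: "p \<in> K" for p \<phi>
  proof -
    have pU: "p \<in> U" using p K by blast
    have w: "1 \<le> (1 + norm \<phi>) ^ N" by (intro one_le_power) auto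
    have c3: "S / r0 ^ 3 \<le> C4" "2 * S / r0 ^ 4 \<le> C4" using SS r0 by (auto simp: C4_def field_simps)
    show "norm (Fn e p \<phi>) \<le> C4 * norm \<phi> ^ 3 * (1 + norm \<phi>) ^ N"
    proof (cases "norm \<phi> < r0")
      case True
      obtain \<tau> \<omega> where d: "\<phi> = \<tau> *\<^sub>R \<omega>" "norm \<omega> \<le> 1" "\<tau> = norm \<phi>" using dec by blast
      have "norm (Fl e p \<omega> (\<i> * of_real \<tau>)) \<le> S / r0 ^ Suc 2 * norm (\<i> * complex_of_real \<tau>) ^ Suc 2"
      proof (rule holomorphic_order_bound[OF hol(1)[OF p d(2)] _ r0(1) Fl_order[OF pU]])
        show "norm (\<i> * complex_of_real \<tau>) < r0" using True d(3) by (simp add: norm_mult)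
      qed (use Fb[OF p _ d(2)] in auto)
      moreover have "Fn e p \<phi> = Fl e p \<omega> (\<i> * of_real \<tau>)" using Fl_scale[of e p \<tau> \<omega>] by (simp add: Fn_def d(1))
      ultimately have "norm (Fn e p \<phi>) \<le> S / r0 ^ 3 * norm \<phi> ^ 3" by (simp add: norm_mult d(3) eval_nat_numeral)
      also have "\<dots> \<le> C4 * norm \<phi> ^ 3 * 1" using mult_right_mono[OF c3(1), of "norm \<phi> ^ 3"] by simp
      also have "\<dots> \<le> C4 * norm \<phi> ^ 3 * (1 + norm \<phi>) ^ N" using w Cpos by (intro mult_left_mono) auto
      finally show ?thesis .
    next
      case False
      have "norm (Fn e p \<phi>) \<le> S * 1 * (1 + norm \<phi>) ^ N" using Fg[OF p, of \<phi>] by (simp add: N_def)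
      also have "\<dots> \<le> S * (norm \<phi> / r0) ^ 3 * (1 + norm \<phi>) ^ N"
        using big[OF False, of 3] SS by (intro mult_right_mono mult_left_mono) auto
      also have "\<dots> = S / r0 ^ 3 * norm \<phi> ^ 3 * (1 + norm \<phi>) ^ N" by (simp add: power_divide)
      also have "\<dots> \<le> C4 * norm \<phi> ^ 3 * (1 + norm \<phi>) ^ N" using c3(1) by (intro mult_right_mono) auto
      finally show ?thesis .
    qed
    show "norm (Fn e p \<phi> + Fn e p (- \<phi>)) \<le> C4 * norm \<phi> ^ 4 * (1 + norm \<phi>) ^ N"
    proof (cases "norm \<phi> < r0")
      case True
      obtain \<tau> \<omega> where d: "\<phi> = \<tau> *\<^sub>R \<omega>" "norm \<omega> \<le> 1" "\<tau> = norm \<phi>" using dec by blast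
      let ?O = "\<lambda>\<zeta>. Fl e p \<omega> \<zeta> + Fl e p \<omega> (- \<zeta>)"
      have "(Fl e p \<omega> \<circ> uminus) holomorphic_on ball 0 r0"
        by (rule holomorphic_on_compose_gen[OF _ hol(1)[OF p d(2)]]) (auto intro!: holomorphic_intros)
      then have hO: "?O holomorphic_on ball 0 r0" using hol(1)[OF p d(2)] by (intro holomorphic_intros) (auto simp: o_def)
      \<comment> \<open>The even part inherits the second-order limit from both signs of t. Being
        even, it then gains two orders, not just one, in
        \<open>holomorphic_order_bound_parity\<close>.\<close>
      have lO: "((\<lambda>t::real. ?O (of_real t) / of_real t ^ 2) \<longlongrightarrow> 0) (at 0)"
      proof -
        have "filterlim uminus (at 0) (at (0::real))"
          by (auto simp: filterlim_at eventually_at_filter intro!: tendsto_eq_intros)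
        from filterlim_compose[OF Fl_order[OF pU, of e \<omega>] this] have "((\<lambda>t::real. Fl e p \<omega> (- of_real t) / of_real t ^ 2) \<longlongrightarrow> 0) (at 0)"
          by simp
        from tendsto_add[OF Fl_order[OF pU, of e \<omega>] this] show ?thesis by (simp add: add_divide_distrib)
      qed
      have "norm (?O (\<i> * of_real \<tau>)) \<le> (2 * S) / r0 ^ (2 + 2) * norm (\<i> * complex_of_real \<tau>) ^ (2 + 2)"
      proof (rule holomorphic_order_bound_parity[OF hO _ r0(1) lO])
        show "norm (?O z) \<le> 2 * S" if "norm z < r0" for z
          using norm_triangle_ineq[of "Fl e p \<omega> z" "Fl e p \<omega> (- z)"] Fb[OF p that d(2)] Fb[OF p _ d(2), of "- z"] that by simp
        show "norm (\<i> * complex_of_real \<tau>) < r0" using True d(3) by (simp add: norm_mult)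
      qed simp
      moreover have "Fn e p \<phi> + Fn e p (- \<phi>) = ?O (\<i> * of_real \<tau>)"
        using Fl_scale[of e p \<tau> \<omega>] Fl_scale[of e p "- \<tau>" \<omega>] by (simp add: Fn_def d(1))
      ultimately have "norm (Fn e p \<phi> + Fn e p (- \<phi>)) \<le> 2 * S / r0 ^ 4 * norm \<phi> ^ 4"
        by (simp add: norm_mult d(3))
      also have "\<dots> \<le> C4 * norm \<phi> ^ 4 * 1" using mult_right_mono[OF c3(2), of "norm \<phi> ^ 4"] by simp
      also have "\<dots> \<le> C4 * norm \<phi> ^ 4 * (1 + norm \<phi>) ^ N" using w Cpos by (intro mult_left_mono) auto
      finally show ?thesis .
    next
      case False
      have "norm (Fn e p \<phi> + Fn e p (- \<phi>)) \<le> 2 * S * 1 * (1 + norm \<phi>) ^ N"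
        using norm_triangle_ineq[of "Fn e p \<phi>" "Fn e p (- \<phi>)"] Fg[OF p, of \<phi>] Fg[OF p, of "- \<phi>"] by (simp add: N_def)
      also have "\<dots> \<le> 2 * S * (norm \<phi> / r0) ^ 4 * (1 + norm \<phi>) ^ N"
        using big[OF False, of 4] SS by (intro mult_right_mono mult_left_mono) auto
      also have "\<dots> = 2 * S / r0 ^ 4 * norm \<phi> ^ 4 * (1 + norm \<phi>) ^ N" by (simp add: power_divide)
      also have "\<dots> \<le> C4 * norm \<phi> ^ 4 * (1 + norm \<phi>) ^ N" using c3(2) by (intro mult_right_mono) auto
      finally show ?thesis .
    qed
  qed
  define V where "V = measure lborel (ball (0::real^'d) r) / 2 ^ Suc DIM(real^'d)"
  have V: "0 < V" using r by (simp add: V_def)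
  define W where "W = kernel_mass TYPE(real^'d) 1 0 PP c / r + C3 * kernel_mass TYPE(real^'d) 3 0 PP c"
  \<comment> \<open>From here on W / sqrt (n - 1) is at most V / 2: the errors in the denominator
    are at most half of the main term.\<close>
  obtain n2 :: nat where n2: "(2 * W / V)\<^sup>2 < real n2" using reals_Archimedean2 by blast
  define n0 where "n0 = n1 + n2 + 5"
  have nW: "W / sqrt (real (n - 1)) \<le> V / 2" if "n0 \<le> n" for n
  proof -
    have "(2 * W / V)\<^sup>2 \<le> real (n - 1)" using n2 that by (simp add: n0_def)
    then have "\<bar>2 * W / V\<bar> \<le> sqrt (real (n - 1))" by (metis real_sqrt_abs real_sqrt_le_mono)
    then have "2 * W / V \<le> sqrt (real (n - 1))" by linarith
    moreover have "0 < sqrt (real (n - 1))" using that by (simp add: n0_def)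
    ultimately show ?thesis using V by (simp add: field_simps)
  qed
  have fin: "0 < Re (\<integral>\<phi>. Tn p \<phi> ^ n \<partial>lborel)"
    "real n * norm ((\<integral>\<phi>. Fn e p \<phi> * Tn p \<phi> ^ (n - 1) \<partial>lborel) / (\<integral>\<phi>. Tn p \<phi> ^ n \<partial>lborel))
      \<le> ((C4 * kernel_mass TYPE(real^'d) 4 N PP c + 2 * C4 * C3 * kernel_mass TYPE(real^'d) 6 N PP c) * 2 ^ (4 + DIM(real^'d)) / (V / 2)) / real n"
    if p: "p \<in> K" and n: "n0 \<le> n" for p n
  proof -
    have pU: "p \<in> U" using p K by blast
    have Tm: "Tn p \<in> borel_measurable borel" by (rule borel_measurable_continuous_onI[OF Tn_cont[OF pU]])
    have Fm: "Fn e p \<in> borel_measurable borel" by (rule borel_measurable_continuous_onI[OF Fn_cont[OF pU]])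
    have dcy: "norm (Tn p \<phi>) ^ k \<le> 1 / (1 + c * real k * (norm \<phi>)\<^sup>2) ^ PP" if "n1 \<le> k" for k \<phi>
      unfolding norm_Tn[OF pU] using c(3)[OF that, of "fst p" "snd p" \<phi>] p by simp
    have PP: "6 + N + DIM(real^'d) \<le> PP" by (simp add: PP_def)
    have n14: "n1 + 4 \<le> n" using n by (simp add: n0_def)
    note L = laplace_ratio[OF c(1,2) PP r(1) C2r Cpos(3,2,1) Tm Fm norm_Tn_le[OF pU] Tn_cnj[OF pU] dcy hypT[OF p] hypR[OF p] hypF[OF p] hypE[OF p] n14,
        folded V_def W_def, OF _ _ nW[OF n]]
    show "0 < Re (\<integral>\<phi>. Tn p \<phi> ^ n \<partial>lborel)" by (rule L(1))
    show "real n * norm ((\<integral>\<phi>. Fn e p \<phi> * Tn p \<phi> ^ (n - 1) \<partial>lborel) / (\<integral>\<phi>. Tn p \<phi> ^ n \<partial>lborel))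
      \<le> ((C4 * kernel_mass TYPE(real^'d) 4 N PP c + 2 * C4 * C3 * kernel_mass TYPE(real^'d) 6 N PP c) * 2 ^ (4 + DIM(real^'d)) / (V / 2)) / real n"
      by (rule L(2))
  qed
  have "1 \<le> n0" by (simp add: n0_def)
  then show ?thesis using that fin by blast
qed

end

section \<open>Integration by parts and the score\<close>

context saddle_model
begin

text \<open>
  Up to the factor \<open>\<i>\<close>, \<open>kpn p j\<close> is the partial derivative of \<open>Tn p\<close> in \<open>\<phi> $ j\<close>.
\<close>

definition kpn :: "(real ^ 'd) \<times> (real ^ 'p) \<Rightarrow> 'd \<Rightarrow> real ^ 'd \<Rightarrow> complex" where
  "kpn p j \<phi> = (dM0 P Y [] [j] (cvec (fst p) \<phi>) (snd p) - of_real (kg p $ j) * M0 P Y (cvec (fst p) \<phi>) (snd p))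
     / of_real (mgf (fst p) (snd p)) * exp (- (\<i> * of_real (\<phi> \<bullet> kg p)))"

definition Gn :: "real ^ 'p \<Rightarrow> (real ^ 'd) \<times> (real ^ 'p) \<Rightarrow> real ^ 'd \<Rightarrow> complex" where
  "Gn e p \<phi> = dM [] \<phi> (0, e) p / of_real (mgf (fst p) (snd p)) * exp (- (\<i> * of_real (\<phi> \<bullet> kg p)))"

lemma kpn_cont: "p \<in> U \<Longrightarrow> continuous_on UNIV (kpn p j)"
  unfolding kpn_def[abs_def]
  by (intro continuous_on_mult continuous_on_divide continuous_on_diff M0_cont dM0_cont exp_cont continuous_on_const) (use mgf_nz in auto)

lemma Gn_cont: "p \<in> U \<Longrightarrow> continuous_on UNIV (Gn e p)"
  unfolding Gn_def[abs_def]
  by (intro continuous_on_mult continuous_on_divide dM_cont exp_cont continuous_on_const) (use mgf_nz in auto)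

lemma Tn_deriv:
  assumes p: "p \<in> U"
  shows "((\<lambda>t. Tn p (\<phi> + t *\<^sub>R axis j 1)) has_vector_derivative \<i> * kpn p j \<phi>) (at 0)"
proof -
  let ?m = "complex_of_real (mgf (fst p) (snd p))"
  have M: "((\<lambda>t. M0 P Y (cvec (fst p) (\<phi> + t *\<^sub>R axis j 1)) (snd p)) has_vector_derivative \<i> * dM0 P Y [] [j] (cvec (fst p) \<phi>) (snd p)) (at 0)"
    using M0_phi_deriv[of "fst p" "snd p"] p by simp
  have M': "((\<lambda>t. M0 P Y (cvec (fst p) (\<phi> + t *\<^sub>R axis j 1)) (snd p) / ?m) has_vector_derivative (\<i> * dM0 P Y [] [j] (cvec (fst p) \<phi>) (snd p)) / ?m) (at 0)"
    using bounded_linear.has_vector_derivative[OF bounded_linear_divide M] .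
  let ?x = "\<lambda>t. - (\<i> * (of_real (\<phi> \<bullet> kg p) + of_real t * of_real (kg p $ j)))"
  have "((\<lambda>t. exp (?x t)) has_vector_derivative (- (\<i> * of_real (kg p $ j))) * exp (?x 0)) (at 0)"
    by (rule field_vector_diff_chain_at[of ?x "- (\<i> * of_real (kg p $ j))" 0 exp "exp (?x 0)", unfolded o_def])
       (auto intro!: derivative_eq_intros has_vector_derivative_real_field simp: has_vector_derivative_def scaleR_conv_of_real)
  then have E: "((\<lambda>t. exp (- (\<i> * of_real ((\<phi> + t *\<^sub>R axis j 1) \<bullet> kg p)))) has_vector_derivative
     (- (\<i> * of_real (kg p $ j))) * exp (- (\<i> * of_real (\<phi> \<bullet> kg p)))) (at 0)"
    by (simp add: inner_add_left inner_axis' mult.commute)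
  show ?thesis
    unfolding Tn_eq
    by (rule has_vector_derivative_eq_rhs[OF has_vector_derivative_mult[OF M' E]])
       (simp add: kpn_def algebra_simps diff_divide_distrib)
qed

text \<open>The integrand on the left is the derivative in the j-th coordinate of l T ^ (\<nu> + 1),
  so its integral is 0. The weight \<open>l\<close> is affine with slope \<open>c\<close> in that
  coordinate; below it is 1 or a coordinate of \<phi>.\<close>

lemma moment_integration_by_parts:
  assumes p: "p \<in> U"
    and i0: "integrable lborel (\<lambda>\<phi>. of_real (l \<phi>) * Tn p \<phi> ^ Suc \<nu>)"
    and i1: "integrable lborel (\<lambda>\<phi>. of_real c * Tn p \<phi> ^ Suc \<nu>)"
    and i2: "integrable lborel (\<lambda>\<phi>. of_real (l \<phi>) * kpn p j \<phi> * Tn p \<phi> ^ \<nu>)"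
    and l: "\<And>\<phi> t. l (\<phi> + t *\<^sub>R axis j 1) = l \<phi> + t * c" "continuous_on UNIV l"
  shows "(\<integral>\<phi>. of_real c * Tn p \<phi> ^ Suc \<nu> \<partial>lborel) + of_nat (Suc \<nu>) * \<i> * (\<integral>\<phi>. of_real (l \<phi>) * kpn p j \<phi> * Tn p \<phi> ^ \<nu> \<partial>lborel) = 0"
proof -
  let ?H = "\<lambda>\<phi>. of_real c * Tn p \<phi> ^ Suc \<nu> + of_nat (Suc \<nu>) * \<i> * (of_real (l \<phi>) * kpn p j \<phi> * Tn p \<phi> ^ \<nu>)"
  have iH: "integrable lborel ?H" by (rule Bochner_Integration.integrable_add[OF i1 integrable_mult_right[OF i2]])
  have "(\<integral>\<phi>. ?H \<phi> \<partial>lborel) = 0"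
  proof (rule integral_directional_derivative_eq_0[OF i0 iH, of "axis j 1"])
    show "continuous_on UNIV ?H"
      by (intro continuous_intros Tn_cont kpn_cont p l)
    fix \<phi> :: "real ^ 'd"
    have pw: "((\<lambda>t. Tn p (\<phi> + t *\<^sub>R axis j 1) ^ Suc \<nu>) has_vector_derivative (\<i> * kpn p j \<phi>) * (of_nat (Suc \<nu>) * Tn p \<phi> ^ \<nu>)) (at 0)"
      by (rule field_vector_diff_chain_at[OF Tn_deriv[OF p], of "\<lambda>z. z ^ Suc \<nu>", unfolded o_def])
         (rule DERIV_cong[OF DERIV_power_Suc[OF DERIV_ident]], simp)
    have lv: "((\<lambda>t. complex_of_real (l (\<phi> + t *\<^sub>R axis j 1))) has_vector_derivative of_real c) (at 0)"
      unfolding l has_vector_derivative_def by (auto intro!: derivative_eq_intros simp: scaleR_conv_of_real)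
    show "((\<lambda>t. of_real (l (\<phi> + t *\<^sub>R axis j 1)) * Tn p (\<phi> + t *\<^sub>R axis j 1) ^ Suc \<nu>) has_vector_derivative ?H \<phi>) (at 0)"
      by (rule has_vector_derivative_eq_rhs[OF has_vector_derivative_mult[OF lv pw]]) (simp add: algebra_simps)
  qed
  moreover have "(\<integral>\<phi>. ?H \<phi> \<partial>lborel) = (\<integral>\<phi>. of_real c * Tn p \<phi> ^ Suc \<nu> \<partial>lborel)
      + (\<integral>\<phi>. of_nat (Suc \<nu>) * \<i> * (of_real (l \<phi>) * kpn p j \<phi> * Tn p \<phi> ^ \<nu>) \<partial>lborel)"
    by (rule Bochner_Integration.integral_add[OF i1 integrable_mult_right[OF i2]])
  ultimately show ?thesis by (simp only: integral_mult_right_zero)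
qed

text \<open>Exhibits \<open>Fn\<close> as \<open>Gn\<close> minus a constant multiple of
  \<open>Tn\<close>, plus derivatives of \<open>Tn\<close> with coefficients affine in \<phi>. After
  multiplication by a power of \<open>Tn\<close>, all summands but the first have integrals known in
  terms of that of \<open>Tn p \<phi> ^ n\<close>.\<close>

lemma Fn_decompose:
  assumes p: "p \<in> U"
  shows "Fn e p \<phi> = Gn e p \<phi> - of_real (dird (0, e) kap p) * Tn p \<phi> + (\<Sum>j\<in>UNIV. of_real (sa p e $ j) * kpn p j \<phi>)
    + \<i> * (\<Sum>j\<in>UNIV. \<Sum>k\<in>UNIV. of_real (Cm e p $ j $ k) * (of_real (\<phi> $ k) * kpn p j \<phi>))"
proof -
  let ?M = "M0 P Y (cvec (fst p) \<phi>) (snd p)" and ?m = "complex_of_real (mgf (fst p) (snd p))"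
  let ?E = "exp (- (\<i> * of_real (\<phi> \<bullet> kg p)))"
  let ?d = "\<lambda>j. dM0 P Y [] [j] (cvec (fst p) \<phi>) (snd p)"
  have s: "(\<Sum>j\<in>UNIV. of_real (v $ j) * kpn p j \<phi>) = (dM [] \<phi> (v, 0) p - of_real (kg p \<bullet> v) * ?M) / ?m * ?E" for v
    by (simp add: kpn_def dM_def inner_vec_def scaleR_conv_of_real sum_distrib_right sum_distrib_left
        sum_subtractf[symmetric] sum_divide_distrib algebra_simps diff_divide_distrib)
  have "(\<Sum>j\<in>UNIV. \<Sum>k\<in>UNIV. of_real (Cm e p $ j $ k) * (of_real (\<phi> $ k) * kpn p j \<phi>))
    = (\<Sum>j\<in>UNIV. of_real ((Cm e p *v \<phi>) $ j) * kpn p j \<phi>)"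
    by (simp add: matrix_vector_mult_def sum_distrib_right mult.assoc)
  also note s
  finally have 2: "(\<Sum>j\<in>UNIV. \<Sum>k\<in>UNIV. of_real (Cm e p $ j $ k) * (of_real (\<phi> $ k) * kpn p j \<phi>))
    = (dM [] \<phi> (Cm e p *v \<phi>, 0) p - of_real (kg p \<bullet> (Cm e p *v \<phi>)) * ?M) / ?m * ?E" .
  have 3: "dM [] \<phi> (sa p e, e) p = dM [] \<phi> (sa p e, 0) p + dM [] \<phi> (0, e) p"
    using linear_add[OF linear_dM[of "[]" \<phi> p], of "(sa p e, 0)" "(0, e)"] by simp
  show ?thesis
    unfolding 2 s Fn_eq 3 dird_sa_kap[OF p] Gn_def Tn_eq
    by (simp add: inner_commute[of "kg p"] algebra_simps diff_divide_distrib add_divide_distrib)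
qed

lemma score_integrands_growth:
  assumes K: "compact K" "K \<subseteq> U"
  obtains C N where "\<And>p \<phi> j. p \<in> K \<Longrightarrow> norm (kpn p j \<phi>) \<le> C * (1 + norm \<phi>) ^ N"
    "\<And>p \<phi>. p \<in> K \<Longrightarrow> norm (Gn e p \<phi>) \<le> C * (1 + norm \<phi>) ^ N" "0 \<le> C"
proof -
  obtain C N where C: "1 \<le> C" and dM0C: "\<And>is js s \<theta> \<phi>. length is \<le> 1 \<Longrightarrow> 1 \<le> length is + length js \<Longrightarrow> length is + length js \<le> 6 \<Longrightarrow> (s, \<theta>) \<in> K \<Longrightarrow>
    cmod (dM0 P Y is js (cvec s \<phi>) \<theta>) \<le> C * (1 + norm \<phi>) ^ N"
    using dM0_bound[OF K] by blast
  have m': "continuous_on K (\<lambda>p. mgf (fst p) (snd p))" by (rule continuous_on_subset[OF mgf_continuous K(2)])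
  have mpos: "0 < mgf (fst p) (snd p)" if "p \<in> U" for p using mgf_pos[of "fst p" "snd p"] that by simp
  have "continuous_on K (\<lambda>p. 1 / mgf (fst p) (snd p))"
    using mpos K(2) by (intro continuous_on_divide m' continuous_on_const) (auto simp: less_imp_neq[symmetric] subset_iff)
  then obtain M2 where M2: "1 \<le> M2" "\<And>p. p \<in> K \<Longrightarrow> norm (1 / mgf (fst p) (snd p)) \<le> M2"
    by (rule compact_bound[OF K(1)]) (rule that)
  obtain G1 where G1: "1 \<le> G1" "\<And>p. p \<in> K \<Longrightarrow> norm (kg p) \<le> G1"
    by (rule compact_bound[OF K(1) continuous_on_subset[OF C1_on_continuous[OF kg_C1] K(2)]]) (rule that)
  define q where "q = real (CARD('d) + CARD('p))"
  define D where "D = C * M2 + G1 + q * norm e * C * M2"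
  have nn: "0 \<le> C * M2" "0 \<le> q * norm e * C * M2" using C M2 by (auto simp: q_def)
  show ?thesis
  proof (rule that[of D N])
    show "0 \<le> D" using nn G1(1) by (simp add: D_def)
    fix p and \<phi> :: "real ^ 'd" and j assume p: "p \<in> K"
    have pU: "p \<in> U" using p K by blast
    let ?w = "(1 + norm \<phi>) ^ N"
    have w: "1 \<le> ?w" by (intro one_le_power) auto
    have im: "norm (inverse (complex_of_real (mgf (fst p) (snd p)))) \<le> M2"
      using M2(2)[OF p] by (auto simp: norm_inverse norm_divide inverse_eq_divide)
    have d: "norm (dM0 P Y [] [j] (cvec (fst p) \<phi>) (snd p)) \<le> C * ?w" using p by (intro dM0C) auto
    have k: "\<bar>kg p $ j\<bar> \<le> G1" using component_le_norm_cart[of "kg p" j] G1(2)[OF p] by linarith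
    have "kpn p j \<phi> = dM0 P Y [] [j] (cvec (fst p) \<phi>) (snd p) * inverse (of_real (mgf (fst p) (snd p))) * exp (- (\<i> * of_real (\<phi> \<bullet> kg p)))
       - of_real (kg p $ j) * Tn p \<phi>"
      by (simp add: kpn_def Tn_eq algebra_simps diff_divide_distrib divide_inverse)
    also have "norm \<dots> \<le> norm (dM0 P Y [] [j] (cvec (fst p) \<phi>) (snd p)) * norm (inverse (complex_of_real (mgf (fst p) (snd p)))) + \<bar>kg p $ j\<bar> * norm (Tn p \<phi>)"
      by (rule order_trans[OF norm_triangle_ineq4]) (simp add: norm_mult norm_exp_i[simplified])
    also have "\<dots> \<le> (C * ?w) * M2 + G1 * 1"
      using C G1(1) by (intro add_mono mult_mono d im k norm_Tn_le pU) auto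
    also have "\<dots> \<le> (C * M2) * ?w + G1 * ?w" using w G1(1) by (simp add: mult_ac)
    also have "\<dots> \<le> D * ?w" using nn(2) w by (simp add: D_def distrib_right)
    finally show "norm (kpn p j \<phi>) \<le> D * ?w" .
  next
    fix p and \<phi> :: "real ^ 'd" assume p: "p \<in> K"
    let ?w = "(1 + norm \<phi>) ^ N"
    have im: "norm (inverse (complex_of_real (mgf (fst p) (snd p)))) \<le> M2"
      using M2(2)[OF p] by (auto simp: norm_inverse norm_divide inverse_eq_divide)
    have d: "norm (dM [] \<phi> (0, e) p) \<le> q * norm (0::real^'d, e) * (C * ?w)"
      unfolding q_def using p by (intro norm_dM_le dM0C) auto
    have "norm (Gn e p \<phi>) = norm (dM [] \<phi> (0, e) p) * norm (inverse (complex_of_real (mgf (fst p) (snd p))))"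
      unfolding Gn_def norm_mult[of _ "exp _"] norm_exp_i divide_inverse norm_mult[of _ "inverse _"] by simp
    also have "\<dots> \<le> (q * norm (0::real^'d, e) * (C * ?w)) * M2"
      using C by (intro mult_mono d im) (auto simp: q_def)
    also have "\<dots> = (q * norm e * C * M2) * ?w" by (simp add: norm_Pair)
    also have "\<dots> \<le> D * ?w" using nn(1) G1(1) by (intro mult_right_mono) (auto simp: D_def)
    finally show "norm (Gn e p \<phi>) \<le> D * ?w" .
  qed
qed

text \<open>By the decomposition and integration by parts, n \<integral> F T ^ (n - 1) equals n
  \<integral> G T ^ (n - 1) minus \<open>sdl p n e\<close> times \<integral> T ^ n. This is exact,
  so the whole error is the quotient already bounded in \<open>laplace_model\<close>.\<close>

lemma score_quotient_approx:
  assumes K: "compact K" "K \<subseteq> U"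
  obtains n0 B where "1 \<le> n0"
    "\<And>p n. p \<in> K \<Longrightarrow> n0 \<le> n \<Longrightarrow> 0 < Re (\<integral>\<phi>. Tn p \<phi> ^ n \<partial>lborel)"
    "\<And>p n. p \<in> K \<Longrightarrow> n0 \<le> n \<Longrightarrow>
      norm (of_nat n * (\<integral>\<phi>. Gn e p \<phi> * Tn p \<phi> ^ (n - 1) \<partial>lborel) / (\<integral>\<phi>. Tn p \<phi> ^ n \<partial>lborel) - of_real (sdl p n e)) \<le> B / real n"
proof -
  obtain n0 B where L: "1 \<le> n0" "\<And>p n. p \<in> K \<Longrightarrow> n0 \<le> n \<Longrightarrow> 0 < Re (\<integral>\<phi>. Tn p \<phi> ^ n \<partial>lborel)"
    "\<And>p n. p \<in> K \<Longrightarrow> n0 \<le> n \<Longrightarrow>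
      real n * norm ((\<integral>\<phi>. Fn e p \<phi> * Tn p \<phi> ^ (n - 1) \<partial>lborel) / (\<integral>\<phi>. Tn p \<phi> ^ n \<partial>lborel)) \<le> B / real n"
    using laplace_model[OF K, of e] by blast
  obtain C N where g: "\<And>p \<phi> j. p \<in> K \<Longrightarrow> norm (kpn p j \<phi>) \<le> C * (1 + norm \<phi>) ^ N"
    "\<And>p \<phi>. p \<in> K \<Longrightarrow> norm (Gn e p \<phi>) \<le> C * (1 + norm \<phi>) ^ N" "0 \<le> C"
    using score_integrands_growth[OF K, of e] by blast
  obtain n1 where n1: "1 \<le> n1" "\<And>p k g C. p \<in> K \<Longrightarrow> n1 \<le> k \<Longrightarrow> continuous_on UNIV g \<Longrightarrow> (\<And>\<phi>. norm (g \<phi>) \<le> C * (1 + norm \<phi>) ^ Suc N) \<Longrightarrow>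
    integrable lborel (\<lambda>\<phi>. g \<phi> * Tn p \<phi> ^ k)"
    using Tn_integrable[OF K, of "Suc N"] by blast
  have "norm (of_nat n * (\<integral>\<phi>. Gn e p \<phi> * Tn p \<phi> ^ (n - 1) \<partial>lborel) / (\<integral>\<phi>. Tn p \<phi> ^ n \<partial>lborel) - of_real (sdl p n e)) \<le> B / real n"
    if p: "p \<in> K" and n: "n0 + n1 + 1 \<le> n" for p n
  proof -
    have pU: "p \<in> U" using p K by blast
    define \<nu> where "\<nu> = n - 1"
    have \<nu>: "n = Suc \<nu>" "n - 1 = \<nu>" "n1 \<le> \<nu>" "n1 \<le> Suc \<nu>" using n by (auto simp: \<nu>_def)
    have w: "(1 + norm \<phi>) ^ N \<le> (1 + norm \<phi>) ^ Suc N" "1 \<le> (1 + norm \<phi>) ^ Suc N" "norm \<phi> \<le> (1 + norm \<phi>) ^ Suc N"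
      "norm \<phi> * (1 + norm \<phi>) ^ N \<le> (1 + norm \<phi>) ^ Suc N" for \<phi> :: "real^'d"
    proof -
      show "(1 + norm \<phi>) ^ N \<le> (1 + norm \<phi>) ^ Suc N" by (rule power_increasing) auto
      show "1 \<le> (1 + norm \<phi>) ^ Suc N" by (rule one_le_power) auto
      have "(1 + norm \<phi>) ^ 1 \<le> (1 + norm \<phi>) ^ Suc N" by (rule power_increasing) auto
      then show "norm \<phi> \<le> (1 + norm \<phi>) ^ Suc N" by simp
      show "norm \<phi> * (1 + norm \<phi>) ^ N \<le> (1 + norm \<phi>) ^ Suc N" by (simp add: mult_right_mono)
    qed
    have iG: "integrable lborel (\<lambda>\<phi>. Gn e p \<phi> * Tn p \<phi> ^ \<nu>)"
      by (rule n1(2)[OF p \<nu>(3) Gn_cont[OF pU]]) (rule order_trans[OF g(2)[OF p] mult_left_mono[OF w(1) g(3)]])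
    have iT: "integrable lborel (\<lambda>\<phi>. Tn p \<phi> ^ Suc \<nu>)"
      using n1(2)[OF p \<nu>(4), of "\<lambda>_. 1" 1] w(2) by simp
    have ik: "integrable lborel (\<lambda>\<phi>. kpn p j \<phi> * Tn p \<phi> ^ \<nu>)" for j
      by (rule n1(2)[OF p \<nu>(3) kpn_cont[OF pU]]) (rule order_trans[OF g(1)[OF p] mult_left_mono[OF w(1) g(3)]])
    have cc: "\<bar>\<phi> $ k\<bar> \<le> norm \<phi>" for \<phi> :: "real^'d" and k by (rule component_le_norm_cart)
    have il: "integrable lborel (\<lambda>\<phi>. of_real (\<phi> $ k) * Tn p \<phi> ^ Suc \<nu>)" for k
    proof (rule n1(2)[OF p \<nu>(4)])
      show "continuous_on UNIV (\<lambda>\<phi>::real^'d. complex_of_real (\<phi> $ k))" by (intro continuous_intros continuous_on_nth)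
      show "norm (complex_of_real (\<phi> $ k)) \<le> 1 * (1 + norm \<phi>) ^ Suc N" for \<phi> :: "real^'d"
        using order_trans[OF cc w(3)] by simp
    qed
    have ikl: "integrable lborel (\<lambda>\<phi>. of_real (\<phi> $ k) * kpn p j \<phi> * Tn p \<phi> ^ \<nu>)" for j k
    proof (rule n1(2)[OF p \<nu>(3)])
      show "continuous_on UNIV (\<lambda>\<phi>. complex_of_real (\<phi> $ k) * kpn p j \<phi>)" by (intro continuous_intros continuous_on_nth kpn_cont pU)
      fix \<phi> :: "real ^ 'd"
      have "norm (complex_of_real (\<phi> $ k) * kpn p j \<phi>) \<le> norm \<phi> * (C * (1 + norm \<phi>) ^ N)"
        unfolding norm_mult norm_of_real using cc by (intro mult_mono g p) auto
      also have "\<dots> = C * (norm \<phi> * (1 + norm \<phi>) ^ N)" by simp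
      also have "\<dots> \<le> C * (1 + norm \<phi>) ^ Suc N" by (rule mult_left_mono[OF w(4) g(3)])
      finally show "norm (complex_of_real (\<phi> $ k) * kpn p j \<phi>) \<le> C * (1 + norm \<phi>) ^ Suc N" .
    qed
    let ?IT = "\<integral>\<phi>. Tn p \<phi> ^ Suc \<nu> \<partial>lborel"
    \<comment> \<open>Integration by parts with weight 1: a pure derivative of a power of
      \<open>Tn\<close> integrates to 0, so the summand with \<open>sa\<close> is free.\<close>
    have b1: "(\<integral>\<phi>. kpn p j \<phi> * Tn p \<phi> ^ \<nu> \<partial>lborel) = 0" for j
      using moment_integration_by_parts[OF pU, of "\<lambda>_. 1" \<nu> 0 j] iT ik[of j] by (simp add: of_nat_Suc[symmetric] del: of_nat_Suc power_Suc)
    \<comment> \<open>Integration by parts with weight \<phi> $ k, whose slope in coordinate j is 1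
      or 0; only the diagonal of \<open>Cm\<close> survives and yields its trace.\<close>
    have b2: "of_nat (Suc \<nu>) * \<i> * (\<integral>\<phi>. of_real (\<phi> $ k) * kpn p j \<phi> * Tn p \<phi> ^ \<nu> \<partial>lborel) = - (if j = k then ?IT else 0)" for j k
    proof -
      have "(\<integral>\<phi>. of_real (if j = k then 1 else 0) * Tn p \<phi> ^ Suc \<nu> \<partial>lborel)
          + of_nat (Suc \<nu>) * \<i> * (\<integral>\<phi>. of_real (\<phi> $ k) * kpn p j \<phi> * Tn p \<phi> ^ \<nu> \<partial>lborel) = 0"
      proof (rule moment_integration_by_parts[OF pU il _ ikl])
        show "integrable lborel (\<lambda>\<phi>. complex_of_real (if j = k then 1 else 0) * Tn p \<phi> ^ Suc \<nu>)"
          using iT by (intro integrable_mult_right) auto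
      qed (auto simp: axis_def intro!: continuous_intros continuous_on_nth)
      then show ?thesis by (cases "j = k") (simp_all add: eq_neg_iff_add_eq_0 add.commute del: power_Suc)
    qed
    let ?S1 = "\<lambda>\<phi>. \<Sum>j\<in>UNIV. of_real (sa p e $ j) * (kpn p j \<phi> * Tn p \<phi> ^ \<nu>)"
    let ?S2 = "\<lambda>\<phi>. \<Sum>j\<in>UNIV. \<Sum>k\<in>UNIV. of_real (Cm e p $ j $ k) * (of_real (\<phi> $ k) * kpn p j \<phi> * Tn p \<phi> ^ \<nu>)"
    have dec: "Fn e p \<phi> * Tn p \<phi> ^ \<nu> = Gn e p \<phi> * Tn p \<phi> ^ \<nu> - of_real (dird (0, e) kap p) * Tn p \<phi> ^ Suc \<nu> + ?S1 \<phi> + \<i> * ?S2 \<phi>" for \<phi>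
    proof -
      have "?S1 \<phi> = (\<Sum>j\<in>UNIV. of_real (sa p e $ j) * kpn p j \<phi>) * Tn p \<phi> ^ \<nu>"
        by (simp add: sum_distrib_right mult.assoc)
      moreover have "?S2 \<phi> = (\<Sum>j\<in>UNIV. \<Sum>k\<in>UNIV. of_real (Cm e p $ j $ k) * (of_real (\<phi> $ k) * kpn p j \<phi>)) * Tn p \<phi> ^ \<nu>"
        by (simp add: sum_distrib_right mult.assoc)
      ultimately show ?thesis unfolding Fn_decompose[OF pU] by (simp add: distrib_right left_diff_distrib mult.assoc)
    qed
    have i1: "integrable lborel ?S1" by (intro Bochner_Integration.integrable_sum integrable_mult_right ik)
    have i2: "integrable lborel ?S2" by (intro Bochner_Integration.integrable_sum integrable_mult_right ikl)
    have z1: "(\<integral>\<phi>. ?S1 \<phi> \<partial>lborel) = 0"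
      using ik by (subst Bochner_Integration.integral_sum) (auto simp: b1)
    have z2: "of_nat (Suc \<nu>) * \<i> * (\<integral>\<phi>. ?S2 \<phi> \<partial>lborel) = - of_real (trace (Cm e p)) * ?IT"
    proof -
      have "(\<integral>\<phi>. ?S2 \<phi> \<partial>lborel) = (\<Sum>j\<in>UNIV. \<Sum>k\<in>UNIV. of_real (Cm e p $ j $ k) * (\<integral>\<phi>. of_real (\<phi> $ k) * kpn p j \<phi> * Tn p \<phi> ^ \<nu> \<partial>lborel))"
        using ikl by (subst Bochner_Integration.integral_sum, (intro Bochner_Integration.integrable_sum integrable_mult_right ikl),
           subst Bochner_Integration.integral_sum, (intro integrable_mult_right ikl), simp)
      then have "of_nat (Suc \<nu>) * \<i> * (\<integral>\<phi>. ?S2 \<phi> \<partial>lborel) = (\<Sum>j\<in>UNIV. \<Sum>k\<in>UNIV. of_real (Cm e p $ j $ k) * (of_nat (Suc \<nu>) * \<i> * (\<integral>\<phi>. of_real (\<phi> $ k) * kpn p j \<phi> * Tn p \<phi> ^ \<nu> \<partial>lborel)))"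
        by (simp only: sum_distrib_left mult.left_commute)
      also have "\<dots> = (\<Sum>j\<in>UNIV. \<Sum>k\<in>UNIV. if j = k then - (of_real (Cm e p $ j $ j) * ?IT) else 0)"
        unfolding b2 by (intro sum.cong refl) simp
      also have "\<dots> = - of_real (trace (Cm e p)) * ?IT"
        by (simp add: trace_def sum_distrib_right sum_negf del: power_Suc)
      finally show ?thesis .
    qed
    let ?IG = "\<integral>\<phi>. Gn e p \<phi> * Tn p \<phi> ^ \<nu> \<partial>lborel"
    have "(\<integral>\<phi>. Fn e p \<phi> * Tn p \<phi> ^ \<nu> \<partial>lborel) = ?IG - of_real (dird (0, e) kap p) * ?IT + (\<integral>\<phi>. ?S1 \<phi> \<partial>lborel) + \<i> * (\<integral>\<phi>. ?S2 \<phi> \<partial>lborel)"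
      unfolding dec using iG iT i1 i2 by (simp del: power_Suc)
    then have "of_nat (Suc \<nu>) * (\<integral>\<phi>. Fn e p \<phi> * Tn p \<phi> ^ \<nu> \<partial>lborel)
       = of_nat (Suc \<nu>) * ?IG - of_real (real (Suc \<nu>) * dird (0, e) kap p) * ?IT + of_nat (Suc \<nu>) * \<i> * (\<integral>\<phi>. ?S2 \<phi> \<partial>lborel)"
      unfolding z1 by (simp only: distrib_left right_diff_distrib of_real_mult of_real_of_nat_eq mult.assoc add_0_right)
    also have "\<dots> = of_nat (Suc \<nu>) * ?IG - of_real (real (Suc \<nu>) * dird (0, e) kap p + trace (Cm e p)) * ?IT"
      unfolding z2 by (simp add: algebra_simps)
    \<comment> \<open>The trace of \<open>Cm\<close>, with its factor - 1 / 2, is the derivative of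
      the log-determinant term of the saddlepoint likelihood.\<close>
    also have "real (Suc \<nu>) * dird (0, e) kap p + trace (Cm e p) = sdl p n e"
      by (simp add: sdl_def \<nu>(1) Cm_def trace_def sum_negf sum_divide_distrib)
    finally have id: "of_nat n * (\<integral>\<phi>. Fn e p \<phi> * Tn p \<phi> ^ \<nu> \<partial>lborel) = of_nat n * ?IG - of_real (sdl p n e) * ?IT"
      by (simp only: \<nu>(1))
    have nz: "?IT \<noteq> 0" using L(2)[OF p, of n] n unfolding \<nu>(1) by auto
    have "of_nat n * ?IG / ?IT - of_real (sdl p n e) = of_nat n * ((\<integral>\<phi>. Fn e p \<phi> * Tn p \<phi> ^ \<nu> \<partial>lborel) / ?IT)"
      using id nz by (simp add: field_simps del: power_Suc)
    then have "norm (of_nat n * ?IG / ?IT - of_real (sdl p n e)) = real n * norm ((\<integral>\<phi>. Fn e p \<phi> * Tn p \<phi> ^ \<nu> \<partial>lborel) / ?IT)"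
      by (simp only: norm_mult norm_of_nat)
    also have "\<dots> \<le> B / real n" using L(3)[OF p, of n] n unfolding \<nu>(2) by (simp only: \<nu>(1))
    finally show ?thesis unfolding \<nu>(2) by (simp only: \<nu>(1))
  qed
  then show ?thesis using that[of "n0 + n1 + 1" B] L(2) by fastforce
qed

end

subsection \<open>The density of the sum\<close>

text \<open>Integrability is assumed for the transform of the tilted law, not for the characteristic
  function of \<open>X\<close>. The tilted measure is finite, so it can be inverted, and dividing
  its density by exp (s \<bullet> x) gives that of \<open>X\<close>.\<close>

lemma tilted_cont_density:
  fixes X :: "'w \<Rightarrow> real ^ 'd"
  assumes "prob_space M" and X [measurable]: "X \<in> borel_measurable M"
    and int: "integrable M (\<lambda>w. exp (s \<bullet> X w))"
    and cf: "\<And>\<phi>. cf \<phi> = (CLINT w|M. exp (s \<bullet> X w) * iexp (\<phi> \<bullet> X w))"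
    and icf: "integrable lborel cf"
  shows "is_cont_density M X (\<lambda>x. exp (- (s \<bullet> x)) * inv_density cf x)"
    and "(CLINT \<phi>|lborel. cf \<phi> * iexp (- (\<phi> \<bullet> x))) = of_real ((2 * pi) ^ CARD('d) * inv_density cf x)"
proof -
  interpret prob_space M by fact
  let ?\<mu> = "distr M borel X"
  define \<nu> where "\<nu> = density ?\<mu> (\<lambda>x. ennreal (exp (s \<bullet> x)))"
  have sets [measurable_cong]: "sets \<nu> = sets borel" by (simp add: \<nu>_def)
  have "emeasure \<nu> (space \<nu>) = (\<integral>\<^sup>+ x. ennreal (exp (s \<bullet> x)) \<partial>?\<mu>)"
    by (simp add: \<nu>_def emeasure_density)
  also have "\<dots> = (\<integral>\<^sup>+ w. ennreal (exp (s \<bullet> X w)) \<partial>M)" by (subst nn_integral_distr) auto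
  also have "\<dots> < \<infinity>" using nn_integral_eq_integral[OF int] by simp
  finally have fin: "finite_measure \<nu>" by (intro finite_measureI) (simp add: less_top[symmetric])
  have chi: "cf \<phi> = (CLINT y|\<nu>. iexp (\<phi> \<bullet> y))" for \<phi>
  proof -
    have "(CLINT y|\<nu>. iexp (\<phi> \<bullet> y)) = (CLINT y|?\<mu>. exp (s \<bullet> y) *\<^sub>R iexp (\<phi> \<bullet> y))"
      unfolding \<nu>_def by (subst integral_density) auto
    also have "\<dots> = cf \<phi>"
      unfolding cf by (subst integral_distr) (auto simp: scaleR_conv_of_real)
    finally show ?thesis by simp
  qed
  note inv = fin sets chi icf
  show "(CLINT \<phi>|lborel. cf \<phi> * iexp (- (\<phi> \<bullet> x))) = of_real ((2 * pi) ^ CARD('d) * inv_density cf x)"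
    using inv_density_complex[OF inv, of x] by simp
  have m [measurable]: "inv_density cf \<in> borel_measurable borel" by (rule inv_density_measurable[OF inv])
  have "distr M lborel X = ?\<mu>" by (intro distr_cong) auto
  also have "\<dots> = density \<nu> (\<lambda>x. ennreal (exp (- (s \<bullet> x))))"
    unfolding \<nu>_def by (subst density_density_eq) (auto simp: ennreal_mult[symmetric] exp_minus density_1)
  also have "\<dots> = density lborel (\<lambda>x. ennreal (exp (- (s \<bullet> x)) * inv_density cf x))"
    unfolding fourier_inversion_density[OF inv]
    by (subst density_density_eq) (auto simp: ennreal_mult[symmetric] inv_density_nonneg[OF inv] mult.commute)
  finally show "is_cont_density M X (\<lambda>x. exp (- (s \<bullet> x)) * inv_density cf x)"
    unfolding is_cont_density_def distributed_def
    by (auto intro!: continuous_intros continuous_inv_density[OF inv] mult_nonneg_nonneg inv_density_nonneg[OF inv])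
qed

text \<open>The points of disagreement form an open set of measure 0, and such a set is
  empty.\<close>

lemma continuous_AE_eq:
  fixes f g :: "'a::euclidean_space \<Rightarrow> real"
  assumes f: "continuous_on UNIV f" and g: "continuous_on UNIV g" and ae: "AE x in lborel. f x = g x"
  shows "f = g"
proof (rule ccontr)
  let ?S = "{x. f x \<noteq> g x}"
  assume "f \<noteq> g"
  then have "?S \<noteq> {}" by auto
  moreover have "open ?S" by (rule open_Collect_neq[OF f g])
  moreover have "negligible ?S"
  proof -
    have "?S \<in> null_sets lborel" using ae \<open>open ?S\<close> by (subst (asm) AE_iff_null) (auto simp: borel_open)
    then show ?thesis by (simp add: negligible_iff_null_sets null_sets_completionI)
  qed
  ultimately show False using open_not_negligible by blast
qed

lemma is_cont_density_unique:
  assumes "is_cont_density M X f" "is_cont_density M X g"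
  shows "f = g"
proof (rule continuous_AE_eq)
  show f: "continuous_on UNIV f" and g: "continuous_on UNIV g" using assms by (auto simp: is_cont_density_def)
  have "density lborel (\<lambda>x. ennreal (f x)) = density lborel (\<lambda>x. ennreal (g x))"
    using assms by (simp add: is_cont_density_def distributed_def)
  then have "AE x in lborel. ennreal (f x) = ennreal (g x)"
    using borel_measurable_continuous_onI[OF f] borel_measurable_continuous_onI[OF g]
    by (subst (asm) sigma_finite_measure.density_unique_iff[OF lborel.sigma_finite_measure_axioms]) auto
  then show "AE x in lborel. f x = g x"
    using assms by (auto simp: is_cont_density_def)
qed

text \<open>Uniqueness of the continuous density resolves the definite description in
  \<open>lik\<close>. It also makes the inversion formula independent of the tilt, so one
  \<open>s\<close> may serve for all parameters near \<theta>.\<close>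

lemma lik_eq: "is_cont_density (P \<theta>) (X_sum Yc n \<theta>) f \<Longrightarrow> lik P Yc n \<theta> x = f x"
  unfolding lik_def using is_cont_density_unique by (metis (no_types, lifting) the_equality)

locale sample_model = saddle_model R P Y
  for R :: "(real ^ 'p) set" and P :: "real ^ 'p \<Rightarrow> 'w measure" and Y :: "real ^ 'p \<Rightarrow> 'w \<Rightarrow> real ^ 'd" +
  fixes Yc :: "real ^ 'p \<Rightarrow> nat \<Rightarrow> 'w \<Rightarrow> real ^ 'd"
  assumes indep: "\<And>\<theta>. \<theta> \<in> R \<Longrightarrow> prob_space.indep_vars (P \<theta>) (\<lambda>_. borel) (Yc \<theta>) UNIV"
    and copies: "\<And>\<theta> i. \<theta> \<in> R \<Longrightarrow> distr (P \<theta>) borel (Yc \<theta> i) = law \<theta>"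
begin

text \<open>Independence turns the transform of the sum into a product of equal factors; its case
  \<phi> = 0 shows that the tilt of the sum is integrable.\<close>

lemma X_sum_transform:
  assumes p: "(s, \<theta>) \<in> U"
  shows "X_sum Yc n \<theta> \<in> borel_measurable (P \<theta>)"
    and "integrable (P \<theta>) (\<lambda>w. exp (s \<bullet> X_sum Yc n \<theta> w))"
    and "M0 P Y (cvec s \<phi>) \<theta> ^ n = (CLINT w|P \<theta>. exp (s \<bullet> X_sum Yc n \<theta> w) * iexp (\<phi> \<bullet> X_sum Yc n \<theta> w))"
proof -
  have \<theta>: "\<theta> \<in> R" by (rule U_R[OF p])
  interpret prob_space "P \<theta>" by (rule prob[OF \<theta>])
  have mY [measurable]: "Yc \<theta> i \<in> borel_measurable (P \<theta>)" for i
    using indep[OF \<theta>] unfolding indep_vars_def by auto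
  show "X_sum Yc n \<theta> \<in> borel_measurable (P \<theta>)" unfolding X_sum_def[abs_def] by measurable
  let ?h = "\<lambda>\<phi> y. complex_of_real (exp (s \<bullet> y)) * iexp (\<phi> \<bullet> y)"
  have hY: "integrable (P \<theta>) (\<lambda>w. ?h \<phi> (Yc \<theta> i w))" for \<phi> i
    using integrable_law_complex[OF p, of \<phi>] unfolding copies[OF \<theta>, of i, symmetric]
    by (subst (asm) integrable_distr_eq) auto
  have eY: "(CLINT w|P \<theta>. ?h \<phi> (Yc \<theta> i w)) = M0 P Y (cvec s \<phi>) \<theta>" for \<phi> i
    unfolding M0_law[OF \<theta>] copies[OF \<theta>, of i, symmetric] by (subst integral_distr) auto
  have ind: "indep_vars (\<lambda>_. borel) (\<lambda>i w. ?h \<phi> (Yc \<theta> i w)) {..<n}" for \<phi>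
    by (rule indep_vars_compose2[OF indep_vars_subset[OF indep[OF \<theta>]]]) auto
  have prod: "(\<Prod>i<n. ?h \<phi> (Yc \<theta> i w)) = ?h \<phi> (X_sum Yc n \<theta> w)" for \<phi> w
    by (simp add: X_sum_def inner_sum_right exp_sum prod.distrib sum_distrib_left)
  have "integrable (P \<theta>) (\<lambda>w. ?h 0 (X_sum Yc n \<theta> w))"
    using indep_vars_integrable[OF finite_lessThan ind[of 0] hY] unfolding prod .
  then have "integrable (P \<theta>) (\<lambda>w. Re (?h 0 (X_sum Yc n \<theta> w)))" by (rule integrable_Re)
  then show "integrable (P \<theta>) (\<lambda>w. exp (s \<bullet> X_sum Yc n \<theta> w))" by simp
  show "M0 P Y (cvec s \<phi>) \<theta> ^ n = (CLINT w|P \<theta>. exp (s \<bullet> X_sum Yc n \<theta> w) * iexp (\<phi> \<bullet> X_sum Yc n \<theta> w))"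
    using indep_vars_lebesgue_integral[OF finite_lessThan ind[of \<phi>] hY] unfolding prod eY by simp
qed

lemma tilted_lik:
  assumes p: "(s, u) \<in> U" and int: "integrable lborel (\<lambda>\<phi>. M0 P Y (cvec s \<phi>) u ^ n)"
  defines "I \<equiv> \<lambda>x. CLINT \<phi>|lborel. M0 P Y (cvec s \<phi>) u ^ n * iexp (- (\<phi> \<bullet> x))"
  shows "\<exists>f. is_cont_density (P u) (X_sum Yc n u) f"
    and "lik P Yc n u x = exp (- (s \<bullet> x)) / (2 * pi) ^ CARD('d) * Re (I x)"
    and "Im (I x) = 0"
proof -
  note t = tilted_cont_density[OF prob[OF U_R[OF p]] X_sum_transform[OF p] int]
  show "\<exists>f. is_cont_density (P u) (X_sum Yc n u) f" using t(1) by blast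
  have "I x = of_real ((2 * pi) ^ CARD('d) * inv_density (\<lambda>\<phi>. M0 P Y (cvec s \<phi>) u ^ n) x)"
    unfolding I_def by (rule t(2))
  then show "lik P Yc n u x = exp (- (s \<bullet> x)) / (2 * pi) ^ CARD('d) * Re (I x)" "Im (I x) = 0"
    by (simp_all add: lik_eq[of P u Yc n, OF t(1)])
qed

text \<open>The tilt \<open>s\<close> stays at the saddlepoint of the base parameter while
  \<open>u\<close> varies, so \<open>u\<close> enters the inverse integral through \<open>M0\<close>
  only. At x = n y the oscillating factor is an n-th power and merges into the centred transforms;
  the powers of the mgf cancel in the quotient.\<close>

lemma lik_has_derivative:
  assumes K: "compact K" "K \<subseteq> U"
  obtains n0 where "1 \<le> n0" "\<And>p n e. p \<in> K \<Longrightarrow> n0 \<le> n \<Longrightarrow> 0 < Re (\<integral>\<phi>. Tn p \<phi> ^ n \<partial>lborel) \<Longrightarrow>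
      log_lik_grad_exists P Yc n (snd p) (real n *\<^sub>R kg p)"
    "\<And>p n. p \<in> K \<Longrightarrow> n0 \<le> n \<Longrightarrow> 0 < Re (\<integral>\<phi>. Tn p \<phi> ^ n \<partial>lborel) \<Longrightarrow>
      ((\<lambda>u. ln (lik P Yc n u (real n *\<^sub>R kg p))) has_derivative
        (\<lambda>e. Re (of_nat n * (\<integral>\<phi>. Gn e p \<phi> * Tn p \<phi> ^ (n - 1) \<partial>lborel) / (\<integral>\<phi>. Tn p \<phi> ^ n \<partial>lborel)))) (at (snd p))"
proof -
  obtain K' \<rho> where K': "compact K'" "K' \<subseteq> U" "0 < \<rho>" "K \<subseteq> K'"
    and nb: "\<And>s \<theta> v e. (s, \<theta>) \<in> K \<Longrightarrow> norm v \<le> \<rho> \<Longrightarrow> norm e \<le> \<rho> \<Longrightarrow> (s + v, \<theta> + e) \<in> K'"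
    using compact_thicken[OF K(1) open_interior K(2)] by blast
  obtain C N where C: "1 \<le> C" and dM0C: "\<And>is js s \<theta> \<phi>. length is \<le> 1 \<Longrightarrow> 1 \<le> length is + length js \<Longrightarrow> length is + length js \<le> 6 \<Longrightarrow> (s, \<theta>) \<in> K' \<Longrightarrow>
    cmod (dM0 P Y is js (cvec s \<phi>) \<theta>) \<le> C * (1 + norm \<phi>) ^ N"
    using dM0_bound[OF K'(1,2)] by blast
  define PP where "PP = N + CARD('d)"
  obtain c n1 where c: "0 < c" "1 \<le> n1"
    "\<And>n s \<theta> \<phi>. n1 \<le> n \<Longrightarrow> (s, \<theta>) \<in> K' \<Longrightarrow> norm (M0 P Y (cvec s \<phi>) \<theta> / of_real (mgf s \<theta>)) ^ n \<le> 1 / (1 + c * real n * (norm \<phi>)\<^sup>2) ^ PP"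
    using M0_decay[OF K'(1,2), of PP] by blast
  obtain G where G: "1 \<le> G" "\<And>p. p \<in> K' \<Longrightarrow> norm (mgf (fst p) (snd p)) \<le> G"
    by (rule compact_bound[OF K'(1) continuous_on_subset[OF mgf_continuous K'(2)]]) (rule that)
  define q where "q = real (CARD('d) + CARD('p))"
  have Mpow: "norm (M0 P Y (cvec s \<phi>) u) ^ k \<le> G ^ k * (1 / (1 + c * real k * (norm \<phi>)\<^sup>2) ^ PP)" if "(s, u) \<in> K'" "n1 \<le> k" for s u \<phi> k
  proof -
    have pU: "(s, u) \<in> U" using that K' by blast
    have m: "0 < mgf s u" by (rule mgf_pos[OF pU])
    have "norm (M0 P Y (cvec s \<phi>) u) ^ k = mgf s u ^ k * norm (M0 P Y (cvec s \<phi>) u / of_real (mgf s u)) ^ k"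
      using m by (simp add: norm_divide power_divide)
    also have "\<dots> \<le> G ^ k * (1 / (1 + c * real k * (norm \<phi>)\<^sup>2) ^ PP)"
      using m G(2)[OF that(1)] G(1) by (intro mult_mono power_mono c(3) that) auto
    finally show ?thesis .
  qed
  have Mint: "integrable lborel (\<lambda>\<phi>. M0 P Y (cvec s \<phi>) u ^ k)" if "(s, u) \<in> K'" "n1 \<le> k" for s u k
  proof (rule Bochner_Integration.integrable_bound)
    show "integrable lborel (\<lambda>\<phi>::real^'d. G ^ k * moment_kernel 0 0 PP (c * real k) \<phi>)"
      using c that by (intro integrable_mult_right integrable_moment_kernel) (auto simp: PP_def)
    show "(\<lambda>\<phi>. M0 P Y (cvec s \<phi>) u ^ k) \<in> borel_measurable lborel"
      using M0_measurable[of s u] that K' by auto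
    show "AE \<phi> in lborel. norm (M0 P Y (cvec s \<phi>) u ^ k) \<le> norm (G ^ k * moment_kernel 0 0 PP (c * real k) \<phi>)"
    proof (rule AE_I2)
      fix \<phi> :: "real ^ 'd"
      have "norm (M0 P Y (cvec s \<phi>) u ^ k) \<le> G ^ k * moment_kernel 0 0 PP (c * real k) \<phi>"
        using Mpow[OF that, of \<phi>] by (simp add: moment_kernel_def norm_power)
      then show "norm (M0 P Y (cvec s \<phi>) u ^ k) \<le> norm (G ^ k * moment_kernel 0 0 PP (c * real k) \<phi>)"
        unfolding real_norm_def by (rule order_trans[OF _ abs_ge_self])
    qed
  qed
  have main: "log_lik_grad_exists P Yc n (snd p) (real n *\<^sub>R kg p)"
    "((\<lambda>u. ln (lik P Yc n u (real n *\<^sub>R kg p))) has_derivative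
        (\<lambda>e. Re (of_nat n * (\<integral>\<phi>. Gn e p \<phi> * Tn p \<phi> ^ (n - 1) \<partial>lborel) / (\<integral>\<phi>. Tn p \<phi> ^ n \<partial>lborel)))) (at (snd p))"
    if p: "p \<in> K" and n: "n1 + 1 \<le> n" and T: "0 < Re (\<integral>\<phi>. Tn p \<phi> ^ n \<partial>lborel)" for p n
  proof -
    obtain s \<theta> where ps: "p = (s, \<theta>)" by (cases p)
    have pU: "p \<in> U" using p K by blast
    let ?x = "real n *\<^sub>R kg p"
    let ?w = "\<lambda>\<phi>. iexp (- (\<phi> \<bullet> ?x))"
    let ?m = "complex_of_real (mgf s \<theta>)"
    have m0: "0 < mgf s \<theta>" using mgf_pos pU by (simp add: ps)
    define f where "f u \<phi> = M0 P Y (cvec s \<phi>) u ^ n * ?w \<phi>" for u \<phi>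
    define f' where "f' u \<phi> e = of_nat n * M0 P Y (cvec s \<phi>) u ^ (n - 1) * dM [] \<phi> (0, e) (s, u) * ?w \<phi>" for u \<phi> e
    \<comment> \<open>The thickened compact set contains the same \<open>s\<close> with every nearby
      parameter, so the decay and growth constants hold uniformly in \<open>u\<close>.\<close>
    have uK: "(s, u) \<in> K'" if "u \<in> ball \<theta> \<rho>" for u
      using nb[of s \<theta> 0 "u - \<theta>"] p that K'(3) by (simp add: ps dist_norm norm_minus_commute)
    have uU: "(s, u) \<in> U" if "u \<in> ball \<theta> \<rho>" for u using uK[OF that] K' by blast
    have nw: "norm (?w \<phi>) = 1" for \<phi> by simp
    have der: "((\<lambda>u. f u \<phi>) has_derivative f' u \<phi>) (at u)" if "u \<in> ball \<theta> \<rho>" for u \<phi>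
    proof -
      let ?g = "\<lambda>p. M0 P Y (cvec (fst p) \<phi>) (snd p)"
      have "(?g has_derivative (\<lambda>v. dM [] \<phi> v (s, u))) (at (s, u))"
        using C1_on_has_derivative[OF C1_on_dM0[of "[]" \<phi>] uU[OF that]] dird_dM0[of "[]" "(s, u)" _ \<phi>] uU[OF that] by simp
      moreover have "((\<lambda>u. (s, u)) has_derivative (\<lambda>e. (0, e))) (at u)" by (auto intro!: derivative_eq_intros)
      ultimately have "((\<lambda>u. ?g (s, u)) has_derivative (\<lambda>e. dM [] \<phi> (0, e) (s, u))) (at u)"
        by (rule has_derivative_compose[rotated])
      then have "((\<lambda>u. M0 P Y (cvec s \<phi>) u) has_derivative (\<lambda>e. dM [] \<phi> (0, e) (s, u))) (at u)" by simp
      from has_derivative_mult_left[OF has_derivative_power[OF this, of n], of "?w \<phi>"] show ?thesis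
        unfolding f_def f'_def[abs_def] by (simp add: mult_ac)
    qed
    have int: "integrable lborel (f u)" if "u \<in> ball \<theta> \<rho>" for u
    proof (rule Bochner_Integration.integrable_bound[OF Mint[OF uK[OF that], of n]])
      show "f u \<in> borel_measurable lborel"
        unfolding f_def[abs_def] using M0_measurable[OF uU[OF that]] by simp
      show "AE \<phi> in lborel. norm (f u \<phi>) \<le> norm (M0 P Y (cvec s \<phi>) u ^ n)"
        by (intro AE_I2) (simp add: f_def norm_mult)
    qed (use n in simp)
    \<comment> \<open>Differentiation leaves n - 1 factors of \<open>M0\<close> to supply decay,
      which is why the threshold is n1 + 1; the derivative contributes the growth (1 + |\<phi>|) ^
      N.\<close>
    define g where "g \<phi> = real n * G ^ (n - 1) * q * C * moment_kernel 0 N PP (c * real (n - 1)) \<phi>" for \<phi> :: "real ^ 'd"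
    have gint: "integrable lborel g"
      unfolding g_def[abs_def] using c n by (intro integrable_mult_right integrable_moment_kernel) (auto simp: PP_def)
    have bound: "norm (f' u \<phi> v) \<le> g \<phi> * norm v" if "u \<in> ball \<theta> \<rho>" for u \<phi> v
    proof -
      have d: "norm (dM [] \<phi> (0, v) (s, u)) \<le> q * norm (0::real^'d, v) * (C * (1 + norm \<phi>) ^ N)"
        unfolding q_def using uK[OF that] by (intro norm_dM_le dM0C) auto
      have "norm (f' u \<phi> v) = real n * norm (M0 P Y (cvec s \<phi>) u) ^ (n - 1) * norm (dM [] \<phi> (0, v) (s, u))"
        unfolding f'_def by (simp add: norm_mult norm_power)
      also have "\<dots> \<le> real n * (G ^ (n - 1) * (1 / (1 + c * real (n - 1) * (norm \<phi>)\<^sup>2) ^ PP)) * (q * norm (0::real^'d, v) * (C * (1 + norm \<phi>) ^ N))"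
        using n c G by (intro mult_mono mult_left_mono Mpow uK that d) (auto intro!: mult_nonneg_nonneg)
      also have "\<dots> = g \<phi> * norm v" by (simp add: g_def moment_kernel_def norm_Pair)
      finally show ?thesis .
    qed
    have meas: "(\<lambda>\<phi>. f' \<theta> \<phi> v) \<in> borel_measurable lborel" for v
    proof -
      have "continuous_on UNIV (\<lambda>\<phi>. f' \<theta> \<phi> v)"
        unfolding f'_def using M0_cont[OF pU] dM_cont[OF pU, of "\<lambda>_. 0" v]
        by (intro continuous_intros) (simp_all add: ps)
      then show ?thesis by (simp add: borel_measurable_continuous_onI)
    qed
    have dF: "((\<lambda>u. \<integral>\<phi>. f u \<phi> \<partial>lborel) has_derivative (\<lambda>e. \<integral>\<phi>. f' \<theta> \<phi> e \<partial>lborel)) (at \<theta>)"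
      by (rule has_derivative_lebesgue_integral[OF K'(3) der int gint bound meas])
    let ?F = "\<lambda>u. \<integral>\<phi>. f u \<phi> \<partial>lborel"
    have ww: "?w \<phi> = exp (- (\<i> * of_real (\<phi> \<bullet> kg p))) ^ n" for \<phi>
      by (simp add: exp_of_nat_mult[symmetric] mult_ac)
    have ft: "f \<theta> \<phi> = ?m ^ n * Tn p \<phi> ^ n" for \<phi>
      unfolding f_def ww unfolding Tn_eq ps using m0 by (simp add: power_mult_distrib power_divide)
    have ft': "f' \<theta> \<phi> e = ?m ^ n * of_nat n * (Gn e p \<phi> * Tn p \<phi> ^ (n - 1))" for \<phi> e
    proof -
      obtain k where k: "n = Suc k" using n by (cases n) auto
      show ?thesis
        unfolding f'_def ww unfolding Tn_eq Gn_def ps k using m0 by (simp add: power_mult_distrib power_divide)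
    qed
    let ?IT = "\<integral>\<phi>. Tn p \<phi> ^ n \<partial>lborel" and ?IG = "\<lambda>e. \<integral>\<phi>. Gn e p \<phi> * Tn p \<phi> ^ (n - 1) \<partial>lborel"
    have F: "?F \<theta> = of_real (mgf s \<theta> ^ n) * ?IT" unfolding ft by simp
    have F': "(\<integral>\<phi>. f' \<theta> \<phi> e \<partial>lborel) = of_real (mgf s \<theta> ^ n) * (of_nat n * ?IG e)" for e unfolding ft' by (simp add: mult.assoc)
    have tl: "\<exists>f. is_cont_density (P u) (X_sum Yc n u) f"
      "lik P Yc n u ?x = exp (- (s \<bullet> ?x)) / (2 * pi) ^ CARD('d) * Re (?F u)" "Im (?F u) = 0" if "u \<in> ball \<theta> \<rho>" for u
      using tilted_lik(1)[OF uU[OF that] Mint[OF uK[OF that], of n]] tilted_lik(2,3)[OF uU[OF that] Mint[OF uK[OF that], of n], of ?x] n unfolding f_def by auto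
    have \<theta>: "\<theta> \<in> ball \<theta> \<rho>" using K'(3) by simp
    \<comment> \<open>The inverse integral is a positive multiple of a density value, hence real, so
      the real part of the quotient below is the quotient of the real parts.\<close>
    have IT: "?IT = of_real (Re ?IT)"
      using tl(3)[OF \<theta>] m0 unfolding F by (simp add: complex_eq_iff)
    have Re_F: "0 < Re (?F \<theta>)" unfolding F using m0 T by simp
    have dR: "((\<lambda>u. Re (?F u)) has_derivative (\<lambda>e. Re (\<integral>\<phi>. f' \<theta> \<phi> e \<partial>lborel))) (at \<theta>)"
      by (rule has_derivative_Re[OF dF])
    let ?c = "exp (- (s \<bullet> ?x)) / (2 * pi) ^ CARD('d)"
    have c0: "0 < ?c" by simp
    have rr: "Re (of_real a * z) = a * Re z" for a z by simp
    have "((\<lambda>u. ln (?c * Re (?F u))) has_derivative (\<lambda>e. (?c * Re (\<integral>\<phi>. f' \<theta> \<phi> e \<partial>lborel)) * inverse (?c * Re (?F \<theta>)))) (at \<theta>)"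
      using has_derivative_ln[OF _ has_derivative_mult_right[OF dR, of ?c]] mult_pos_pos[OF c0 Re_F] by blast
    moreover have "(?c * Re (\<integral>\<phi>. f' \<theta> \<phi> e \<partial>lborel)) * inverse (?c * Re (?F \<theta>)) = Re (of_nat n * ?IG e / ?IT)" for e
    proof -
      have "(?c * Re (\<integral>\<phi>. f' \<theta> \<phi> e \<partial>lborel)) * inverse (?c * Re (?F \<theta>)) = Re (\<integral>\<phi>. f' \<theta> \<phi> e \<partial>lborel) / Re (?F \<theta>)"
        using c0 by (simp only: mult_divide_mult_cancel_left divide_inverse[symmetric])
      also have "\<dots> = (mgf s \<theta> ^ n * Re (of_nat n * ?IG e)) / (mgf s \<theta> ^ n * Re ?IT)"
        unfolding F F' by (simp only: rr)
      also have "\<dots> = Re (of_nat n * ?IG e) / Re ?IT" using m0 by simp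
      also have "\<dots> = Re (of_nat n * ?IG e / of_real (Re ?IT))" by (simp only: Re_divide_of_real)
      finally show ?thesis by (simp only: IT[symmetric])
    qed
    ultimately have dl: "((\<lambda>u. ln (?c * Re (?F u))) has_derivative (\<lambda>e. Re (of_nat n * ?IG e / ?IT))) (at \<theta>)" by simp
    have D: "((\<lambda>u. ln (lik P Yc n u ?x)) has_derivative (\<lambda>e. Re (of_nat n * ?IG e / ?IT))) (at \<theta>)"
      by (rule has_derivative_transform_within_open[OF dl open_ball \<theta>]) (simp only: tl(2))
    then show "((\<lambda>u. ln (lik P Yc n u ?x)) has_derivative (\<lambda>e. Re (of_nat n * ?IG e / ?IT))) (at (snd p))" by (simp add: ps)
    \<comment> \<open>The integral is differentiable in \<open>u\<close>, hence continuous at the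
      base parameter, so the likelihood stays positive nearby and its logarithm is meaningful on a
      neighbourhood.\<close>
    have "((\<lambda>u. Re (?F u)) \<longlongrightarrow> Re (?F \<theta>)) (nhds \<theta>)"
      using has_derivative_continuous[OF dR] tendsto_at_iff_tendsto_nhds[of "\<lambda>u. Re (?F u)" \<theta>] by (simp add: isCont_def)
    from order_tendstoD(1)[OF this Re_F] have "\<forall>\<^sub>F u in nhds \<theta>. 0 < Re (?F u)" .
    moreover have "\<forall>\<^sub>F u in nhds \<theta>. u \<in> ball \<theta> \<rho>" by (rule eventually_nhds_in_open[OF open_ball \<theta>])
    ultimately have "\<forall>\<^sub>F u in nhds \<theta>. (\<exists>f. is_cont_density (P u) (X_sum Yc n u) f) \<and> lik P Yc n u ?x > 0"
    proof eventually_elim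
      case (elim u)
      show ?case using tl(1)[OF elim(2)] mult_pos_pos[OF c0 elim(1)] unfolding tl(2)[OF elim(2)] by blast
    qed
    moreover have "(\<lambda>u. ln (lik P Yc n u ?x)) differentiable at \<theta>" using D unfolding differentiable_def by blast
    ultimately show "log_lik_grad_exists P Yc n (snd p) ?x" by (simp add: log_lik_grad_exists_def ps)
  qed
  show ?thesis using that[of "n1 + 1"] main by simp
qed

end

section \<open>From directional derivatives to gradients\<close>

lemma grad_nth:
  fixes h :: "real ^ 'n \<Rightarrow> real"
  assumes h: "(h has_derivative h') (at x)"
  shows "grad h x $ i = h' (axis i 1)"
proof -
  define D where "D = (\<Sum>b\<in>Basis. h' b *\<^sub>R b)"
  interpret bounded_linear h' using h by (rule has_derivative_bounded_linear)
  have e: "h' v = v \<bullet> D" for v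
  proof -
    have "h' v = h' (\<Sum>b\<in>Basis. (v \<bullet> b) *\<^sub>R b)" by (simp only: euclidean_representation)
    also have "\<dots> = v \<bullet> D" by (simp add: D_def sum scaleR inner_sum_right mult.commute)
    finally show ?thesis .
  qed
  have "(h has_derivative (\<lambda>v. v \<bullet> D)) (at x)" using h by (simp only: e[symmetric])
  then have "grad h x = D" by (rule grad_eq)
  then show ?thesis by (simp add: e inner_axis')
qed

context sample_model
begin

text \<open>\<open>score_quotient_approx\<close> fixes the direction, and its threshold and constant
  depend on it. The coordinate directions are finitely many, and the norm is at most the sum of the
  components, so sums of thresholds and constants suffice.\<close>

lemma uniform_gradient_error:
  assumes K: "compact K" "K \<subseteq> U"
  obtains n0 B where "\<And>p n. p \<in> K \<Longrightarrow> n0 \<le> n \<Longrightarrow>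
      log_lik_grad_exists P Yc n (snd p) (real n *\<^sub>R kg p) \<and>
      log_saddle_lik_grad_exists R P Y n (snd p) (real n *\<^sub>R kg p) \<and>
      norm (grad (\<lambda>u. ln (saddle_lik R P Y n u (real n *\<^sub>R kg p))) (snd p)
          - grad (\<lambda>u. ln (lik P Yc n u (real n *\<^sub>R kg p))) (snd p)) \<le> B / real n"
proof -
  obtain n1 where n1: "1 \<le> n1" "\<And>p n e. p \<in> K \<Longrightarrow> n1 \<le> n \<Longrightarrow> 0 < Re (\<integral>\<phi>. Tn p \<phi> ^ n \<partial>lborel) \<Longrightarrow>
      log_lik_grad_exists P Yc n (snd p) (real n *\<^sub>R kg p)"
    "\<And>p n. p \<in> K \<Longrightarrow> n1 \<le> n \<Longrightarrow> 0 < Re (\<integral>\<phi>. Tn p \<phi> ^ n \<partial>lborel) \<Longrightarrow>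
      ((\<lambda>u. ln (lik P Yc n u (real n *\<^sub>R kg p))) has_derivative
        (\<lambda>e. Re (of_nat n * (\<integral>\<phi>. Gn e p \<phi> * Tn p \<phi> ^ (n - 1) \<partial>lborel) / (\<integral>\<phi>. Tn p \<phi> ^ n \<partial>lborel)))) (at (snd p))"
    by (rule lik_has_derivative[OF K]) (rule that)
  let ?L = "\<lambda>p n e. of_nat n * (\<integral>\<phi>. Gn e p \<phi> * Tn p \<phi> ^ (n - 1) \<partial>lborel) / (\<integral>\<phi>. Tn p \<phi> ^ n \<partial>lborel)"
  define Q where "Q i n0 B \<longleftrightarrow> (\<forall>p\<in>K. \<forall>n\<ge>n0. 0 < Re (\<integral>\<phi>. Tn p \<phi> ^ n \<partial>lborel) \<and> norm (?L p n (axis i 1) - of_real (sdl p n (axis i 1))) \<le> B / real n)"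
    for i n0 B
  have "\<exists>n0 B. Q i n0 B" for i
  proof -
    obtain n0 B where a: "\<And>p n. p \<in> K \<Longrightarrow> n0 \<le> n \<Longrightarrow> 0 < Re (\<integral>\<phi>. Tn p \<phi> ^ n \<partial>lborel)"
      and b: "\<And>p n. p \<in> K \<Longrightarrow> n0 \<le> n \<Longrightarrow> norm (?L p n (axis i 1) - of_real (sdl p n (axis i 1))) \<le> B / real n"
      by (rule score_quotient_approx[OF K, of "axis i 1"]) (rule that)
    show ?thesis unfolding Q_def by (intro exI[of _ n0] exI[of _ B] ballI allI impI conjI; rule a b)
  qed
  then obtain n2 B where "\<And>i. Q i (n2 i) (B i)" by metis
  then have nB: "p \<in> K \<Longrightarrow> n2 i \<le> n \<Longrightarrow> 0 < Re (\<integral>\<phi>. Tn p \<phi> ^ n \<partial>lborel)"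
    "p \<in> K \<Longrightarrow> n2 i \<le> n \<Longrightarrow> norm (?L p n (axis i 1) - of_real (sdl p n (axis i 1))) \<le> B i / real n" for i p n
    unfolding Q_def by auto
  \<comment> \<open>The sum exceeds each of its terms, so it works as a common threshold for all
    coordinates.\<close>
  define n0 where "n0 = n1 + (\<Sum>i\<in>UNIV. n2 i)"
  show ?thesis
  proof (rule that[of n0 "\<Sum>i\<in>UNIV. B i"])
    fix p n assume p: "p \<in> K" and n: "n0 \<le> n"
    have nn: "n1 \<le> n" "1 \<le> n" using n n1(1) by (auto simp: n0_def)
    have n2: "n2 i \<le> n" for i
      using n member_le_sum[of i UNIV n2] by (simp add: n0_def)
    note T = nB(1)[OF p n2]
    have pU: "(fst p, snd p) \<in> U" using p K by auto
    have dl: "((\<lambda>u. ln (lik P Yc n u (real n *\<^sub>R kg p))) has_derivative (\<lambda>e. Re (?L p n e))) (at (snd p))"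
      by (rule n1(3)[OF p nn(1) T])
    have ds: "((\<lambda>u. ln (saddle_lik R P Y n u (real n *\<^sub>R kg p))) has_derivative sdl p n) (at (snd p))"
      using saddle_lik_has_derivative(1)[OF pU nn(2)] by simp
    let ?d = "grad (\<lambda>u. ln (saddle_lik R P Y n u (real n *\<^sub>R kg p))) (snd p) - grad (\<lambda>u. ln (lik P Yc n u (real n *\<^sub>R kg p))) (snd p)"
    have "norm ?d \<le> (\<Sum>i\<in>UNIV. \<bar>?d $ i\<bar>)" by (rule norm_le_l1_cart)
    also have "\<dots> \<le> (\<Sum>i\<in>UNIV. B i / real n)"
    proof (rule sum_mono)
      fix i
      have "\<bar>?d $ i\<bar> = \<bar>Re (?L p n (axis i 1) - of_real (sdl p n (axis i 1)))\<bar>"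
        by (simp only: vector_minus_component grad_nth[OF ds] grad_nth[OF dl] minus_complex.sel Re_complex_of_real abs_minus_commute)
      also have "\<dots> \<le> B i / real n" by (rule order_trans[OF abs_Re_le_cmod nB(2)[OF p n2]])
      finally show "\<bar>?d $ i\<bar> \<le> B i / real n" .
    qed
    finally have "norm ?d \<le> (\<Sum>i\<in>UNIV. B i) / real n" by (simp add: sum_divide_distrib)
    moreover have "log_saddle_lik_grad_exists R P Y n (snd p) (real n *\<^sub>R kg p)"
      using saddle_lik_has_derivative(2)[OF pU nn(2)] by simp
    ultimately show "log_lik_grad_exists P Yc n (snd p) (real n *\<^sub>R kg p) \<and>
      log_saddle_lik_grad_exists R P Y n (snd p) (real n *\<^sub>R kg p) \<and> norm ?d \<le> (\<Sum>i\<in>UNIV. B i) / real n"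
      using n1(2)[OF p nn(1) T] by blast
  qed
qed

text \<open>\<open>Psi\<close> is continuous, so it carries a compact set of pairs (y, \<theta>) to
  a compact set of pairs (s, \<theta>) in \<open>U\<close>, over which the constants are
  uniform.\<close>

lemma uniform_gradient_error_Y_open:
  assumes C: "compact C" "C \<subseteq> Y_open R P Y"
  shows "\<exists>n0 B. \<forall>n\<ge>n0. \<forall>(y, \<theta>) \<in> C.
             log_lik_grad_exists P Yc n \<theta> (real n *\<^sub>R y) \<and>
             log_saddle_lik_grad_exists R P Y n \<theta> (real n *\<^sub>R y) \<and>
             norm (grad (\<lambda>u. ln (saddle_lik R P Y n u (real n *\<^sub>R y))) \<theta>
                   - grad (\<lambda>u. ln (lik P Yc n u (real n *\<^sub>R y))) \<theta>)
               \<le> B / real n"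
proof -
  have K: "compact (Psi ` C)" "Psi ` C \<subseteq> U"
    using C Psi_in_U by (auto intro!: compact_continuous_image continuous_on_subset[OF Psi_continuous])
  obtain n0 B where b: "\<And>p n. p \<in> Psi ` C \<Longrightarrow> n0 \<le> n \<Longrightarrow>
      log_lik_grad_exists P Yc n (snd p) (real n *\<^sub>R kg p) \<and>
      log_saddle_lik_grad_exists R P Y n (snd p) (real n *\<^sub>R kg p) \<and>
      norm (grad (\<lambda>u. ln (saddle_lik R P Y n u (real n *\<^sub>R kg p))) (snd p)
          - grad (\<lambda>u. ln (lik P Yc n u (real n *\<^sub>R kg p))) (snd p)) \<le> B / real n"
    by (rule uniform_gradient_error[OF K]) (rule that)
  have "snd (Psi (y, \<theta>)) = \<theta> \<and> kg (Psi (y, \<theta>)) = y" if "(y, \<theta>) \<in> C" for y \<theta>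
    using Phi_Psi[of "(y, \<theta>)"] that C(2) by (auto simp: Phi_def)
  then show ?thesis using b by (intro exI[of _ n0] exI[of _ B]) (fastforce dest: b[OF imageI])
qed

end

theorem theorem1:
  fixes R :: "(real ^ 'p) set"
    and P :: "real ^ 'p \<Rightarrow> 'w measure"
    and Y :: "real ^ 'p \<Rightarrow> 'w \<Rightarrow> real ^ 'd"
    and Yc :: "real ^ 'p \<Rightarrow> nat \<Rightarrow> 'w \<Rightarrow> real ^ 'd"
  assumes "open R"
    and "\<And>\<theta>. \<theta> \<in> R \<Longrightarrow> prob_space (P \<theta>)"
    and "\<And>\<theta>. \<theta> \<in> R \<Longrightarrow> Y \<theta> \<in> borel_measurable (P \<theta>)"
    and "\<And>\<theta>. \<theta> \<in> R \<Longrightarrow> prob_space.indep_vars (P \<theta>) (\<lambda>_. borel) (Yc \<theta>) UNIV"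
    and "\<And>\<theta> i. \<theta> \<in> R \<Longrightarrow> distr (P \<theta>) borel (Yc \<theta> i) = distr (P \<theta>) borel (Y \<theta>)"
    and "decay_condition R P Y"
    and "growth_condition R P Y"
  shows "(\<forall>(y, \<theta>) \<in> interior (Y_open R P Y).
           (\<forall>\<^sub>F n in sequentially.
             log_lik_grad_exists P Yc n \<theta> (real n *\<^sub>R y) \<and>
             log_saddle_lik_grad_exists R P Y n \<theta> (real n *\<^sub>R y)) \<and>
           (\<lambda>n. norm (grad (\<lambda>u. ln (saddle_lik R P Y n u (real n *\<^sub>R y))) \<theta>
                      - grad (\<lambda>u. ln (lik P Yc n u (real n *\<^sub>R y))) \<theta>))
             \<in> O(\<lambda>n. 1 / real n)) \<and>
         (\<forall>C. compact C \<and> C \<subseteq> interior (Y_open R P Y) \<longrightarrow>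
           (\<exists>n0 B. \<forall>n\<ge>n0. \<forall>(y, \<theta>) \<in> C.
             log_lik_grad_exists P Yc n \<theta> (real n *\<^sub>R y) \<and>
             log_saddle_lik_grad_exists R P Y n \<theta> (real n *\<^sub>R y) \<and>
             norm (grad (\<lambda>u. ln (saddle_lik R P Y n u (real n *\<^sub>R y))) \<theta>
                   - grad (\<lambda>u. ln (lik P Yc n u (real n *\<^sub>R y))) \<theta>)
               \<le> B / real n))"
proof -
  interpret sample_model R P Y Yc
    by (intro sample_model.intro saddle_model.intro sample_model_axioms.intro) (fact assms)+
  let ?E = "\<lambda>n y \<theta>. norm (grad (\<lambda>u. ln (saddle_lik R P Y n u (real n *\<^sub>R y))) \<theta>
                   - grad (\<lambda>u. ln (lik P Yc n u (real n *\<^sub>R y))) \<theta>)"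
  have pointwise: "(\<forall>\<^sub>F n in sequentially. log_lik_grad_exists P Yc n \<theta> (real n *\<^sub>R y) \<and>
        log_saddle_lik_grad_exists R P Y n \<theta> (real n *\<^sub>R y)) \<and> (\<lambda>n. ?E n y \<theta>) \<in> O(\<lambda>n. 1 / real n)"
    if "(y, \<theta>) \<in> interior (Y_open R P Y)" for y \<theta>
  proof -
    \<comment> \<open>The pointwise claim is the uniform one on a single point.\<close>
    have "compact {(y, \<theta>)}" "{(y, \<theta>)} \<subseteq> Y_open R P Y" using that interior_subset by auto
    from uniform_gradient_error_Y_open[OF this] obtain n0 B where b: "\<And>n. n0 \<le> n \<Longrightarrow>
        log_lik_grad_exists P Yc n \<theta> (real n *\<^sub>R y) \<and>
        log_saddle_lik_grad_exists R P Y n \<theta> (real n *\<^sub>R y) \<and> ?E n y \<theta> \<le> B / real n" by auto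
    have "\<forall>\<^sub>F n in sequentially. norm (?E n y \<theta>) \<le> B * norm (1 / real n)"
      using eventually_ge_at_top[of n0] by eventually_elim (use b in simp)
    then have "(\<lambda>n. ?E n y \<theta>) \<in> O(\<lambda>n. 1 / real n)" by (rule bigoI)
    moreover have "\<forall>\<^sub>F n in sequentially. log_lik_grad_exists P Yc n \<theta> (real n *\<^sub>R y) \<and>
        log_saddle_lik_grad_exists R P Y n \<theta> (real n *\<^sub>R y)"
      using eventually_ge_at_top[of n0] by eventually_elim (use b in simp)
    ultimately show ?thesis by (rule conjI[rotated])
  qed
  then have "\<forall>(y, \<theta>) \<in> interior (Y_open R P Y). (\<forall>\<^sub>F n in sequentially. log_lik_grad_exists P Yc n \<theta> (real n *\<^sub>R y) \<and>
        log_saddle_lik_grad_exists R P Y n \<theta> (real n *\<^sub>R y)) \<and> (\<lambda>n. ?E n y \<theta>) \<in> O(\<lambda>n. 1 / real n)"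
    by (intro ballI case_prodI2) simp
  moreover have "C \<subseteq> interior (Y_open R P Y) \<Longrightarrow> C \<subseteq> Y_open R P Y" for C
    using interior_subset by blast
  ultimately show ?thesis
    by (intro conjI allI impI uniform_gradient_error_Y_open) auto
qed

end
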